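(* Let $\Bbbk$ be an algebraically closed field of characteristic zero and let $q,r,s\in\Bbbk^\times\setminus\{1\}$ satisfy $qrs=1$, with $s$ a root of unity of order $L$ and $q,r$ not roots of unity. Let $V$ be a braided vector space of diagonal type with basis $x_1,x_2,x_3$ and braiding matrix $\mathfrak q=(q_{ij})$ such that $q_{11}=q$, $\widetilde q_{12}=q^{-1}$, $q_{22}=-1$, $\widetilde q_{23}=r^{-1}$, $q_{33}=r$, $\widetilde q_{13}=1$ (type $D(2,1;\alpha)$). Then the algebra $$\widehat{\mathscr{B}}_{\mathfrak q}=T(V)/\langle x_2^2,\ x_{13},\ x_{112},\ x_{332}\rangle$$ is an eminent pre-Nichols algebra of $\mathfrak q$, with basis $$B=\{x_3^{n_1}x_{23}^{n_2}x_2^{n_3}x_{12^23}^{n_4}x_{123}^{n_5}x_{12}^{n_6}x_1^{n_7}:\ n_2,n_3,n_5,n_6\in\{0,1\},\ n_1,n_4,n_7\in\mathbb{N}_0\},$$ where $x_{12^23}=[x_{123},x_2]_c$, so $\operatorname{GKdim}\widehat{\mathscr{B}}_{\mathfrak q}=3$. Also, if $\mathcal Z$ is the subalgebra of $\widehat{\mathscr{B}}_{\mathfrak q}$ generated by $x_{12^23}^{L}$, then $\mathcal Z\hookrightarrow\widehat{\mathscr{B}}_{\mathfrak q}\twoheadrightarrow\mathscr{B}_{\mathfrak q}$ is a degree-preserving extension of braided Hopf algebras.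
   Context: Diagonal type with braiding matrix $(q_{ij})$ means $c(x_i\otimes x_j)=q_{ij}\,x_j\otimes x_i$, $q_{ij}\in\Bbbk^\times$; $\widetilde q_{ij}=q_{ij}q_{ji}$ for $i\neq j$. $T(V)$ is a braided graded Hopf algebra with $V$ primitive. A pre-Nichols algebra of $V$ (or of $\mathfrak q$) is a quotient of $T(V)$ by an $\mathbb{N}_0$-homogeneous (braided) Hopf ideal generated by elements of degree $\ge2$; the Nichols algebra $\mathscr{B}_{\mathfrak q}=\mathscr{B}(V)$ is the quotient by the largest such ideal. A pre-Nichols algebra $\widehat{\mathscr{B}}$ of $V$ with finite Gelfand-Kirillov dimension is eminent if every pre-Nichols algebra of $V$ with finite $\operatorname{GKdim}$ is a quotient of $\widehat{\mathscr{B}}$ via an epimorphism induced by the identity of $V$. For $\mathbb{Z}^3$-homogeneous $x,y$ of degrees $\beta,\gamma$ ($\deg x_i=\alpha_i$, the canonical basis), $[x,y]_c=xy-\chi(\beta,\gamma)yx$, where $\chi$ is the bicharacter on $\mathbb{Z}^3$ with $\chi(\alpha_i,\alpha_j)=q_{ij}$; and $x_{i_1i_2\cdots i_k}=[x_{i_1},x_{i_2\cdots i_k}]_c$ recursively, e.g. $x_{ij}=x_ix_j-q_{ij}x_jx_i$, $x_{112}=[x_1,x_{12}]_c$, $x_{123}=[x_1,x_{23}]_c$. A sequence $\mathcal Z\xrightarrow{\iota}H\xrightarrow{\pi}K$ of (degree-preserving) morphisms of graded braided Hopf algebras is a (degree-preserving) extension if $\iota$ is injective, $\pi$ is surjective,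 $\ker\pi=H\iota(\mathcal Z)^+$ (where $^+$ denotes the augmentation ideal) and $\iota(\mathcal Z)=H^{\operatorname{co}\pi}=\{h\in H:(\mathrm{id}\otimes\pi)\Delta(h)=h\otimes1\}$. *)

theory Defs
  imports
    "HOL-Computational_Algebra.Polynomial"
    "HOL-Library.Poly_Mapping"
    "HOL-Library.Numeral_Type"
    "HOL-Library.Extended_Real"
    "HOL-Library.Liminf_Limsup"
    "HOL-Algebra.QuotRing"
    "HOL-Algebra.Module"
begin

section \<open>Associative algebras over a field type\<close>

text \<open>
  An algebra over the field type \<open>'k\<close> is a record \<open>('k, 'a) module\<close> of HOL-Algebra; unlike
  in the library locale \<open>algebra\<close>, multiplication need not be commutative.
\<close>

definition lspan :: "('k::field, 'a) module \<Rightarrow> 'a set \<Rightarrow> 'a set" where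
  "lspan A S = {(\<Oplus>\<^bsub>A\<^esub>v\<in>F. c v \<odot>\<^bsub>A\<^esub> v) | F c. finite F \<and> F \<subseteq> S}"

definition lin_indep :: "('k::field, 'a) module \<Rightarrow> 'a set \<Rightarrow> bool" where
  "lin_indep A S \<longleftrightarrow>
     (\<forall>F c. finite F \<and> F \<subseteq> S \<and> (\<Oplus>\<^bsub>A\<^esub>v\<in>F. c v \<odot>\<^bsub>A\<^esub> v) = \<zero>\<^bsub>A\<^esub> \<longrightarrow> (\<forall>v\<in>F. c v = 0))"

definition is_basis_of :: "('k::field, 'a) module \<Rightarrow> 'a set \<Rightarrow> 'a set \<Rightarrow> bool" where
  "is_basis_of A W B \<longleftrightarrow> B \<subseteq> W \<and> lin_indep A B \<and> lspan A B = W"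

text \<open>The dimension of a finite-dimensional subspace.\<close>

definition fdim :: "('k::field, 'a) module \<Rightarrow> 'a set \<Rightarrow> nat" where
  "fdim A W = (THE d. \<exists>B. finite B \<and> is_basis_of A W B \<and> card B = d)"

definition subalgebra :: "('k::field, 'a) module \<Rightarrow> 'a set \<Rightarrow> bool" where
  "subalgebra A C \<longleftrightarrow> C \<subseteq> carrier A \<and> \<zero>\<^bsub>A\<^esub> \<in> C \<and> \<one>\<^bsub>A\<^esub> \<in> C \<and>
     (\<forall>x\<in>C. \<forall>y\<in>C. x \<oplus>\<^bsub>A\<^esub> y \<in> C \<and> x \<otimes>\<^bsub>A\<^esub> y \<in> C) \<and> (\<forall>c. \<forall>x\<in>C. c \<odot>\<^bsub>A\<^esub> x \<in> C)"

definition alg_hom :: "('k::field, 'a) module \<Rightarrow> ('k, 'b) module \<Rightarrow> ('a \<Rightarrow> 'b) set" where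
  "alg_hom A B = {f \<in> ring_hom A B. \<forall>c. \<forall>x\<in>carrier A. f (c \<odot>\<^bsub>A\<^esub> x) = c \<odot>\<^bsub>B\<^esub> f x}"

text \<open>
  The filtration \<open>W\<^sup>0 + W\<^sup>1 + \<dots> + W\<^sup>n\<close> attached to the subspace \<open>W\<close> spanned by \<open>S\<close>. For finite
  \<open>S\<close> these \<open>W\<close> are exactly the finite-dimensional subspaces, and the Gelfand-Kirillov dimension
  is the supremum over them of \<open>limsup (log\<^sub>n dim)\<close>.
\<close>

definition word_filtration :: "('k::field, 'a) module \<Rightarrow> 'a set \<Rightarrow> nat \<Rightarrow> 'a set" where
  "word_filtration A S n =
     lspan A {foldr (mult A) xs \<one>\<^bsub>A\<^esub> | xs. set xs \<subseteq> S \<and> length xs \<le> n}"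

definition GKdim :: "('k::field, 'a) module \<Rightarrow> ereal" where
  "GKdim A = (SUP S\<in>{S. finite S \<and> S \<subseteq> carrier A}.
     limsup (\<lambda>n. ereal (log (real n) (real (fdim A (word_filtration A S n))))))"

definition quot_alg :: "('k::field, 'a) module \<Rightarrow> 'a set \<Rightarrow> ('k, 'a set) module" where
  "quot_alg A I =
     ring.extend (A Quot I) (module.fields (\<lambda>c X. \<Union>x\<in>X. I +>\<^bsub>A\<^esub> (c \<odot>\<^bsub>A\<^esub> x)))"


section \<open>The tensor algebra of a braided vector space of diagonal type\<close>

text \<open>
  The basis of \<open>V\<close> is indexed by a finite type \<open>'i\<close>. Words in \<open>'i\<close> form a (noncommutative,
  additively written) monoid under concatenation, and \<open>T(V)\<close> is its monoid algebra, with the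
  convolution product of the library.
\<close>

datatype 'i word = Word (letters: "'i list")

instantiation word :: (type) monoid_add
begin

definition zero_word :: "'a word" where "zero_word = Word []"

definition plus_word :: "'a word \<Rightarrow> 'a word \<Rightarrow> 'a word" where
  "plus_word u v = Word (letters u @ letters v)"

instance by standard (auto simp: zero_word_def plus_word_def)

end

type_synonym ('i, 'k) tens_alg = "'i word \<Rightarrow>\<^sub>0 'k"

text \<open>The basis of \<open>T(V) \<otimes> T(V)\<close> consists of pairs of words.\<close>

type_synonym ('i, 'k) tens_sq = "('i word \<times> 'i word) \<Rightarrow>\<^sub>0 'k"

definition scal :: "'k::field \<Rightarrow> ('b \<Rightarrow>\<^sub>0 'k) \<Rightarrow> ('b \<Rightarrow>\<^sub>0 'k)" where
  "scal c x = Poly_Mapping.map ((*) c) x"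

text \<open>Linear extension of a map given on the basis.\<close>

definition lext :: "('b \<Rightarrow> ('c \<Rightarrow>\<^sub>0 'k::field)) \<Rightarrow> ('b \<Rightarrow>\<^sub>0 'k) \<Rightarrow> ('c \<Rightarrow>\<^sub>0 'k)" where
  "lext f x = (\<Sum>w\<in>Poly_Mapping.keys x. scal (Poly_Mapping.lookup x w) (f w))"

definition wd :: "'i list \<Rightarrow> ('i, 'k::field) tens_alg" where
  "wd is = Poly_Mapping.single (Word is) 1"

definition tens :: "('i, 'k::field) tens_alg \<Rightarrow> ('i, 'k) tens_alg \<Rightarrow> ('i, 'k) tens_sq" where
  "tens x y = lext (\<lambda>u. lext (\<lambda>v. Poly_Mapping.single (u, v) 1) y) x"

definition TV :: "('k::field, ('i, 'k) tens_alg) module" where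
  "TV = \<lparr>carrier = UNIV, mult = (*), one = 1, zero = 0, add = (+), smult = scal\<rparr>"

text \<open>The \<open>\<nat>\<^sub>0\<close>-grading of \<open>T(V)\<close>.\<close>

definition TV_comp :: "nat \<Rightarrow> ('i, 'k::field) tens_alg set" where
  "TV_comp n = {x. \<forall>w\<in>Poly_Mapping.keys x. length (letters w) = n}"

text \<open>The \<open>\<int>\<^sup>I\<close>-degree of a word and the bicharacter with \<open>\<chi>(\<alpha>\<^sub>i, \<alpha>\<^sub>j) = q\<^sub>i\<^sub>j\<close>.\<close>

definition wdeg :: "'i word \<Rightarrow> 'i \<Rightarrow> int" where
  "wdeg w i = int (count_list (letters w) i)"

definition bichar :: "('i::finite \<Rightarrow> 'i \<Rightarrow> 'k::field) \<Rightarrow> ('i \<Rightarrow> int) \<Rightarrow> ('i \<Rightarrow> int) \<Rightarrow> 'k" where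
  "bichar q \<beta> \<gamma> = (\<Prod>i\<in>UNIV. \<Prod>j\<in>UNIV. q i j powi (\<beta> i * \<gamma> j))"

definition homogeneous :: "('i \<Rightarrow> int) \<Rightarrow> ('i, 'k::field) tens_alg \<Rightarrow> bool" where
  "homogeneous \<beta> x \<longleftrightarrow> (\<forall>w\<in>Poly_Mapping.keys x. wdeg w = \<beta>)"

text \<open>The braiding \<open>c(u \<otimes> v) = \<chi>(deg u, deg v) v \<otimes> u\<close> and the multiplication of \<open>T(V)\<close>.\<close>

definition braid :: "('i::finite \<Rightarrow> 'i \<Rightarrow> 'k::field) \<Rightarrow> ('i, 'k) tens_sq \<Rightarrow> ('i, 'k) tens_sq" where
  "braid q = lext (\<lambda>(u, v). Poly_Mapping.single (v, u) (bichar q (wdeg u) (wdeg v)))"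

definition mul :: "('i, 'k::field) tens_sq \<Rightarrow> ('i, 'k) tens_alg" where
  "mul = lext (\<lambda>(u, v). Poly_Mapping.single (u + v) 1)"

text \<open>
  The braided commutator as a bilinear operation, \<open>xy - mul(c(x \<otimes> y))\<close>; the lemma
  \<open>cbracket_homogeneous\<close> below gives its value on homogeneous elements.
\<close>

definition cbracket ::
    "('i::finite \<Rightarrow> 'i \<Rightarrow> 'k::field) \<Rightarrow> ('i, 'k) tens_alg \<Rightarrow> ('i, 'k) tens_alg \<Rightarrow> ('i, 'k) tens_alg" where
  "cbracket q x y = x * y - mul (braid q (tens x y))"

fun xw :: "('i::finite \<Rightarrow> 'i \<Rightarrow> 'k::field) \<Rightarrow> 'i list \<Rightarrow> ('i, 'k) tens_alg" where
  "xw q [] = 1"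
| "xw q [i] = wd [i]"
| "xw q (i # j # is) = cbracket q (wd [i]) (xw q (j # is))"

text \<open>
  The braided tensor square: \<open>(a \<otimes> b)(c \<otimes> d) = \<chi>(deg b, deg c) ac \<otimes> bd\<close>.
\<close>

definition tmult ::
    "('i::finite \<Rightarrow> 'i \<Rightarrow> 'k::field) \<Rightarrow> ('i, 'k) tens_sq \<Rightarrow> ('i, 'k) tens_sq \<Rightarrow> ('i, 'k) tens_sq" where
  "tmult q s t = lext (\<lambda>(a, b). lext (\<lambda>(c, d).
     Poly_Mapping.single (a + c, b + d) (bichar q (wdeg b) (wdeg c))) t) s"

definition TT :: "('i::finite \<Rightarrow> 'i \<Rightarrow> 'k::field) \<Rightarrow> ('k, ('i, 'k) tens_sq) module" where
  "TT q = \<lparr>carrier = UNIV, mult = tmult q, one = tens 1 1, zero = 0, add = (+), smult = scal\<rparr>"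

text \<open>
  Comultiplication: the algebra map into the braided tensor square for which every \<open>x\<^sub>i\<close> is
  primitive. The antipode satisfies \<open>S(x\<^sub>i) = -x\<^sub>i\<close> and
  \<open>S(xy) = mul((S \<otimes> S)(c(x \<otimes> y)))\<close>.
\<close>

fun comult_list :: "('i::finite \<Rightarrow> 'i \<Rightarrow> 'k::field) \<Rightarrow> 'i list \<Rightarrow> ('i, 'k) tens_sq" where
  "comult_list q [] = tens 1 1"
| "comult_list q (i # is) = tmult q (tens (wd [i]) 1 + tens 1 (wd [i])) (comult_list q is)"

definition comult :: "('i::finite \<Rightarrow> 'i \<Rightarrow> 'k::field) \<Rightarrow> ('i, 'k) tens_alg \<Rightarrow> ('i, 'k) tens_sq" where
  "comult q = lext (\<lambda>w. comult_list q (letters w))"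

definition counit :: "('i, 'k::field) tens_alg \<Rightarrow> 'k" where
  "counit x = Poly_Mapping.lookup x 0"

fun antip_list :: "('i::finite \<Rightarrow> 'i \<Rightarrow> 'k::field) \<Rightarrow> 'i list \<Rightarrow> ('i, 'k) tens_alg" where
  "antip_list q [] = 1"
| "antip_list q (i # is) =
     scal (bichar q (wdeg (Word [i])) (wdeg (Word is))) (antip_list q is * (- wd [i]))"

definition antip :: "('i::finite \<Rightarrow> 'i \<Rightarrow> 'k::field) \<Rightarrow> ('i, 'k) tens_alg \<Rightarrow> ('i, 'k) tens_alg" where
  "antip q = lext (\<lambda>w. antip_list q (letters w))"


section \<open>Pre-Nichols algebras\<close>

text \<open>The subspace \<open>A \<otimes> B\<close> of \<open>T(V) \<otimes> T(V)\<close>.\<close>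

definition tens_sub ::
    "('i::finite \<Rightarrow> 'i \<Rightarrow> 'k::field) \<Rightarrow> ('i, 'k) tens_alg set \<Rightarrow> ('i, 'k) tens_alg set \<Rightarrow>
     ('i, 'k) tens_sq set" where
  "tens_sub q A B = lspan (TT q) {tens a b | a b. a \<in> A \<and> b \<in> B}"

definition tens_ker ::
    "('i::finite \<Rightarrow> 'i \<Rightarrow> 'k::field) \<Rightarrow> ('i, 'k) tens_alg set \<Rightarrow> ('i, 'k) tens_alg set \<Rightarrow>
     ('i, 'k) tens_sq set" where
  "tens_ker q I J = tens_sub q I UNIV <+>\<^bsub>TT q\<^esub> tens_sub q UNIV J"

text \<open>
  The two conditions on the braiding say that \<open>c\<close> and its inverse descend to \<open>T(V)/I\<close>; without
  them the quotient would not be a braided Hopf algebra.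
\<close>

definition braided_hopf_ideal ::
    "('i::finite \<Rightarrow> 'i \<Rightarrow> 'k::field) \<Rightarrow> ('i, 'k) tens_alg set \<Rightarrow> bool" where
  "braided_hopf_ideal q I \<longleftrightarrow>
     ideal I TV \<and>
     braid q ` tens_sub q I UNIV = tens_sub q UNIV I \<and>
     braid q ` tens_sub q UNIV I = tens_sub q I UNIV \<and>
     comult q ` I \<subseteq> tens_ker q I I \<and>
     counit ` I \<subseteq> {0} \<and>
     antip q ` I \<subseteq> I"

text \<open>
  A pre-Nichols algebra is represented by its ideal \<open>I\<close>; the algebra itself is \<open>pquot I\<close>. The
  generators in \<open>G\<close> are homogeneous of degree at least 2, so \<open>I\<close> is \<open>\<nat>\<^sub>0\<close>-homogeneous.
\<close>

definition pre_nichols_ideal ::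
    "('i::finite \<Rightarrow> 'i \<Rightarrow> 'k::field) \<Rightarrow> ('i, 'k) tens_alg set \<Rightarrow> bool" where
  "pre_nichols_ideal q I \<longleftrightarrow>
     braided_hopf_ideal q I \<and> (\<exists>G. G \<subseteq> (\<Union>n\<in>{2..}. TV_comp n) \<and> I = Idl\<^bsub>TV\<^esub> G)"

definition nichols_ideal ::
    "('i::finite \<Rightarrow> 'i \<Rightarrow> 'k::field) \<Rightarrow> ('i, 'k) tens_alg set" where
  "nichols_ideal q = (GREATEST I. pre_nichols_ideal q I)"

definition pquot :: "('i, 'k::field) tens_alg set \<Rightarrow> ('k, ('i, 'k) tens_alg set) module" where
  "pquot I = quot_alg TV I"

definition pcls :: "('i, 'k::field) tens_alg set \<Rightarrow> ('i, 'k) tens_alg \<Rightarrow> ('i, 'k) tens_alg set" where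
  "pcls I x = I +>\<^bsub>TV\<^esub> x"

definition pcomp :: "('i, 'k::field) tens_alg set \<Rightarrow> nat \<Rightarrow> ('i, 'k) tens_alg set set" where
  "pcomp I n = pcls I ` TV_comp n"

text \<open>
  \<open>T(V)/I \<otimes> T(V)/J\<close> is realised as \<open>(T(V) \<otimes> T(V)) / (I \<otimes> T(V) + T(V) \<otimes> J)\<close>, with pure tensors
  \<open>ptens\<close>. All structure maps below are induced from those of \<open>T(V)\<close>.
\<close>

definition ptens_sp ::
    "('i::finite \<Rightarrow> 'i \<Rightarrow> 'k::field) \<Rightarrow> ('i, 'k) tens_alg set \<Rightarrow> ('i, 'k) tens_alg set \<Rightarrow>
     ('k, ('i, 'k) tens_sq set) module" where
  "ptens_sp q I J = quot_alg (TT q) (tens_ker q I J)"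

definition ptens ::
    "('i::finite \<Rightarrow> 'i \<Rightarrow> 'k::field) \<Rightarrow> ('i, 'k) tens_alg set \<Rightarrow> ('i, 'k) tens_alg set \<Rightarrow>
     ('i, 'k) tens_alg set \<Rightarrow> ('i, 'k) tens_alg set \<Rightarrow> ('i, 'k) tens_sq set" where
  "ptens q I J X Y = (\<Union>x\<in>X. \<Union>y\<in>Y. tens_ker q I J +>\<^bsub>TT q\<^esub> tens x y)"

definition pcomult ::
    "('i::finite \<Rightarrow> 'i \<Rightarrow> 'k::field) \<Rightarrow> ('i, 'k) tens_alg set \<Rightarrow>
     ('i, 'k) tens_alg set \<Rightarrow> ('i, 'k) tens_sq set" where
  "pcomult q I X = (\<Union>x\<in>X. tens_ker q I I +>\<^bsub>TT q\<^esub> comult q x)"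

definition pcounit :: "('i, 'k::field) tens_alg set \<Rightarrow> 'k" where
  "pcounit X = the_elem (counit ` X)"

definition pantip ::
    "('i::finite \<Rightarrow> 'i \<Rightarrow> 'k::field) \<Rightarrow> ('i, 'k) tens_alg set \<Rightarrow>
     ('i, 'k) tens_alg set \<Rightarrow> ('i, 'k) tens_alg set" where
  "pantip q I X = (\<Union>x\<in>X. pcls I (antip q x))"

definition pbraid ::
    "('i::finite \<Rightarrow> 'i \<Rightarrow> 'k::field) \<Rightarrow> ('i, 'k) tens_alg set \<Rightarrow>
     ('i, 'k) tens_sq set \<Rightarrow> ('i, 'k) tens_sq set" where
  "pbraid q I \<Xi> = (\<Union>t\<in>\<Xi>. tens_ker q I I +>\<^bsub>TT q\<^esub> braid q t)"

text \<open>
  The linear map \<open>f \<otimes> g : T(V)/I \<otimes> T(V)/J \<rightarrow> T(V)/I' \<otimes> T(V)/J'\<close> for linear \<open>f\<close> and \<open>g\<close>; its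
  value does not depend on the representative \<open>t\<close>.
\<close>

definition ptens_map ::
    "('i::finite \<Rightarrow> 'i \<Rightarrow> 'k::field) \<Rightarrow>
     ('i, 'k) tens_alg set \<Rightarrow> ('i, 'k) tens_alg set \<Rightarrow>
     ('i, 'k) tens_alg set \<Rightarrow> ('i, 'k) tens_alg set \<Rightarrow>
     (('i, 'k) tens_alg set \<Rightarrow> ('i, 'k) tens_alg set) \<Rightarrow>
     (('i, 'k) tens_alg set \<Rightarrow> ('i, 'k) tens_alg set) \<Rightarrow>
     ('i, 'k) tens_sq set \<Rightarrow> ('i, 'k) tens_sq set" where
  "ptens_map q I J I' J' f g \<Xi> = the_elem ((\<lambda>t.
     \<Oplus>\<^bsub>ptens_sp q I' J'\<^esub>p\<in>Poly_Mapping.keys t. Poly_Mapping.lookup t p \<odot>\<^bsub>ptens_sp q I' J'\<^esub>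
       ptens q I' J' (f (pcls I (wd (letters (fst p))))) (g (pcls J (wd (letters (snd p)))))) ` \<Xi>)"

text \<open>Morphisms \<open>T(V)/I \<rightarrow> T(V)/J\<close> of \<open>\<nat>\<^sub>0\<close>-graded braided Hopf algebras.\<close>

definition hopf_hom ::
    "('i::finite \<Rightarrow> 'i \<Rightarrow> 'k::field) \<Rightarrow> ('i, 'k) tens_alg set \<Rightarrow> ('i, 'k) tens_alg set \<Rightarrow>
     (('i, 'k) tens_alg set \<Rightarrow> ('i, 'k) tens_alg set) set" where
  "hopf_hom q I J = {\<phi> \<in> alg_hom (pquot I) (pquot J).
     (\<forall>n. \<phi> ` pcomp I n \<subseteq> pcomp J n) \<and>
     (\<forall>\<Xi>\<in>carrier (ptens_sp q I I).
        ptens_map q I I J J \<phi> \<phi> (pbraid q I \<Xi>) = pbraid q J (ptens_map q I I J J \<phi> \<phi> \<Xi>)) \<and>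
     (\<forall>X\<in>carrier (pquot I).
        ptens_map q I I J J \<phi> \<phi> (pcomult q I X) = pcomult q J (\<phi> X) \<and>
        pcounit (\<phi> X) = pcounit X \<and>
        \<phi> (pantip q I X) = pantip q J (\<phi> X))}"

definition eminent ::
    "('i::finite \<Rightarrow> 'i \<Rightarrow> 'k::field) \<Rightarrow> ('i, 'k) tens_alg set \<Rightarrow> bool" where
  "eminent q I \<longleftrightarrow> pre_nichols_ideal q I \<and> GKdim (pquot I) < \<infinity> \<and>
     (\<forall>J. pre_nichols_ideal q J \<and> GKdim (pquot J) < \<infinity> \<longrightarrow>
        (\<exists>\<phi>\<in>hopf_hom q I J. \<phi> ` carrier (pquot I) = carrier (pquot J) \<and>
           (\<forall>i. \<phi> (pcls I (wd [i])) = pcls J (wd [i]))))"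


section \<open>Extensions\<close>

definition ptens_sub ::
    "('i::finite \<Rightarrow> 'i \<Rightarrow> 'k::field) \<Rightarrow> ('i, 'k) tens_alg set \<Rightarrow>
     ('i, 'k) tens_alg set set \<Rightarrow> ('i, 'k) tens_alg set set \<Rightarrow> ('i, 'k) tens_sq set set" where
  "ptens_sub q I A B = lspan (ptens_sp q I I) {ptens q I I X Y | X Y. X \<in> A \<and> Y \<in> B}"

text \<open>
  \<open>Z \<subseteq> T(V)/I\<close> is a graded braided Hopf algebra for the restricted structure, so that the
  inclusion is a (degree-preserving, injective) morphism of graded braided Hopf algebras.
\<close>

definition graded_hopf_subalgebra ::
    "('i::finite \<Rightarrow> 'i \<Rightarrow> 'k::field) \<Rightarrow> ('i, 'k) tens_alg set \<Rightarrow>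
     ('i, 'k) tens_alg set set \<Rightarrow> bool" where
  "graded_hopf_subalgebra q I Z \<longleftrightarrow>
     subalgebra (pquot I) Z \<and>
     Z = lspan (pquot I) (\<Union>n. Z \<inter> pcomp I n) \<and>
     pbraid q I ` ptens_sub q I Z Z = ptens_sub q I Z Z \<and>
     pcomult q I ` Z \<subseteq> ptens_sub q I Z Z \<and>
     pantip q I ` Z \<subseteq> Z"

text \<open>
  The sequence \<open>Z \<rightarrow> T(V)/I \<rightarrow> T(V)/J\<close>, whose first map is the inclusion and whose second map
  is \<open>\<pi>\<close>, is a degree-preserving extension of braided Hopf algebras.
\<close>

definition hopf_extension ::
    "('i::finite \<Rightarrow> 'i \<Rightarrow> 'k::field) \<Rightarrow> ('i, 'k) tens_alg set set \<Rightarrow>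
     ('i, 'k) tens_alg set \<Rightarrow> ('i, 'k) tens_alg set \<Rightarrow>
     (('i, 'k) tens_alg set \<Rightarrow> ('i, 'k) tens_alg set) \<Rightarrow> bool" where
  "hopf_extension q Z I J \<pi> \<longleftrightarrow>
     graded_hopf_subalgebra q I Z \<and>
     \<pi> \<in> hopf_hom q I J \<and>
     \<pi> ` carrier (pquot I) = carrier (pquot J) \<and>
     {X \<in> carrier (pquot I). \<pi> X = \<zero>\<^bsub>pquot J\<^esub>} =
       lspan (pquot I) {X \<otimes>\<^bsub>pquot I\<^esub> Y | X Y. X \<in> carrier (pquot I) \<and> Y \<in> Z \<and> pcounit Y = 0} \<and>
     Z = {X \<in> carrier (pquot I).
            ptens_map q I I I J (\<lambda>Y. Y) \<pi> (pcomult q I X) = ptens q I J X \<one>\<^bsub>pquot J\<^esub>}"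

text \<open>The projection \<open>T(V)/I \<rightarrow> T(V)/J\<close> induced by the identity, for \<open>I \<subseteq> J\<close>.\<close>

definition can_proj ::
    "('i, 'k::field) tens_alg set \<Rightarrow> ('i, 'k) tens_alg set \<Rightarrow> ('i, 'k) tens_alg set" where
  "can_proj J X = (\<Union>x\<in>X. pcls J x)"


section \<open>The algebra of type \<open>D(2,1;\<alpha>)\<close>\<close>

text \<open>The three basis vectors are indexed by the type \<open>3\<close>, whose elements are \<open>1\<close>, \<open>2\<close> and \<open>3 = 0\<close>.\<close>

definition D21_ideal :: "(3 \<Rightarrow> 3 \<Rightarrow> 'k::field) \<Rightarrow> (3, 'k) tens_alg set" where
  "D21_ideal q = Idl\<^bsub>TV\<^esub> {xw q [2] ^ 2, xw q [1, 3], xw q [1, 1, 2], xw q [3, 3, 2]}"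

definition x1223 :: "(3 \<Rightarrow> 3 \<Rightarrow> 'k::field) \<Rightarrow> (3, 'k) tens_alg" where
  "x1223 q = cbracket q (xw q [1, 2, 3]) (xw q [2])"

definition D21_exponents :: "(nat \<times> nat \<times> nat \<times> nat \<times> nat \<times> nat \<times> nat) set" where
  "D21_exponents = {(n1, n2, n3, n4, n5, n6, n7).
     n2 \<in> {0, 1} \<and> n3 \<in> {0, 1} \<and> n5 \<in> {0, 1} \<and> n6 \<in> {0, 1}}"

definition D21_monomial ::
    "(3 \<Rightarrow> 3 \<Rightarrow> 'k::field) \<Rightarrow> nat \<times> nat \<times> nat \<times> nat \<times> nat \<times> nat \<times> nat \<Rightarrow> (3, 'k) tens_alg set" where
  "D21_monomial q = (\<lambda>(n1, n2, n3, n4, n5, n6, n7). pcls (D21_ideal q)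
     (xw q [3] ^ n1 * xw q [2, 3] ^ n2 * xw q [2] ^ n3 * x1223 q ^ n4 *
      xw q [1, 2, 3] ^ n5 * xw q [1, 2] ^ n6 * xw q [1] ^ n7))"


section \<open>The braided commutator on homogeneous elements\<close>

lemma lookup_scal [simp]: "Poly_Mapping.lookup (scal c x) w = c * Poly_Mapping.lookup x w"
  by (simp add: scal_def Poly_Mapping.map.rep_eq when_def)

lemma scal_zero [simp]: "scal c 0 = 0" "scal 0 x = 0"
  by (auto intro!: poly_mapping_eqI)

lemma scal_add: "scal c (x + y) = scal c x + scal c y" "scal (a + b) x = scal a x + scal b x"
  by (auto intro!: poly_mapping_eqI simp: lookup_add algebra_simps)

lemma scal_scal: "scal a (scal b x) = scal (a * b) x"
  by (auto intro!: poly_mapping_eqI simp: algebra_simps)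

lemma scal_one [simp]: "scal 1 x = x"
  by (auto intro!: poly_mapping_eqI)

lemma scal_single [simp]:
  "scal a (Poly_Mapping.single w b) = Poly_Mapping.single w (a * b)"
  by (auto intro!: poly_mapping_eqI simp: lookup_single when_def)

lemma scal_sum: "scal c (\<Sum>i\<in>A. f i) = (\<Sum>i\<in>A. scal c (f i))"
  by (induction A rule: infinite_finite_induct) (auto simp: scal_add)

lemma lext_superset:
  assumes "finite A" "Poly_Mapping.keys x \<subseteq> A"
  shows "lext f x = (\<Sum>w\<in>A. scal (Poly_Mapping.lookup x w) (f w))"
  unfolding lext_def using assms
  by (intro sum.mono_neutral_left) (auto simp: in_keys_iff)

lemma lext_single [simp]: "lext f (Poly_Mapping.single w c) = scal c (f w)"
  by (subst lext_superset[of "{w}"]) auto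

lemma lext_add: "lext f (x + y) = lext f x + lext f y"
proof -
  let ?A = "Poly_Mapping.keys x \<union> Poly_Mapping.keys y"
  have "Poly_Mapping.keys (x + y) \<subseteq> ?A"
    by (rule Poly_Mapping.keys_add)
  then show ?thesis
    by (simp add: lext_superset[of ?A] lookup_add scal_add sum.distrib)
qed

lemma lext_zero [simp]: "lext f 0 = 0"
  by (simp add: lext_def)

lemma lext_scal: "lext f (scal c x) = scal c (lext f x)"
proof -
  have "Poly_Mapping.keys (scal c x) \<subseteq> Poly_Mapping.keys x"
    by (auto simp: in_keys_iff)
  then show ?thesis
    by (simp add: lext_superset[of "Poly_Mapping.keys x"] scal_sum scal_scal)
qed

lemma lext_sum: "lext f (\<Sum>i\<in>A. g i) = (\<Sum>i\<in>A. lext f (g i))"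
  by (induction A rule: infinite_finite_induct) (auto simp: lext_add)

lemma tens_expand:
  "tens x y = (\<Sum>u\<in>Poly_Mapping.keys x. \<Sum>v\<in>Poly_Mapping.keys y.
     Poly_Mapping.single (u, v) (Poly_Mapping.lookup x u * Poly_Mapping.lookup y v))"
  unfolding tens_def lext_def by (simp add: scal_sum)

lemma expand_single:
  "x = (\<Sum>u\<in>Poly_Mapping.keys x. Poly_Mapping.single u (Poly_Mapping.lookup x u))"
  by (auto intro!: poly_mapping_eqI simp: lookup_sum lookup_single when_def in_keys_iff)

lemma mult_expand:
  fixes x y :: "('i, 'k::field) tens_alg"
  shows "x * y = (\<Sum>u\<in>Poly_Mapping.keys x. \<Sum>v\<in>Poly_Mapping.keys y.
     Poly_Mapping.single (u + v) (Poly_Mapping.lookup x u * Poly_Mapping.lookup y v))"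
proof -
  have "x * y = (\<Sum>u\<in>Poly_Mapping.keys x. Poly_Mapping.single u (Poly_Mapping.lookup x u)) *
      (\<Sum>v\<in>Poly_Mapping.keys y. Poly_Mapping.single v (Poly_Mapping.lookup y v))"
    using expand_single[of x] expand_single[of y] by simp
  then show ?thesis
    by (simp add: sum_product mult_single)
qed

lemma mul_tens: "mul (tens x y) = x * y"
  by (simp add: mul_def tens_expand lext_sum mult_expand)

lemma cbracket_homogeneous:
  assumes "homogeneous \<beta> x" "homogeneous \<gamma> y"
  shows "cbracket q x y = x * y - scal (bichar q \<beta> \<gamma>) (y * x)"
proof -
  have "mul (braid q (tens x y)) =
      (\<Sum>u\<in>Poly_Mapping.keys x. \<Sum>v\<in>Poly_Mapping.keys y. Poly_Mapping.single (v + u)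
        (Poly_Mapping.lookup x u * Poly_Mapping.lookup y v * bichar q (wdeg u) (wdeg v)))"
    by (simp add: mul_def braid_def tens_expand lext_sum)
  also have "\<dots> = (\<Sum>u\<in>Poly_Mapping.keys x. \<Sum>v\<in>Poly_Mapping.keys y.
      scal (bichar q \<beta> \<gamma>) (Poly_Mapping.single (v + u)
        (Poly_Mapping.lookup y v * Poly_Mapping.lookup x u)))"
    using assms by (intro sum.cong refl) (simp add: homogeneous_def mult_ac)
  also have "\<dots> = scal (bichar q \<beta> \<gamma>) (y * x)"
    by (subst sum.swap) (simp add: mult_expand scal_sum)
  finally show ?thesis
    by (simp add: cbracket_def)
qed

end

theory Submission
  imports Defs "HOL-Library.Function_Algebras" "HOL-Real_Asymp.Real_Asymp"
begin

text \<open>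
  The skew derivations \<open>\<partial>\<^sub>i\<close>, the slices of \<open>\<Delta>\<close> at \<open>x\<^sub>i\<close> in the right factor, descend to every
  pre-Nichols algebra. Modulo the ideal \<open>I\<close> of the relations, composites of them such as
  \<open>\<partial>\<^sub>1\<close>, \<open>\<partial>\<^sub>1\<partial>\<^sub>2\<close>, \<open>\<partial>\<^sub>1\<partial>\<^sub>2\<partial>\<^sub>3\<close>, \<open>\<partial>\<^sub>1\<partial>\<^sub>2\<partial>\<^sub>3\<partial>\<^sub>2\<close> lower the exponent of one PBW generator at a time. This
  proves that the PBW monomials, which span by straightening, are independent, and that the
  common kernel of all \<open>\<partial>\<^sub>i\<close> is spanned by the powers of \<open>y = x\<^sub>1\<^sub>2\<^sub>2\<^sub>3\<^sup>L\<close>; these are independent because the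
  coefficient of the word \<open>(1232)\<^sup>m\<close> vanishes on \<open>I\<close>. The description of the common kernel makes \<open>y\<close>
  primitive and normal modulo \<open>I\<close>, identifies the coinvariants of the projection onto
  \<open>T(V)/\<langle>I, y\<rangle>\<close>, and shows that \<open>\<langle>I, y\<rangle>\<close> is the largest pre-Nichols ideal, since lowering an element of a
  pre-Nichols ideal leads to a polynomial in \<open>y\<close> without constant term.

  For eminence, suppose that a relation \<open>w\<close> is not zero in a pre-Nichols algebra. Since \<open>w\<close> is primitive there,
  the iterated braided commutators of a suitable \<open>x\<^sub>i\<close> and \<open>w\<close> have independent ordered products,
  whose number outgrows every polynomial.
\<close>

text \<open>The obstacle is that s is a root of unity. The operator lowering the exponent n of
  x_1223 multiplies by the s-number [n]_s up to a nonzero factor, so it sees nothing at n = L. The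
  exponent is therefore divided by L with remainder; the powers of y are moved to the front of the
  monomial at the cost of nonzero scalars and told apart by word coefficients, while the remainder
  stays below L. For x_1 and x_3 no such obstruction arises, as q and r are not roots of unity. All
  elements stay in T(V) and are compared modulo I, where gradings, word coefficients and slices of
  tensors remain available.

  For growth, let a primitive a act on a primitive b by iterated braided commutators. These stay
  nondegenerate if [n] at chi(a,a) is nonzero for n >= 1 and chi(a,a)^n chi(a,b) chi(b,a) is never
  1. With w as b, x_1 or x_3 can serve as a for every relation except x_2^2. There the roles are
  exchanged: x_2^2 acts on x_1 with self-braiding 1, where [n] = n is nonzero in characteristic
  zero, and with double braiding q^-2.\<close>

declare plus_fun_apply [simp del] times_fun_apply [simp del] zero_fun_apply [simp del]

section \<open>Linear maps on the tensor algebra and its square\<close>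

abbreviation bs :: "'b \<Rightarrow> ('b \<Rightarrow>\<^sub>0 'k::field)" where
  "bs w \<equiv> Poly_Mapping.single w 1"

interpretation pm: vector_space "scal :: 'k::field \<Rightarrow> ('b \<Rightarrow>\<^sub>0 'k) \<Rightarrow> ('b \<Rightarrow>\<^sub>0 'k)"
  by standard (auto simp: scal_add scal_scal)

lemma pm_induct [case_names zero add scal bs]:
  fixes x :: "'b \<Rightarrow>\<^sub>0 'k::field"
  assumes "P 0" "\<And>x y. P x \<Longrightarrow> P y \<Longrightarrow> P (x + y)" "\<And>c x. P x \<Longrightarrow> P (scal c x)" "\<And>w. P (bs w)"
  shows "P x"
proof -
  have single: "P (Poly_Mapping.single w c)" for w c
    using assms(3)[OF assms(4), of c w] by simp
  have "P (\<Sum>u\<in>A. Poly_Mapping.single u (Poly_Mapping.lookup x u))" for A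
    by (induction A rule: infinite_finite_induct) (auto intro: assms(1,2) single)
  then show ?thesis
    using expand_single[of x] by metis
qed

lemma scal_minus: "scal c (- x) = - scal c x" "scal (- c) x = - scal c x"
  by (auto intro!: poly_mapping_eqI simp: lookup_uminus)

lemma scal_diff: "scal c (x - y) = scal c x - scal c y"
  by (auto intro!: poly_mapping_eqI simp: lookup_minus algebra_simps)

lemma pm_induct_single [case_names zero add single]:
  fixes x :: "'b \<Rightarrow>\<^sub>0 'k::field"
  assumes "P 0" "\<And>x y. P x \<Longrightarrow> P y \<Longrightarrow> P (x + y)" "\<And>w c. P (Poly_Mapping.single w c)"
  shows "P x"
proof -
  have "P (\<Sum>u\<in>A. Poly_Mapping.single u (Poly_Mapping.lookup x u))" for A
    by (induction A rule: infinite_finite_induct) (auto intro: assms)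
  then show ?thesis
    using expand_single[of x] by metis
qed

lemma scal_mult_left [simp]:
  fixes x y :: "('i, 'k::field) tens_alg"
  shows "scal c x * y = scal c (x * y)"
proof (induction x rule: pm_induct_single)
  case (single w d)
  show ?case
    by (induction y rule: pm_induct_single) (auto simp: algebra_simps scal_add mult_single)
qed (auto simp: algebra_simps scal_add)

lemma scal_mult_right [simp]:
  fixes x y :: "('i, 'k::field) tens_alg"
  shows "x * scal c y = scal c (x * y)"
proof (induction x rule: pm_induct_single)
  case (single w d)
  show ?case
    by (induction y rule: pm_induct_single) (auto simp: algebra_simps scal_add mult_single)
qed (auto simp: algebra_simps scal_add)

lemma bs_zero: "bs (0 :: 'i word) = (1 :: ('i, 'k::field) tens_alg)"
  by simp

lemma bs_mult: "bs u * bs v = (bs (u + v) :: ('i, 'k::field) tens_alg)"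
  by (simp add: mult_single)

lemma wd_eq: "wd is = bs (Word is)"
  by (simp add: wd_def)

lemma wd_mult: "wd is * wd js = (wd (is @ js) :: ('i, 'k::field) tens_alg)"
  by (simp add: wd_def mult_single plus_word_def)

lemma word_induct [case_names Nil Cons]:
  assumes "P 0" "\<And>i w. P w \<Longrightarrow> P (Word [i] + w)"
  shows "P w"
proof -
  have "P (Word is)" for "is"
  proof (induction "is")
    case (Cons i "is")
    then show ?case using assms(2)[of "Word is" i] by (simp add: plus_word_def)
  qed (use assms(1) in \<open>simp add: zero_word_def\<close>)
  then show ?thesis by (metis word.exhaust)
qed

text \<open>Induction on words letter by letter, the recursion along which
  \<open>comult_list\<close> and \<open>antip_list\<close> are defined; linearity takes care of
  general elements.\<close>

lemma T_induct [case_names one wd add scal]: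
  fixes x :: "('i, 'k::field) tens_alg"
  assumes "P 1" "\<And>i w. P (bs w) \<Longrightarrow> P (wd [i] * bs w)" "\<And>x y. P x \<Longrightarrow> P y \<Longrightarrow> P (x + y)" "\<And>c x. P x \<Longrightarrow> P (scal c x)"
  shows "P x"
proof (induction x rule: pm_induct)
  case zero
  then show ?case using assms(4)[OF assms(1), of 0] by simp
next
  case (bs w)
  then show ?case
  proof (induction w rule: word_induct)
    case (Cons i w)
    then show ?case using assms(2)[of w i] by (simp add: wd_eq bs_mult)
  qed (use assms(1) in simp)
qed (auto intro: assms(3,4))

text \<open>Linearity as a predicate on bare functions, so that composites with slices, products and
  tensors are recognised by introduction rules; \<open>pfun\<close> is the variant for functionals,
  whose values lie in the field itself.\<close>

definition plin :: "(('b \<Rightarrow>\<^sub>0 'k::field) \<Rightarrow> ('c \<Rightarrow>\<^sub>0 'k)) \<Rightarrow> bool" where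
  "plin f \<longleftrightarrow> (\<forall>x y. f (x + y) = f x + f y) \<and> (\<forall>c x. f (scal c x) = scal c (f x))"

definition pfun :: "(('b \<Rightarrow>\<^sub>0 'k::field) \<Rightarrow> 'k) \<Rightarrow> bool" where
  "pfun f \<longleftrightarrow> (\<forall>x y. f (x + y) = f x + f y) \<and> (\<forall>c x. f (scal c x) = c * f x)"

lemma plin_add: "plin f \<Longrightarrow> f (x + y) = f x + f y"
  and plin_scal: "plin f \<Longrightarrow> f (scal c x) = scal c (f x)"
  by (auto simp: plin_def)

lemma plin_zero: "plin f \<Longrightarrow> f 0 = 0"
  using plin_scal[of f 0 0] by simp

lemma plin_minus: "plin f \<Longrightarrow> f (- x) = - f x"
  using plin_scal[of f "- 1" x] by (simp add: scal_minus)

lemma plin_diff: "plin f \<Longrightarrow> f (x - y) = f x - f y"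
  using plin_add[of f x "- y"] by (simp add: plin_minus)

lemma plin_sum: "plin f \<Longrightarrow> f (\<Sum>i\<in>A. g i) = (\<Sum>i\<in>A. f (g i))"
  by (induction A rule: infinite_finite_induct) (auto simp: plin_add plin_zero)

lemma pfun_add: "pfun f \<Longrightarrow> f (x + y) = f x + f y"
  and pfun_scal: "pfun f \<Longrightarrow> f (scal c x) = c * f x"
  by (auto simp: pfun_def)

lemma pfun_zero: "pfun f \<Longrightarrow> f 0 = 0"
  using pfun_scal[of f 0 0] by simp

lemma plin_lext: "plin (lext f)"
  by (simp add: plin_def lext_add lext_scal)

lemma plin_comp: "plin f \<Longrightarrow> plin g \<Longrightarrow> plin (\<lambda>x. f (g x))"
  by (simp add: plin_def)

lemma pfun_comp: "pfun f \<Longrightarrow> plin g \<Longrightarrow> pfun (\<lambda>x. f (g x))"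
  by (simp add: plin_def pfun_def)

lemma plin_id: "plin (\<lambda>x. x)"
  by (simp add: plin_def)

lemma plin_scale: "plin f \<Longrightarrow> plin (\<lambda>x. scal c (f x))"
  by (simp add: plin_def scal_add scal_scal mult.commute)

lemma plin_plus: "plin f \<Longrightarrow> plin g \<Longrightarrow> plin (\<lambda>x. f x + g x)"
  by (simp add: plin_def scal_add algebra_simps)

lemma plin_minus_fun: "plin f \<Longrightarrow> plin g \<Longrightarrow> plin (\<lambda>x. f x - g x)"
  by (simp add: plin_def scal_diff algebra_simps)

lemma pfun_lookup: "pfun (\<lambda>x. Poly_Mapping.lookup x w)"
  by (simp add: pfun_def lookup_add)

lemma plin_eqI:
  assumes "plin f" "plin g" "\<And>w. f (bs w) = g (bs w)"
  shows "f x = g x"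
  by (induction x rule: pm_induct) (auto simp: assms plin_add plin_scal plin_zero)

lemma plin_mult_left: "plin (\<lambda>x. y * x :: ('i, 'k::field) tens_alg)"
  and plin_mult_right: "plin (\<lambda>x. x * y :: ('i, 'k::field) tens_alg)"
  by (auto simp: plin_def algebra_simps)

lemma subspace_kernel: "plin f \<Longrightarrow> pm.subspace S \<Longrightarrow> pm.subspace {x. f x \<in> S}"
  by (auto simp: pm.subspace_def plin_add plin_scal plin_zero)

lemma plin_image_span:
  assumes "plin f"
  shows "f ` pm.span S = pm.span (f ` S)"
proof -
  have "f x \<in> pm.span (f ` S)" if "x \<in> pm.span S" for x
    using that by (induction rule: pm.span_induct_alt)
      (auto simp: plin_add[OF assms] plin_scal[OF assms] plin_zero[OF assms] pm.span_zero
        intro!: pm.span_add pm.span_scale intro: pm.span_base)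
  moreover have "pm.span (f ` S) \<subseteq> f ` pm.span S"
  proof (rule pm.span_minimal)
    show "pm.subspace (f ` pm.span S)"
      unfolding pm.subspace_def
    proof (safe)
      show "0 \<in> f ` pm.span S" by (metis plin_zero[OF assms] imageI pm.span_zero)
      show "f x + f y \<in> f ` pm.span S" if "x \<in> pm.span S" "y \<in> pm.span S" for x y
        by (metis plin_add[OF assms] imageI pm.span_add that)
      show "scal c (f x) \<in> f ` pm.span S" if "x \<in> pm.span S" for c x
        by (metis plin_scal[OF assms] imageI pm.span_scale that)
    qed
  qed (auto intro: pm.span_base)
  ultimately show ?thesis by auto
qed

text \<open>The workhorse for containments: a linear map is checked on a spanning set, with a
  subspace as target. The target \<open>{0}\<close> turns it into a proof of an equation.\<close>

lemma plin_span_into: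
  assumes "plin f" "pm.subspace U" "\<And>x. x \<in> S \<Longrightarrow> f x \<in> U" "x \<in> pm.span S"
  shows "f x \<in> U"
  using assms(4) pm.span_minimal[OF _ subspace_kernel[OF assms(1,2)], of S] assms(3) by auto

section \<open>Tensors\<close>

lemma tens_single:
  "tens (Poly_Mapping.single u a) (Poly_Mapping.single v b) = Poly_Mapping.single (u, v) (a * b)"
  by (simp add: tens_def)

lemma tens_bs: "tens (bs u) (bs v) = bs (u, v)"
  by (simp add: tens_single)

lemma plin_tens_left: "plin (\<lambda>x. tens x y)"
  unfolding tens_def by (rule plin_lext)

lemma plin_tens_right: "plin (\<lambda>y. tens x y)"
  unfolding plin_def tens_def
proof (intro conjI allI)
  fix y z c
  let ?t = "\<lambda>y u. lext (\<lambda>v. Poly_Mapping.single (u, v) 1) y"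
  show "lext (?t (y + z)) x = lext (?t y) x + lext (?t z) x"
    by (induction x rule: pm_induct) (auto simp: lext_add lext_scal scal_add algebra_simps)
  show "lext (?t (scal c y)) x = scal c (lext (?t y) x)"
    by (induction x rule: pm_induct) (auto simp: lext_add lext_scal scal_add scal_scal algebra_simps)
qed

lemmas tens_add_left = plin_add[OF plin_tens_left]
  and tens_add_right = plin_add[OF plin_tens_right]
  and tens_scal_left = plin_scal[OF plin_tens_left]
  and tens_scal_right = plin_scal[OF plin_tens_right]
  and tens_diff_left = plin_diff[OF plin_tens_left]
  and tens_diff_right = plin_diff[OF plin_tens_right]

lemma tens_zero [simp]: "tens 0 y = 0" "tens x 0 = 0"
  by (simp_all add: plin_zero[OF plin_tens_left] plin_zero[OF plin_tens_right])

lemma tens_sq_induct [case_names zero add scal tens]: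
  fixes t :: "('i, 'k::field) tens_sq"
  assumes "P 0" "\<And>x y. P x \<Longrightarrow> P y \<Longrightarrow> P (x + y)" "\<And>c x. P x \<Longrightarrow> P (scal c x)"
    "\<And>u v. P (tens (bs u) (bs v))"
  shows "P t"
  by (induction t rule: pm_induct) (auto simp: assms simp flip: tens_bs)

lemma plin_eqI_tens:
  assumes "plin f" "plin g" "\<And>u v. f (tens (bs u) (bs v)) = g (tens (bs u) (bs v))"
  shows "f t = g t"
  by (induction t rule: tens_sq_induct) (auto simp: assms plin_add plin_scal plin_zero)

section \<open>The bicharacter and the braided tensor square\<close>

lemma wdeg_plus: "wdeg (u + v) = wdeg u + wdeg v"
  by (auto simp: wdeg_def plus_word_def plus_fun_apply)

lemma wdeg_zero [simp]: "wdeg 0 = 0"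
  by (auto simp: wdeg_def zero_word_def zero_fun_apply)

lemma bichar_zero [simp]: "bichar q 0 \<gamma> = 1" "bichar q \<beta> 0 = 1"
  by (auto simp: bichar_def zero_fun_apply)

definition unitv :: "'i \<Rightarrow> 'i \<Rightarrow> int" where
  "unitv i j = (if i = j then 1 else 0)"

lemma wdeg_single: "wdeg (Word [i]) = unitv i"
  by (auto simp: wdeg_def unitv_def)

lemma bichar_unitv: "bichar q (unitv i) (unitv j) = q i j"
proof -
  have "q a b powi (unitv i a * unitv j b) = (if b = j then (if a = i then q a b else 1) else 1)" for a b
    by (auto simp: unitv_def)
  then show ?thesis by (simp add: bichar_def prod.delta)
qed

lemma homogeneous_single [simp]: "homogeneous (wdeg w) (Poly_Mapping.single w c)"
  by (auto simp: homogeneous_def)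

lemma homogeneous_zero [simp]: "homogeneous \<beta> 0"
  by (auto simp: homogeneous_def)

lemma homogeneous_one [simp]: "homogeneous 0 (1 :: ('i, 'k::field) tens_alg)"
  using homogeneous_single[of 0 1] by simp

lemma homogeneous_wd: "homogeneous (unitv i) (wd [i])"
  using homogeneous_single[of "Word [i]" 1] by (simp add: wd_eq wdeg_single)

lemma homogeneous_add: "homogeneous \<beta> x \<Longrightarrow> homogeneous \<beta> y \<Longrightarrow> homogeneous \<beta> (x + y)"
  using Poly_Mapping.keys_add[of x y] by (auto simp: homogeneous_def)

lemma homogeneous_scal: "homogeneous \<beta> x \<Longrightarrow> homogeneous \<beta> (scal c x)"
  by (auto simp: homogeneous_def in_keys_iff)

lemma homogeneous_diff: "homogeneous \<beta> x \<Longrightarrow> homogeneous \<beta> y \<Longrightarrow> homogeneous \<beta> (x - y)"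
  using homogeneous_add[of \<beta> x "- y"] homogeneous_scal[of \<beta> y "-1"] by (simp add: scal_minus)

lemma homogeneous_induct [consumes 1, case_names zero add scal bs]:
  fixes x :: "('i, 'k::field) tens_alg"
  assumes "homogeneous \<beta> x" "P 0" "\<And>x y. P x \<Longrightarrow> P y \<Longrightarrow> P (x + y)" "\<And>c x. P x \<Longrightarrow> P (scal c x)"
    "\<And>w. wdeg w = \<beta> \<Longrightarrow> P (bs w)"
  shows "P x"
proof -
  have "P (\<Sum>u\<in>A. Poly_Mapping.single u (Poly_Mapping.lookup x u))" if "A \<subseteq> Poly_Mapping.keys x" for A
    using that
  proof (induction A rule: infinite_finite_induct)
    case (insert w A)
    have "P (Poly_Mapping.single w (Poly_Mapping.lookup x w))"
      using assms(4)[OF assms(5), of w "Poly_Mapping.lookup x w"] assms(1) insert by (auto simp: homogeneous_def)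
    then show ?case using insert by (simp add: assms(3))
  qed (auto intro: assms(2))
  then show ?thesis
    using expand_single[of x] by (metis order_refl)
qed

lemma homogeneous_mult:
  assumes "homogeneous \<beta> x" "homogeneous \<gamma> y"
  shows "homogeneous (\<beta> + \<gamma>) (x * y)"
  using assms(1)
proof (induction rule: homogeneous_induct)
  case (bs u)
  note u = this
  show ?case using assms(2)
  proof (induction rule: homogeneous_induct)
    case (bs v)
    show ?case using homogeneous_single[of "u + v" 1] unfolding wdeg_plus u bs by (simp add: bs_mult)
  qed (auto simp: distrib_left homogeneous_add homogeneous_scal)
qed (auto simp: distrib_right homogeneous_add homogeneous_scal)

text \<open>Multiples of a degree under a name of their own: the simplifier meets only
  \<open>dmul_Suc\<close>, and \<open>bichar_mult_right\<close> converts them into powers.\<close>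

definition dmul :: "nat \<Rightarrow> ('i \<Rightarrow> int) \<Rightarrow> 'i \<Rightarrow> int" where
  "dmul n \<beta> i = int n * \<beta> i"

lemma dmul_0 [simp]: "dmul 0 \<beta> = 0"
  and dmul_Suc: "dmul (Suc n) \<beta> = \<beta> + dmul n \<beta>"
  by (auto simp: dmul_def plus_fun_apply zero_fun_apply algebra_simps)

lemma homogeneous_power: "homogeneous \<beta> x \<Longrightarrow> homogeneous (dmul n \<beta>) (x ^ n)"
  by (induction n) (auto simp: dmul_Suc homogeneous_mult)

lemma plin_tmult_left: "plin (\<lambda>s. tmult q s t)"
  unfolding tmult_def by (rule plin_lext)

lemma plin_tmult_right: "plin (\<lambda>t. tmult q s t)"
  unfolding plin_def tmult_def
  by (intro conjI allI; induction s rule: pm_induct)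
    (auto simp: lext_add lext_scal scal_add scal_scal split_beta algebra_simps)

lemma tmult_bs:
  "tmult q (tens (bs a) (bs b)) (tens (bs c) (bs d)) =
    scal (bichar q (wdeg b) (wdeg c)) (tens (bs (a + c)) (bs (b + d)))"
  by (simp add: tmult_def tens_bs)

lemmas tmult_add_left = plin_add[OF plin_tmult_left]
  and tmult_add_right = plin_add[OF plin_tmult_right]
  and tmult_scal_left = plin_scal[OF plin_tmult_left]
  and tmult_scal_right = plin_scal[OF plin_tmult_right]
  and tmult_diff_left = plin_diff[OF plin_tmult_left]
  and tmult_diff_right = plin_diff[OF plin_tmult_right]
  and tmult_zero_left [simp] = plin_zero[OF plin_tmult_left]
  and tmult_zero_right [simp] = plin_zero[OF plin_tmult_right]

text \<open>The diagonal automorphism by which an element of degree \<open>\<beta>\<close> acts through the braiding.\<close>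

definition gl :: "('i::finite \<Rightarrow> 'i \<Rightarrow> 'k::field) \<Rightarrow> ('i \<Rightarrow> int) \<Rightarrow> ('i, 'k) tens_alg \<Rightarrow> ('i, 'k) tens_alg" where
  "gl q \<beta> = lext (\<lambda>w. scal (bichar q \<beta> (wdeg w)) (bs w))"

lemma plin_gl: "plin (gl q \<beta>)"
  unfolding gl_def by (rule plin_lext)

lemmas gl_add = plin_add[OF plin_gl] and gl_scal = plin_scal[OF plin_gl]
  and gl_zero [simp] = plin_zero[OF plin_gl]

lemma gl_bs: "gl q \<beta> (bs w) = scal (bichar q \<beta> (wdeg w)) (bs w)"
  by (simp add: gl_def)

lemma gl_one [simp]: "gl q \<beta> 1 = 1"
  using gl_bs[of q \<beta> 0] by simp

lemma gl_homogeneous: "homogeneous \<gamma> x \<Longrightarrow> gl q \<beta> x = scal (bichar q \<beta> \<gamma>) x"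
  by (induction rule: homogeneous_induct) (auto simp: gl_add gl_scal scal_add scal_scal mult.commute gl_bs)

locale diag_braiding =
  fixes q :: "'i::finite \<Rightarrow> 'i \<Rightarrow> 'k::field"
  assumes q_nz: "q i j \<noteq> 0"
begin

lemma bichar_add_left: "bichar q (\<beta> + \<beta>') \<gamma> = bichar q \<beta> \<gamma> * bichar q \<beta>' \<gamma>"
  unfolding bichar_def by (simp add: plus_fun_apply distrib_right power_int_add q_nz prod.distrib)

lemma bichar_add_right: "bichar q \<gamma> (\<beta> + \<beta>') = bichar q \<gamma> \<beta> * bichar q \<gamma> \<beta>'"
  unfolding bichar_def by (simp add: plus_fun_apply distrib_left power_int_add q_nz prod.distrib)

lemma bichar_nz [simp]: "bichar q \<beta> \<gamma> \<noteq> 0"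
  by (simp add: bichar_def q_nz)

lemma bichar_mult_right: "bichar q \<beta> (dmul n \<gamma>) = bichar q \<beta> \<gamma> ^ n"
  by (induction n) (auto simp: dmul_Suc bichar_add_right)

lemma gl_mult: "gl q \<beta> (x * y) = gl q \<beta> x * gl q \<beta> y"
proof (induction x rule: pm_induct)
  case (bs u)
  show ?case
    by (induction y rule: pm_induct)
      (auto simp: gl_add gl_scal distrib_left bs_mult gl_bs wdeg_plus bichar_add_right mult_single
        simp del: scal_single)
qed (auto simp: gl_add gl_scal distrib_right)

lemma gl_gl: "gl q \<beta> (gl q \<gamma> x) = gl q (\<beta> + \<gamma>) x"
  by (induction x rule: pm_induct) (auto simp: gl_add gl_scal gl_bs bichar_add_left scal_scal mult.commute simp del: scal_single)

lemma tmult_assoc: "tmult q (tmult q s t) u = tmult q s (tmult q t u)"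
proof (induction s rule: tens_sq_induct)
  case (tens s1 s2)
  show ?case
  proof (induction t rule: tens_sq_induct)
    case (tens t1 t2)
    show ?case
      by (induction u rule: tens_sq_induct)
        (auto simp: tmult_add_right tmult_scal_right tmult_scal_left tmult_bs wdeg_plus
          bichar_add_left bichar_add_right scal_scal algebra_simps)
  qed (auto simp: tmult_add_left tmult_add_right tmult_scal_right tmult_scal_left)
qed (auto simp: tmult_add_left tmult_scal_left)

text \<open>Only b has to be homogeneous: moving c to the left of b is the linear map
  \<open>gl q \<beta>\<close> on c, so c may be arbitrary.\<close>

lemma tmult_tens_gl:
  assumes "homogeneous \<beta> b"
  shows "tmult q (tens a b) (tens c d) = tens (a * gl q \<beta> c) (b * d)"
  using assms
proof (induction rule: homogeneous_induct)
  case (bs b)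
  show ?case
  proof (induction a rule: pm_induct)
    case (bs a)
    show ?case
    proof (induction c rule: pm_induct)
      case (bs c)
      show ?case
        by (induction d rule: pm_induct)
          (auto simp: tens_add_right tens_scal_right tmult_add_right tmult_scal_right distrib_left
            tmult_bs gl_bs \<open>wdeg b = \<beta>\<close> bs_mult tens_scal_left simp del: scal_single)
    qed (auto simp: tens_add_left tens_scal_left tmult_add_right tmult_scal_right gl_add gl_scal distrib_left)
  qed (auto simp: tens_add_left tens_scal_left tmult_add_left tmult_scal_left distrib_right)
qed (auto simp: tens_add_right tens_scal_right tmult_add_left tmult_scal_left distrib_right)

lemma tmult_tens:
  assumes "homogeneous \<beta> b" "homogeneous \<gamma> c"
  shows "tmult q (tens a b) (tens c d) = scal (bichar q \<beta> \<gamma>) (tens (a * c) (b * d))"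
  using tmult_tens_gl[OF assms(1)] gl_homogeneous[OF assms(2), of q \<beta>] by (simp add: tens_scal_left)

lemma tmult_tens_1: "tmult q (tens a 1) (tens c d) = tens (a * c) d"
proof -
  have "gl q 0 c = c" by (induction c rule: pm_induct) (auto simp: gl_add gl_scal gl_bs)
  then show ?thesis using tmult_tens_gl[of 0 1] by simp
qed

lemma tmult_1_left [simp]: "tmult q (tens 1 1) t = t"
  by (induction t rule: tens_sq_induct) (auto simp: tmult_add_right tmult_scal_right tmult_tens_1)

lemma tmult_1_right [simp]: "tmult q t (tens 1 1) = t"
  by (induction t rule: tens_sq_induct)
    (auto simp: tmult_add_left tmult_scal_left tmult_tens[OF homogeneous_single homogeneous_one])

section \<open>The braided Hopf algebra structure\<close>

lemma plin_comult: "plin (comult q)"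
  unfolding comult_def by (rule plin_lext)

lemmas comult_add = plin_add[OF plin_comult] and comult_scal = plin_scal[OF plin_comult]
  and comult_diff = plin_diff[OF plin_comult] and comult_zero [simp] = plin_zero[OF plin_comult]

lemma comult_bs: "comult q (bs w) = comult_list q (letters w)"
  by (simp add: comult_def)

lemma comult_one [simp]: "comult q 1 = tens 1 1"
  using comult_bs[of 0] by simp (simp add: zero_word_def)

lemma comult_wd: "comult q (wd [i]) = tens (wd [i]) 1 + tens 1 (wd [i])"
  by (simp add: wd_eq comult_bs)

lemma comult_wd_mult: "comult q (wd [i] * x) = tmult q (comult q (wd [i])) (comult q x)"
  by (induction x rule: pm_induct)
    (auto simp: distrib_left comult_add comult_scal tmult_add_right tmult_scal_right wd_eq bs_mult
      comult_bs plus_word_def)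

lemma comult_mult: "comult q (x * y) = tmult q (comult q x) (comult q y)"
  by (induction x rule: T_induct)
    (auto simp: distrib_right comult_add comult_scal tmult_add_left tmult_scal_left mult.assoc
      comult_wd_mult tmult_assoc)

section \<open>The antipode of T(V)\<close>

lemma plin_antip: "plin (antip q)"
  unfolding antip_def by (rule plin_lext)

lemmas antip_add = plin_add[OF plin_antip] and antip_scal = plin_scal[OF plin_antip]
  and antip_zero [simp] = plin_zero[OF plin_antip] and antip_diff = plin_diff[OF plin_antip]

lemma antip_bs: "antip q (bs w) = antip_list q (letters w)"
  by (simp add: antip_def)

lemma antip_one [simp]: "antip q 1 = 1"
  using antip_bs[of 0] by simp (simp add: zero_word_def)

lemma antip_Cons: "antip q (bs (Word [i] + w)) = scal (bichar q (unitv i) (wdeg w)) (antip q (bs w) * (- wd [i]))"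
  by (simp add: antip_bs plus_word_def wdeg_single)

lemma antip_append: "antip q (bs (u + v)) = scal (bichar q (wdeg u) (wdeg v)) (antip q (bs v) * antip q (bs u))"
proof (induction u rule: word_induct)
  case (Cons i u)
  have "antip q (bs (Word [i] + u + v)) = antip q (bs (Word [i] + (u + v)))"
    by (simp only: add.assoc)
  also have "\<dots> = scal (bichar q (unitv i) (wdeg (u + v))) (scal (bichar q (wdeg u) (wdeg v)) (antip q (bs v) * antip q (bs u)) * (- wd [i]))"
    by (simp only: antip_Cons Cons)
  also have "\<dots> = scal (bichar q (wdeg (Word [i] + u)) (wdeg v)) (antip q (bs v) * antip q (bs (Word [i] + u)))"
    by (simp only: antip_Cons wdeg_plus wdeg_single bichar_add_left bichar_add_right scal_mult_left scal_mult_right scal_scal mult.assoc mult.commute mult.left_commute)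
  finally show ?case .
qed auto

lemma antip_mult:
  assumes "homogeneous \<beta> x" "homogeneous \<gamma> y"
  shows "antip q (x * y) = scal (bichar q \<beta> \<gamma>) (antip q y * antip q x)"
  using assms(1)
proof (induction rule: homogeneous_induct)
  case (bs u)
  show ?case using assms(2)
    by (induction rule: homogeneous_induct)
      (auto simp: distrib_left distrib_right antip_add antip_scal scal_add scal_scal bs_mult antip_append bs mult.commute)
qed (auto simp: distrib_left distrib_right antip_add antip_scal scal_add scal_scal mult.commute)

definition mul_antip :: "('i, 'k) tens_sq \<Rightarrow> ('i, 'k) tens_alg" where
  "mul_antip = lext (\<lambda>(u, v). antip q (bs u) * bs v)"

lemma plin_mul_antip: "plin mul_antip"
  unfolding mul_antip_def by (rule plin_lext)

lemma mul_antip_bs: "mul_antip (bs (u, v)) = antip q (bs u) * bs v"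
  unfolding mul_antip_def by simp

lemma mul_antip_tens: "mul_antip (tens x y) = antip q x * y"
proof (induction x rule: pm_induct)
  case (bs u)
  show ?case
    by (induction y rule: pm_induct)
      (auto simp: tens_add_right tens_scal_right plin_add[OF plin_mul_antip] plin_scal[OF plin_mul_antip]
        distrib_left tens_bs plin_zero[OF plin_mul_antip] mul_antip_bs)
qed (auto simp: tens_add_left tens_scal_left plin_add[OF plin_mul_antip] plin_scal[OF plin_mul_antip]
        distrib_right antip_add antip_scal plin_zero[OF plin_mul_antip])

text \<open>Delta(x_i) times u (x) v has the parts x_i u (x) v and chi u (x) x_i v. As S(x_i u) =
  chi S(u)(-x_i), applying S to the first slot and multiplying makes them cancel.\<close>

lemma mul_antip_primitive: "mul_antip (tmult q (comult q (wd [i])) t) = 0"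
proof (induction t rule: tens_sq_induct)
  case (tens u v)
  have "tmult q (comult q (wd [i])) (tens (bs u) (bs v)) =
      tens (bs (Word [i] + u)) (bs v) + scal (bichar q (unitv i) (wdeg u)) (tens (bs u) (wd [i] * bs v))"
    by (simp add: comult_wd tmult_add_left tmult_tens_1 tmult_tens[OF homogeneous_wd homogeneous_single])
      (simp add: wd_eq bs_mult)
  then show ?case
    by (simp only: plin_add[OF plin_mul_antip] plin_scal[OF plin_mul_antip] mul_antip_tens antip_Cons)
      (simp add: mult.assoc scal_minus)
qed (auto simp: plin_add[OF plin_mul_antip] plin_scal[OF plin_mul_antip] plin_zero[OF plin_mul_antip]
    tmult_add_right tmult_scal_right)

lemma pfun_counit: "pfun counit"
  by (simp add: pfun_def counit_def lookup_add)

lemma counit_bs: "counit (bs w) = (if w = 0 then 1 else 0)"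
  by (simp add: counit_def lookup_single when_def)

lemma counit_mult: "counit (x * y) = counit x * counit (y :: ('i, 'k) tens_alg)"
proof (induction x rule: pm_induct)
  case (bs u)
  show ?case
  proof (induction y rule: pm_induct)
    case (bs v)
    have "u + v = 0 \<longleftrightarrow> u = 0 \<and> v = 0" for u v :: "'i word"
      by (cases u; cases v) (auto simp: plus_word_def zero_word_def)
    then show ?case by (simp add: bs_mult counit_bs)
  qed (auto simp: distrib_left pfun_add[OF pfun_counit] pfun_scal[OF pfun_counit] pfun_zero[OF pfun_counit])
qed (auto simp: distrib_right pfun_add[OF pfun_counit] pfun_scal[OF pfun_counit] pfun_zero[OF pfun_counit])

lemma mul_antip_comult: "mul_antip (comult q x) = scal (counit x) 1"
proof (induction x rule: T_induct)
  case one
  have "counit (1 :: ('i, 'k) tens_alg) = 1" by (simp add: counit_def)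
  then show ?case by (simp add: mul_antip_tens)
next
  case (wd i w)
  have "counit (wd [i] * bs w :: ('i, 'k) tens_alg) = 0"
    by (simp add: counit_mult wd_eq counit_bs zero_word_def)
  then show ?case by (simp add: comult_wd_mult mul_antip_primitive)
qed (auto simp: comult_add comult_scal plin_add[OF plin_mul_antip] plin_scal[OF plin_mul_antip]
    pfun_add[OF pfun_counit] pfun_scal[OF pfun_counit] scal_add scal_scal)

lemma plin_braid: "plin (braid q)"
  unfolding braid_def by (rule plin_lext)

lemma braid_bs: "braid q (tens (bs u) (bs v)) = scal (bichar q (wdeg u) (wdeg v)) (tens (bs v) (bs u))"
  by (simp add: braid_def tens_bs)

lemmas braid_add = plin_add[OF plin_braid] and braid_scal = plin_scal[OF plin_braid]
  and braid_zero [simp] = plin_zero[OF plin_braid] and braid_diff = plin_diff[OF plin_braid]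

lemma braid_tens:
  assumes "homogeneous \<beta> x" "homogeneous \<gamma> y"
  shows "braid q (tens x y) = scal (bichar q \<beta> \<gamma>) (tens y x)"
  using assms(1)
proof (induction rule: homogeneous_induct)
  case (bs u)
  note u = this
  show ?case using assms(2)
  proof (induction rule: homogeneous_induct)
    case (bs v)
    then show ?case using u by (simp add: braid_bs del: scal_single)
  qed (auto simp: tens_add_left tens_scal_left tens_add_right tens_scal_right braid_add
        braid_scal scal_add scal_scal mult.commute)
qed (auto simp: tens_add_left tens_scal_left tens_add_right tens_scal_right braid_add
        braid_scal scal_add scal_scal mult.commute)

end

declare scal_single [simp del]

section \<open>Slices of tensors and skew derivations\<close>

text \<open>\<open>rsl f = id \<otimes> f\<close> and \<open>lsl f = f \<otimes> id\<close> for a functional \<open>f\<close>, and \<open>idt D = id \<otimes> D\<close>, \<open>tid D = D \<otimes> id\<close>.\<close>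

definition rsl :: "(('i, 'k::field) tens_alg \<Rightarrow> 'k) \<Rightarrow> ('i, 'k) tens_sq \<Rightarrow> ('i, 'k) tens_alg" where
  "rsl f = lext (\<lambda>(u, v). scal (f (bs v)) (bs u))"

definition lsl :: "(('i, 'k::field) tens_alg \<Rightarrow> 'k) \<Rightarrow> ('i, 'k) tens_sq \<Rightarrow> ('i, 'k) tens_alg" where
  "lsl f = lext (\<lambda>(u, v). scal (f (bs u)) (bs v))"

definition idt :: "(('i, 'k::field) tens_alg \<Rightarrow> ('i, 'k) tens_alg) \<Rightarrow> ('i, 'k) tens_sq \<Rightarrow> ('i, 'k) tens_sq" where
  "idt D = lext (\<lambda>(u, v). tens (bs u) (D (bs v)))"

definition tid :: "(('i, 'k::field) tens_alg \<Rightarrow> ('i, 'k) tens_alg) \<Rightarrow> ('i, 'k) tens_sq \<Rightarrow> ('i, 'k) tens_sq" where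
  "tid D = lext (\<lambda>(u, v). tens (D (bs u)) (bs v))"

lemma plin_rsl: "plin (rsl f)" and plin_lsl: "plin (lsl f)" and plin_idt: "plin (idt D)" and plin_tid: "plin (tid D)"
  unfolding rsl_def lsl_def idt_def tid_def by (rule plin_lext)+

lemma rsl_bs: "rsl f (tens (bs u) (bs v)) = scal (f (bs v)) (bs u)"
  and lsl_bs: "lsl f (tens (bs u) (bs v)) = scal (f (bs u)) (bs v)"
  and idt_bs: "idt D (tens (bs u) (bs v)) = tens (bs u) (D (bs v))"
  and tid_bs: "tid D (tens (bs u) (bs v)) = tens (D (bs u)) (bs v)"
  by (simp_all add: rsl_def lsl_def idt_def tid_def tens_bs)

lemma bilinear_eqI:
  assumes "\<And>y. plin (\<lambda>x. f x y)" "\<And>y. plin (\<lambda>x. g x y)" "\<And>x. plin (f x)" "\<And>x. plin (g x)"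
    "\<And>u v. f (bs u) (bs v) = g (bs u) (bs v)"
  shows "f x y = g x y"
proof -
  have "f (bs u) y = g (bs u) y" for u
    by (rule plin_eqI[of "f (bs u)" "g (bs u)"]) (use assms in auto)
  then show ?thesis
    by (rule plin_eqI[of "\<lambda>x. f x y" "\<lambda>x. g x y", OF assms(1,2)])
qed

lemma plin_scal_pfun: "pfun f \<Longrightarrow> plin (\<lambda>y. scal (f y) x)"
  by (simp add: plin_def pfun_def scal_add scal_scal)

lemma rsl_tens:
  assumes "pfun f"
  shows "rsl f (tens x y) = scal (f y) x"
  by (rule bilinear_eqI[of "\<lambda>x y. rsl f (tens x y)" "\<lambda>x y. scal (f y) x"])
    (auto intro!: plin_comp[OF plin_rsl] plin_tens_left plin_tens_right plin_scale plin_id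
      plin_scal_pfun assms simp: rsl_bs)

lemma lsl_tens:
  assumes "pfun f"
  shows "lsl f (tens x y) = scal (f x) y"
  by (rule bilinear_eqI[of "\<lambda>x y. lsl f (tens x y)" "\<lambda>x y. scal (f x) y"])
    (auto intro!: plin_comp[OF plin_lsl] plin_tens_left plin_tens_right plin_scale plin_id
      plin_scal_pfun assms simp: lsl_bs)

lemma idt_tens:
  assumes "plin D"
  shows "idt D (tens x y) = tens x (D y)"
  by (rule bilinear_eqI[of "\<lambda>x y. idt D (tens x y)" "\<lambda>x y. tens x (D y)"])
    (auto intro!: plin_comp[OF plin_idt] plin_comp[OF plin_tens_right assms] plin_tens_left
      plin_tens_right simp: idt_bs)

lemma tid_tens:
  assumes "plin D"
  shows "tid D (tens x y) = tens (D x) y"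
  by (rule bilinear_eqI[of "\<lambda>x y. tid D (tens x y)" "\<lambda>x y. tens (D x) y"])
    (auto intro!: plin_comp[OF plin_tid] plin_comp[OF plin_tens_left assms] plin_tens_left
      plin_tens_right simp: tid_bs)

lemmas rsl_add = plin_add[OF plin_rsl] and rsl_scal = plin_scal[OF plin_rsl]
  and rsl_zero [simp] = plin_zero[OF plin_rsl]
lemmas lsl_add = plin_add[OF plin_lsl] and lsl_scal = plin_scal[OF plin_lsl]
  and lsl_zero [simp] = plin_zero[OF plin_lsl]
lemmas idt_add = plin_add[OF plin_idt] and idt_scal = plin_scal[OF plin_idt]
  and idt_zero [simp] = plin_zero[OF plin_idt]

lemma lsl_idt:
  assumes "pfun f" "plin D"
  shows "lsl f (idt D t) = D (lsl f t)"
  by (rule plin_eqI_tens[of "\<lambda>t. lsl f (idt D t)" "\<lambda>t. D (lsl f t)"])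
    (auto intro!: plin_comp[OF plin_lsl plin_idt] plin_comp[OF assms(2) plin_lsl]
      simp: idt_tens lsl_tens assms plin_scal)

definition coeff1 :: "'i \<Rightarrow> ('i, 'k::field) tens_alg \<Rightarrow> 'k" where
  "coeff1 i x = Poly_Mapping.lookup x (Word [i])"

lemma pfun_coeff1: "pfun (coeff1 i)"
  by (simp add: coeff1_def pfun_def lookup_add)

definition gl2 :: "('i::finite \<Rightarrow> 'i \<Rightarrow> 'k::field) \<Rightarrow> ('i \<Rightarrow> int) \<Rightarrow> ('i, 'k) tens_sq \<Rightarrow> ('i, 'k) tens_sq" where
  "gl2 q \<beta> = lext (\<lambda>(u, v). scal (bichar q \<beta> (wdeg u + wdeg v)) (tens (bs u) (bs v)))"

lemma plin_gl2: "plin (gl2 q \<beta>)"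
  unfolding gl2_def by (rule plin_lext)

lemma gl2_bs: "gl2 q \<beta> (tens (bs u) (bs v)) = scal (bichar q \<beta> (wdeg u + wdeg v)) (tens (bs u) (bs v))"
  by (simp add: gl2_def tens_bs)

context diag_braiding
begin

lemma gl2_tens: "gl2 q \<beta> (tens x y) = tens (gl q \<beta> x) (gl q \<beta> y)"
  by (rule bilinear_eqI[of "\<lambda>x y. gl2 q \<beta> (tens x y)" "\<lambda>x y. tens (gl q \<beta> x) (gl q \<beta> y)"])
    (auto intro!: plin_comp[OF plin_gl2] plin_comp[OF plin_tens_left plin_gl] plin_comp[OF plin_tens_right plin_gl]
      plin_tens_left plin_tens_right simp: gl2_bs gl_bs tens_scal_left tens_scal_right scal_scal
      bichar_add_right)

lemma gl2_tmult: "gl2 q \<beta> (tmult q s t) = tmult q (gl2 q \<beta> s) (gl2 q \<beta> t)"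
proof (rule plin_eqI_tens[of "\<lambda>s. gl2 q \<beta> (tmult q s t)" "\<lambda>s. tmult q (gl2 q \<beta> s) (gl2 q \<beta> t)"])
  fix u v
  show "gl2 q \<beta> (tmult q (tens (bs u) (bs v)) t) = tmult q (gl2 q \<beta> (tens (bs u) (bs v))) (gl2 q \<beta> t)"
  proof (induction t rule: tens_sq_induct)
    case (tens u' v')
    show ?case
      by (simp add: gl2_bs tmult_scal_right tmult_scal_left tmult_bs plin_scal[OF plin_gl2] scal_scal wdeg_plus
          bichar_add_right mult_ac)
  qed (auto simp: plin_add[OF plin_gl2] plin_scal[OF plin_gl2] tmult_add_right tmult_scal_right plin_zero[OF plin_gl2])
qed (auto intro!: plin_comp[OF plin_gl2 plin_tmult_left] plin_comp[OF plin_tmult_left plin_gl2])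

text \<open>Delta preserves the total degree, hence commutes with diagonal automorphisms. This is
  needed because the twist in \<open>pd_wd_mult\<close> has to pass through Delta in
  \<open>comult_pd\<close>.\<close>

lemma comult_gl: "comult q (gl q \<beta> x) = gl2 q \<beta> (comult q x)"
proof (rule plin_eqI[of "\<lambda>x. comult q (gl q \<beta> x)" "\<lambda>x. gl2 q \<beta> (comult q x)"])
  fix w
  show "comult q (gl q \<beta> (bs w)) = gl2 q \<beta> (comult q (bs w))"
  proof (induction w rule: word_induct)
    case (Cons i w)
    have "comult q (gl q \<beta> (wd [i])) = gl2 q \<beta> (comult q (wd [i]))"
      by (simp add: gl_homogeneous[OF homogeneous_wd] comult_scal comult_wd plin_add[OF plin_gl2]
          gl2_tens tens_scal_left tens_scal_right scal_add)
    then have "comult q (gl q \<beta> (wd [i] * bs w)) = gl2 q \<beta> (comult q (wd [i] * bs w))"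
      by (simp add: gl_mult comult_mult gl2_tmult Cons)
    then show ?case by (simp add: wd_eq bs_mult)
  qed (simp add: gl2_tens)
qed (auto intro!: plin_comp[OF plin_comult plin_gl] plin_comp[OF plin_gl2 plin_comult])

text \<open>The counit kills every word that starts with x_i, so of Delta(x_i) only x_i (x) 1
  contributes and the induction runs letter by letter.\<close>

lemma rsl_counit_comult: "rsl counit (comult q x) = x"
proof (rule plin_eqI[of "\<lambda>x. rsl counit (comult q x)" "\<lambda>x. x"])
  fix w :: "'i word"
  have step: "rsl counit (tmult q (comult q (wd [i])) t) = wd [i] * rsl counit t" for i t
  proof (rule plin_eqI_tens[of "\<lambda>t. rsl counit (tmult q (comult q (wd [i])) t)" "\<lambda>t. wd [i] * rsl counit t"])
    fix u v
    have "counit (wd [i] * bs v :: ('i, 'k) tens_alg) = 0"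
      by (simp add: counit_mult wd_eq counit_bs zero_word_def)
    then show "rsl counit (tmult q (comult q (wd [i])) (tens (bs u) (bs v))) = wd [i] * rsl counit (tens (bs u) (bs v))"
      by (simp add: comult_wd tmult_add_left tmult_tens_1 tmult_tens_gl[OF homogeneous_wd] rsl_add
          rsl_tens[OF pfun_counit])
  qed (auto intro!: plin_comp[OF plin_rsl plin_tmult_right] plin_comp[OF plin_mult_left plin_rsl])
  show "rsl counit (comult q (bs w)) = bs w"
  proof (induction w rule: word_induct)
    case Nil
    show ?case by (simp add: rsl_tens[OF pfun_counit]) (simp add: counit_def)
  next
    case (Cons i w)
    then have "rsl counit (comult q (wd [i] * bs w)) = wd [i] * bs w"
      by (simp only: comult_mult step)
    then show ?case by (simp add: wd_eq bs_mult)
  qed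
qed (auto intro!: plin_comp[OF plin_rsl plin_comult] plin_id)

text \<open>Here the part 1 (x) x_i survives; braiding it past the left slot costs nothing, since
  the counit sees only degree zero.\<close>

lemma lsl_counit_comult: "lsl counit (comult q x) = x"
proof (rule plin_eqI[of "\<lambda>x. lsl counit (comult q x)" "\<lambda>x. x"])
  fix w :: "'i word"
  have step: "lsl counit (tmult q (comult q (wd [i])) t) = wd [i] * lsl counit t" for i t
  proof (rule plin_eqI_tens[of "\<lambda>t. lsl counit (tmult q (comult q (wd [i])) t)" "\<lambda>t. wd [i] * lsl counit t"])
    fix u v
    have "counit (wd [i] * bs u :: ('i, 'k) tens_alg) = 0"
      by (simp add: counit_mult wd_eq counit_bs zero_word_def)
    moreover have "counit (gl q \<beta> (bs u)) = counit (bs u)" for \<beta>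
      by (auto simp: gl_bs pfun_scal[OF pfun_counit] counit_bs)
    ultimately show "lsl counit (tmult q (comult q (wd [i])) (tens (bs u) (bs v))) = wd [i] * lsl counit (tens (bs u) (bs v))"
      by (simp add: comult_wd tmult_add_left tmult_tens_1 tmult_tens_gl[OF homogeneous_wd] lsl_add
          lsl_tens[OF pfun_counit])
  qed (auto intro!: plin_comp[OF plin_lsl plin_tmult_right] plin_comp[OF plin_mult_left plin_lsl])
  show "lsl counit (comult q (bs w)) = bs w"
  proof (induction w rule: word_induct)
    case Nil
    show ?case by (simp add: lsl_tens[OF pfun_counit]) (simp add: counit_def)
  next
    case (Cons i w)
    then have "lsl counit (comult q (wd [i] * bs w)) = wd [i] * bs w"
      by (simp only: comult_mult step)
    then show ?case by (simp add: wd_eq bs_mult)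
  qed
qed (auto intro!: plin_comp[OF plin_lsl plin_comult] plin_id)

section \<open>Skew derivations of T(V)\<close>

definition pd :: "'i \<Rightarrow> ('i, 'k) tens_alg \<Rightarrow> ('i, 'k) tens_alg" where
  "pd i x = rsl (coeff1 i) (comult q x)"

lemma plin_pd: "plin (pd i)"
  unfolding pd_def by (rule plin_comp[OF plin_rsl plin_comult])

lemmas pd_add = plin_add[OF plin_pd] and pd_scal = plin_scal[OF plin_pd]
  and pd_diff = plin_diff[OF plin_pd] and pd_zero [simp] = plin_zero[OF plin_pd]

lemma pd_one [simp]: "pd i 1 = 0"
proof -
  have "coeff1 i (1 :: ('i, 'k) tens_alg) = 0"
    by (simp add: coeff1_def zero_word_def lookup_single flip: bs_zero)
  then show ?thesis by (simp add: pd_def rsl_tens[OF pfun_coeff1])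
qed

lemma coeff1_wd_mult: "coeff1 i (wd [j] * x) = (if i = j then counit x else 0)"
proof (induction x rule: pm_induct)
  case (bs w)
  show ?case
    by (cases w) (auto simp: wd_eq bs_mult coeff1_def counit_def lookup_single plus_word_def zero_word_def when_def)
qed (auto simp: distrib_left pfun_add[OF pfun_coeff1] pfun_scal[OF pfun_coeff1] pfun_zero[OF pfun_coeff1]
    pfun_add[OF pfun_counit] pfun_scal[OF pfun_counit] pfun_zero[OF pfun_counit])

lemma pd_wd_mult: "pd i (wd [j] * x) = wd [j] * pd i x + (if i = j then gl q (unitv i) x else 0)"
proof -
  have "rsl (coeff1 i) (tmult q (comult q (wd [j])) t) =
      wd [j] * rsl (coeff1 i) t + (if i = j then gl q (unitv i) (rsl counit t) else 0)" for t
  proof (rule plin_eqI_tens[of "\<lambda>t. rsl (coeff1 i) (tmult q (comult q (wd [j])) t)"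
        "\<lambda>t. wd [j] * rsl (coeff1 i) t + (if i = j then gl q (unitv i) (rsl counit t) else 0)"])
    fix u v
    show "rsl (coeff1 i) (tmult q (comult q (wd [j])) (tens (bs u) (bs v))) = wd [j] * rsl (coeff1 i) (tens (bs u) (bs v)) +
        (if i = j then gl q (unitv i) (rsl counit (tens (bs u) (bs v))) else 0)"
      by (simp add: comult_wd tmult_add_left tmult_tens_1 tmult_tens_gl[OF homogeneous_wd] rsl_add
          rsl_tens[OF pfun_coeff1] rsl_tens[OF pfun_counit] coeff1_wd_mult gl_scal)
  next
    show "plin (\<lambda>t. wd [j] * rsl (coeff1 i) t + (if i = j then gl q (unitv i) (rsl counit t) else 0))"
      by (cases "i = j") (auto intro!: plin_plus plin_comp[OF plin_mult_left plin_rsl] plin_comp[OF plin_gl plin_rsl])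
  qed (auto intro!: plin_comp[OF plin_rsl plin_tmult_right])
  then show ?thesis
    by (simp add: pd_def comult_wd_mult rsl_counit_comult)
qed

lemma pd_wd: "pd i (wd [j]) = (if i = j then 1 else 0)"
  using pd_wd_mult[of i j 1] by simp

text \<open>The twist acts on y: an x_i in the second slot of Delta(x) must be braided past the
  first slot of Delta(y) before the slots are multiplied.\<close>

lemma pd_mult: "pd i (x * y) = x * pd i y + pd i x * gl q (unitv i) y"
proof (induction x rule: T_induct)
  case (wd j w)
  then show ?case by (auto simp: mult.assoc pd_wd_mult gl_mult algebra_simps)
qed (auto simp: distrib_right distrib_left pd_add pd_scal scal_add algebra_simps)

text \<open>Coassociativity in a form that avoids triple tensor products: \<open>pd i\<close> is
  itself a slice of Delta at the last factor.\<close>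

lemma comult_pd: "comult q (pd i x) = idt (pd i) (comult q x)"
proof (induction x rule: T_induct)
  case one
  show ?case by (simp add: idt_tens[OF plin_pd])
next
  case (wd j w)
  have "idt (pd i) (tmult q (comult q (wd [j])) t) = tmult q (comult q (wd [j])) (idt (pd i) t) +
      (if i = j then gl2 q (unitv i) t else 0)" for t
  proof (rule plin_eqI_tens[of "\<lambda>t. idt (pd i) (tmult q (comult q (wd [j])) t)"
        "\<lambda>t. tmult q (comult q (wd [j])) (idt (pd i) t) + (if i = j then gl2 q (unitv i) t else 0)"])
    fix u v
    show "idt (pd i) (tmult q (comult q (wd [j])) (tens (bs u) (bs v))) =
      tmult q (comult q (wd [j])) (idt (pd i) (tens (bs u) (bs v))) + (if i = j then gl2 q (unitv i) (tens (bs u) (bs v)) else 0)"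
      by (simp add: comult_wd tmult_add_left tmult_tens_1 tmult_tens_gl[OF homogeneous_wd] idt_add
          idt_tens[OF plin_pd] pd_wd_mult gl2_tens tens_add_right)
  next
    show "plin (\<lambda>t. tmult q (comult q (wd [j])) (idt (pd i) t) + (if i = j then gl2 q (unitv i) t else 0))"
      by (cases "i = j") (auto intro!: plin_plus plin_comp[OF plin_tmult_right plin_idt] plin_gl2 simp: plin_comp[OF plin_tmult_right plin_idt])
  qed (auto intro!: plin_comp[OF plin_idt plin_tmult_right])
  then show ?case
    using wd by (simp add: comult_mult pd_wd_mult comult_add comult_gl)
qed (auto simp: pd_add pd_scal comult_add comult_scal idt_add idt_scal)

end

section \<open>Ideals of the tensor algebra\<close>

text \<open>Negatives and scalar multiples come for free, as multiplication by
  \<open>scal c 1\<close>.\<close>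

definition tideal :: "('i, 'k::field) tens_alg set \<Rightarrow> bool" where
  "tideal I \<longleftrightarrow> 0 \<in> I \<and> (\<forall>x\<in>I. \<forall>y\<in>I. x + y \<in> I) \<and> (\<forall>x\<in>I. \<forall>y. y * x \<in> I \<and> x * y \<in> I)"

lemma tideal_add: "tideal I \<Longrightarrow> x \<in> I \<Longrightarrow> y \<in> I \<Longrightarrow> x + y \<in> I"
  and tideal_zero: "tideal I \<Longrightarrow> 0 \<in> I"
  and tideal_left: "tideal I \<Longrightarrow> x \<in> I \<Longrightarrow> y * x \<in> I"
  and tideal_right: "tideal I \<Longrightarrow> x \<in> I \<Longrightarrow> x * y \<in> I"
  by (auto simp: tideal_def)

lemma tideal_scal: "tideal I \<Longrightarrow> x \<in> I \<Longrightarrow> scal c x \<in> I"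
  using tideal_left[of I x "scal c 1"] by simp

lemma tideal_subspace: "tideal I \<Longrightarrow> pm.subspace I"
  by (auto simp: pm.subspace_def tideal_add tideal_zero tideal_scal)

lemma ring_TV: "ring (TV :: ('k::field, ('i, 'k) tens_alg) module)"
proof -
  have "\<exists>y. y + x = 0 \<and> x + y = 0" for x :: "('i, 'k) tens_alg"
    by (rule exI[of _ "- x"]) simp
  then show ?thesis
    by unfold_locales (auto simp: TV_def algebra_simps Units_def)
qed

lemma ideal_TV_iff: "ideal I (TV :: ('k::field, ('i, 'k) tens_alg) module) \<longleftrightarrow> tideal I"
proof
  assume "ideal I (TV :: ('k, ('i, 'k) tens_alg) module)"
  then interpret ideal I "TV :: ('k, ('i, 'k) tens_alg) module" .
  show "tideal I"
    using additive_subgroup.zero_closed[OF additive_subgroup_axioms]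
      additive_subgroup.a_closed[OF additive_subgroup_axioms] I_l_closed I_r_closed
    by (auto simp: tideal_def TV_def)
next
  assume I: "tideal I"
  interpret ring "TV :: ('k, ('i, 'k) tens_alg) module" by (rule ring_TV)
  have inv: "\<ominus>\<^bsub>TV :: ('k, ('i, 'k) tens_alg) module\<^esub> x = - x" for x :: "('i, 'k) tens_alg"
    by (rule minus_equality) (auto simp: TV_def)
  show "ideal I (TV :: ('k, ('i, 'k) tens_alg) module)"
  proof (rule idealI[OF ring_TV])
    show "subgroup I (add_monoid (TV :: ('k, ('i, 'k) tens_alg) module))"
    proof (rule add.subgroupI)
      show "\<ominus>\<^bsub>TV :: ('k, ('i, 'k) tens_alg) module\<^esub> x \<in> I" if "x \<in> I" for x
        unfolding inv using tideal_scal[OF I that, of "-1"] by (simp add: scal_minus)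
    qed (use I in \<open>auto simp: TV_def tideal_def\<close>)
  qed (use I in \<open>auto simp: TV_def tideal_def\<close>)
qed

lemma tideal_span:
  fixes G :: "('i, 'k::field) tens_alg set"
  shows "tideal (pm.span {bs u * g * bs v | u g v. g \<in> G})" (is "tideal (pm.span ?S)")
  unfolding tideal_def
proof (intro conjI ballI allI)
  fix x y assume x: "x \<in> pm.span ?S"
  show "y * x \<in> pm.span ?S"
  proof (induction y rule: pm_induct)
    case (bs w)
    show ?case
    proof (rule plin_span_into[OF plin_mult_left pm.subspace_span _ x])
      fix z assume "z \<in> ?S"
      then obtain u g v where z: "z = bs u * g * bs v" "g \<in> G" by blast
      then have "bs w * z = bs (w + u) * g * bs v" by (simp add: mult.assoc flip: bs_mult)
      then show "bs w * z \<in> pm.span ?S" using z by (intro pm.span_base) blast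
    qed
  qed (auto simp: distrib_right pm.span_zero pm.span_add pm.span_scale)
  show "x * y \<in> pm.span ?S"
  proof (induction y rule: pm_induct)
    case (bs w)
    show ?case
    proof (rule plin_span_into[OF plin_mult_right pm.subspace_span _ x])
      fix z assume "z \<in> ?S"
      then obtain u g v where z: "z = bs u * g * bs v" "g \<in> G" by blast
      then have "z * bs w = bs u * g * bs (v + w)" by (simp add: mult.assoc flip: bs_mult)
      then show "z * bs w \<in> pm.span ?S" using z by (intro pm.span_base) blast
    qed
  qed (auto simp: distrib_left pm.span_zero pm.span_add pm.span_scale)
qed (auto simp: pm.span_zero pm.span_add)

text \<open>A concrete spanning set of the generated ideal: a linear map can then be tested on the
  products u g v with words u and v.\<close>

lemma Idl_TV: "Idl\<^bsub>TV\<^esub> G = pm.span {bs u * g * bs v | u g v. g \<in> (G :: ('i, 'k::field) tens_alg set)}"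
proof
  have "G \<subseteq> pm.span {bs u * g * bs v | u g v. g \<in> G}"
  proof
    fix g assume "g \<in> G"
    then have "\<exists>u g' v. g = bs u * g' * bs v \<and> g' \<in> G"
      by (intro exI[of _ 0] exI[of _ g]) simp
    then show "g \<in> pm.span {bs u * g * bs v | u g v. g \<in> G}" by (intro pm.span_base) blast
  qed
  then show "Idl\<^bsub>TV\<^esub> G \<subseteq> pm.span {bs u * g * bs v | u g v. g \<in> G}"
    unfolding genideal_def ideal_TV_iff using tideal_span[of G] by auto
next
  show "pm.span {bs u * g * bs v | u g v. g \<in> G} \<subseteq> Idl\<^bsub>TV\<^esub> G"
    unfolding genideal_def ideal_TV_iff
  proof (safe intro!: Inter_greatest)
    fix x J assume "x \<in> pm.span {bs u * g * bs v | u g v. g \<in> G}" "tideal J" "G \<subseteq> J"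
    moreover have "{bs u * g * bs v | u g v. g \<in> G} \<subseteq> J"
      using calculation by (auto intro: tideal_left tideal_right)
    ultimately show "x \<in> J" using pm.span_minimal tideal_subspace by blast
  qed
qed

lemma tideal_Idl: "tideal (Idl\<^bsub>TV\<^esub> G)"
  unfolding Idl_TV by (rule tideal_span)

lemma Idl_TV_base: "g \<in> G \<Longrightarrow> g \<in> Idl\<^bsub>TV\<^esub> (G :: ('i, 'k::field) tens_alg set)"
  unfolding genideal_def by auto

lemma Idl_TV_least: "tideal J \<Longrightarrow> G \<subseteq> J \<Longrightarrow> Idl\<^bsub>TV\<^esub> G \<subseteq> J"
  unfolding genideal_def ideal_TV_iff by auto

definition prj :: "nat \<Rightarrow> ('i, 'k::field) tens_alg \<Rightarrow> ('i, 'k) tens_alg" where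
  "prj n = lext (\<lambda>w. if length (letters w) = n then bs w else 0)"

lemma plin_prj: "plin (prj n)"
  unfolding prj_def by (rule plin_lext)

lemma prj_single: "prj n (Poly_Mapping.single w c) = (if length (letters w) = n then Poly_Mapping.single w c else 0)"
  by (simp add: prj_def scal_single)

lemma prj_bs: "prj n (bs w) = (if length (letters w) = n then bs w else 0)"
  by (simp add: prj_def)

lemma TV_comp_subspace: "pm.subspace (TV_comp n)"
  using Poly_Mapping.keys_add by (fastforce simp: pm.subspace_def TV_comp_def in_keys_iff)

lemma prj_TV_comp: "x \<in> TV_comp m \<Longrightarrow> prj n x = (if n = m then x else 0)"
proof -
  assume x: "x \<in> TV_comp m"
  have "prj n (\<Sum>u\<in>A. Poly_Mapping.single u (Poly_Mapping.lookup x u)) =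
     (if n = m then (\<Sum>u\<in>A. Poly_Mapping.single u (Poly_Mapping.lookup x u)) else 0)" if "A \<subseteq> Poly_Mapping.keys x" for A
    using that x by (induction A rule: infinite_finite_induct)
      (auto simp: plin_zero[OF plin_prj] plin_add[OF plin_prj] TV_comp_def prj_single)
  then show ?thesis using expand_single[of x] by (metis order_refl)
qed

lemma length_plus_word: "length (letters (u + v)) = length (letters u) + length (letters v)"
  by (simp add: plus_word_def)

lemma bs_TV_comp: "bs w \<in> TV_comp (length (letters w))"
  by (simp add: TV_comp_def)

lemma TV_comp_mult:
  fixes x y :: "('i, 'k::field) tens_alg"
  assumes "x \<in> TV_comp m" "y \<in> TV_comp n" shows "x * y \<in> TV_comp (m + n)"
proof -
  have "x * y = (\<Sum>u\<in>Poly_Mapping.keys x. \<Sum>v\<in>Poly_Mapping.keys y.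
     Poly_Mapping.single (u + v) (Poly_Mapping.lookup x u * Poly_Mapping.lookup y v))"
    by (rule mult_expand)
  moreover have "\<dots> \<in> TV_comp (m + n)"
    using assms by (intro pm.subspace_sum[OF TV_comp_subspace])
      (auto simp: TV_comp_def length_plus_word split: if_splits)
  ultimately show ?thesis by simp
qed

lemma prj_Idl:
  assumes "G \<subseteq> (\<Union>n. TV_comp n)" "x \<in> Idl\<^bsub>TV\<^esub> (G :: ('i, 'k::field) tens_alg set)"
  shows "prj n x \<in> Idl\<^bsub>TV\<^esub> G"
  using assms(2) unfolding Idl_TV
proof (rule plin_span_into[OF plin_prj pm.subspace_span, rotated])
  fix z assume "z \<in> {bs u * g * bs v | u g v. g \<in> G}"
  then obtain u g v where z: "z = bs u * g * bs v" "g \<in> G" by blast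
  then obtain m where "g \<in> TV_comp m" using assms(1) by blast
  then have "z \<in> TV_comp (length (letters u) + m + length (letters v))"
    unfolding z by (intro TV_comp_mult bs_TV_comp)
  then have "prj n z = z \<or> prj n z = 0" by (simp add: prj_TV_comp)
  then show "prj n z \<in> pm.span {bs u * g * bs v | u g v. g \<in> G}"
    using z by (auto intro: pm.span_zero pm.span_base)
qed

section \<open>Quotients as cosets\<close>

text \<open>The algebra records in use have the whole type as carrier, so their cosets reduce to
  translates in the additive group; every quotient construction is translated into this
  form.\<close>

definition cos :: "'a::ab_group_add set \<Rightarrow> 'a \<Rightarrow> 'a set" where
  "cos I x = (\<lambda>i. i + x) ` I"

lemma in_cos: "y \<in> cos I x \<longleftrightarrow> y - x \<in> I"
  by (force simp: cos_def image_iff)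

lemma cos_self: "pm.subspace I \<Longrightarrow> x \<in> cos I x"
  by (simp add: in_cos pm.subspace_0)

lemma cos_eq_iff:
  assumes "pm.subspace I"
  shows "cos I x = cos I y \<longleftrightarrow> x - y \<in> I"
proof
  assume "cos I x = cos I y"
  then have "x \<in> cos I y" using cos_self[OF assms, of x] by simp
  then show "x - y \<in> I" by (simp add: in_cos)
next
  assume xy: "x - y \<in> I"
  have "z - x \<in> I \<longleftrightarrow> z - y \<in> I" for z
    using pm.subspace_add[OF assms xy, of "z - x"] pm.subspace_diff[OF assms _ xy, of "z - y"] by auto
  then show "cos I x = cos I y" by (auto simp: in_cos)
qed

text \<open>Structure maps on quotients are written as unions over representatives; congruent
  representatives give one and the same coset, and the union collapses.\<close>

lemma UN_cos:
  assumes "pm.subspace I" "\<And>x'. x' - x \<in> I \<Longrightarrow> h x' = h x"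
  shows "(\<Union>x'\<in>cos I x. h x') = h x"
proof -
  have "(\<Union>x'\<in>cos I x. h x') = (\<Union>x'\<in>cos I x. h x)"
    using assms(2) by (intro SUP_cong) (auto simp: in_cos)
  then show ?thesis using cos_self[OF assms(1), of x] by auto
qed

lemma image_cos:
  assumes "pm.subspace I" "\<And>x'. x' - x \<in> I \<Longrightarrow> h x' = h x"
  shows "h ` cos I x = {h x}"
proof -
  have "h ` cos I x = (\<lambda>x'. h x) ` cos I x"
    using assms(2) by (intro image_cong) (auto simp: in_cos)
  then show ?thesis using cos_self[OF assms(1), of x] by auto
qed

lemma cos_zero: "cos I 0 = I"
  by (simp add: cos_def)

text \<open>Common to T(V) and its braided square. The product is left open, as the linear structure
  of a quotient does not involve it.\<close>

locale pm_alg =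
  fixes A :: "('k::field, 'b \<Rightarrow>\<^sub>0 'k) module"
  assumes carrier_A [simp]: "carrier A = UNIV" and add_A [simp]: "add A = (+)"
    and zero_A [simp]: "zero A = 0" and smult_A [simp]: "smult A = scal"
begin

lemma finsum_A:
  assumes "finite F" shows "finsum A f F = sum f F"
proof -
  interpret abelian_monoid A
    by (rule abelian_monoidI) (simp_all add: add_ac)
  show ?thesis using assms by (induction F rule: finite_induct) simp_all
qed

lemma lspan_A: "lspan A S = pm.span S"
  proof -
  have "(\<Oplus>\<^bsub>A\<^esub>v\<in>F. c v \<odot>\<^bsub>A\<^esub> v) = (\<Sum>v\<in>F. scal (c v) v)" if "finite F" for F c
    using finsum_A[OF that] by simp
  then show ?thesis unfolding lspan_def pm.span_explicit by (intro Collect_cong ex_cong1) auto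
qed

lemma coset_A: "I +>\<^bsub>A\<^esub> x = cos I x"
  by (auto simp: a_r_coset_def r_coset_def cos_def)

lemma quot_zero: "zero (quot_alg A I) = I"
  by (simp add: quot_alg_def ring.defs FactRing_def)

lemma quot_carrier: "carrier (quot_alg A I) = range (cos I)"
  by (auto simp: quot_alg_def ring.defs FactRing_def A_RCOSETS_def RCOSETS_def r_coset_def cos_def)

lemma quot_one: "one (quot_alg A I) = cos I (one A)"
  by (simp add: quot_alg_def ring.defs FactRing_def coset_A)

context
  fixes I :: "('b \<Rightarrow>\<^sub>0 'k) set" assumes I: "pm.subspace I"
begin

lemma quot_add: "add (quot_alg A I) (cos I x) (cos I y) = cos I (x + y)"
proof -
  have "add (quot_alg A I) (cos I x) (cos I y) = {a + b | a b. a \<in> cos I x \<and> b \<in> cos I y}"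
    by (auto simp: quot_alg_def ring.defs FactRing_def set_add_def set_mult_def)
  also have "\<dots> = cos I (x + y)"
  proof (intro equalityI subsetI)
    fix z assume "z \<in> {a + b | a b. a \<in> cos I x \<and> b \<in> cos I y}"
    then obtain a b where "z = a + b" "a - x \<in> I" "b - y \<in> I" by (auto simp: in_cos)
    moreover have "a + b - (x + y) = (a - x) + (b - y)" by simp
    ultimately show "z \<in> cos I (x + y)" using pm.subspace_add[OF I] by (metis in_cos)
  next
    fix z assume "z \<in> cos I (x + y)"
    then have "z - y \<in> cos I x" by (simp add: in_cos algebra_simps)
    then have "\<exists>a b. z = a + b \<and> a \<in> cos I x \<and> b \<in> cos I y"
      using cos_self[OF I, of y] by (intro exI[of _ "z - y"] exI[of _ y]) auto
    then show "z \<in> {a + b | a b. a \<in> cos I x \<and> b \<in> cos I y}" by blast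
  qed
  finally show ?thesis .
qed

lemma quot_smult: "smult (quot_alg A I) c (cos I x) = cos I (scal c x)"
proof -
  have "smult (quot_alg A I) c (cos I x) = (\<Union>x'\<in>cos I x. cos I (scal c x'))"
    by (simp add: quot_alg_def ring.defs module.defs coset_A)
  also have "\<dots> = cos I (scal c x)"
    by (rule UN_cos[OF I]) (simp add: cos_eq_iff[OF I] pm.subspace_scale[OF I] flip: scal_diff)
  finally show ?thesis .
qed

lemma quot_mult:
  assumes "\<And>x x' y y'. x' - x \<in> I \<Longrightarrow> y' - y \<in> I \<Longrightarrow> mult A x' y' - mult A x y \<in> I"
  shows "mult (quot_alg A I) (cos I x) (cos I y) = cos I (mult A x y)"
proof -
  have "mult (quot_alg A I) (cos I x) (cos I y) = (\<Union>x'\<in>cos I x. \<Union>y'\<in>cos I y. cos I (mult A x' y'))"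
    by (simp add: quot_alg_def ring.defs FactRing_def rcoset_mult_def coset_A)
  also have "\<dots> = (\<Union>x'\<in>cos I x. \<Union>y'\<in>cos I y. cos I (mult A x y))"
    using assms by (intro SUP_cong refl) (auto simp: in_cos cos_eq_iff[OF I])
  also have "\<dots> = cos I (mult A x y)"
    using cos_self[OF I] by auto
  finally show ?thesis .
qed

lemma quot_abelian_monoid: "abelian_monoid (quot_alg A I)"
proof (rule abelian_monoidI)
  show "\<zero>\<^bsub>quot_alg A I\<^esub> \<in> carrier (quot_alg A I)"
    using cos_zero[of I] by (auto simp: quot_carrier quot_zero)
  have z: "\<zero>\<^bsub>quot_alg A I\<^esub> = cos I 0" by (simp add: quot_zero cos_zero)
  show "\<zero>\<^bsub>quot_alg A I\<^esub> \<oplus>\<^bsub>quot_alg A I\<^esub> x = x" if "x \<in> carrier (quot_alg A I)" for x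
    using that unfolding z by (auto simp: quot_carrier quot_add)
qed (auto simp: quot_carrier quot_add add_ac)

lemma quot_finsum:
  assumes "finite F"
  shows "finsum (quot_alg A I) (\<lambda>i. cos I (f i)) F = cos I (sum f F)"
proof -
  interpret abelian_monoid "quot_alg A I" by (rule quot_abelian_monoid)
  show ?thesis using assms
    by (induction F rule: finite_induct) (simp_all add: quot_zero cos_zero quot_carrier quot_add)
qed

text \<open>The two sides index coefficients differently, by cosets and by representatives. One
  inclusion chooses representatives; in the other, several vectors of S may lie in one coset and
  their coefficients have to be added.\<close>

lemma quot_lspan: "lspan (quot_alg A I) (cos I ` S) = cos I ` pm.span S"
proof (intro equalityI subsetI)
  interpret abelian_monoid "quot_alg A I" by (rule quot_abelian_monoid)
  fix X assume "X \<in> lspan (quot_alg A I) (cos I ` S)"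
  then obtain F c where F: "finite F" "F \<subseteq> cos I ` S"
    and X: "X = finsum (quot_alg A I) (\<lambda>v. c v \<odot>\<^bsub>quot_alg A I\<^esub> v) F"
    by (auto simp: lspan_def)
  obtain g where g: "\<And>v. v \<in> F \<Longrightarrow> g v \<in> S \<and> v = cos I (g v)"
    using F(2) by (metis (no_types, lifting) image_iff subset_iff)
  have "X = finsum (quot_alg A I) (\<lambda>v. cos I (scal (c v) (g v))) F"
    unfolding X
  proof (rule finsum_cong')
    fix v assume "v \<in> F"
    then show "c v \<odot>\<^bsub>quot_alg A I\<^esub> v = cos I (scal (c v) (g v))" using g[of v] by (metis quot_smult)
  qed (auto simp: quot_carrier)
  then have "X = cos I (\<Sum>v\<in>F. scal (c v) (g v))" using F by (simp add: quot_finsum)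
  moreover have "(\<Sum>v\<in>F. scal (c v) (g v)) \<in> pm.span S"
    using g by (auto intro!: pm.span_sum pm.span_scale intro: pm.span_base)
  ultimately show "X \<in> cos I ` pm.span S" by blast
next
  interpret abelian_monoid "quot_alg A I" by (rule quot_abelian_monoid)
  fix X assume "X \<in> cos I ` pm.span S"
  then obtain x where x: "X = cos I x" "x \<in> pm.span S" by blast
  have closed: "\<exists>c. finite F \<longrightarrow> cos I y = finsum (quot_alg A I) (\<lambda>v. c v \<odot>\<^bsub>quot_alg A I\<^esub> v) (cos I ` F)"
    if F: "finite F" and y: "y \<in> pm.span F" for F y
  proof -
    define rep where "rep v = (SOME u. u \<in> F \<and> cos I u = v)" for v
    have rep: "rep v \<in> F" "cos I (rep v) = v" if "v \<in> cos I ` F" for v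
      using someI_ex[of "\<lambda>u. u \<in> F \<and> cos I u = v"] that unfolding rep_def by blast+
    obtain r where yr: "y = (\<Sum>u\<in>F. scal (r u) u)" using y pm.span_finite[OF F] by auto
    \<comment> \<open>The sum over the fibre of a coset. Then y differs from the combination of the
      chosen representatives by multiples of \<open>u - rep v\<close>, which lie in I.\<close>
    define c where "c v = (\<Sum>u\<in>{u\<in>F. cos I u = v}. r u)" for v
    have "cos I y = cos I (\<Sum>v\<in>cos I ` F. scal (c v) (rep v))"
    proof (subst cos_eq_iff[OF I])
      have "y = (\<Sum>v\<in>cos I ` F. \<Sum>u\<in>{u\<in>F. cos I u = v}. scal (r u) u)"
        unfolding yr using F by (simp add: sum.image_gen[of F _ "cos I"])
      moreover have "(\<Sum>v\<in>cos I ` F. scal (c v) (rep v)) = (\<Sum>v\<in>cos I ` F. \<Sum>u\<in>{u\<in>F. cos I u = v}. scal (r u) (rep v))"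
        unfolding c_def by (simp add: pm.scale_sum_left)
      ultimately have "y - (\<Sum>v\<in>cos I ` F. scal (c v) (rep v)) =
          (\<Sum>v\<in>cos I ` F. \<Sum>u\<in>{u\<in>F. cos I u = v}. scal (r u) (u - rep v))"
        by (simp add: sum_subtractf scal_diff)
      moreover have "u - rep v \<in> I" if "v \<in> cos I ` F" "cos I u = v" for u v
        using rep[OF that(1)] that(2) cos_eq_iff[OF I, of u "rep v"] by simp
      ultimately show "y - (\<Sum>v\<in>cos I ` F. scal (c v) (rep v)) \<in> I"
        by (auto intro!: pm.subspace_sum[OF I] pm.subspace_scale[OF I])
    qed
    also have "\<dots> = finsum (quot_alg A I) (\<lambda>v. cos I (scal (c v) (rep v))) (cos I ` F)"
      using F by (simp add: quot_finsum)
    also have "\<dots> = finsum (quot_alg A I) (\<lambda>v. c v \<odot>\<^bsub>quot_alg A I\<^esub> v) (cos I ` F)"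
    proof (rule finsum_cong')
      fix v assume v: "v \<in> cos I ` F"
      show "cos I (scal (c v) (rep v)) = c v \<odot>\<^bsub>quot_alg A I\<^esub> v"
        using quot_smult[of "c v" "rep v"] rep(2)[OF v] by simp
    next
      show "(\<lambda>v. c v \<odot>\<^bsub>quot_alg A I\<^esub> v) \<in> cos I ` F \<rightarrow> carrier (quot_alg A I)"
        by (auto simp: quot_smult quot_carrier)
    qed simp
    finally show ?thesis by blast
  qed
  obtain F r where "finite F" "F \<subseteq> S" "x = (\<Sum>u\<in>F. scal (r u) u)"
    using x(2) unfolding pm.span_explicit by blast
  then have "x \<in> pm.span F" by (auto intro!: pm.span_sum pm.span_scale intro: pm.span_base)
  then obtain c where "X = finsum (quot_alg A I) (\<lambda>v. c v \<odot>\<^bsub>quot_alg A I\<^esub> v) (cos I ` F)"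
    using closed[OF \<open>finite F\<close>] x(1) \<open>finite F\<close> by auto
  then show "X \<in> lspan (quot_alg A I) (cos I ` S)"
    unfolding lspan_def using \<open>finite F\<close> \<open>F \<subseteq> S\<close> by blast
qed

end

end

interpretation TV: pm_alg "TV :: ('k::field, ('i, 'k) tens_alg) module"
  by unfold_locales (auto simp: TV_def)

interpretation TT: pm_alg "TT q :: ('k::field, ('i::finite, 'k) tens_sq) module" for q
  by unfold_locales (auto simp: TT_def)

lemma TV_mult [simp]: "mult TV = (*)" and TV_one [simp]: "one TV = 1"
  and TT_mult [simp]: "mult (TT q) = tmult q"
  by (auto simp: TV_def TT_def)

section \<open>Linear algebra modulo a subspace\<close>

text \<open>A basis of J is extended to a basis of the whole space and then sent to zero, the other
  basis vectors being fixed. P stands in for the quotient map while staying within one type, where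
  independence and dimension from the library apply.\<close>

lemma ex_projection:
  fixes J :: "('b \<Rightarrow>\<^sub>0 'k::field) set"
  assumes "pm.subspace J"
  obtains P where "plin P" "\<And>x. P x = 0 \<longleftrightarrow> x \<in> J" "\<And>x. P x - x \<in> J"
proof -
  interpret vp: vector_space_pair "scal :: 'k \<Rightarrow> ('b \<Rightarrow>\<^sub>0 'k) \<Rightarrow> _" "scal :: 'k \<Rightarrow> ('b \<Rightarrow>\<^sub>0 'k) \<Rightarrow> _" ..
  obtain B where B: "B \<subseteq> J" "pm.independent B" "J \<subseteq> pm.span B"
    by (rule pm.maximal_independent_subset[of J])
  obtain C where C: "B \<subseteq> C" "pm.independent C" "UNIV \<subseteq> pm.span C"
    using pm.maximal_independent_subset_extend[OF subset_UNIV B(2)] by metis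
  define P where "P = vp.construct C (\<lambda>b. if b \<in> B then 0 else b)"
  have lin: "Vector_Spaces.linear scal scal P"
    unfolding P_def by (rule vp.linear_construct[OF C(2)])
  then have P: "plin P"
    by (simp add: plin_def Vector_Spaces.linear_def module_hom_def module_hom_axioms_def)
  have PC: "P b = (if b \<in> B then 0 else b)" if "b \<in> C" for b
    unfolding P_def using vp.construct_basis[OF C(2) that] by simp
  have 1: "P x - x \<in> J" for x
  proof -
    have "x \<in> pm.span C" using C by auto
    then show ?thesis
    proof (rule plin_span_into[OF plin_minus_fun[OF P plin_id] assms, rotated])
      show "P b - b \<in> J" if "b \<in> C" for b
        using PC[OF that] B assms by (auto simp: pm.subspace_0 pm.subspace_neg)
    qed
  qed
  have 2: "P x = 0" if "x \<in> J" for x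
  proof -
    have "x \<in> pm.span B" using that B by auto
    then have "P x \<in> {0}"
      by (rule plin_span_into[OF P pm.subspace_single_0, rotated]) (use PC B C in auto)
    then show ?thesis by simp
  qed
  have "x \<in> J" if "P x = 0" for x
    using 1[of x] that pm.subspace_neg[OF assms, of "- x"] by simp
  then show ?thesis using that[OF P] 1 2 by blast
qed

text \<open>Indexed by e rather than stated for a set of vectors, so that coinciding classes already
  count as a dependence.\<close>

definition indep_mod :: "('b \<Rightarrow>\<^sub>0 'k::field) set \<Rightarrow> 'e set \<Rightarrow> ('e \<Rightarrow> ('b \<Rightarrow>\<^sub>0 'k)) \<Rightarrow> bool" where
  "indep_mod J E m \<longleftrightarrow> (\<forall>F c. finite F \<and> F \<subseteq> E \<and> (\<Sum>e\<in>F. scal (c e) (m e)) \<in> J \<longrightarrow> (\<forall>e\<in>F. c e = 0))"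

lemma indep_modD: "indep_mod J E m \<Longrightarrow> finite F \<Longrightarrow> F \<subseteq> E \<Longrightarrow> (\<Sum>e\<in>F. scal (c e) (m e)) \<in> J \<Longrightarrow> e \<in> F \<Longrightarrow> c e = 0"
  unfolding indep_mod_def by blast

lemma indep_mod_subset: "indep_mod J E m \<Longrightarrow> E' \<subseteq> E \<Longrightarrow> indep_mod J E' m"
  unfolding indep_mod_def by blast

lemma indep_mod_inj:
  assumes "indep_mod J E m" "pm.subspace J"
  shows "inj_on (\<lambda>e. cos J (m e)) E"
proof (rule inj_onI, rule ccontr)
  fix e e' assume e: "e \<in> E" "e' \<in> E" "cos J (m e) = cos J (m e')" "e \<noteq> e'"
  then have "m e - m e' \<in> J" by (simp add: cos_eq_iff assms)
  then have "(\<Sum>a\<in>{e, e'}. scal (if a = e then 1 else -1) (m a)) \<in> J"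
    using e by (simp add: scal_minus)
  then show False
    using indep_modD[OF assms(1), of "{e, e'}" "\<lambda>a. if a = e then 1 else -1" e] e by simp
qed

lemma (in pm_alg) lin_indep_quot:
  assumes J: "pm.subspace J" and m: "indep_mod J E m"
  shows "lin_indep (quot_alg A J) ((\<lambda>e. cos J (m e)) ` E)"
  unfolding lin_indep_def
proof (intro allI impI ballI)
  interpret abelian_monoid "quot_alg A J" by (rule quot_abelian_monoid[OF J])
  fix F c v
  assume *: "finite F \<and> F \<subseteq> (\<lambda>e. cos J (m e)) ` E \<and> (\<Oplus>\<^bsub>quot_alg A J\<^esub>v\<in>F. c v \<odot>\<^bsub>quot_alg A J\<^esub> v) = \<zero>\<^bsub>quot_alg A J\<^esub>"
    and v: "v \<in> F"
  then have F: "finite F" "F \<subseteq> (\<lambda>e. cos J (m e)) ` E" by auto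
  obtain E' where E': "E' \<subseteq> E" "finite E'" "F = (\<lambda>e. cos J (m e)) ` E'"
    using finite_subset_image[OF F] by blast
  have inj: "inj_on (\<lambda>e. cos J (m e)) E'"
    using indep_mod_inj[OF m J] E'(1) inj_on_subset by blast
  have "(\<Oplus>\<^bsub>quot_alg A J\<^esub>v\<in>F. c v \<odot>\<^bsub>quot_alg A J\<^esub> v) = (\<Oplus>\<^bsub>quot_alg A J\<^esub>e\<in>E'. cos J (scal (c (cos J (m e))) (m e)))"
    unfolding E'(3)
  proof (subst finsum_reindex[OF _ inj])
    show "(\<lambda>v. c v \<odot>\<^bsub>quot_alg A J\<^esub> v) \<in> (\<lambda>e. cos J (m e)) ` E' \<rightarrow> carrier (quot_alg A J)"
      by (auto simp: quot_smult[OF J] quot_carrier)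
  qed (simp add: quot_smult[OF J])
  then have "cos J (\<Sum>e\<in>E'. scal (c (cos J (m e))) (m e)) = cos J 0"
    using * E'(2) by (simp add: quot_finsum[OF J] quot_zero cos_zero)
  then have "(\<Sum>e\<in>E'. scal (c (cos J (m e))) (m e)) \<in> J"
    by (simp add: cos_eq_iff[OF J])
  then have "\<forall>e\<in>E'. c (cos J (m e)) = 0"
    using indep_modD[OF m E'(2,1), of "\<lambda>e. c (cos J (m e))"] by blast
  then show "c v = 0" using v E'(3) by auto
qed

lemma indep_mod_imp_independent:
  assumes "plin P" "\<And>x. P x = 0 \<longleftrightarrow> x \<in> J" "indep_mod J E m"
  shows "inj_on (\<lambda>e. P (m e)) E" "pm.independent ((\<lambda>e. P (m e)) ` E)"
proof -
  show inj: "inj_on (\<lambda>e. P (m e)) E"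
  proof (rule inj_onI, rule ccontr)
    fix e e' assume e: "e \<in> E" "e' \<in> E" "P (m e) = P (m e')" "e \<noteq> e'"
    then have "m e - m e' \<in> J" by (simp add: plin_diff[OF assms(1)] flip: assms(2))
    then have "(\<Sum>a\<in>{e, e'}. scal (if a = e then 1 else -1) (m a)) \<in> J"
      using e by (simp add: scal_minus)
    then show False
      using indep_modD[OF assms(3), of "{e, e'}" "\<lambda>a. if a = e then 1 else -1" e] e by simp
  qed
  show "pm.independent ((\<lambda>e. P (m e)) ` E)"
    unfolding pm.dependent_explicit
  proof (safe)
    fix S u v assume S: "finite S" "S \<subseteq> (\<lambda>e. P (m e)) ` E" "(\<Sum>v\<in>S. scal (u v) v) = 0" and v: "v \<in> S" "u v \<noteq> 0"
    obtain E' where E': "E' \<subseteq> E" "finite E'" "S = (\<lambda>e. P (m e)) ` E'"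
      using finite_subset_image[OF S(1,2)] by blast
    have "(\<Sum>v\<in>S. scal (u v) v) = (\<Sum>e\<in>E'. scal (u (P (m e))) (P (m e)))"
      unfolding E'(3) by (subst sum.reindex) (use inj E' in \<open>auto intro: inj_on_subset\<close>)
    also have "\<dots> = P (\<Sum>e\<in>E'. scal (u (P (m e))) (m e))"
      by (simp add: plin_sum[OF assms(1)] plin_scal[OF assms(1)])
    finally have "(\<Sum>e\<in>E'. scal (u (P (m e))) (m e)) \<in> J" using S(3) assms(2) by metis
    then have "\<forall>e\<in>E'. u (P (m e)) = 0"
      using indep_modD[OF assms(3) E'(2,1), of "\<lambda>e. u (P (m e))"] by blast
    then show False using v E'(3) by auto
  qed
qed

text \<open>\<open>fdim\<close> is a definite description, so both the existence of a finite basis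
  and the uniqueness of its cardinality are needed. P carries both questions over to the span of the
  image of S.\<close>

lemma (in pm_alg) fdim_quot:
  assumes J: "pm.subspace J" and P: "plin P" "\<And>x. P x = 0 \<longleftrightarrow> x \<in> J" and S: "finite S"
  shows "fdim (quot_alg A J) (cos J ` pm.span S) = pm.dim (P ` S)"
proof -
  interpret abelian_monoid "quot_alg A J" by (rule quot_abelian_monoid[OF J])
  have cosP: "cos J x = cos J y \<longleftrightarrow> P x = P y" for x y
    by (simp add: cos_eq_iff[OF J] plin_diff[OF P(1)] flip: P(2))
  have cosP_image: "cos J ` X = cos J ` Y \<longleftrightarrow> P ` X = P ` Y" for X Y
  proof -
    have "cos J x \<in> cos J ` Y \<longleftrightarrow> P x \<in> P ` Y" for x Y by (simp add: image_iff cosP)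
    then have "cos J ` X \<subseteq> cos J ` Y \<longleftrightarrow> P ` X \<subseteq> P ` Y" for X Y by (simp only: image_subset_iff)
    then show ?thesis by (simp only: set_eq_subset)
  qed
  have unique: "card B = pm.dim (P ` S)" if B: "finite B" "is_basis_of (quot_alg A J) (cos J ` pm.span S) B" for B
  proof -
    have B': "B \<subseteq> cos J ` pm.span S" "lin_indep (quot_alg A J) B" "lspan (quot_alg A J) B = cos J ` pm.span S"
      using B(2) by (auto simp: is_basis_of_def)
    obtain R where R: "R \<subseteq> pm.span S" "B = cos J ` R" "inj_on (cos J) R"
      using B'(1) unfolding subset_image_inj by blast
    have fR: "finite R" using R B(1) finite_imageD by blast
    have ind: "indep_mod J R (\<lambda>x. x)"
      unfolding indep_mod_def
    proof (intro allI impI ballI)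
      fix F c e assume F: "finite F \<and> F \<subseteq> R \<and> (\<Sum>e\<in>F. scal (c e) e) \<in> J" and e: "e \<in> F"
      have injF: "inj_on (cos J) F" using F R(3) inj_on_subset by blast
      define d where "d v = c (the_inv_into F (cos J) v)" for v
      have d: "d (cos J x) = c x" if "x \<in> F" for x using that by (simp add: d_def the_inv_into_f_f[OF injF])
      have "(\<Oplus>\<^bsub>quot_alg A J\<^esub>v\<in>cos J ` F. d v \<odot>\<^bsub>quot_alg A J\<^esub> v) = (\<Oplus>\<^bsub>quot_alg A J\<^esub>x\<in>F. cos J (scal (c x) x))"
      proof (subst finsum_reindex[OF _ injF])
        show "(\<lambda>v. d v \<odot>\<^bsub>quot_alg A J\<^esub> v) \<in> cos J ` F \<rightarrow> carrier (quot_alg A J)"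
          by (auto simp: quot_smult[OF J] quot_carrier)
        show "(\<Oplus>\<^bsub>quot_alg A J\<^esub>x\<in>F. d (cos J x) \<odot>\<^bsub>quot_alg A J\<^esub> cos J x) = (\<Oplus>\<^bsub>quot_alg A J\<^esub>x\<in>F. cos J (scal (c x) x))"
          by (rule finsum_cong') (auto simp: quot_smult[OF J] quot_carrier d)
      qed
      also have "\<dots> = \<zero>\<^bsub>quot_alg A J\<^esub>"
        using F by (simp add: quot_finsum[OF J] quot_zero) (metis cos_eq_iff[OF J] cos_zero diff_zero)
      finally have "\<forall>v\<in>cos J ` F. d v = 0"
        using B'(2) F unfolding lin_indep_def R(2) by (elim allE[of _ "cos J ` F"] allE[of _ d] impE) auto
      then show "c e = 0" using d e by auto
    qed
    have "cos J ` pm.span R = cos J ` pm.span S" using B'(3) R(2) quot_lspan[OF J, of R] by simp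
    then have "P ` pm.span R = P ` pm.span S"
      using cosP_image[of "pm.span R" "pm.span S"] by simp
    then have sp: "pm.span (P ` R) = pm.span (P ` S)"
      by (simp add: plin_image_span[OF P(1)])
    have "pm.dim (P ` S) = card (P ` R)"
      using indep_mod_imp_independent(2)[OF P ind] sp by (intro pm.dim_eq_card) auto
    also have "\<dots> = card R" using indep_mod_imp_independent(1)[OF P ind] by (rule card_image)
    also have "\<dots> = card B" using R by (simp add: card_image)
    finally show ?thesis by simp
  qed
  have exist: "\<exists>B. finite B \<and> is_basis_of (quot_alg A J) (cos J ` pm.span S) B"
  proof -
    obtain B where B: "B \<subseteq> P ` S" "pm.independent B" "P ` S \<subseteq> pm.span B"
      by (rule pm.maximal_independent_subset[of "P ` S"])
    obtain R where R: "R \<subseteq> S" "B = P ` R" "inj_on P R"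
      using B(1) unfolding subset_image_inj by blast
    have fR: "finite R" using R(1) S finite_subset by blast
    have ind: "indep_mod J R (\<lambda>x. x)"
      unfolding indep_mod_def
    proof (intro allI impI ballI)
      fix F c e assume F: "finite F \<and> F \<subseteq> R \<and> (\<Sum>e\<in>F. scal (c e) e) \<in> J" and e: "e \<in> F"
      have injF: "inj_on P F" using F R(3) inj_on_subset by blast
      define d where "d v = c (the_inv_into F P v)" for v
      have d: "d (P x) = c x" if "x \<in> F" for x using that by (simp add: d_def the_inv_into_f_f[OF injF])
      have "(\<Sum>v\<in>P ` F. scal (d v) v) = P (\<Sum>e\<in>F. scal (c e) e)"
        by (simp add: sum.reindex[OF injF] d plin_sum[OF P(1)] plin_scal[OF P(1)])
      also have "\<dots> = 0" using F P(2) by blast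
      finally have "\<forall>v\<in>P ` F. d v = 0"
        using pm.independentD[OF B(2), of "P ` F" d] F R(2) by auto
      then show "c e = 0" using d e by auto
    qed
    have "P ` pm.span R = P ` pm.span S"
      using B R by (simp add: plin_image_span[OF P(1)] pm.span_eq) (meson image_mono pm.span_superset subset_trans)
    then have "cos J ` pm.span R = cos J ` pm.span S"
      using cosP_image[of "pm.span R" "pm.span S"] by simp
    then have "is_basis_of (quot_alg A J) (cos J ` pm.span S) (cos J ` R)"
      using lin_indep_quot[OF J ind] quot_lspan[OF J, of R] R(1)
      by (auto simp: is_basis_of_def intro: pm.span_base)
    then show ?thesis using fR by blast
  qed
  show ?thesis
    unfolding fdim_def using unique exist by (intro the_equality) auto
qed

lemma (in pm_alg) fdim_ge:
  assumes J: "pm.subspace J" and S: "finite S" and E: "finite E" "indep_mod J E m"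
    and sub: "\<And>e. e \<in> E \<Longrightarrow> m e \<in> pm.span S"
  shows "card E \<le> fdim (quot_alg A J) (cos J ` pm.span S)"
proof -
  obtain P where P: "plin P" "\<And>x. P x = 0 \<longleftrightarrow> x \<in> J" "\<And>x. P x - x \<in> J"
    by (rule ex_projection[OF J]) blast
  note ind = indep_mod_imp_independent[OF P(1,2) E(2)]
  obtain B where B: "B \<subseteq> P ` S" "pm.independent B" "P ` S \<subseteq> pm.span B"
    by (rule pm.maximal_independent_subset[of "P ` S"])
  have "finite B" using B(1) S finite_subset by blast
  have "(\<lambda>e. P (m e)) ` E \<subseteq> P ` pm.span S" using sub by blast
  then have "(\<lambda>e. P (m e)) ` E \<subseteq> pm.span B"
    using pm.span_minimal[OF B(3) pm.subspace_span] unfolding plin_image_span[OF P(1)] by blast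
  then have "card ((\<lambda>e. P (m e)) ` E) \<le> card B"
    using pm.independent_span_bound[OF \<open>finite B\<close> ind(2)] by blast
  moreover have "card B = pm.dim (P ` S)"
    by (rule pm.basis_card_eq_dim[OF B(1,3,2)])
  ultimately show ?thesis
    using fdim_quot[OF J P(1,2) S] card_image[OF ind(1)] by simp
qed

lemma (in pm_alg) fdim_le:
  assumes J: "pm.subspace J" and S: "finite S" and R: "finite R"
    and sub: "\<And>x. x \<in> S \<Longrightarrow> \<exists>y\<in>pm.span R. x - y \<in> J"
  shows "fdim (quot_alg A J) (cos J ` pm.span S) \<le> card R"
proof -
  obtain P where P: "plin P" "\<And>x. P x = 0 \<longleftrightarrow> x \<in> J" "\<And>x. P x - x \<in> J"
    by (rule ex_projection[OF J]) blast
  have "P ` S \<subseteq> pm.span (P ` R)"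
  proof safe
    fix x assume "x \<in> S"
    then obtain y where y: "y \<in> pm.span R" "x - y \<in> J" using sub by blast
    then have "P x = P y" using plin_diff[OF P(1), of x y] P(2)[of "x - y"] by simp
    then show "P x \<in> pm.span (P ` R)" using y by (simp add: plin_image_span[OF P(1), symmetric])
  qed
  then have "pm.dim (P ` S) \<le> card (P ` R)"
    using R by (intro pm.dim_le_card) auto
  also have "\<dots> \<le> card R" by (rule card_image_le[OF R])
  finally show ?thesis by (simp add: fdim_quot[OF J P(1,2) S])
qed

section \<open>Braided Hopf ideals\<close>

lemma set_add_TT: "A <+>\<^bsub>TT q\<^esub> B = {a + b | a b. a \<in> A \<and> b \<in> B}"
  by (auto simp: set_add_def set_mult_def)

lemma tens_sub_eq: "tens_sub q A B = pm.span {tens a b | a b. a \<in> A \<and> b \<in> B}"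
  by (simp add: tens_sub_def TT.lspan_A)

lemma tens_ker_eq: "tens_ker q I J = pm.span ({tens a b | a b. a \<in> I} \<union> {tens a b | a b. b \<in> J})"
  by (simp add: tens_ker_def set_add_TT tens_sub_eq pm.span_Un)

lemma tens_ker_subspace: "pm.subspace (tens_ker q I J)"
  by (simp add: tens_ker_eq)

lemma tens_ker_left: "a \<in> I \<Longrightarrow> tens a b \<in> tens_ker q I J"
  and tens_ker_right: "b \<in> J \<Longrightarrow> tens a b \<in> tens_ker q I J"
  unfolding tens_ker_eq by (auto intro!: pm.span_base)

lemma tens_ker_into:
  assumes "plin f" "pm.subspace U" "\<And>a b. a \<in> I \<Longrightarrow> f (tens a b) \<in> U" "\<And>a b. b \<in> J \<Longrightarrow> f (tens a b) \<in> U"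
    "t \<in> tens_ker q I J"
  shows "f t \<in> U"
  using assms(5) unfolding tens_ker_eq
  by (rule plin_span_into[OF assms(1,2), rotated]) (use assms(3,4) in auto)

lemma tens_ker_mono: "I \<subseteq> I' \<Longrightarrow> J \<subseteq> J' \<Longrightarrow> tens_ker q I J \<subseteq> tens_ker q I' J'"
  unfolding tens_ker_eq by (intro pm.span_mono) auto

text \<open>Spanned by elements homogeneous for the finer degree \<open>wdeg\<close>. The braiding
  is a scalar only between homogeneous elements, so this is what lets it descend to the
  quotient.\<close>

definition hspan :: "('i, 'k::field) tens_alg set \<Rightarrow> bool" where
  "hspan I \<longleftrightarrow> I \<subseteq> pm.span {x \<in> I. \<exists>\<beta>. homogeneous \<beta> x}"

lemma hspan_Idl:
  fixes G :: "('i, 'k::field) tens_alg set"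
  assumes "\<And>g. g \<in> G \<Longrightarrow> \<exists>\<beta>. homogeneous \<beta> g"
  shows "hspan (Idl\<^bsub>TV\<^esub> G)"
proof -
  have "{bs u * g * bs v | u g v. g \<in> G} \<subseteq> {x \<in> Idl\<^bsub>TV\<^esub> G. \<exists>\<beta>. homogeneous \<beta> x}"
  proof safe
    fix u g v assume g: "g \<in> G"
    show "bs u * g * bs v \<in> Idl\<^bsub>TV\<^esub> G"
      by (intro tideal_right tideal_left tideal_Idl Idl_TV_base g)
    show "\<exists>\<beta>. homogeneous \<beta> (bs u * g * bs v)"
      using assms[OF g] homogeneous_mult[OF homogeneous_mult[OF homogeneous_single] homogeneous_single] by blast
  qed
  then have "pm.span {bs u * g * bs v | u g v. g \<in> G} \<subseteq> pm.span {x \<in> Idl\<^bsub>TV\<^esub> G. \<exists>\<beta>. homogeneous \<beta> x}"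
    by (rule pm.span_mono)
  then show ?thesis
    unfolding hspan_def by (rule order_trans[OF equalityD1[OF Idl_TV]])
qed

lemma plin_hspan_into:
  assumes "hspan I" "plin f" "pm.subspace U" "\<And>x \<beta>. x \<in> I \<Longrightarrow> homogeneous \<beta> x \<Longrightarrow> f x \<in> U" "x \<in> I"
  shows "f x \<in> U"
proof -
  have "x \<in> pm.span {x \<in> I. \<exists>\<beta>. homogeneous \<beta> x}" using assms(1,5) by (auto simp: hspan_def)
  then show ?thesis by (rule plin_span_into[OF assms(2,3), rotated]) (use assms(4) in auto)
qed

context diag_braiding
begin

text \<open>In the braided square an element of I meets the other factors through the braiding. Once
  it is reduced to a homogeneous element this is a scalar, and ordinary ideal closure in each slot
  suffices.\<close>

lemma tens_ker_ideal:
  assumes I: "tideal I" "hspan I" and J: "tideal J" "hspan J" and t: "t \<in> tens_ker q I J"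
  shows "tmult q s t \<in> tens_ker q I J" "tmult q t s \<in> tens_ker q I J"
proof -
  let ?U = "{t. \<forall>s. tmult q s t \<in> tens_ker q I J \<and> tmult q t s \<in> tens_ker q I J}"
  have U: "pm.subspace ?U"
    using tens_ker_subspace[of q I J]
    by (auto simp: pm.subspace_def tmult_add_left tmult_add_right tmult_scal_left tmult_scal_right)
  have U1: "tens a b \<in> ?U" if ab: "\<And>u v. tmult q (tens (bs u) (bs v)) (tens a b) \<in> tens_ker q I J \<and>
      tmult q (tens a b) (tens (bs u) (bs v)) \<in> tens_ker q I J" for a b
  proof safe
    fix s
    show "tmult q s (tens a b) \<in> tens_ker q I J"
      by (induction s rule: tens_sq_induct) (use tens_ker_subspace[of q I J] ab in
        \<open>auto simp: tmult_add_left tmult_scal_left pm.subspace_def\<close>)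
    show "tmult q (tens a b) s \<in> tens_ker q I J"
      by (induction s rule: tens_sq_induct) (use tens_ker_subspace[of q I J] ab in
        \<open>auto simp: tmult_add_right tmult_scal_right pm.subspace_def\<close>)
  qed
  have "t \<in> ?U"
  proof (rule tens_ker_into[OF plin_id U _ _ t])
    fix a b assume "a \<in> I"
    then show "tens a b \<in> ?U"
    proof (rule plin_hspan_into[OF I(2) plin_tens_left U, rotated])
      fix x \<beta> assume x: "x \<in> I" "homogeneous \<beta> x"
      show "tens x b \<in> ?U"
      proof (induction b rule: pm_induct)
        case (bs w)
        show ?case
          by (rule U1) (simp add: tmult_tens[OF homogeneous_single x(2)] tmult_tens[OF homogeneous_single homogeneous_single]
            pm.subspace_scale[OF tens_ker_subspace] tens_ker_left tideal_left[OF I(1) x(1)] tideal_right[OF I(1) x(1)])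
      next
        case zero
        show ?case using pm.subspace_0[OF U] by (simp only: tens_zero)
      next
        case (add y z)
        then show ?case using pm.subspace_add[OF U] by (simp only: tens_add_right)
      next
        case (scal c y)
        then show ?case using pm.subspace_scale[OF U] by (simp only: tens_scal_right)
      qed
    qed
  next
    fix a b assume "b \<in> J"
    then show "tens a b \<in> ?U"
    proof (rule plin_hspan_into[OF J(2) plin_tens_right U, rotated])
      fix x \<beta> assume x: "x \<in> J" "homogeneous \<beta> x"
      show "tens a x \<in> ?U"
      proof (induction a rule: pm_induct)
        case (bs w)
        show ?case
          by (rule U1) (simp add: tmult_tens[OF x(2) homogeneous_single] tmult_tens[OF homogeneous_single homogeneous_single]
            pm.subspace_scale[OF tens_ker_subspace] tens_ker_right tideal_left[OF J(1) x(1)] tideal_right[OF J(1) x(1)])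
      next
        case zero
        show ?case using pm.subspace_0[OF U] by (simp only: tens_zero)
      next
        case (add y z)
        then show ?case using pm.subspace_add[OF U] by (simp only: tens_add_left)
      next
        case (scal c y)
        then show ?case using pm.subspace_scale[OF U] by (simp only: tens_scal_left)
      qed
    qed
  qed
  then show "tmult q s t \<in> tens_ker q I J" "tmult q t s \<in> tens_ker q I J" by auto
qed

text \<open>That the images are attained, not merely contained, comes from the bicharacter being
  invertible: rescaling a homogeneous element of I by the inverse value gives a preimage.\<close>

lemma braid_tens_sub_subset:
  assumes "hspan I" "tideal I"
  shows "braid q ` tens_sub q I UNIV \<subseteq> tens_sub q UNIV I"
    "braid q ` tens_sub q UNIV I \<subseteq> tens_sub q I UNIV"
    "tens_sub q UNIV I \<subseteq> braid q ` tens_sub q I UNIV"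
    "tens_sub q I UNIV \<subseteq> braid q ` tens_sub q UNIV I"
proof -
  let ?L = "tens_sub q I UNIV" and ?R = "tens_sub q UNIV I"
  have sub: "pm.subspace ?L" "pm.subspace ?R" by (auto simp: tens_sub_eq)
  have img: "pm.subspace (braid q ` ?L)" "pm.subspace (braid q ` ?R)"
    by (simp_all add: tens_sub_eq plin_image_span[OF plin_braid])
  have base: "tens a b \<in> ?L" "tens b a \<in> ?R" if "a \<in> I" for a b
    using that by (auto simp: tens_sub_eq intro!: pm.span_base)
  have main: "f t \<in> U" if f: "plin f" "pm.subspace U" "\<And>x \<beta> w. x \<in> I \<Longrightarrow> homogeneous \<beta> x \<Longrightarrow> f (tens x (bs w)) \<in> U"
    and t: "t \<in> ?L" for f t and U :: "('i, 'k) tens_sq set"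
  proof (rule plin_span_into[OF f(1,2) _ t[unfolded tens_sub_eq]], clarify)
    fix a b :: "('i, 'k) tens_alg" assume a: "a \<in> I"
    show "f (tens a b) \<in> U"
    proof (rule plin_hspan_into[OF assms(1) plin_comp[OF f(1) plin_tens_left] f(2) _ a])
      fix x \<beta> assume x: "x \<in> I" "homogeneous \<beta> x"
      show "f (tens x b) \<in> U"
        by (induction b rule: pm_induct) (use f x in \<open>auto simp: tens_add_right tens_scal_right plin_add plin_scal plin_zero pm.subspace_def\<close>)
    qed
  qed
  have main': "f t \<in> U" if f: "plin f" "pm.subspace U" "\<And>x \<beta> w. x \<in> I \<Longrightarrow> homogeneous \<beta> x \<Longrightarrow> f (tens (bs w) x) \<in> U"
    and t: "t \<in> ?R" for f t and U :: "('i, 'k) tens_sq set"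
  proof (rule plin_span_into[OF f(1,2) _ t[unfolded tens_sub_eq]], clarify)
    fix a b :: "('i, 'k) tens_alg" assume a: "b \<in> I"
    show "f (tens a b) \<in> U"
    proof (rule plin_hspan_into[OF assms(1) plin_comp[OF f(1) plin_tens_right] f(2) _ a])
      fix x \<beta> assume x: "x \<in> I" "homogeneous \<beta> x"
      show "f (tens a x) \<in> U"
        by (induction a rule: pm_induct) (use f x in \<open>auto simp: tens_add_left tens_scal_left plin_add plin_scal plin_zero pm.subspace_def\<close>)
    qed
  qed
  show "braid q ` ?L \<subseteq> ?R"
    using main[OF plin_braid sub(2)] by (auto simp: braid_tens[OF _ homogeneous_single] intro!: pm.subspace_scale[OF sub(2)] base)
  show "braid q ` ?R \<subseteq> ?L"
    using main'[OF plin_braid sub(1)] by (auto simp: braid_tens[OF homogeneous_single] intro!: pm.subspace_scale[OF sub(1)] base)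
  show "?R \<subseteq> braid q ` ?L"
  proof
    fix t assume "t \<in> ?R"
    then show "t \<in> braid q ` ?L"
    proof (rule main'[OF plin_id img(1), rotated])
      fix x \<beta> w assume x: "x \<in> I" "homogeneous \<beta> x"
      have "tens (bs w) x = braid q (tens (scal (inverse (bichar q \<beta> (wdeg w))) x) (bs w))"
        by (simp add: tens_scal_left braid_scal braid_tens[OF x(2) homogeneous_single] scal_scal)
      then show "tens (bs w) x \<in> braid q ` ?L" using base(1)[OF tideal_scal[OF assms(2) x(1)]] by blast
    qed
  qed
  show "?L \<subseteq> braid q ` ?R"
  proof
    fix t assume "t \<in> ?L"
    then show "t \<in> braid q ` ?R"
    proof (rule main[OF plin_id img(2), rotated])
      fix x \<beta> w assume x: "x \<in> I" "homogeneous \<beta> x"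
      have "tens x (bs w) = braid q (tens (bs w) (scal (inverse (bichar q (wdeg w) \<beta>)) x))"
        by (simp add: tens_scal_right braid_scal braid_tens[OF homogeneous_single x(2)] scal_scal)
      then show "tens x (bs w) \<in> braid q ` ?R" using base(2)[OF tideal_scal[OF assms(2) x(1)]] by blast
    qed
  qed
qed

text \<open>S reverses products up to scalars, so S(u g v) is a multiple of S(v) S(g) S(u) and only
  the generators matter.\<close>

lemma antip_Idl:
  assumes hom: "\<And>g. g \<in> G \<Longrightarrow> \<exists>\<beta>. homogeneous \<beta> g" and G: "\<And>g. g \<in> G \<Longrightarrow> antip q g \<in> Idl\<^bsub>TV\<^esub> G"
  shows "antip q ` (Idl\<^bsub>TV\<^esub> G) \<subseteq> Idl\<^bsub>TV\<^esub> G"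
proof
  fix y assume "y \<in> antip q ` (Idl\<^bsub>TV\<^esub> G)"
  then obtain x where x: "y = antip q x" "x \<in> pm.span {bs u * g * bs v | u g v. g \<in> G}" by (auto simp: Idl_TV)
  have "antip q x \<in> Idl\<^bsub>TV\<^esub> G"
  proof (rule plin_span_into[OF plin_antip tideal_subspace[OF tideal_Idl] _ x(2)], clarify)
    fix u g v assume g: "g \<in> G"
    obtain \<beta> where \<beta>: "homogeneous \<beta> g" using hom[OF g] by blast
    have "antip q (bs u * g * bs v) \<in> (\<lambda>c. scal c (antip q (bs v) * (antip q g * antip q (bs u)))) ` UNIV"
      by (auto simp: antip_mult[OF homogeneous_mult[OF homogeneous_single \<beta>] homogeneous_single] antip_mult[OF homogeneous_single \<beta>] scal_scal)
    moreover have "antip q (bs v) * (antip q g * antip q (bs u)) \<in> Idl\<^bsub>TV\<^esub> G"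
      by (intro tideal_left tideal_right tideal_Idl G g)
    ultimately show "antip q (bs u * g * bs v) \<in> Idl\<^bsub>TV\<^esub> G"
      by (auto intro: tideal_scal[OF tideal_Idl])
  qed
  then show "y \<in> Idl\<^bsub>TV\<^esub> G" using x by simp
qed

text \<open>
  Generators that are primitive modulo a smaller ideal \<open>I\<^sub>0\<close> generate a Hopf ideal; the antipode
  is controlled by \<open>mul \<circ> (S \<otimes> id) \<circ> \<Delta> = \<epsilon>\<close>, which gives \<open>S(g) + g \<in> I\<^sub>0\<close>.
\<close>

lemma pre_nichols_Idl:
  assumes hom: "\<And>g. g \<in> G \<Longrightarrow> \<exists>\<beta>. homogeneous \<beta> g"
    and deg: "G \<subseteq> (\<Union>n\<in>{2..}. TV_comp n)"
    and I0: "I\<^sub>0 \<subseteq> Idl\<^bsub>TV\<^esub> G" "tideal I\<^sub>0" "antip q ` I\<^sub>0 \<subseteq> I\<^sub>0"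
    and prim: "\<And>g. g \<in> G \<Longrightarrow> comult q g - tens g 1 - tens 1 g \<in> tens_ker q I\<^sub>0 I\<^sub>0"
  shows "pre_nichols_ideal q (Idl\<^bsub>TV\<^esub> G)"
proof -
  let ?I = "Idl\<^bsub>TV\<^esub> G"
  let ?K = "tens_ker q ?I ?I"
  note idl = tideal_Idl[of G] and hsp = hspan_Idl[of G, OF hom]
  have cou: "counit g = 0" if "g \<in> G" for g
  proof -
    from that deg obtain n where "n \<ge> 2" "g \<in> TV_comp n" by auto
    then have "0 \<notin> Poly_Mapping.keys g" by (force simp: TV_comp_def zero_word_def)
    then show ?thesis by (simp add: counit_def in_keys_iff)
  qed
  have comult: "comult q x \<in> ?K" if x: "x \<in> ?I" for x
  proof (rule plin_span_into[OF plin_comult tens_ker_subspace _ x[unfolded Idl_TV]], clarify)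
    fix u g v assume g: "g \<in> G"
    have "comult q g - tens g 1 - tens 1 g + tens g 1 + tens 1 g \<in> ?K"
      by (intro pm.subspace_add[OF tens_ker_subspace] tens_ker_left tens_ker_right Idl_TV_base g
        subsetD[OF tens_ker_mono[OF I0(1,1)] prim])
    then have "comult q g \<in> ?K" by simp
    then show "comult q (bs u * g * bs v) \<in> ?K"
      unfolding comult_mult by (intro tens_ker_ideal idl hsp)
  qed
  have "counit x \<in> {0}" if x: "x \<in> ?I" for x
  proof -
    have "scal (counit x) (1 :: ('i, 'k) tens_alg) \<in> {0}"
    proof (rule plin_span_into[OF plin_scal_pfun[OF pfun_counit] pm.subspace_single_0 _ x[unfolded Idl_TV]], clarify)
      fix u g v assume "g \<in> G"
      then show "scal (counit (bs u * g * bs v)) (1 :: ('i, 'k) tens_alg) = 0"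
        by (simp add: counit_mult cou)
    qed
    then have "Poly_Mapping.lookup (scal (counit x) (1 :: ('i, 'k) tens_alg)) 0 = 0" by simp
    then show ?thesis by (simp add: lookup_one)
  qed
  moreover have "antip q g \<in> ?I" if g: "g \<in> G" for g
  proof -
    have "mul_antip (comult q g - tens g 1 - tens 1 g) \<in> I\<^sub>0"
    proof (rule tens_ker_into[OF plin_mul_antip tideal_subspace[OF I0(2)] _ _ prim[OF g]])
      show "mul_antip (tens a b) \<in> I\<^sub>0" if "a \<in> I\<^sub>0" for a b
        unfolding mul_antip_tens using I0(2,3) that by (auto intro!: tideal_right)
      show "mul_antip (tens a b) \<in> I\<^sub>0" if "b \<in> I\<^sub>0" for a b
        unfolding mul_antip_tens using I0(2) that by (auto intro!: tideal_left)
    qed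
    then have "- antip q g - g \<in> I\<^sub>0"
      by (simp add: plin_diff[OF plin_mul_antip] mul_antip_comult mul_antip_tens cou[OF g])
    then have "- antip q g - g \<in> ?I" using I0(1) by blast
    then have "- antip q g - g + g \<in> ?I"
      by (rule tideal_add[OF idl _ Idl_TV_base[OF g]])
    then show ?thesis using tideal_scal[OF idl, of "- antip q g" "-1"] by (simp add: scal_minus)
  qed
  ultimately have "antip q ` ?I \<subseteq> ?I" "counit ` ?I \<subseteq> {0}"
    using antip_Idl[of G, OF hom] by auto
  then have "braided_hopf_ideal q ?I"
    unfolding braided_hopf_ideal_def ideal_TV_iff
    using idl comult braid_tens_sub_subset[OF hsp idl] by (intro conjI equalityI) auto
  then show ?thesis unfolding pre_nichols_ideal_def using deg by auto
qed

end

section \<open>Quotients of the tensor algebra\<close>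

lemma pcls_eq: "pcls I x = cos I x"
  by (simp add: pcls_def TV.coset_A)

lemma carrier_pquot: "carrier (pquot I) = range (cos I)"
  by (simp add: pquot_def TV.quot_carrier)

lemma zero_pquot: "zero (pquot I) = I"
  by (simp add: pquot_def TV.quot_zero)

lemma one_pquot: "one (pquot I) = cos I 1"
  by (simp add: pquot_def TV.quot_one)

lemma add_pquot: "tideal I \<Longrightarrow> add (pquot I) (cos I x) (cos I y) = cos I (x + y)"
  by (simp add: pquot_def TV.quot_add tideal_subspace)

lemma smult_pquot: "tideal I \<Longrightarrow> smult (pquot I) c (cos I x) = cos I (scal c x)"
  by (simp add: pquot_def TV.quot_smult tideal_subspace)

lemma mult_pquot:
  assumes I: "tideal I"
  shows "mult (pquot I) (cos I x) (cos I y) = cos I (x * y)"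
proof -
  have "x' * y' - x * y \<in> I" if "x' - x \<in> I" "y' - y \<in> I" for x x' y y'
  proof -
    have "x' * y' - x * y = (x' - x) * y' + x * (y' - y)" by (simp add: algebra_simps)
    then show ?thesis using that I by (auto intro: tideal_add tideal_left tideal_right)
  qed
  then show ?thesis using TV.quot_mult[OF tideal_subspace[OF I], of x y] by (simp add: pquot_def)
qed

lemma pow_pquot: "tideal I \<Longrightarrow> cos I x [^]\<^bsub>pquot I\<^esub> (n::nat) = cos I (x ^ n)"
proof (induction n)
  case (Suc n)
  then show ?case by (simp add: mult_pquot power_commutes)
qed (simp add: one_pquot)

lemma can_proj_cos: "I \<subseteq> J \<Longrightarrow> pm.subspace I \<Longrightarrow> pm.subspace J \<Longrightarrow> can_proj J (cos I x) = cos J x"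
  unfolding can_proj_def pcls_eq by (rule UN_cos) (auto simp: cos_eq_iff)

lemma ptens_cos:
  assumes "pm.subspace I" "pm.subspace J"
  shows "ptens q I J (cos I x) (cos J y) = cos (tens_ker q I J) (tens x y)"
proof -
  have eq: "cos (tens_ker q I J) (tens x' y') = cos (tens_ker q I J) (tens x y)" if "x' - x \<in> I" "y' - y \<in> J" for x' y'
  proof -
    have "tens x' y' - tens x y = tens (x' - x) y' + tens x (y' - y)"
      by (simp add: tens_diff_left tens_diff_right)
    moreover have "\<dots> \<in> tens_ker q I J"
      by (intro pm.subspace_add[OF tens_ker_subspace] tens_ker_left tens_ker_right that)
    ultimately show ?thesis by (simp add: cos_eq_iff[OF tens_ker_subspace])
  qed
  have "ptens q I J (cos I x) (cos J y) = (\<Union>x'\<in>cos I x. \<Union>y'\<in>cos J y. cos (tens_ker q I J) (tens x' y'))"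
    by (simp add: ptens_def TT.coset_A)
  also have "\<dots> = (\<Union>x'\<in>cos I x. \<Union>y'\<in>cos J y. cos (tens_ker q I J) (tens x y))"
    by (intro SUP_cong refl) (auto simp: in_cos eq)
  also have "\<dots> = cos (tens_ker q I J) (tens x y)"
    using cos_self[OF assms(1), of x] cos_self[OF assms(2), of y] by auto
  finally show ?thesis .
qed

lemma carrier_ptens_sp: "carrier (ptens_sp q I J) = range (cos (tens_ker q I J))"
  by (simp add: ptens_sp_def TT.quot_carrier)

text \<open>When both maps are induced by the identity, so is their tensor product. The inclusions
  of the ideals make the image of a whole coset a singleton, which is what \<open>the_elem\<close>
  requires.\<close>

lemma ptens_map_cos:
  fixes I J I' J' :: "('i::finite, 'k::field) tens_alg set"
  assumes sub: "pm.subspace I" "pm.subspace J" "pm.subspace I'" "pm.subspace J'"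
    and IJ: "I \<subseteq> I'" "J \<subseteq> J'" and f: "\<And>x. f (cos I x) = cos I' x" and g: "\<And>x. g (cos J x) = cos J' x"
  shows "ptens_map q I J I' J' f g (cos (tens_ker q I J) t) = cos (tens_ker q I' J') t"
proof -
  interpret abelian_monoid "ptens_sp q I' J'"
    unfolding ptens_sp_def by (rule TT.quot_abelian_monoid[OF tens_ker_subspace])
  let ?h = "\<lambda>t. \<Oplus>\<^bsub>ptens_sp q I' J'\<^esub>p\<in>Poly_Mapping.keys t. Poly_Mapping.lookup t p \<odot>\<^bsub>ptens_sp q I' J'\<^esub>
       ptens q I' J' (f (pcls I (wd (letters (fst p))))) (g (pcls J (wd (letters (snd p)))))"
  have h: "?h t = cos (tens_ker q I' J') t" for t
  proof -
    have "?h t = (\<Oplus>\<^bsub>ptens_sp q I' J'\<^esub>p\<in>Poly_Mapping.keys t. cos (tens_ker q I' J') (Poly_Mapping.single p (Poly_Mapping.lookup t p)))"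
    proof (rule finsum_cong')
      fix p
      have "tens (wd (letters (fst p))) (wd (letters (snd p))) = (bs p :: ('i, 'k) tens_sq)"
        by (simp add: wd_eq tens_bs)
      then show "Poly_Mapping.lookup t p \<odot>\<^bsub>ptens_sp q I' J'\<^esub> ptens q I' J' (f (pcls I (wd (letters (fst p))))) (g (pcls J (wd (letters (snd p))))) =
          cos (tens_ker q I' J') (Poly_Mapping.single p (Poly_Mapping.lookup t p))"
        by (simp add: pcls_eq f g ptens_cos[OF sub(3,4)] ptens_sp_def TT.quot_smult[OF tens_ker_subspace] scal_single)
    qed (auto simp: carrier_ptens_sp)
    also have "\<dots> = cos (tens_ker q I' J') t"
      unfolding ptens_sp_def by (subst TT.quot_finsum[OF tens_ker_subspace]) (simp_all flip: expand_single)
    finally show ?thesis .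
  qed
  have "?h ` cos (tens_ker q I J) t = {cos (tens_ker q I' J') t}"
    unfolding h using tens_ker_mono[OF IJ, of q]
    by (intro image_cos[OF tens_ker_subspace]) (auto simp: cos_eq_iff[OF tens_ker_subspace])
  then show ?thesis by (simp only: ptens_map_def the_elem_eq)
qed

lemma pcomult_cos:
  assumes "pm.subspace I" "comult q ` I \<subseteq> tens_ker q I I" "plin (comult q)"
  shows "pcomult q I (cos I x) = cos (tens_ker q I I) (comult q x)"
  unfolding pcomult_def TT.coset_A using assms(2)
  by (intro UN_cos[OF assms(1)]) (auto simp: cos_eq_iff[OF tens_ker_subspace] simp flip: plin_diff[OF assms(3)])

lemma pcounit_cos:
  assumes "pm.subspace I" "counit ` I \<subseteq> {0}"
  shows "pcounit (cos I x) = counit x"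
proof -
  have "counit ` cos I x = {counit x}"
  proof (rule image_cos[OF assms(1)])
    fix x' assume "x' - x \<in> I"
    then have "counit (x' - x) = 0" using assms(2) by blast
    then show "counit x' = counit x" by (simp add: counit_def lookup_minus)
  qed
  then show ?thesis by (simp add: pcounit_def)
qed

context diag_braiding
begin

lemma braided_hopf_idealD:
  assumes "braided_hopf_ideal q I"
  shows "tideal I" "pm.subspace I" "comult q ` I \<subseteq> tens_ker q I I" "counit ` I \<subseteq> {0}" "antip q ` I \<subseteq> I"
    "\<And>t. t \<in> tens_ker q I I \<Longrightarrow> braid q t \<in> tens_ker q I I"
proof -
  show I: "tideal I" using assms by (simp add: braided_hopf_ideal_def ideal_TV_iff)
  then show "pm.subspace I" by (rule tideal_subspace)
  show "comult q ` I \<subseteq> tens_ker q I I" "counit ` I \<subseteq> {0}" "antip q ` I \<subseteq> I"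
    using assms by (simp_all add: braided_hopf_ideal_def)
  have br: "braid q ` tens_sub q I UNIV = tens_sub q UNIV I" "braid q ` tens_sub q UNIV I = tens_sub q I UNIV"
    using assms by (auto simp: braided_hopf_ideal_def)
  have sub: "tens_sub q UNIV I \<subseteq> tens_ker q I I" "tens_sub q I UNIV \<subseteq> tens_ker q I I"
    unfolding tens_sub_eq tens_ker_eq by (auto intro!: pm.span_mono)
  fix t assume t: "t \<in> tens_ker q I I"
  show "braid q t \<in> tens_ker q I I"
  proof (rule tens_ker_into[OF plin_braid tens_ker_subspace _ _ t])
    fix a b :: "('i, 'k) tens_alg"
    have "tens a b \<in> tens_sub q I UNIV" if "a \<in> I" using that by (auto simp: tens_sub_eq intro!: pm.span_base)
    then show "braid q (tens a b) \<in> tens_ker q I I" if "a \<in> I" using that br sub by blast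
    have "tens a b \<in> tens_sub q UNIV I" if "b \<in> I" using that by (auto simp: tens_sub_eq intro!: pm.span_base)
    then show "braid q (tens a b) \<in> tens_ker q I I" if "b \<in> I" using that br sub by blast
  qed
qed

lemma pbraid_cos:
  assumes "braided_hopf_ideal q I"
  shows "pbraid q I (cos (tens_ker q I I) t) = cos (tens_ker q I I) (braid q t)"
  unfolding pbraid_def TT.coset_A using braided_hopf_idealD(6)[OF assms]
  by (intro UN_cos[OF tens_ker_subspace]) (auto simp: cos_eq_iff[OF tens_ker_subspace] simp flip: braid_diff)

lemma pantip_cos:
  assumes "braided_hopf_ideal q I"
  shows "pantip q I (cos I x) = cos I (antip q x)"
  unfolding pantip_def pcls_eq using braided_hopf_idealD(2,5)[OF assms]
  by (intro UN_cos) (auto simp: cos_eq_iff simp flip: antip_diff)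

text \<open>All structure maps of a quotient are induced from those of T(V), so the map induced by
  the identity commutes with each of them by evaluation on representatives.\<close>

lemma can_proj_hopf_hom:
  assumes I: "braided_hopf_ideal q I" and J: "braided_hopf_ideal q J" and IJ: "I \<subseteq> J"
  shows "can_proj J \<in> hopf_hom q I J" "can_proj J ` carrier (pquot I) = carrier (pquot J)"
    "can_proj J (pcls I x) = pcls J x"
proof -
  note I' = braided_hopf_idealD[OF I] and J' = braided_hopf_idealD[OF J]
  have pr: "can_proj J (cos I x) = cos J x" for x by (rule can_proj_cos[OF IJ I'(2) J'(2)])
  note pm = ptens_map_cos[OF I'(2,2) J'(2,2) IJ IJ, of "can_proj J" "can_proj J", OF pr pr]
  show "can_proj J (pcls I x) = pcls J x" by (simp add: pcls_eq pr)
  show "can_proj J ` carrier (pquot I) = carrier (pquot J)"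
    by (simp add: carrier_pquot image_image pr)
  have alg: "can_proj J \<in> alg_hom (pquot I) (pquot J)"
    unfolding alg_hom_def ring_hom_def
    by (auto simp: carrier_pquot pr mult_pquot add_pquot smult_pquot one_pquot I'(1) J'(1))
  show "can_proj J \<in> hopf_hom q I J"
    unfolding hopf_hom_def using alg
    by (auto simp: pcomp_def pcls_eq pr carrier_ptens_sp carrier_pquot pbraid_cos[OF I] pbraid_cos[OF J] pm
        pcomult_cos[OF I'(2,3) plin_comult] pcomult_cos[OF J'(2,3) plin_comult]
        pcounit_cos[OF I'(2,4)] pcounit_cos[OF J'(2,4)] pantip_cos[OF I] pantip_cos[OF J])
qed

end

section \<open>Growth of quotients\<close>

definition wprods :: "('i, 'k::field) tens_alg set \<Rightarrow> nat \<Rightarrow> ('i, 'k) tens_alg set" where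
  "wprods S n = {prod_list xs | xs. set xs \<subseteq> S \<and> length xs \<le> n}"

lemma finite_wprods: "finite S \<Longrightarrow> finite (wprods S n)"
proof -
  assume "finite S"
  then have "finite (prod_list ` {xs. set xs \<subseteq> S \<and> length xs \<le> n})"
    by (intro finite_imageI finite_lists_length_le)
  moreover have "wprods S n = prod_list ` {xs. set xs \<subseteq> S \<and> length xs \<le> n}"
    by (auto simp: wprods_def)
  ultimately show ?thesis by simp
qed

lemma word_filtration_cos:
  assumes J: "tideal J"
  shows "word_filtration (pquot J) (cos J ` S) n = cos J ` pm.span (wprods S n)"
proof -
  have fold: "foldr (mult (pquot J)) (map (cos J) ys) \<one>\<^bsub>pquot J\<^esub> = cos J (prod_list ys)" for ys
    by (induction ys) (auto simp: one_pquot mult_pquot[OF J])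
  have "{foldr (mult (pquot J)) xs \<one>\<^bsub>pquot J\<^esub> | xs. set xs \<subseteq> cos J ` S \<and> length xs \<le> n} = cos J ` wprods S n"
  proof (intro equalityI subsetI)
    fix X assume "X \<in> {foldr (mult (pquot J)) xs \<one>\<^bsub>pquot J\<^esub> | xs. set xs \<subseteq> cos J ` S \<and> length xs \<le> n}"
    then obtain xs where xs: "X = foldr (mult (pquot J)) xs \<one>\<^bsub>pquot J\<^esub>" "set xs \<subseteq> cos J ` S" "length xs \<le> n" by blast
    have "xs \<in> lists (cos J ` S)" using xs(2) by auto
    then obtain ys where "xs = map (cos J) ys" "set ys \<subseteq> S" by (auto simp: lists_image)
    then show "X \<in> cos J ` wprods S n" using xs fold by (auto simp: wprods_def)
  next
    fix X assume "X \<in> cos J ` wprods S n"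
    then obtain ys where "X = cos J (prod_list ys)" "set ys \<subseteq> S" "length ys \<le> n" by (auto simp: wprods_def)
    then show "X \<in> {foldr (mult (pquot J)) xs \<one>\<^bsub>pquot J\<^esub> | xs. set xs \<subseteq> cos J ` S \<and> length xs \<le> n}"
      using fold[of ys] image_mono[of "set ys" S "cos J"] by (auto intro!: exI[of _ "map (cos J) ys"])
  qed
  then show ?thesis
    unfolding word_filtration_def pquot_def by (simp add: TV.quot_lspan[OF tideal_subspace[OF J]])
qed

lemma GKdim_ge_limsup:
  assumes "finite S"
  shows "limsup (\<lambda>n. ereal (log (real n) (real (fdim (pquot J) (word_filtration (pquot J) (cos J ` S) n))))) \<le> GKdim (pquot J)"
  unfolding GKdim_def by (rule SUP_upper) (use assms in \<open>auto simp: carrier_pquot\<close>)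

lemma fdim_wprods_ge:
  assumes "tideal J" "finite S" "finite E" "indep_mod J E m" "\<And>e. e \<in> E \<Longrightarrow> m e \<in> pm.span (wprods S n)"
  shows "card E \<le> fdim (pquot J) (word_filtration (pquot J) (cos J ` S) n)"
  unfolding word_filtration_cos[OF assms(1)] unfolding pquot_def
  by (rule TV.fdim_ge[OF tideal_subspace[OF assms(1)] finite_wprods[OF assms(2)] assms(3-5)])

text \<open>For fixed k the word length k(kM + 1) grows linearly in M, while there are M^k
  independent elements. Hence the dimension exceeds every fixed power of the length infinitely
  often, which is enough for a limsup.\<close>

lemma GKdim_infinite:
  assumes J: "tideal J" and S: "finite S"
    and big: "\<And>k M. \<exists>(E :: 'e set) m. finite E \<and> M ^ k \<le> card E \<and> indep_mod J E m \<and>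
      (\<forall>e\<in>E. m e \<in> pm.span (wprods S (k * (k * M + 1))))"
  shows "GKdim (pquot J) = \<infinity>"
proof -
  let ?d = "\<lambda>n. fdim (pquot J) (word_filtration (pquot J) (cos J ` S) n)"
  let ?l = "\<lambda>n. ereal (log (real n) (real (?d n)))"
  have "ereal (real k) \<le> limsup ?l" for k
  proof -
    \<comment> \<open>Once n <= M^2 is known, n^k <= M^(2k) <= M^K; the added 1 keeps K
      positive.\<close>
    define K where "K = 2 * k + 1"
    have frequent: "\<exists>n\<ge>N. ereal (real k) \<le> ?l n" for N
    proof -
      \<comment> \<open>The summands are chosen so that n = K^2 M + K is at most M^2; the summand N
        forces n >= N, and the 2 forces n >= 2.\<close>
      define M where "M = K ^ 2 + K + N + 2"
      define n where "n = K * (K * M + 1)"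
      obtain E :: "'e set" and m where E: "finite E" "M ^ K \<le> card E" "indep_mod J E m"
        "\<And>e. e \<in> E \<Longrightarrow> m e \<in> pm.span (wprods S n)"
        using big[of M K] unfolding n_def by blast
      have "card E \<le> ?d n" by (rule fdim_wprods_ge[OF J S E(1,3,4)])
      then have d: "M ^ K \<le> ?d n" using E(2) by linarith
      have K: "K \<ge> 1" by (simp add: K_def)
      have nM: "n \<le> M ^ 2"
      proof -
        have "n = K ^ 2 * M + K" by (simp add: n_def power2_eq_square algebra_simps)
        also have "\<dots> \<le> K ^ 2 * M + (K + N + 2) * M"
          using K by (intro add_left_mono) (simp add: M_def algebra_simps)
        also have "\<dots> = M ^ 2" by (simp add: M_def power2_eq_square algebra_simps)
        finally show ?thesis .
      qed
      have MK: "M \<le> K * M" using K by simp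
      also have "\<dots> \<le> n" unfolding n_def by (rule mult_left_mono[OF trans_le_add1[OF MK]]) simp
      finally have Mn: "M \<le> n" .
      then have n2: "n \<ge> 2" "n \<ge> N" by (auto simp: M_def)
      have "n ^ k \<le> (M ^ 2) ^ k" by (rule power_mono[OF nM]) simp
      also have "\<dots> = M ^ (2 * k)" by (simp add: power_mult)
      also have "\<dots> \<le> M ^ K" by (rule power_increasing) (auto simp: K_def M_def)
      finally have "real n ^ k \<le> real (?d n)" using d by (metis le_trans of_nat_le_iff of_nat_power)
      moreover have "0 < real n ^ k" using n2 by simp
      ultimately have "log (real n) (real n ^ k) \<le> log (real n) (real (?d n))"
        using n2 by (intro log_mono) auto
      moreover have "log (real n) (real n ^ k) = k"
        using n2 by (simp add: log_nat_power)
      ultimately show ?thesis using n2(2) by auto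
    qed
    show ?thesis
    proof (rule ccontr)
      assume "\<not> ereal (real k) \<le> limsup ?l"
      then have "eventually (\<lambda>n. ?l n < ereal (real k)) sequentially"
        by (intro Limsup_lessD) auto
      then obtain N where "\<And>n. n \<ge> N \<Longrightarrow> ?l n < ereal (real k)" by (auto simp: eventually_sequentially)
      then show False using frequent[of N] by (metis leD)
    qed
  qed
  then have "ereal (real k) \<le> GKdim (pquot J)" for k
    using GKdim_ge_limsup[OF S, of J] by (rule order_trans)
  then have "ereal B \<le> GKdim (pquot J)" for B
    using real_arch_simple[of B] order_trans[of "ereal B" "ereal (real _)"] by (metis ereal_less_eq(3))
  then show ?thesis by (rule ereal_top)
qed

section \<open>Two primitive elements of infinite growth\<close>

definition qnum :: "'k::field \<Rightarrow> nat \<Rightarrow> 'k" where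
  "qnum c n = (\<Sum>j<n. c ^ j)"

lemma qnum_0 [simp]: "qnum c 0 = 0"
  and qnum_Suc: "qnum c (Suc n) = qnum c n + c ^ n"
  by (simp_all add: qnum_def)

text \<open>A nonzero coordinate of the projection of x modulo U, rescaled.\<close>

lemma separating_functional:
  fixes U :: "('b \<Rightarrow>\<^sub>0 'k::field) set"
  assumes "pm.subspace U" "x \<notin> U"
  obtains f where "pfun f" "f x = 1" "\<And>u. u \<in> U \<Longrightarrow> f u = 0"
proof -
  obtain P where P: "plin P" "\<And>x. P x = 0 \<longleftrightarrow> x \<in> U" "\<And>x. P x - x \<in> U"
    by (rule ex_projection[OF assms(1)]) blast
  have "P x \<noteq> 0" using P(2) assms(2) by simp
  then obtain w where w: "Poly_Mapping.lookup (P x) w \<noteq> 0"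
    by (metis lookup_zero poly_mapping_eqI)
  let ?f = "\<lambda>z. Poly_Mapping.lookup (P z) w / Poly_Mapping.lookup (P x) w"
  have "pfun ?f"
    by (simp add: pfun_def plin_add[OF P(1)] plin_scal[OF P(1)] lookup_add add_divide_distrib)
  moreover have "?f u = 0" if "u \<in> U" for u
    using that P(2)[of u] by simp
  ultimately show ?thesis using w that[of ?f] by simp
qed

lemma subspace_scal_cancel:
  assumes "pm.subspace U" "scal c x \<in> U" "c \<noteq> 0"
  shows "x \<in> U"
  using pm.subspace_scale[OF assms(1,2), of "inverse c"] assms(3) by (simp add: scal_scal)

lemma wprods_mult:
  fixes x y :: "('i, 'k::field) tens_alg"
  assumes "x \<in> pm.span (wprods S m)" "y \<in> pm.span (wprods S n)"
  shows "x * y \<in> pm.span (wprods S (m + n))"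
proof (rule plin_span_into[OF plin_mult_right pm.subspace_span _ assms(1)])
  fix x assume "x \<in> wprods S m"
  then obtain xs where xs: "x = prod_list xs" "set xs \<subseteq> S" "length xs \<le> m" by (auto simp: wprods_def)
  show "x * y \<in> pm.span (wprods S (m + n))"
  proof (rule plin_span_into[OF plin_mult_left pm.subspace_span _ assms(2)])
    fix y assume "y \<in> wprods S n"
    then obtain ys where "y = prod_list ys" "set ys \<subseteq> S" "length ys \<le> n" by (auto simp: wprods_def)
    then have "x * y = prod_list (xs @ ys)" "set (xs @ ys) \<subseteq> S" "length (xs @ ys) \<le> m + n" using xs by auto
    then show "x * y \<in> pm.span (wprods S (m + n))" by (auto simp: wprods_def intro!: pm.span_base exI[of _ "xs @ ys"])
  qed
qed

lemma wprods_mono: "m \<le> n \<Longrightarrow> wprods S m \<subseteq> wprods S n"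
  by (auto simp: wprods_def intro: le_trans)

lemma wprods_gen: "x \<in> S \<Longrightarrow> 1 \<le> n \<Longrightarrow> x \<in> pm.span (wprods S n)"
  by (rule pm.span_base) (auto simp: wprods_def intro!: exI[of _ "[x]"])

lemma wprods_one: "1 \<in> pm.span (wprods S n)"
  by (rule pm.span_base) (auto simp: wprods_def intro!: exI[of _ "[]"])

section \<open>Skew derivations attached to two primitive elements\<close>

context diag_braiding
begin

definition primitive :: "('i, 'k) tens_alg \<Rightarrow> bool" where
  "primitive x \<longleftrightarrow> comult q x = tens x 1 + tens 1 x"

end

text \<open>The functionals are dual to a and b on the subalgebra these generate: zero on 1, on the
  other generator and on all products of at least two factors. That subalgebra need not be free, so
  they are assumed here and constructed in \<open>GKdim_infinite_primitive\<close>. Vanishing on J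
  lets the resulting derivations descend.\<close>

locale two_primitives = diag_braiding q for q :: "'i::finite \<Rightarrow> 'i \<Rightarrow> 'k::field" +
  fixes a b :: "('i, 'k) tens_alg" and \<alpha> \<beta> and J and fa fb
  assumes ha: "homogeneous \<alpha> a" and hb: "homogeneous \<beta> b"
    and pa: "primitive a" and pb: "primitive b"
    and J: "tideal J" "comult q ` J \<subseteq> tens_ker q J J" "1 \<notin> J"
    and fa: "pfun fa" "\<And>x. x \<in> J \<Longrightarrow> fa x = 0" "fa 1 = 0" "fa a = 1" "fa b = 0"
      "\<And>xs. set xs \<subseteq> {a, b} \<Longrightarrow> 2 \<le> length xs \<Longrightarrow> fa (prod_list xs) = 0"
    and fb: "pfun fb" "\<And>x. x \<in> J \<Longrightarrow> fb x = 0" "fb 1 = 0" "fb a = 0" "fb b = 1"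
      "\<And>xs. set xs \<subseteq> {a, b} \<Longrightarrow> 2 \<le> length xs \<Longrightarrow> fb (prod_list xs) = 0"
begin

definition Ws where "Ws = {prod_list xs | xs. set xs \<subseteq> {a, b}}"
definition W1 where "W1 = {prod_list xs | xs. xs \<noteq> [] \<and> set xs \<subseteq> {a, b}}"

abbreviation "K \<equiv> pm.span Ws"

lemma Ws_I: "set xs \<subseteq> {a, b} \<Longrightarrow> prod_list xs \<in> Ws"
  and W1_I: "xs \<noteq> [] \<Longrightarrow> set xs \<subseteq> {a, b} \<Longrightarrow> prod_list xs \<in> W1"
  unfolding Ws_def W1_def by blast+

lemma Ws_Cons: "p \<in> {a, b} \<Longrightarrow> x \<in> Ws \<Longrightarrow> p * x \<in> Ws"
  and W1_Cons: "p \<in> {a, b} \<Longrightarrow> x \<in> Ws \<Longrightarrow> p * x \<in> W1"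
proof -
  assume p: "p \<in> {a, b}" and "x \<in> Ws"
  then obtain xs where xs: "x = prod_list xs" "set xs \<subseteq> {a, b}" by (auto simp: Ws_def)
  show "p * x \<in> Ws" using Ws_I[of "p # xs"] p xs by simp
  show "p * x \<in> W1" using W1_I[of "p # xs"] p xs by simp
qed

lemma W1_Ws: "x \<in> W1 \<Longrightarrow> x \<in> Ws"
  unfolding Ws_def W1_def by blast

lemma W1_gen: "p \<in> {a, b} \<Longrightarrow> p \<in> W1"
  using W1_I[of "[p]"] by simp

lemma Ws_induct [consumes 1, case_names one mult]: "x \<in> Ws \<Longrightarrow> P 1 \<Longrightarrow> (\<And>p y. p \<in> {a, b} \<Longrightarrow> y \<in> Ws \<Longrightarrow> P y \<Longrightarrow> P (p * y)) \<Longrightarrow> P x"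
proof -
  assume x: "x \<in> Ws" and 1: "P 1" and step: "\<And>p y. p \<in> {a, b} \<Longrightarrow> y \<in> Ws \<Longrightarrow> P y \<Longrightarrow> P (p * y)"
  have "set xs \<subseteq> {a, b} \<Longrightarrow> P (prod_list xs)" for xs
  proof (induction xs)
    case (Cons p xs)
    then have "prod_list xs \<in> Ws" by (auto simp: Ws_def)
    then show ?case using Cons step[of p "prod_list xs"] by auto
  qed (simp add: 1)
  then show "P x" using x by (auto simp: Ws_def)
qed

lemma f_word2: "p \<in> {a, b} \<Longrightarrow> z \<in> W1 \<Longrightarrow> fa (p * z) = 0" "p \<in> {a, b} \<Longrightarrow> z \<in> W1 \<Longrightarrow> fb (p * z) = 0"
proof -
  assume p: "p \<in> {a, b}" and "z \<in> W1"
  then obtain xs where xs: "z = prod_list xs" "xs \<noteq> []" "set xs \<subseteq> {a, b}" by (auto simp: W1_def)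
  have "2 \<le> length (p # xs)" using xs(2) by (cases xs) auto
  then show "fa (p * z) = 0" "fb (p * z) = 0"
    using fa(6)[of "p # xs"] fb(6)[of "p # xs"] p xs by auto
qed

lemma hom_gen: "p \<in> {a, b} \<Longrightarrow> \<exists>\<gamma>. homogeneous \<gamma> p"
  using ha hb by auto

lemma prim_gen: "p \<in> {a, b} \<Longrightarrow> comult q p = tens p 1 + tens 1 p"
  using pa pb by (auto simp: primitive_def)

lemma hom_word: "x \<in> Ws \<Longrightarrow> \<exists>\<gamma>. homogeneous \<gamma> x"
proof (induction x rule: Ws_induct)
  case one
  show ?case using homogeneous_one by blast
next
  case (mult p y)
  then show ?case using hom_gen homogeneous_mult by blast
qed

text \<open>Contains what Delta(x) has besides x (x) 1: the second slots are nonempty words in a and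
  b. A further letter in that slot gives words of length at least two, which \<open>fa\<close> and
  \<open>fb\<close> kill.\<close>

definition R where "R = pm.span {tens y z | y z. y \<in> Ws \<and> z \<in> W1}"

lemma R_mult:
  assumes p: "p \<in> {a, b}" and r: "r \<in> R"
  shows "tmult q (tens p 1) r \<in> R" "tmult q (tens 1 p) r \<in> R"
proof -
  obtain \<gamma> where \<gamma>: "homogeneous \<gamma> p" using hom_gen[OF p] by blast
  have sub: "pm.subspace R" by (simp add: R_def)
  show "tmult q (tens p 1) r \<in> R"
  proof (rule plin_span_into[OF plin_tmult_right sub _ r[unfolded R_def]], clarify)
    fix y z assume "y \<in> Ws" "z \<in> W1"
    then show "tmult q (tens p 1) (tens y z) \<in> R"
      using Ws_Cons[OF p] by (auto simp: tmult_tens_1 R_def intro!: pm.span_base)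
  qed
  show "tmult q (tens 1 p) r \<in> R"
  proof (rule plin_span_into[OF plin_tmult_right sub _ r[unfolded R_def]], clarify)
    fix y z assume yz: "y \<in> Ws" "z \<in> W1"
    obtain \<delta> where \<delta>: "homogeneous \<delta> y" using hom_word[OF yz(1)] by blast
    have "tens y (p * z) \<in> R"
      unfolding R_def using yz W1_Cons[OF p W1_Ws[OF yz(2)]] by (auto intro!: pm.span_base)
    then show "tmult q (tens 1 p) (tens y z) \<in> R"
      by (simp add: tmult_tens[OF \<gamma> \<delta>] pm.subspace_scale[OF sub])
  qed
qed

lemma comult_word: "x \<in> Ws \<Longrightarrow> comult q x - tens x 1 \<in> R"
proof (induction x rule: Ws_induct)
  case one
  show ?case by (simp add: R_def pm.span_zero)
next
  case (mult p y)
  obtain \<gamma> where \<gamma>: "homogeneous \<gamma> p" using hom_gen[OF mult(1)] by blast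
  obtain \<delta> where \<delta>: "homogeneous \<delta> y" using hom_word[OF mult(2)] by blast
  let ?r = "comult q y - tens y 1"
  have sub: "pm.subspace R" by (simp add: R_def)
  have "comult q (p * y) - tens (p * y) 1 = scal (bichar q \<gamma> \<delta>) (tens y p) + tmult q (tens p 1) ?r + tmult q (tens 1 p) ?r"
    by (simp add: comult_mult prim_gen[OF mult(1)] tmult_add_left tmult_diff_right tmult_tens_1 tmult_tens[OF \<gamma> \<delta>])
  moreover have "tens y p \<in> R"
    unfolding R_def using mult W1_gen by (auto intro!: pm.span_base)
  ultimately show ?case
    by (auto intro!: pm.subspace_add[OF sub] pm.subspace_scale[OF sub] R_mult mult)
qed

definition Da where "Da x = rsl fa (comult q x)"
definition Db where "Db x = rsl fb (comult q x)"

lemma plin_Da: "plin Da" and plin_Db: "plin Db"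
  unfolding Da_def Db_def by (auto intro!: plin_comp[OF plin_rsl plin_comult])

text \<open>In the product of 1 (x) p with Delta(x), only the contribution of x (x) 1 survives the
  slice, since the rest of Delta(x) lies in \<open>R\<close>.\<close>

lemma D_rule:
  assumes f: "pfun f" "\<And>p z. p \<in> {a, b} \<Longrightarrow> z \<in> W1 \<Longrightarrow> f (p * z) = 0"
    and p: "p \<in> {a, b}" "homogeneous \<gamma> p" and x: "x \<in> Ws"
  shows "rsl f (comult q (p * x)) = p * rsl f (comult q x) + scal (f p) (gl q \<gamma> x)"
proof -
  let ?r = "comult q x - tens x 1"
  have 1: "rsl f (tmult q (tens p 1) t) = p * rsl f t" for t
    by (rule plin_eqI_tens[of "\<lambda>t. rsl f (tmult q (tens p 1) t)" "\<lambda>t. p * rsl f t"])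
      (auto intro!: plin_comp[OF plin_rsl plin_tmult_right] plin_comp[OF plin_mult_left plin_rsl] simp: tmult_tens_1 rsl_tens[OF f(1)])
  have "rsl f (tmult q (tens 1 p) ?r) \<in> {0}"
  proof (rule plin_span_into[OF plin_comp[OF plin_rsl plin_tmult_right] pm.subspace_single_0 _ comult_word[OF x, unfolded R_def]], clarify)
    fix y z assume "y \<in> Ws" "z \<in> W1"
    then show "rsl f (tmult q (tens 1 p) (tens y z)) = 0"
      by (simp add: tmult_tens_gl[OF p(2)] rsl_tens[OF f(1)] f(2)[OF p(1)])
  qed
  then have "rsl f (tmult q (tens 1 p) (comult q x)) = rsl f (tmult q (tens 1 p) (tens x 1))"
    by (simp add: tmult_diff_right plin_diff[OF plin_rsl])
  then show ?thesis
    by (simp add: comult_mult prim_gen[OF p(1)] tmult_add_left rsl_add 1 tmult_tens_gl[OF p(2)] rsl_tens[OF f(1)])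
qed

lemma Da_rule: "x \<in> Ws \<Longrightarrow> Da (a * x) = a * Da x + gl q \<alpha> x" "x \<in> Ws \<Longrightarrow> Da (b * x) = b * Da x"
  and Db_rule: "x \<in> Ws \<Longrightarrow> Db (a * x) = a * Db x" "x \<in> Ws \<Longrightarrow> Db (b * x) = b * Db x + gl q \<beta> x"
  using D_rule[OF fa(1) f_word2(1) _ ha] D_rule[OF fa(1) f_word2(1) _ hb]
    D_rule[OF fb(1) f_word2(2) _ ha] D_rule[OF fb(1) f_word2(2) _ hb]
  by (auto simp: Da_def Db_def fa fb)

lemma D_one [simp]: "Da 1 = 0" "Db 1 = 0"
  by (simp_all add: Da_def Db_def rsl_tens fa fb)

lemma Ws_mult: "x \<in> Ws \<Longrightarrow> y \<in> Ws \<Longrightarrow> x * y \<in> Ws"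
proof -
  assume "x \<in> Ws" "y \<in> Ws"
  then obtain xs ys where "x = prod_list xs" "y = prod_list ys" "set xs \<subseteq> {a, b}" "set ys \<subseteq> {a, b}"
    by (auto simp: Ws_def)
  then show ?thesis using Ws_I[of "xs @ ys"] by simp
qed

lemma D_mult_word:
  assumes "y \<in> Ws" "x \<in> Ws"
  shows "Da (x * y) = x * Da y + Da x * gl q \<alpha> y" "Db (x * y) = x * Db y + Db x * gl q \<beta> y"
proof -
  have "Da (x * y) = x * Da y + Da x * gl q \<alpha> y \<and> Db (x * y) = x * Db y + Db x * gl q \<beta> y"
    using assms(2)
  proof (induction x rule: Ws_induct)
    case (mult p x)
    then show ?case using Ws_mult[OF mult(2) assms(1)]
      by (auto simp: Da_rule Db_rule mult.assoc gl_mult distrib_left distrib_right add_ac)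
  qed auto
  then show "Da (x * y) = x * Da y + Da x * gl q \<alpha> y" "Db (x * y) = x * Db y + Db x * gl q \<beta> y" by auto
qed

lemma D_mult:
  assumes x: "x \<in> K" and y: "y \<in> K"
  shows "Da (x * y) = x * Da y + Da x * gl q \<alpha> y" "Db (x * y) = x * Db y + Db x * gl q \<beta> y"
proof -
  have ext: "D (x * y) = x * D y + D x * gl q \<gamma> y"
    if D: "plin D" and w: "\<And>x y. x \<in> Ws \<Longrightarrow> y \<in> Ws \<Longrightarrow> D (x * y) = x * D y + D x * gl q \<gamma> y" for D \<gamma>
  proof -
    have "D (x * y) - (x * D y + D x * gl q \<gamma> y) \<in> {0}"
    proof (rule plin_span_into[OF _ pm.subspace_single_0 _ x, of "\<lambda>x. D (x * y) - (x * D y + D x * gl q \<gamma> y)"])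
      fix x assume xw: "x \<in> Ws"
      show "D (x * y) - (x * D y + D x * gl q \<gamma> y) \<in> {0}"
      proof (rule plin_span_into[OF _ pm.subspace_single_0 _ y, of "\<lambda>y. D (x * y) - (x * D y + D x * gl q \<gamma> y)"])
        show "D (x * y) - (x * D y + D x * gl q \<gamma> y) \<in> {0}" if "y \<in> Ws" for y
          using w[OF xw that] by simp
      qed (intro plin_minus_fun plin_plus plin_comp[OF D] plin_comp[OF plin_mult_left] plin_mult_left plin_gl D)
    qed (intro plin_minus_fun plin_plus plin_comp[OF D plin_mult_right] plin_comp[OF plin_mult_right D] plin_mult_right)
    then show ?thesis by simp
  qed
  show "Da (x * y) = x * Da y + Da x * gl q \<alpha> y" by (rule ext[OF plin_Da D_mult_word(1)])
  show "Db (x * y) = x * Db y + Db x * gl q \<beta> y" by (rule ext[OF plin_Db D_mult_word(2)])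
qed

lemma K_mult: "x \<in> K \<Longrightarrow> y \<in> K \<Longrightarrow> x * y \<in> K"
proof -
  assume x: "x \<in> K" and y: "y \<in> K"
  show ?thesis
  proof (rule plin_span_into[OF plin_mult_right pm.subspace_span _ x])
    fix x assume "x \<in> Ws"
    then show "x * y \<in> K"
      by (intro plin_span_into[OF plin_mult_left pm.subspace_span _ y] pm.span_base[OF Ws_mult])
  qed
qed

lemma K_one: "1 \<in> K" and K_a: "a \<in> K" and K_b: "b \<in> K"
proof -
  have "1 \<in> Ws" by (auto simp: Ws_def intro!: exI[of _ "[]"])
  moreover have "a \<in> Ws" "b \<in> Ws" using W1_Ws W1_gen by auto
  ultimately show "1 \<in> K" "a \<in> K" "b \<in> K" by (auto intro: pm.span_base)
qed

lemma K_power: "x \<in> K \<Longrightarrow> x ^ n \<in> K"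
  by (induction n) (auto intro: K_one K_mult)

lemma K_gl: "x \<in> K \<Longrightarrow> gl q \<gamma> x \<in> K"
proof (erule plin_span_into[OF plin_gl pm.subspace_span, rotated])
  fix x assume x: "x \<in> Ws"
  then obtain \<delta> where "homogeneous \<delta> x" using hom_word by blast
  then show "gl q \<gamma> x \<in> K" using x by (simp add: gl_homogeneous pm.span_scale pm.span_base)
qed

lemma K_Da: "x \<in> K \<Longrightarrow> Da x \<in> K" and K_Db: "x \<in> K \<Longrightarrow> Db x \<in> K"
proof -
  have w: "Da x \<in> K \<and> Db x \<in> K" if "x \<in> Ws" for x
    using that
  proof (induction x rule: Ws_induct)
    case one
    show ?case by (simp add: pm.span_zero)
  next
    case (mult p y)
    then show ?case using K_gl[OF pm.span_base[OF mult(2)]]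
      by (auto simp: Da_rule Db_rule intro!: pm.span_add K_mult K_a K_b)
  qed
  show "x \<in> K \<Longrightarrow> Da x \<in> K" by (erule plin_span_into[OF plin_Da pm.subspace_span, rotated]) (use w in auto)
  show "x \<in> K \<Longrightarrow> Db x \<in> K" by (erule plin_span_into[OF plin_Db pm.subspace_span, rotated]) (use w in auto)
qed

lemma D_gen: "Da a = 1" "Da b = 0" "Db a = 0" "Db b = 1"
proof -
  have "1 \<in> Ws" by (auto simp: Ws_def intro!: exI[of _ "[]"])
  from Da_rule[OF this] Db_rule[OF this] show "Da a = 1" "Da b = 0" "Db a = 0" "Db b = 1" by simp_all
qed

text \<open>The coideal property splits Delta(x) between J (x) T(V) and T(V) (x) J; a functional
  vanishing on J sends the first part into J and the second to zero.\<close>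

lemma D_ideal: "x \<in> J \<Longrightarrow> Da x \<in> J" "x \<in> J \<Longrightarrow> Db x \<in> J"
proof -
  have "rsl f (comult q x) \<in> J" if f: "pfun f" "\<And>x. x \<in> J \<Longrightarrow> f x = 0" and x: "x \<in> J" for f
  proof (rule tens_ker_into[OF plin_rsl tideal_subspace[OF J(1)]])
    show "comult q x \<in> tens_ker q J J" using J(2) x by auto
    show "rsl f (tens a b) \<in> J" if "a \<in> J" for a b
      using that by (simp add: rsl_tens[OF f(1)] tideal_scal[OF J(1)])
    show "rsl f (tens a b) \<in> J" if "b \<in> J" for a b
      using that f(2) by (simp add: rsl_tens[OF f(1)] tideal_zero[OF J(1)])
  qed
  then show "x \<in> J \<Longrightarrow> Da x \<in> J" "x \<in> J \<Longrightarrow> Db x \<in> J"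
    using fa fb by (simp_all add: Da_def Db_def)
qed

lemma Da_iter_ideal: "x \<in> J \<Longrightarrow> (Da ^^ n) x \<in> J"
  by (induction n) (auto intro: D_ideal)

lemma plin_Da_iter: "plin (Da ^^ n)"
  by (induction n) (auto simp: plin_def plin_add[OF plin_Da] plin_scal[OF plin_Da])

section \<open>Iterated braided commutators and their ordered products\<close>

abbreviation "\<chi>aa \<equiv> bichar q \<alpha> \<alpha>"
abbreviation "\<chi>ab \<equiv> bichar q \<alpha> \<beta> * bichar q \<beta> \<alpha>"

text \<open>\<open>y n\<close> is the iterated braided commutator \<open>(ad a)\<^sup>n b\<close>.\<close>

primrec y :: "nat \<Rightarrow> ('i, 'k) tens_alg" where
  "y 0 = b"
| "y (Suc n) = a * y n - scal (bichar q \<alpha> (dmul n \<alpha> + \<beta>)) (y n * a)"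

lemma hom_y: "homogeneous (dmul n \<alpha> + \<beta>) (y n)"
proof (induction n)
  case (Suc n)
  have "homogeneous (\<alpha> + (dmul n \<alpha> + \<beta>)) (a * y n)" by (rule homogeneous_mult[OF ha Suc])
  moreover have "homogeneous ((dmul n \<alpha> + \<beta>) + \<alpha>) (y n * a)" by (rule homogeneous_mult[OF Suc ha])
  ultimately show ?case by (simp add: dmul_Suc add_ac homogeneous_diff homogeneous_scal)
qed (simp add: hb)

lemma K_y: "y n \<in> K"
  by (induction n) (auto intro!: K_b pm.span_diff pm.span_scale K_mult K_a)

text \<open>The bracket coefficient is the scalar by which the twist of \<open>Da\<close> acts on
  \<open>y n\<close>, so the two contributions of the letter a cancel.\<close>

lemma Da_y: "Da (y n) = 0"
  by (induction n) (auto simp: D_gen plin_diff[OF plin_Da] plin_scal[OF plin_Da] D_mult[OF K_a K_y] D_mult[OF K_y K_a]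
    gl_homogeneous[OF hom_y])

definition \<mu> where "\<mu> n = (\<Prod>j<n. 1 - \<chi>aa ^ j * \<chi>ab)"

text \<open>b enters \<open>y n\<close> once, so \<open>Db\<close> leaves a power of a. Each bracket
  contributes a factor 1 - chi(a,a)^j chi(a,b) chi(b,a); this is the origin of the second
  nondegeneracy condition.\<close>

lemma Db_y: "Db (y n) = scal (\<mu> n) (a ^ n)"
proof (induction n)
  case (Suc n)
  have "Db (y (Suc n)) = a * scal (\<mu> n) (a ^ n) - scal (bichar q \<alpha> (dmul n \<alpha> + \<beta>)) (scal (\<mu> n) (a ^ n) * scal (bichar q \<beta> \<alpha>) a)"
    by (simp add: plin_diff[OF plin_Db] plin_scal[OF plin_Db] D_mult[OF K_a K_y] D_mult[OF K_y K_a] D_gen Suc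
        gl_homogeneous[OF ha])
  also have "\<dots> = scal (\<mu> n - bichar q \<alpha> (dmul n \<alpha> + \<beta>) * (bichar q \<beta> \<alpha> * \<mu> n)) (a ^ Suc n)"
    by (simp add: scal_scal power_commutes pm.scale_left_diff_distrib)
  also have "\<mu> n - bichar q \<alpha> (dmul n \<alpha> + \<beta>) * (bichar q \<beta> \<alpha> * \<mu> n) = \<mu> (Suc n)"
    by (simp add: \<mu>_def bichar_add_right bichar_mult_right algebra_simps)
  finally show ?case .
qed (simp add: D_gen \<mu>_def)

lemma Da_power: "Da (a ^ n) = scal (qnum \<chi>aa n) (a ^ (n - 1))"
proof (induction n)
  case (Suc n)
  have "gl q \<alpha> (a ^ n) = scal (\<chi>aa ^ n) (a ^ n)"
    by (simp add: gl_homogeneous[OF homogeneous_power[OF ha]] bichar_mult_right)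
  then have "Da (a ^ Suc n) = scal (qnum \<chi>aa n) (a * a ^ (n - 1)) + scal (\<chi>aa ^ n) (a ^ n)"
    by (simp add: D_mult[OF K_a K_power[OF K_a]] D_gen Suc)
  also have "scal (qnum \<chi>aa n) (a * a ^ (n - 1)) = scal (qnum \<chi>aa n) (a ^ n)"
    by (cases n) auto
  finally show ?case by (simp add: qnum_Suc scal_add)
qed simp

definition qfact where "qfact n = (\<Prod>j\<in>{1..n}. qnum \<chi>aa j)"

lemma Da_iter_power: "(Da ^^ n) (a ^ n) = scal (qfact n) 1"
proof (induction n)
  case (Suc n)
  have "(Da ^^ Suc n) (a ^ Suc n) = (Da ^^ n) (Da (a ^ Suc n))" by (simp add: funpow_swap1)
  also have "\<dots> = scal (qnum \<chi>aa (Suc n)) (scal (qfact n) 1)"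
    by (simp only: Da_power plin_scal[OF plin_Da_iter] diff_Suc_1 Suc)
  finally show ?case by (simp add: qfact_def scal_scal prod.nat_ivl_Suc' mult.commute)
qed (simp add: qfact_def)

lemma Da_iter_power_zero: "n < N \<Longrightarrow> (Da ^^ N) (a ^ n) = 0"
proof (induction N)
  case (Suc N)
  have "(Da ^^ Suc N) (a ^ n) = Da ((Da ^^ N) (a ^ n))" by simp
  also have "\<dots> = 0"
  proof (cases "n = N")
    case True
    then show ?thesis by (simp add: Da_iter_power plin_scal[OF plin_Da])
  next
    case False
    then show ?thesis using Suc by (simp add: plin_zero[OF plin_Da])
  qed
  finally show ?case .
qed simp

lemma Da_iter_K: "x \<in> K \<Longrightarrow> (Da ^^ n) x \<in> K"
  by (induction n) (auto intro: K_Da)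

lemma Da_iter_mult_right:
  assumes "x \<in> K" "z \<in> K" "Da z = 0" "homogeneous \<delta> z" "(Da ^^ n) x = 0"
  shows "(Da ^^ n) (x * z) = 0"
proof -
  have "(Da ^^ n) (x * z) = scal (bichar q \<alpha> \<delta> ^ n) ((Da ^^ n) x * z)"
    by (induction n) (auto simp: plin_scal[OF plin_Da] D_mult[OF Da_iter_K[OF assms(1)] assms(2)] assms(3)
        gl_homogeneous[OF assms(4)] scal_scal mult.commute)
  then show ?thesis using assms(5) by simp
qed

lemma Da_iter_mult_left:
  assumes "x \<in> K" "z \<in> K" "Da z = 0"
  shows "(Da ^^ n) (z * x) = z * (Da ^^ n) x"
  by (induction n) (auto simp: D_mult[OF assms(2) Da_iter_K[OF assms(1)]] assms(3))

text \<open>If all entries are below M, the factor added at list length j has its index in [jM,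
  (j+1)M). Disjoint blocks make the indices increase along the product, and there are M^k lists of
  length k.\<close>

primrec yy :: "nat \<Rightarrow> nat list \<Rightarrow> ('i, 'k) tens_alg" where
  "yy M [] = 1"
| "yy M (m # ms) = yy M ms * y (length ms * M + m)"

lemma K_yy: "yy M ms \<in> K"
  by (induction ms) (auto intro: K_one K_mult K_y)

lemma Da_yy: "Da (yy M ms) = 0"
  by (induction ms) (auto simp: D_mult[OF K_yy K_y] Da_y)

text \<open>
  The indices in \<open>yy M ms\<close> increase strictly, so \<open>Da\<^sup>N \<circ> Db\<close> with \<open>N\<close> the largest index
  strips off the last factor.
\<close>

lemma Da_Db_yy_zero: "set ms \<subseteq> {..<M} \<Longrightarrow> length ms * M \<le> N \<Longrightarrow> (Da ^^ N) (Db (yy M ms)) = 0"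
  and Da_Db_yy: "set ms \<subseteq> {..<M} \<Longrightarrow> length ms * M \<le> N \<Longrightarrow>
    (Da ^^ N) (Db (yy M ms * y n)) = scal (\<mu> n) (yy M ms * (Da ^^ N) (a ^ n))"
proof -
  have zero_imp: "(Da ^^ N) (Db (yy M ms * y n)) = scal (\<mu> n) (yy M ms * (Da ^^ N) (a ^ n))"
    if z: "(Da ^^ N) (Db (yy M ms)) = 0" for ms N n
  proof -
    \<comment> \<open>\<open>Db\<close> reaches either the last factor, leaving a^n, or the earlier
      ones. The latter part dies under Da^N by the assumption \<open>z\<close>, because the extra
      factor \<open>y n\<close> is itself killed by \<open>Da\<close>.\<close>
    have "Db (yy M ms * y n) = scal (\<mu> n) (yy M ms * a ^ n) + scal (bichar q \<beta> (dmul n \<alpha> + \<beta>)) (Db (yy M ms) * y n)"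
      by (simp add: D_mult[OF K_yy K_y] Db_y gl_homogeneous[OF hom_y])
    then show ?thesis
      using Da_iter_mult_right[OF K_Db[OF K_yy] K_y Da_y hom_y z, of n]
      by (simp add: plin_add[OF plin_Da_iter] plin_scal[OF plin_Da_iter]
        Da_iter_mult_left[OF K_power[OF K_a] K_yy Da_yy])
  qed
  show zero: "set ms \<subseteq> {..<M} \<Longrightarrow> length ms * M \<le> N \<Longrightarrow> (Da ^^ N) (Db (yy M ms)) = 0" for N
  proof (induction ms)
    case Nil
    then show ?case by (simp add: plin_zero[OF plin_Da_iter])
  next
    case (Cons m ms)
    then have "(Da ^^ N) (Db (yy M ms)) = 0" by simp
    from zero_imp[OF this] show ?case using Cons.prems by (simp add: Da_iter_power_zero)
  qed
  show "set ms \<subseteq> {..<M} \<Longrightarrow> length ms * M \<le> N \<Longrightarrow>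
    (Da ^^ N) (Db (yy M ms * y n)) = scal (\<mu> n) (yy M ms * (Da ^^ N) (a ^ n))"
    using zero zero_imp by blast
qed

section \<open>Independence of the ordered products\<close>

abbreviation "E (M :: nat) k \<equiv> {ms. set ms \<subseteq> {..<M} \<and> length ms = k}"

lemma finite_E: "finite (E M k)"
  by (rule finite_lists_length_eq) simp

lemma E_Suc: "E M (Suc k) = (\<lambda>(m, ms). m # ms) ` ({..<M} \<times> E M k)"
  by (auto simp: image_iff length_Suc_conv)

context
  assumes nz: "\<And>n. 1 \<le> n \<Longrightarrow> qnum \<chi>aa n \<noteq> 0" "\<And>n. \<chi>aa ^ n * \<chi>ab \<noteq> 1"
begin

lemma \<mu>_nz: "\<mu> n \<noteq> 0"
  unfolding \<mu>_def using nz(2) by (auto simp: eq_commute[of "1::'k"])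

lemma qfact_nz: "qfact n \<noteq> 0"
  unfolding qfact_def using nz(1) by auto

text \<open>The largest index is stripped first: after \<open>Db\<close>, the power Da^N with N = kM
  + m kills a^n for n < N and turns a^N into a nonzero scalar, so only \<open>X m\<close> survives.
  Its term is then subtracted and the argument repeated.\<close>

lemma yy_layers:
  assumes "\<And>m. X m \<in> pm.span (yy M ` E M k)" "(\<Sum>m<M'. X m * y (k * M + m)) \<in> J"
  shows "\<forall>m<M'. X m \<in> J"
  using assms(2)
proof (induction M')
  case (Suc m)
  let ?N = "k * M + m"
  have strip: "(Da ^^ ?N) (Db (X m' * y n)) = scal (\<mu> n) (X m' * (Da ^^ ?N) (a ^ n))" for m' n
  proof -
    have "(Da ^^ ?N) (Db (X m' * y n)) - scal (\<mu> n) (X m' * (Da ^^ ?N) (a ^ n)) \<in> {0}"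
    proof (rule plin_span_into[OF _ pm.subspace_single_0 _ assms(1), of "\<lambda>x. (Da ^^ ?N) (Db (x * y n)) - scal (\<mu> n) (x * (Da ^^ ?N) (a ^ n))"])
      show "plin (\<lambda>x. (Da ^^ ?N) (Db (x * y n)) - scal (\<mu> n) (x * (Da ^^ ?N) (a ^ n)))"
        by (intro plin_minus_fun plin_comp[OF plin_Da_iter] plin_comp[OF plin_Db] plin_mult_right plin_scale)
      show "(Da ^^ ?N) (Db (x * y n)) - scal (\<mu> n) (x * (Da ^^ ?N) (a ^ n)) \<in> {0}" if "x \<in> yy M ` E M k" for x
        using that by (auto simp: Da_Db_yy)
    qed
    then show ?thesis by simp
  qed
  have "(Da ^^ ?N) (Db (\<Sum>m'<Suc m. X m' * y (k * M + m'))) = (\<Sum>m'<Suc m. scal (\<mu> (k * M + m')) (X m' * (Da ^^ ?N) (a ^ (k * M + m'))))"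
    by (simp only: plin_sum[OF plin_Db] plin_sum[OF plin_Da_iter] strip)
  also have "\<dots> = scal (\<mu> ?N * qfact ?N) (X m)"
    by (simp add: Da_iter_power_zero Da_iter_power scal_scal)
  finally have "scal (\<mu> ?N * qfact ?N) (X m) \<in> J"
    using Da_iter_ideal[OF D_ideal(2)[OF Suc.prems], of ?N] by simp
  moreover have "inverse (\<mu> ?N * qfact ?N) * (\<mu> ?N * qfact ?N) = 1"
    by (rule left_inverse) (simp add: \<mu>_nz qfact_nz)
  ultimately have X: "X m \<in> J"
    using tideal_scal[OF J(1), of "scal (\<mu> ?N * qfact ?N) (X m)" "inverse (\<mu> ?N * qfact ?N)"]
    by (simp only: scal_scal scal_one)
  have "(\<Sum>m'<m. X m' * y (k * M + m')) = (\<Sum>m'<Suc m. X m' * y (k * M + m')) - X m * y ?N" by simp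
  also have "\<dots> \<in> J"
    by (rule pm.subspace_diff[OF tideal_subspace[OF J(1)] Suc.prems tideal_right[OF J(1) X]])
  finally show ?case using Suc.IH X by (auto simp: less_Suc_eq)
qed simp

lemma yy_indep: "(\<Sum>ms\<in>E M k. scal (c ms) (yy M ms)) \<in> J \<Longrightarrow> \<forall>ms\<in>E M k. c ms = 0"
proof (induction k arbitrary: c)
  case 0
  have E0: "E M 0 = {[]}" by auto
  from 0 have "scal (c []) 1 \<in> J" unfolding E0 by simp
  then have "c [] = 0" using tideal_scal[OF J(1), of "scal (c []) 1" "inverse (c [])"] J(3)
    by (cases "c [] = 0") (auto simp: scal_scal)
  then show ?case unfolding E0 by simp
next
  case (Suc k)
  define X where "X m = (\<Sum>ms\<in>E M k. scal (c (m # ms)) (yy M ms))" for m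
  have inj: "inj_on (\<lambda>(m, ms). m # ms) ({..<M} \<times> E M k)" by (auto simp: inj_on_def)
  have "(\<Sum>ms\<in>E M (Suc k). scal (c ms) (yy M ms)) = (\<Sum>(m, ms)\<in>{..<M} \<times> E M k. scal (c (m # ms)) (yy M ms * y (k * M + m)))"
    unfolding E_Suc by (subst sum.reindex[OF inj]) (auto intro!: sum.cong)
  also have "\<dots> = (\<Sum>m<M. X m * y (k * M + m))"
    by (simp add: X_def sum_distrib_right flip: sum.cartesian_product)
  finally have "(\<Sum>m<M. X m * y (k * M + m)) \<in> J" using Suc.prems by simp
  then have "\<forall>m<M. X m \<in> J"
    by (rule yy_layers[rotated]) (auto simp: X_def intro!: pm.span_sum pm.span_scale intro: pm.span_base)
  then have "\<forall>ms\<in>E M k. c (m # ms) = 0" if "m < M" for m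
    using that Suc.IH[of "\<lambda>ms. c (m # ms)"] by (simp add: X_def)
  then show ?case unfolding E_Suc by auto
qed

lemma y_wprods: "y n \<in> pm.span (wprods {a, b} (n + 1))"
proof (induction n)
  case (Suc n)
  have "a * y n \<in> pm.span (wprods {a, b} (1 + (n + 1)))" "y n * a \<in> pm.span (wprods {a, b} ((n + 1) + 1))"
    by (rule wprods_mult[OF wprods_gen Suc] wprods_mult[OF Suc wprods_gen]; simp)+
  then show ?case by (auto intro!: pm.span_diff pm.span_scale)
qed (auto intro!: wprods_gen)

lemma yy_wprods: "set ms \<subseteq> {..<M} \<Longrightarrow> length ms \<le> k \<Longrightarrow> yy M ms \<in> pm.span (wprods {a, b} (length ms * (k * M + 1)))"
proof (induction ms)
  case (Cons m ms)
  have "length ms * M + m \<le> k * M"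
  proof -
    have "length ms * M + m \<le> Suc (length ms) * M" using Cons.prems by simp
    also have "\<dots> \<le> k * M" using Cons.prems by (intro mult_right_mono) auto
    finally show ?thesis .
  qed
  then have "y (length ms * M + m) \<in> pm.span (wprods {a, b} (k * M + 1))"
    using y_wprods pm.span_mono[OF wprods_mono] by (metis (no_types, lifting) add_le_mono1 subsetD)
  then have "yy M ms * y (length ms * M + m) \<in> pm.span (wprods {a, b} (length ms * (k * M + 1) + (k * M + 1)))"
    using Cons by (intro wprods_mult) auto
  then show ?case by (simp add: algebra_simps)
qed (simp add: wprods_one)

theorem GKdim_two_primitives: "GKdim (pquot J) = \<infinity>"
proof (rule GKdim_infinite[OF J(1), of "{a, b}"])
  fix k M :: nat
  have "indep_mod J (E M k) (yy M)"
    unfolding indep_mod_def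
  proof (intro allI impI ballI)
    fix F c e assume F: "finite F \<and> F \<subseteq> E M k \<and> (\<Sum>e\<in>F. scal (c e) (yy M e)) \<in> J" and e: "e \<in> F"
    \<comment> \<open>The coefficients on F are padded by zeros to the full index set, the form in
      which \<open>yy_indep\<close> is stated.\<close>
    let ?c = "\<lambda>e. if e \<in> F then c e else 0"
    have "(\<Sum>e\<in>E M k. scal (?c e) (yy M e)) = (\<Sum>e\<in>F. scal (c e) (yy M e))"
      using F finite_E by (intro sum.mono_neutral_cong_right) auto
    then have "(\<Sum>e\<in>E M k. scal (?c e) (yy M e)) \<in> J" using F by (simp only:)
    then have "\<forall>e\<in>E M k. ?c e = 0" by (rule yy_indep)
    then have "?c e = 0" using F e by blast
    then show "c e = 0" using e by simp
  qed
  moreover have "M ^ k \<le> card (E M k)" by (simp add: card_lists_length_eq)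
  moreover have "\<forall>e\<in>E M k. yy M e \<in> pm.span (wprods {a, b} (k * (k * M + 1)))"
    using yy_wprods by auto
  ultimately show "\<exists>(E :: nat list set) m. finite E \<and> M ^ k \<le> card E \<and> indep_mod J E m \<and>
      (\<forall>e\<in>E. m e \<in> pm.span (wprods {a, b} (k * (k * M + 1))))"
    using finite_E by blast
qed simp

end

end

section \<open>Primitive elements in pre-Nichols algebras\<close>

context diag_braiding
begin

lemma coeff1_prj: "coeff1 i x = coeff1 i (prj 1 x)"
  by (induction x rule: pm_induct) (auto simp: prj_bs plin_add[OF plin_prj] plin_scal[OF plin_prj] plin_zero[OF plin_prj]
    lookup_add coeff1_def lookup_single when_def)

text \<open>The ideal lives in degrees at least 2, hence \<open>coeff1 i\<close> vanishes on J;
  together with the coideal property this makes J stable under \<open>pd i\<close>.\<close>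

lemma pre_nicholsD:
  assumes "pre_nichols_ideal q J"
  shows "braided_hopf_ideal q J" "tideal J" "x \<in> J \<Longrightarrow> prj n x \<in> J" "x \<in> J \<Longrightarrow> n < 2 \<Longrightarrow> prj n x = 0" "1 \<notin> J"
    "x \<in> J \<Longrightarrow> pd i x \<in> J"
proof -
  obtain G where G: "G \<subseteq> (\<Union>n\<in>{2..}. TV_comp n)" "J = Idl\<^bsub>TV\<^esub> G"
    using assms by (auto simp: pre_nichols_ideal_def)
  show H: "braided_hopf_ideal q J" using assms by (simp add: pre_nichols_ideal_def)
  note H' = braided_hopf_idealD[OF H]
  show I: "tideal J" by (rule H'(1))
  show "x \<in> J \<Longrightarrow> prj n x \<in> J" using G prj_Idl[of G x n] by blast
  show zero: "prj n x = 0" if x: "x \<in> J" and n: "n < 2" for x n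
  proof -
    have "prj n x \<in> {0}"
    proof (rule plin_span_into[OF plin_prj pm.subspace_single_0 _ x[unfolded G(2) Idl_TV]], clarify)
      fix u g v assume "g \<in> G"
      then obtain m where m: "m \<ge> 2" "g \<in> TV_comp m" using G by auto
      have "bs u * g * bs v \<in> TV_comp (length (letters u) + m + length (letters v))"
        by (intro TV_comp_mult bs_TV_comp m)
      then show "prj n (bs u * g * bs v) = 0" using m n by (simp add: prj_TV_comp)
    qed
    then show ?thesis by simp
  qed
  show "1 \<notin> J" using H'(4) by (auto simp: counit_def lookup_one)
  show "x \<in> J \<Longrightarrow> pd i x \<in> J"
    unfolding pd_def
  proof (rule tens_ker_into[OF plin_rsl tideal_subspace[OF I]])
    show "x \<in> J \<Longrightarrow> comult q x \<in> tens_ker q J J" using H'(3) by auto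
    show "rsl (coeff1 i) (tens a b) \<in> J" if "a \<in> J" for a b
      using that by (simp add: rsl_tens[OF pfun_coeff1] tideal_scal[OF I])
    show "rsl (coeff1 i) (tens a b) \<in> J" if b: "b \<in> J" for a b
    proof -
      have "coeff1 i b = 0" using zero[OF b, of 1] by (subst coeff1_prj) (simp add: pfun_zero[OF pfun_coeff1])
      then show ?thesis by (simp add: rsl_tens[OF pfun_coeff1] tideal_zero[OF I])
    qed
  qed
qed

lemma pd_primitive:
  assumes "primitive w" "w \<in> TV_comp m" "m \<ge> 2"
  shows "pd j w = 0"
proof -
  have "Word [j] \<notin> Poly_Mapping.keys w" using assms(2,3) by (force simp: TV_comp_def)
  then have "coeff1 j w = 0" by (simp add: coeff1_def in_keys_iff)
  moreover have "coeff1 j (1 :: ('i, 'k) tens_alg) = 0"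
    by (simp add: coeff1_def lookup_one zero_word_def)
  ultimately show ?thesis
    using assms(1) by (simp add: pd_def primitive_def rsl_add rsl_tens[OF pfun_coeff1])
qed

lemma primitive_wd: "primitive (wd [i])"
  by (simp add: primitive_def comult_wd)

lemma pd_power: "pd i (wd [i] ^ n) = scal (qnum (q i i) n) (wd [i] ^ (n - 1))"
proof (induction n)
  case (Suc n)
  have "gl q (unitv i) (wd [i] ^ n) = scal (q i i ^ n) (wd [i] ^ n)"
    by (simp add: gl_homogeneous[OF homogeneous_power[OF homogeneous_wd]] bichar_mult_right bichar_unitv)
  then have "pd i (wd [i] ^ Suc n) = scal (qnum (q i i) n) (wd [i] * wd [i] ^ (n - 1)) + scal (q i i ^ n) (wd [i] ^ n)"
    by (simp add: pd_wd_mult Suc)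
  also have "scal (qnum (q i i) n) (wd [i] * wd [i] ^ (n - 1)) = scal (qnum (q i i) n) (wd [i] ^ n)"
    by (cases n) auto
  finally show ?case by (simp add: qnum_Suc scal_add)
qed simp

lemma pd_iter_power: "(pd i ^^ n) (wd [i] ^ n) = scal (\<Prod>j\<in>{1..n}. qnum (q i i) j) 1"
proof (induction n)
  case (Suc n)
  have lin: "plin (pd i ^^ n)" for n
    by (induction n) (auto simp: plin_def pd_add pd_scal)
  have "(pd i ^^ Suc n) (wd [i] ^ Suc n) = (pd i ^^ n) (pd i (wd [i] ^ Suc n))" by (simp add: funpow_swap1)
  also have "\<dots> = scal (qnum (q i i) (Suc n)) (scal (\<Prod>j\<in>{1..n}. qnum (q i i) j) 1)"
    by (simp only: pd_power plin_scal[OF lin] diff_Suc_1 Suc)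
  finally show ?case by (simp add: scal_scal prod.nat_ivl_Suc' mult.commute)
qed simp

text \<open>Compare components of degree m. Products of w with a further factor have larger degree,
  so only a multiple c x_i^m can match w modulo J. Applying \<open>pd i\<close> m times kills w and
  turns x_i^m into a nonzero scalar; as 1 is not in J, c = 0 and w would lie in J. The second claim
  compares components of degree 1.\<close>

lemma primitive_not_in_span:
  assumes J: "pre_nichols_ideal q J" and w: "primitive w" "w \<in> TV_comp m" "m \<ge> 2" "w \<notin> J"
    and qi: "\<And>n. 1 \<le> n \<Longrightarrow> qnum (q i i) n \<noteq> 0"
  shows "w \<notin> pm.span (J \<union> {1, wd [i]} \<union> {prod_list xs | xs. set xs \<subseteq> {wd [i], w} \<and> 2 \<le> length xs})"
    "wd [i] \<notin> pm.span (J \<union> {1, w} \<union> {prod_list xs | xs. set xs \<subseteq> {wd [i], w} \<and> 2 \<le> length xs})"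
proof -
  note J' = pre_nicholsD[OF J] and sub = tideal_subspace[OF pre_nicholsD(2)[OF J]]
  let ?x = "wd [i] :: ('i, 'k) tens_alg"
  have x1: "?x \<in> TV_comp 1" using bs_TV_comp[of "Word [i]"] by (simp add: wd_eq)
  have one: "(1 :: ('i, 'k) tens_alg) \<in> TV_comp 0" using bs_TV_comp[of "0 :: 'i word"] by (simp add: zero_word_def flip: bs_zero)
  \<comment> \<open>The strict bound excludes products with w in degree m, the length bound serves
    degree 1, and the third only carries the induction.\<close>
  have words: "prod_list xs \<in> (\<Union>n\<in>{length xs..}. TV_comp n) \<and> (w \<in> set xs \<and> 2 \<le> length xs \<longrightarrow> prod_list xs \<in> (\<Union>n\<in>{Suc m..}. TV_comp n))
     \<and> (w \<in> set xs \<longrightarrow> prod_list xs \<in> (\<Union>n\<in>{m..}. TV_comp n))"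
    if "set xs \<subseteq> {?x, w}" for xs
    using that
  proof (induction xs)
    case Nil
    then show ?case using one by auto
  next
    case (Cons p xs)
    then have IH: "prod_list xs \<in> (\<Union>n\<in>{length xs..}. TV_comp n)" "w \<in> set xs \<Longrightarrow> prod_list xs \<in> (\<Union>n\<in>{m..}. TV_comp n)" by auto
    from IH(1) obtain n where n: "length xs \<le> n" "prod_list xs \<in> TV_comp n" by auto
    obtain d where d: "p \<in> TV_comp d" "1 \<le> d" "p = w \<Longrightarrow> d = m" using Cons.prems x1 w(2,3)
      by (cases "p = w") auto
    have pr: "prod_list (p # xs) \<in> TV_comp (d + n)" using TV_comp_mult[OF d(1) n(2)] by simp
    have 1: "prod_list (p # xs) \<in> (\<Union>n\<in>{length (p # xs)..}. TV_comp n)" using pr d n by (auto intro!: exI[of _ "d + n"] bexI[of _ "d + n"])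
    have 2: "prod_list (p # xs) \<in> (\<Union>n\<in>{Suc m..}. TV_comp n)" if "w \<in> set xs"
    proof -
      from IH(2)[OF that] obtain n' where "m \<le> n'" "prod_list xs \<in> TV_comp n'" by auto
      then show ?thesis using TV_comp_mult[OF d(1), of "prod_list xs" n'] d(2) by (auto intro!: bexI[of _ "d + n'"])
    qed
    have 3: "prod_list (p # xs) \<in> TV_comp (m + n)" if "p = w" using pr d(3)[OF that] by simp
    have 4: "1 \<le> n" if "1 \<le> length xs" using that n(1) by linarith
    show ?case
    proof (intro conjI impI)
      assume "w \<in> set (p # xs) \<and> 2 \<le> length (p # xs)"
      then show "prod_list (p # xs) \<in> (\<Union>n\<in>{Suc m..}. TV_comp n)"
        using 2 3 4 by (cases "w \<in> set xs") (auto intro!: bexI[of _ "m + n"])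
    next
      assume "w \<in> set (p # xs)"
      then show "prod_list (p # xs) \<in> (\<Union>n\<in>{m..}. TV_comp n)"
        using 2 3 by (cases "w \<in> set xs") (force, auto intro!: bexI[of _ "m + n"])
    qed (rule 1)
  qed
  show "wd [i] \<notin> pm.span (J \<union> {1, w} \<union> {prod_list xs | xs. set xs \<subseteq> {?x, w} \<and> 2 \<le> length xs})"
  proof
    assume "wd [i] \<in> pm.span (J \<union> {1, w} \<union> {prod_list xs | xs. set xs \<subseteq> {?x, w} \<and> 2 \<le> length xs})"
    then have "prj 1 ?x \<in> {0}"
    proof (rule plin_span_into[OF plin_prj pm.subspace_single_0, rotated])
      fix z assume z: "z \<in> J \<union> {1, w} \<union> {prod_list xs | xs. set xs \<subseteq> {?x, w} \<and> 2 \<le> length xs}"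
      have "prj 1 z = 0" if "set xs \<subseteq> {?x, w}" "2 \<le> length xs" "z = prod_list xs" for xs
        using words[OF that(1)] that(2,3) by (auto simp: prj_TV_comp)
      then show "prj 1 z \<in> {0}" using z J'(4)[of z 1] prj_TV_comp[OF one, of 1] prj_TV_comp[OF w(2), of 1] w(3) by auto
    qed
    then have "?x = 0" using prj_TV_comp[OF x1, of 1] by simp
    then have "Poly_Mapping.lookup ?x (Word [i]) = 0" by simp
    then show False by (simp add: wd_eq)
  qed
  show "w \<notin> pm.span (J \<union> {1, wd [i]} \<union> {prod_list xs | xs. set xs \<subseteq> {?x, w} \<and> 2 \<le> length xs})"
  proof
    let ?U = "{z. \<exists>c. z - scal c (?x ^ m) \<in> J}"
    have U: "pm.subspace ?U"
      unfolding pm.subspace_def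
    proof (intro conjI ballI allI)
      show "0 \<in> ?U" using pm.subspace_0[OF sub] by (auto intro!: exI[of _ 0])
      fix z z' assume z: "z \<in> ?U" "z' \<in> ?U"
      then obtain c c' where "z - scal c (?x ^ m) \<in> J" "z' - scal c' (?x ^ m) \<in> J" by auto
      from pm.subspace_add[OF sub this] have "z + z' - scal (c + c') (?x ^ m) \<in> J"
        by (simp add: scal_add algebra_simps)
      then show "z + z' \<in> ?U" by blast
    next
      fix z d assume "z \<in> ?U"
      then obtain c where "z - scal c (?x ^ m) \<in> J" by auto
      from pm.subspace_scale[OF sub this, of d] have "scal d z - scal (d * c) (?x ^ m) \<in> J"
        by (simp add: scal_diff scal_scal)
      then show "scal d z \<in> ?U" by blast
    qed
    assume "w \<in> pm.span (J \<union> {1, wd [i]} \<union> {prod_list xs | xs. set xs \<subseteq> {?x, w} \<and> 2 \<le> length xs})"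
    then have "prj m w \<in> ?U"
    proof (rule plin_span_into[OF plin_prj U, rotated])
      fix z assume z: "z \<in> J \<union> {1, wd [i]} \<union> {prod_list xs | xs. set xs \<subseteq> {?x, w} \<and> 2 \<le> length xs}"
      have inU: "z' \<in> ?U" if "z' \<in> J" for z' using that by (auto intro!: exI[of _ 0])
      have "prj m z \<in> ?U" if xs: "set xs \<subseteq> {?x, w}" "2 \<le> length xs" "z = prod_list xs" for xs
      proof (cases "w \<in> set xs")
        case True
        then obtain n where "Suc m \<le> n" "z \<in> TV_comp n" using words[OF xs(1)] xs(2,3) by auto
        then have "prj m z = 0" by (simp add: prj_TV_comp)
        then show ?thesis using inU[OF pm.subspace_0[OF sub]] by (simp only:)
      next
        case False
        then have "z = ?x ^ length xs" using xs(1,3)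
          by (metis (no_types, lifting) insertE prod_list_replicate replicate_length_same singletonD subsetD)
        moreover have pw: "?x ^ n \<in> TV_comp n" for n
          by (induction n) (use one TV_comp_mult[OF x1] in auto)
        ultimately have z: "prj m z = (if m = length xs then ?x ^ m else 0)"
          using prj_TV_comp[OF pw[of "length xs"], of m] by auto
        show ?thesis
        proof (cases "m = length xs")
          case True
          then have "prj m z - scal 1 (?x ^ m) \<in> J" using z pm.subspace_0[OF sub] by simp
          then show ?thesis by blast
        next
          case False
          then show ?thesis using z inU[OF pm.subspace_0[OF sub]] by (simp only: if_False)
        qed
      qed
      moreover have "prj m ?x = 0" "prj m (1 :: ('i, 'k) tens_alg) = 0"
        using prj_TV_comp[OF x1, of m] prj_TV_comp[OF one, of m] w(3) by auto
      ultimately show "prj m z \<in> ?U" using z J'(3)[of z m] inU[of "prj m z"] inU[OF pm.subspace_0[OF sub]] by auto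
    qed
    then obtain c where c: "w - scal c (?x ^ m) \<in> J" using prj_TV_comp[OF w(2), of m] by auto
    have lin: "plin (pd i ^^ n)" for n by (induction n) (auto simp: plin_def pd_add pd_scal)
    have Jn: "x \<in> J \<Longrightarrow> (pd i ^^ n) x \<in> J" for x n by (induction n) (auto intro: J'(6))
    have "(pd i ^^ m) w = 0"
    proof -
      obtain m' where "m = Suc m'" using w(3) by (cases m) auto
      then show ?thesis by (simp add: funpow_swap1 pd_primitive[OF w(1-3)] plin_zero[OF lin] del: funpow.simps(2)) (simp add: funpow_Suc_right pd_primitive[OF w(1-3)] plin_zero[OF lin] del: funpow.simps(2))
    qed
    then have "scal (- (c * (\<Prod>j\<in>{1..m}. qnum (q i i) j))) 1 \<in> J"
      using Jn[OF c, of m] by (simp add: plin_diff[OF lin] plin_scal[OF lin] pd_iter_power scal_scal scal_minus)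
    then have "c * (\<Prod>j\<in>{1..m}. qnum (q i i) j) = 0"
      using subspace_scal_cancel[OF sub] J'(5) by (metis neg_equal_0_iff_equal)
    then have "c = 0" using qi by auto
    then show False using c w(4) by simp
  qed
qed

text \<open>
  Contrapositively, in finite growth a primitive \<open>w\<close> satisfying the conditions below lies in \<open>J\<close>.
\<close>

lemma GKdim_infinite_primitive:
  assumes J: "pre_nichols_ideal q J" and w: "primitive w" "w \<in> TV_comp m" "m \<ge> 2" "w \<notin> J" "homogeneous \<gamma> w"
    and qi: "\<And>n. 1 \<le> n \<Longrightarrow> qnum (q i i) n \<noteq> 0"
    and cond: "(\<forall>n. q i i ^ n * (bichar q (unitv i) \<gamma> * bichar q \<gamma> (unitv i)) \<noteq> 1) \<or>
      (\<forall>n\<ge>1. qnum (bichar q \<gamma> \<gamma>) n \<noteq> 0) \<and> (\<forall>n. bichar q \<gamma> \<gamma> ^ n * (bichar q \<gamma> (unitv i) * bichar q (unitv i) \<gamma>) \<noteq> 1)"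
  shows "GKdim (pquot J) = \<infinity>"
proof -
  let ?x = "wd [i] :: ('i, 'k) tens_alg"
  note J' = pre_nicholsD[OF J] and H = braided_hopf_idealD[OF pre_nicholsD(1)[OF J]]
  note ni = primitive_not_in_span[OF J w(1-4) qi]
  obtain fw where fw: "pfun fw" "fw w = 1" "\<And>u. u \<in> pm.span (J \<union> {1, ?x} \<union> {prod_list xs | xs. set xs \<subseteq> {?x, w} \<and> 2 \<le> length xs}) \<Longrightarrow> fw u = 0"
    by (rule separating_functional[OF pm.subspace_span ni(1)]) blast+
  obtain fx where fx: "pfun fx" "fx ?x = 1" "\<And>u. u \<in> pm.span (J \<union> {1, w} \<union> {prod_list xs | xs. set xs \<subseteq> {?x, w} \<and> 2 \<le> length xs}) \<Longrightarrow> fx u = 0"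
    by (rule separating_functional[OF pm.subspace_span ni(2)]) blast+
  have fw0: "fw u = 0" if "u \<in> J \<union> {1, ?x} \<union> {prod_list xs | xs. set xs \<subseteq> {?x, w} \<and> 2 \<le> length xs}" for u
    using fw(3) pm.span_base[OF that] by blast
  have fx0: "fx u = 0" if "u \<in> J \<union> {1, w} \<union> {prod_list xs | xs. set xs \<subseteq> {?x, w} \<and> 2 \<le> length xs}" for u
    using fx(3) pm.span_base[OF that] by blast
  have fw2: "fw (prod_list xs) = 0" "fx (prod_list xs) = 0" if "set xs \<subseteq> {?x, w}" "2 \<le> length xs" for xs
    by (rule fw0 fx0; use that in blast)+
  have swap: "set xs \<subseteq> {w, ?x} \<longleftrightarrow> set xs \<subseteq> {?x, w}" for xs by auto
  from cond show ?thesis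
  proof
    assume c: "\<forall>n. q i i ^ n * (bichar q (unitv i) \<gamma> * bichar q \<gamma> (unitv i)) \<noteq> 1"
    interpret two_primitives q ?x w "unitv i" \<gamma> J fx fw
      by unfold_locales (use homogeneous_wd w primitive_wd J' H fw(1,2) fx(1,2) fw0 fx0 fw2 in auto)
    show ?thesis
      using c qi by (intro GKdim_two_primitives) (auto simp: bichar_unitv)
  next
    assume c: "(\<forall>n\<ge>1. qnum (bichar q \<gamma> \<gamma>) n \<noteq> 0) \<and> (\<forall>n. bichar q \<gamma> \<gamma> ^ n * (bichar q \<gamma> (unitv i) * bichar q (unitv i) \<gamma>) \<noteq> 1)"
    \<comment> \<open>Roles exchanged: here w is the element that acts and x_i the one acted
      upon.\<close>
    interpret two_primitives q w ?x \<gamma> "unitv i" J fw fx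
      by unfold_locales (use homogeneous_wd w primitive_wd J' H fw(1,2) fx(1,2) fw0 fx0 fw2 swap in auto)
    show ?thesis
      using c by (intro GKdim_two_primitives) auto
  qed
qed

end

section \<open>Straightening relations\<close>

text \<open>Scalars enter as an operation on a ring type, so that the rewrite rules of rings apply
  to the noncommutative products.\<close>

locale k_algebra =
  fixes sc :: "'k::field \<Rightarrow> 'r::ring \<Rightarrow> 'r"
  assumes sc_add: "sc c (x + y) = sc c x + sc c y"
    and sc_left_add: "sc (c + c') x = sc c x + sc c' x"
    and sc_sc: "sc c (sc c' x) = sc (c * c') x"
    and sc_one: "sc 1 x = x"
    and sc_mult_left: "sc c x * y = sc c (x * y)"
    and sc_mult_right: "x * sc c y = sc c (x * y)"
begin

lemma sc_zero [simp]: "sc c 0 = 0" "sc 0 x = 0"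
  using sc_add[of c 0 0] sc_left_add[of 0 0 x] by auto

lemma sc_minus: "sc c (- x) = - sc c x" "sc (- c) x = - sc c x"
  using sc_add[of c x "- x"] sc_left_add[of c "- c" x] by (auto simp: eq_neg_iff_add_eq_0 add.commute)

lemma sc_diff: "sc c (x - y) = sc c x - sc c y" "sc (c - c') x = sc c x - sc c' x"
  using sc_add[of c x "- y"] sc_left_add[of c "- c'" x] by (auto simp: sc_minus)

lemma sc_cancel: "sc c x = 0 \<Longrightarrow> c \<noteq> 0 \<Longrightarrow> x = 0"
  using sc_sc[of "inverse c" c x] by (simp add: sc_one)

lemmas sc_simps = sc_add sc_minus sc_diff sc_sc sc_one sc_mult_left sc_mult_right
  left_diff_distrib right_diff_distrib distrib_left distrib_right

lemma sc_inj: "sc c x = sc c y \<Longrightarrow> c \<noteq> 0 \<Longrightarrow> x = y"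
  using sc_cancel[of c "x - y"] by (simp add: sc_diff)

lemma ext_rule: "(x :: 'r) * y = z \<Longrightarrow> x * (y * w) = z * w"
  by (simp flip: mult.assoc)

end

text \<open>a, e, g are x_1, x_2, x_3, and b, f, c, d are x_12, x_23, x_123, x_1223.
  \<open>egg\<close> is x_332 = 0 rescaled so that x_2 x_3^2 leads; k is q_12 q_32, and its equation
  encodes r q_23 q_32 = 1.\<close>

locale D21_algebra = k_algebra sc for sc :: "'k::field \<Rightarrow> 'r::ring \<Rightarrow> 'r" +
  fixes a e g b f c d :: 'r and q r q12 q13 q23 k :: 'k
  assumes nz: "q \<noteq> 0" "r \<noteq> 0" "q12 \<noteq> 0" "q13 \<noteq> 0" "q23 \<noteq> 0" "1 + q \<noteq> 0" "1 + r \<noteq> 0" and k: "r * q23 * k = q12"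
    and ee: "e * e = 0" and ag: "a * g = sc q13 (g * a)"
    and aae: "a * (a * e) = sc (q12 * (1 + q)) (a * (e * a)) - sc (q * q12 * q12) (e * (a * a))"
    and egg: "e * (g * g) = sc (q23 * (1 + r)) (g * (e * g)) - sc (r * q23 * q23) (g * (g * e))"
    and b: "b = a * e - sc q12 (e * a)" and f: "f = e * g - sc q23 (g * e)"
    and c: "c = a * f - sc (q12 * q13) (f * a)" and d: "d = c * e + sc k (e * c)"
begin

lemmas ees = ee ext_rule[OF ee] and ags = ag ext_rule[OF ag]

lemma ae: "a * e = b + sc q12 (e * a)" and eg: "e * g = f + sc q23 (g * e)" and af: "a * f = c + sc (q12 * q13) (f * a)"
  and ce: "c * e = d - sc k (e * c)"
  by (simp_all add: b f c d)

lemma ab: "a * b = sc (q * q12) (b * a)"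
  by (simp add: b sc_simps aae mult.assoc) (simp add: distrib_left sc_left_add mult_ac)

lemma ef: "e * f = - sc q23 (f * e)"
  by (simp add: f sc_simps ees mult.assoc)

lemma be: "b * e = - sc q12 (e * b)"
  by (simp add: b sc_simps ees mult.assoc)

lemma fg: "f * g = sc (r * q23) (g * f)"
  by (simp add: f sc_simps egg mult.assoc) (simp add: distrib_left sc_left_add mult_ac)

text \<open>Multiplying \<open>egg\<close> by e on either side and using e^2 = 0 gives two relations
  among e g e g, g e g e and e g g e; they annihilate the expansion of (1 + r) f^2.\<close>

lemma ff: "f * f = 0"
proof (rule sc_cancel[OF _ nz(7)])
  let ?m = "e * (g * (g * e))"
  have "sc q23 (sc (1 + r) (e * (g * (e * g)))) = sc q23 (sc (r * q23) ?m)"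
    using arg_cong[OF egg, of "\<lambda>z. e * z"] by (simp add: sc_simps ees mult_ac)
  then have 1: "sc (1 + r) (e * (g * (e * g))) = sc (r * q23) ?m"
    by (rule sc_inj[OF _ nz(5)])
  have 2: "?m = sc (q23 * (1 + r)) (g * (e * (g * e)))"
    using arg_cong[OF egg, of "\<lambda>z. z * e"] by (simp add: sc_simps ees mult.assoc)
  have "sc (1 + r) (f * f) = sc (1 + r) (e * (g * (e * g))) - sc (1 + r) (sc q23 ?m) + sc q23 (sc (q23 * (1 + r)) (g * (e * (g * e))))"
    by (simp add: f sc_simps ees mult.assoc) (simp add: mult_ac)
  also have "\<dots> = sc (r * q23) ?m - sc ((1 + r) * q23) ?m + sc q23 ?m"
    unfolding 1 2[symmetric] by (simp add: sc_sc)
  also have "\<dots> = 0"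
    by (simp add: algebra_simps sc_left_add)
  finally show "sc (1 + r) (f * f) = 0" .
qed

text \<open>The mirror image of \<open>ff\<close>, with \<open>aae\<close> in place of
  \<open>egg\<close>.\<close>

lemma bb: "b * b = 0"
proof (rule sc_cancel[OF _ nz(6)])
  let ?m = "e * (a * (a * e))"
  have 2: "?m = sc (q12 * (1 + q)) (e * (a * (e * a)))"
    using arg_cong[OF aae, of "\<lambda>z. e * z"] by (simp add: sc_simps ees mult_ac)
  have "sc q12 (sc (1 + q) (a * (e * (a * e)))) = sc q12 (sc (q * q12) ?m)"
    using arg_cong[OF aae, of "\<lambda>z. z * e"] by (simp add: sc_simps ees mult.assoc) (simp add: mult_ac)
  then have 1: "sc (1 + q) (a * (e * (a * e))) = sc (q * q12) ?m"
    by (rule sc_inj[OF _ nz(3)])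
  have "sc (1 + q) (b * b) = sc (1 + q) (a * (e * (a * e))) - sc (1 + q) (sc q12 ?m) + sc q12 (sc (q12 * (1 + q)) (e * (a * (e * a))))"
    by (simp add: b sc_simps ees mult.assoc) (simp add: mult_ac)
  also have "\<dots> = sc (q * q12) ?m - sc ((1 + q) * q12) ?m + sc q12 ?m"
    unfolding 1 2[symmetric] by (simp add: sc_sc)
  also have "\<dots> = 0"
    by (simp add: algebra_simps sc_left_add)
  finally show "sc (1 + q) (b * b) = 0" .
qed

text \<open>x_1 and x_3 commute up to a scalar, so the two bracketings of x_123 agree. This form
  yields the relations of c with a and b, the defining one those with f and g.\<close>

lemma c_alt: "c = b * g - sc (q13 * q23) (g * b)"
  unfolding c f b by (simp add: sc_simps ags mult.assoc) (simp add: ags sc_simps mult_ac)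

lemma ac: "a * c = sc (q * q12 * q13) (c * a)"
  unfolding c_alt by (simp add: sc_simps ags ab ext_rule[OF ab] mult.assoc) (simp add: ags sc_simps mult_ac)

lemma cf: "c * f = - sc (q12 * q13) (f * c)"
  by (simp add: c sc_simps ff ext_rule[OF ff] mult.assoc)

lemma bc: "b * c = - sc (q13 * q23) (c * b)"
  by (simp add: c_alt sc_simps bb ext_rule[OF bb] mult.assoc)

text \<open>Expand one factor as the bracket of a and f and move the other through by
  \<open>ac\<close> and \<open>cf\<close>: c^2 returns multiplied by -q, and 1 + q is
  nonzero.\<close>

lemma cc: "c * c = 0"
proof (rule sc_cancel)
  let ?p = "q12 * q13"
  have fc: "sc ?p (f * c) = - (c * f)" by (simp add: cf)
  have ac': "a * c = sc (q * ?p) (c * a)" by (simp add: ac mult.assoc)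
  have "sc ?p (c * c) = a * sc ?p (f * c) - sc ?p (sc ?p (f * (a * c)))"
    by (subst (1) c) (simp add: sc_simps mult.assoc)
  also have "sc ?p (f * (a * c)) = sc (q * ?p) (sc ?p (f * c) * a)"
    unfolding ac' by (simp add: sc_simps mult_ac)
  also have "a * sc ?p (f * c) = - sc (q * ?p) (c * a) * f"
    unfolding fc by (simp add: ac' flip: mult.assoc)
  also have "- sc (q * ?p) (c * a) * f - sc ?p (sc (q * ?p) (sc ?p (f * c) * a)) = - sc (q * ?p) (c * (a * f - sc ?p (f * a)))"
    unfolding fc by (simp add: sc_simps mult_ac)
  finally have "sc ?p (c * c) = - sc (q * ?p) (c * c)"
    unfolding c[symmetric] .
  then show "sc (?p * (1 + q)) (c * c) = 0"
    by (simp add: distrib_left sc_left_add mult_ac)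
qed (use nz in auto)

lemma cd: "c * d = sc k (d * c)"
  by (simp add: d sc_simps cc ext_rule[OF cc] mult.assoc)

lemma de: "d * e = sc k (e * d)"
  by (simp add: d sc_simps ees mult.assoc)

lemma bd: "b * d = sc (q12 * q13 * q23) (d * b)"
  unfolding d by (simp add: sc_simps be ext_rule[OF be] bc ext_rule[OF bc] mult.assoc)
    (simp add: be ext_rule[OF be] bc ext_rule[OF bc] sc_simps mult_ac)

text \<open>The correction c b comes from a e = b + q_12 e a inside d; it is why
  \<open>pi_ad_pow\<close> carries a second term.\<close>

lemma ad: "a * d = sc (q * q12 * q12 * q13) (d * a) + sc (q * q12 * q13 - k * q13 * q23) (c * b)"
  unfolding d by (simp add: sc_simps ac ext_rule[OF ac] ae ext_rule[OF ae] bc ext_rule[OF bc] mult.assoc)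
    (simp add: ac ext_rule[OF ac] ae ext_rule[OF ae] bc ext_rule[OF bc] sc_simps mult_ac)

lemma df: "d * f = sc (q12 * q13 * q23) (f * d)"
  unfolding d by (simp add: sc_simps ef ext_rule[OF ef] cf ext_rule[OF cf] mult.assoc)
    (simp add: ef ext_rule[OF ef] cf ext_rule[OF cf] sc_simps mult_ac)

lemma cg: "c * g = sc (q13 * q23 * r) (g * c)"
  unfolding c by (simp add: sc_simps fg ext_rule[OF fg] ags mult.assoc)
    (simp add: fg ext_rule[OF fg] ags sc_simps mult_ac)

text \<open>The terms c f and f c, produced when e crosses g, cancel by \<open>cf\<close>; the value
  of k is what makes the coefficients match.\<close>

lemma dg: "d * g = sc (q13 * q23 * (q23 * r)) (g * d)"
proof -
  have k': "k * (q13 * (q23 * r)) = q12 * q13"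
    using k by (simp add: mult_ac)
  have "d * g = c * f + sc (q13 * (q23 * (q23 * r))) (g * (c * e)) + sc (k * (q13 * (q23 * r))) (e * (g * c))"
    unfolding d by (simp add: sc_simps eg cg ext_rule[OF cg] mult.assoc) (simp add: mult_ac)
  also have "sc (k * (q13 * (q23 * r))) (e * (g * c)) = sc (q12 * q13) (f * c) + sc q23 (sc (q12 * q13) (g * (e * c)))"
    unfolding k' by (simp add: ext_rule[OF eg] sc_simps mult.assoc mult.commute)
  also have "sc (q12 * q13) (f * c) = - (c * f)"
    by (simp add: cf)
  also have "sc (q12 * q13) (g * (e * c)) = sc (q13 * (q23 * r)) (g * sc k (e * c))"
    by (simp add: sc_simps k'[symmetric] mult_ac)
  finally show ?thesis
    by (simp add: d sc_simps mult.assoc) (simp add: mult_ac)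
qed

end

section \<open>A type containing every quotient of the tensor algebra\<close>

text \<open>
  The product of the algebras \<open>T(V)/J\<close> over all ideals \<open>J\<close> is a single type, so that computations in
  any quotient can be carried out in a ring type; \<open>qpi J\<close> embeds \<open>T(V)/J\<close> as a factor.
\<close>

definition uq_rel :: "(('i, 'k::field) tens_alg set \<Rightarrow> ('i, 'k) tens_alg) \<Rightarrow> (('i, 'k) tens_alg set \<Rightarrow> ('i, 'k) tens_alg) \<Rightarrow> bool" where
  "uq_rel x y \<longleftrightarrow> (\<forall>J. tideal J \<longrightarrow> x J - y J \<in> J)"

lemma tideal_diff: "tideal J \<Longrightarrow> x \<in> J \<Longrightarrow> y \<in> J \<Longrightarrow> x - y \<in> J"
  using pm.subspace_diff[OF tideal_subspace] .

lemma tideal_minus_cancel: "tideal J \<Longrightarrow> x - y \<in> J \<Longrightarrow> y - z \<in> J \<Longrightarrow> x - z \<in> J"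
  using tideal_add[of J "x - y" "y - z"] by simp

lemma tideal_minus_sym: "tideal J \<Longrightarrow> x - y \<in> J \<Longrightarrow> y - x \<in> J"
  using pm.subspace_neg[OF tideal_subspace, of J "x - y"] by simp

quotient_type (overloaded) ('i, 'k) uq = "('i, 'k::field) tens_alg set \<Rightarrow> ('i, 'k) tens_alg" / uq_rel
proof (rule equivpI)
  show "reflp uq_rel" by (rule reflpI) (simp add: uq_rel_def tideal_zero)
  show "symp uq_rel" by (rule sympI) (auto simp: uq_rel_def intro: tideal_minus_sym)
  show "transp uq_rel" by (rule transpI) (auto simp: uq_rel_def intro: tideal_minus_cancel)
qed

instantiation uq :: (type, field) ring
begin

lift_definition zero_uq :: "('a, 'b) uq" is "\<lambda>_. 0" .

lift_definition plus_uq :: "('a, 'b) uq \<Rightarrow> ('a, 'b) uq \<Rightarrow> ('a, 'b) uq" is "\<lambda>x y J. x J + y J"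
  unfolding uq_rel_def by (metis add_diff_add tideal_add)

lift_definition uminus_uq :: "('a, 'b) uq \<Rightarrow> ('a, 'b) uq" is "\<lambda>x J. - x J"
  unfolding uq_rel_def using tideal_minus_sym by fastforce

lift_definition minus_uq :: "('a, 'b) uq \<Rightarrow> ('a, 'b) uq \<Rightarrow> ('a, 'b) uq" is "\<lambda>x y J. x J - y J"
proof -
  fix x x' y y' :: "('a, 'b) tens_alg set \<Rightarrow> ('a, 'b) tens_alg"
  assume "uq_rel x x'" "uq_rel y y'"
  moreover have "x J - y J - (x' J - y' J) = (x J - x' J) - (y J - y' J)" for J by simp
  ultimately show "uq_rel (\<lambda>J. x J - y J) (\<lambda>J. x' J - y' J)"
    unfolding uq_rel_def by (metis tideal_diff)
qed

lift_definition times_uq :: "('a, 'b) uq \<Rightarrow> ('a, 'b) uq \<Rightarrow> ('a, 'b) uq" is "\<lambda>x y J. x J * y J"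
proof -
  fix x x' y y' :: "('a, 'b) tens_alg set \<Rightarrow> ('a, 'b) tens_alg"
  assume xy: "uq_rel x x'" "uq_rel y y'"
  have eq: "x J * y J - x' J * y' J = (x J - x' J) * y J + x' J * (y J - y' J)" for J by (simp add: algebra_simps)
  show "uq_rel (\<lambda>J. x J * y J) (\<lambda>J. x' J * y' J)"
    unfolding uq_rel_def eq
  proof (intro allI impI)
    fix J :: "('a, 'b) tens_alg set" assume J: "tideal J"
    have "x J - x' J \<in> J" "y J - y' J \<in> J" using xy J by (auto simp: uq_rel_def)
    from tideal_right[OF J this(1)] tideal_left[OF J this(2)]
    show "(x J - x' J) * y J + x' J * (y J - y' J) \<in> J" by (rule tideal_add[OF J])
  qed
qed

instance
  by standard (transfer; simp add: uq_rel_def tideal_zero algebra_simps)+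

end

lift_definition scuq :: "'k::field \<Rightarrow> ('i, 'k) uq \<Rightarrow> ('i, 'k) uq" is "\<lambda>c x J. scal c (x J)"
  unfolding uq_rel_def by (metis scal_diff tideal_scal)

text \<open>x placed in the factor at J, with zero elsewhere. Sums and products are respected, but
  \<open>qpi J 1\<close> is an identity only on the image of \<open>qpi J\<close>; powers are
  therefore formed in T(V) before \<open>qpi J\<close> is applied.\<close>

definition qpi :: "('i, 'k::field) tens_alg set \<Rightarrow> ('i, 'k) tens_alg \<Rightarrow> ('i, 'k) uq" where
  "qpi J x = abs_uq (\<lambda>J'. if J' = J then x else 0)"

interpretation uq: k_algebra scuq
  by standard (transfer; simp add: uq_rel_def tideal_zero scal_add scal_scal)+

lemma qpi_eq_iff: "tideal J \<Longrightarrow> qpi J x = qpi J y \<longleftrightarrow> x - y \<in> J"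
  by (auto simp: qpi_def uq.abs_eq_iff uq_rel_def tideal_zero)

lemma qpi_add: "qpi J (x + y) = qpi J x + qpi J y"
  and qpi_diff: "qpi J (x - y) = qpi J x - qpi J y"
  and qpi_mult: "qpi J (x * y) = qpi J x * qpi J y"
  and qpi_scal: "qpi J (scal z x) = scuq z (qpi J x)"
  and qpi_zero: "qpi J 0 = 0"
  by (auto simp: qpi_def plus_uq.abs_eq minus_uq.abs_eq times_uq.abs_eq scuq.abs_eq
    zero_uq_def uq.abs_eq_iff uq_rel_def tideal_zero)

section \<open>The type \<open>D(2,1;\<alpha>)\<close>: the defining ideal\<close>

declare xw.simps [simp del]

lemma three_cases: "(i :: 3) = 1 \<or> i = 2 \<or> i = 3"
proof (cases i)
  case (of_int z)
  then have "z = 0 \<or> z = 1 \<or> z = 2" by auto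
  then show ?thesis using of_int by auto
qed

locale D21 = diag_braiding Q for Q :: "3 \<Rightarrow> 3 \<Rightarrow> 'k::field_char_0" +
  fixes q r s :: 'k and L :: nat
  assumes q1: "q \<noteq> 0" "q \<noteq> 1" and r1: "r \<noteq> 0" "r \<noteq> 1" and s1: "s \<noteq> 0" "s \<noteq> 1"
    and qrs: "q * r * s = 1"
    and L: "L > 0" "s ^ L = 1" "\<And>m. 0 < m \<Longrightarrow> m < L \<Longrightarrow> s ^ m \<noteq> 1"
    and qn: "\<And>m. m > 0 \<Longrightarrow> q ^ m \<noteq> 1" and rn: "\<And>m. m > 0 \<Longrightarrow> r ^ m \<noteq> 1"
    and Q11: "Q 1 1 = q" and Q12: "Q 1 2 * Q 2 1 = inverse q"
    and Q22: "Q 2 2 = -1" and Q23: "Q 2 3 * Q 3 2 = inverse r"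
    and Q33: "Q 3 3 = r" and Q13: "Q 1 3 * Q 3 1 = 1"
begin

abbreviation "I \<equiv> D21_ideal Q"
abbreviation xa :: "(3, 'k) tens_alg" where "xa \<equiv> wd [1]"
abbreviation xe :: "(3, 'k) tens_alg" where "xe \<equiv> wd [2]"
abbreviation xg :: "(3, 'k) tens_alg" where "xg \<equiv> wd [3]"
abbreviation "xb \<equiv> xw Q [1, 2]"
abbreviation "xf \<equiv> xw Q [2, 3]"
abbreviation "xc \<equiv> xw Q [1, 2, 3]"
abbreviation "xd \<equiv> x1223 Q"

abbreviation \<alpha>1 :: "3 \<Rightarrow> int" where "\<alpha>1 \<equiv> unitv 1"
abbreviation \<alpha>2 :: "3 \<Rightarrow> int" where "\<alpha>2 \<equiv> unitv 2"
abbreviation \<alpha>3 :: "3 \<Rightarrow> int" where "\<alpha>3 \<equiv> unitv 3"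

lemmas bc = bichar_add_left bichar_add_right bichar_unitv

lemma hom_gens: "homogeneous \<alpha>1 xa" "homogeneous \<alpha>2 xe" "homogeneous \<alpha>3 xg"
  by (rule homogeneous_wd)+

lemma xb_eq: "xb = xa * xe - scal (Q 1 2) (xe * xa)"
  and xf_eq: "xf = xe * xg - scal (Q 2 3) (xg * xe)"
  and x13_eq: "xw Q [1, 3] = xa * xg - scal (Q 1 3) (xg * xa)"
  and x32_eq: "xw Q [3, 2] = xg * xe - scal (Q 3 2) (xe * xg)"
  by (simp_all add: xw.simps cbracket_homogeneous[OF homogeneous_wd homogeneous_wd] bichar_unitv)

lemma hom_b: "homogeneous (\<alpha>1 + \<alpha>2) xb"
  unfolding xb_eq using homogeneous_mult[OF hom_gens(1,2)] homogeneous_mult[OF hom_gens(2,1)]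
  by (simp add: add.commute homogeneous_diff homogeneous_scal)

lemma hom_f: "homogeneous (\<alpha>2 + \<alpha>3) xf"
  unfolding xf_eq using homogeneous_mult[OF hom_gens(2,3)] homogeneous_mult[OF hom_gens(3,2)]
  by (simp add: add.commute homogeneous_diff homogeneous_scal)

lemma hom_13: "homogeneous (\<alpha>1 + \<alpha>3) (xw Q [1, 3])"
  unfolding x13_eq using homogeneous_mult[OF hom_gens(1,3)] homogeneous_mult[OF hom_gens(3,1)]
  by (simp add: add.commute homogeneous_diff homogeneous_scal)

lemma hom_32: "homogeneous (\<alpha>3 + \<alpha>2) (xw Q [3, 2])"
  unfolding x32_eq using homogeneous_mult[OF hom_gens(2,3)] homogeneous_mult[OF hom_gens(3,2)]
  by (simp add: add.commute homogeneous_diff homogeneous_scal)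

lemma x112_eq: "xw Q [1, 1, 2] = xa * xb - scal (q * Q 1 2) (xb * xa)"
  and xc_eq: "xc = xa * xf - scal (Q 1 2 * Q 1 3) (xf * xa)"
  and x332_eq: "xw Q [3, 3, 2] = xg * xw Q [3, 2] - scal (r * Q 3 2) (xw Q [3, 2] * xg)"
  using cbracket_homogeneous[OF hom_gens(1) hom_b, of Q] cbracket_homogeneous[OF hom_gens(1) hom_f, of Q]
    cbracket_homogeneous[OF hom_gens(3) hom_32, of Q]
  by (simp_all add: xw.simps(3)[of Q _ _ "_ # _"] xw.simps(2) bc Q11 Q33)

lemma hom_c: "homogeneous (\<alpha>1 + \<alpha>2 + \<alpha>3) xc"
  unfolding xc_eq using homogeneous_mult[OF hom_gens(1) hom_f] homogeneous_mult[OF hom_f hom_gens(1)]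
  by (simp add: add_ac homogeneous_diff homogeneous_scal)

lemma hom_112: "homogeneous (\<alpha>1 + \<alpha>1 + \<alpha>2) (xw Q [1, 1, 2])"
  unfolding x112_eq using homogeneous_mult[OF hom_gens(1) hom_b] homogeneous_mult[OF hom_b hom_gens(1)]
  by (simp add: add_ac homogeneous_diff homogeneous_scal)

lemma hom_332: "homogeneous (\<alpha>3 + \<alpha>3 + \<alpha>2) (xw Q [3, 3, 2])"
  unfolding x332_eq using homogeneous_mult[OF hom_gens(3) hom_32] homogeneous_mult[OF hom_32 hom_gens(3)]
  by (simp add: add_ac homogeneous_diff homogeneous_scal)

definition \<delta> where "\<delta> = \<alpha>1 + \<alpha>2 + \<alpha>3 + \<alpha>2"

text \<open>The bracket has coefficient q_12 q_22 q_32, and q_22 = -1 turns the difference into a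
  sum.\<close>

lemma xd_eq: "xd = xc * xe + scal (Q 1 2 * Q 3 2) (xe * xc)"
  unfolding x1223_def using cbracket_homogeneous[OF hom_c hom_gens(2), of Q]
  by (simp add: xw.simps(2) bc Q22 scal_minus)

lemma hom_d: "homogeneous \<delta> xd"
  unfolding xd_eq \<delta>_def using homogeneous_mult[OF hom_c hom_gens(2)] homogeneous_mult[OF hom_gens(2) hom_c]
  by (simp add: add_ac homogeneous_add homogeneous_scal)

lemma comult_ab_form:
  assumes "primitive x" "homogeneous \<beta> x" "primitive y" "homogeneous \<gamma> y"
  shows "comult Q (x * y) = tens (x * y) 1 + tens x y + scal (bichar Q \<beta> \<gamma>) (tens y x) + tens 1 (x * y)"
  using assms
  by (simp add: primitive_def comult_mult tmult_add_left tmult_add_right tmult_tens_1 tmult_tens[OF assms(2,4)]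
      tmult_tens[OF assms(2) homogeneous_one] algebra_simps)

text \<open>Of the two cross terms, y (x) x cancels and x (x) y keeps a factor. The factor vanishes
  for x_13, and in the Serre relations it is the term to be compensated.\<close>

lemma bracket_comult:
  assumes "primitive x" "homogeneous \<beta> x" "primitive y" "homogeneous \<gamma> y"
  shows "comult Q (x * y - scal (bichar Q \<beta> \<gamma>) (y * x)) = tens (x * y - scal (bichar Q \<beta> \<gamma>) (y * x)) 1
    + scal (1 - bichar Q \<beta> \<gamma> * bichar Q \<gamma> \<beta>) (tens x y) + tens 1 (x * y - scal (bichar Q \<beta> \<gamma>) (y * x))"
  by (simp add: comult_diff comult_scal comult_ab_form[OF assms] comult_ab_form[OF assms(3,4,1,2)] tens_diff_left
      tens_diff_right tens_scal_left tens_scal_right scal_add scal_scal pm.scale_left_diff_distrib)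

lemma prim_13: "primitive (xw Q [1, 3])"
  using bracket_comult[OF primitive_wd homogeneous_wd primitive_wd homogeneous_wd, of 1 3] Q13
  by (simp add: primitive_def x13_eq bichar_unitv)

lemma prim_22: "primitive (xe ^ 2)"
  using comult_ab_form[OF primitive_wd homogeneous_wd primitive_wd homogeneous_wd, of 2 2] Q22
  by (simp add: primitive_def power2_eq_square bichar_unitv scal_minus)

text \<open>The quantum Serre relation of a Cartan pair with Cartan integer \<open>-1\<close>.\<close>

lemma serre_primitive:
  assumes x: "primitive x" "homogeneous \<beta> x" and y: "primitive y" "homogeneous \<gamma> y"
    and cartan: "bichar Q \<beta> \<beta> * (bichar Q \<beta> \<gamma> * bichar Q \<gamma> \<beta>) = 1"
  defines "z \<equiv> x * y - scal (bichar Q \<beta> \<gamma>) (y * x)"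
  shows "primitive (x * z - scal (bichar Q \<beta> \<beta> * bichar Q \<beta> \<gamma>) (z * x))"
proof -
  let ?B = "bichar Q \<beta> \<gamma>" and ?C = "bichar Q \<gamma> \<beta>" and ?A = "bichar Q \<beta> \<beta>"
  have hz: "homogeneous (\<beta> + \<gamma>) z"
    unfolding z_def using homogeneous_mult[OF x(2) y(2)] homogeneous_mult[OF y(2) x(2)]
    by (simp add: add.commute homogeneous_diff homogeneous_scal)
  have cz: "comult Q z = tens z 1 + scal (1 - ?B * ?C) (tens x y) + tens 1 z"
    unfolding z_def by (rule bracket_comult[OF x y])
  have cx: "comult Q x = tens x 1 + tens 1 x" using x(1) by (simp add: primitive_def)
  have xz: "comult Q (x * z) = tens (x * z) 1 + scal (1 - ?B * ?C) (tens (x * x) y) + tens x z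
      + scal (?A * ?B) (tens z x) + scal ((1 - ?B * ?C) * ?A) (tens x (x * y)) + tens 1 (x * z)"
    by (simp add: comult_mult cx cz tmult_add_left tmult_add_right tmult_scal_right tmult_tens_1
        tmult_tens[OF x(2) hz] tmult_tens[OF x(2) x(2)] tmult_tens[OF x(2) homogeneous_one] bichar_add_right scal_add scal_scal mult_ac)
  have zx: "comult Q (z * x) = tens (z * x) 1 + tens z x + scal ((1 - ?B * ?C) * ?C) (tens (x * x) y)
      + scal (1 - ?B * ?C) (tens x (y * x)) + scal (?A * ?C) (tens x z) + tens 1 (z * x)"
    by (simp add: comult_mult cx cz tmult_add_left tmult_add_right tmult_scal_left tmult_tens_1
        tmult_tens[OF hz x(2)] tmult_tens[OF y(2) x(2)] tmult_tens[OF y(2) homogeneous_one] tmult_tens[OF hz homogeneous_one]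
        bichar_add_left scal_add scal_scal mult_ac)
  \<comment> \<open>The Cartan condition A B C = 1, turned into the cancellation of the terms x^2
    (x) y (\<open>k1\<close>) and x (x) z (\<open>k2\<close>, \<open>k3\<close>).\<close>
  have "A * B * ((1 - B * C) * C) = A * (B * C) * (1 - B * C)" "A * B * (A * C) = A * (B * C) * A"
    "1 - A + (1 - B * C) * A = 1 - A * (B * C)" for A B C :: 'k
    by (simp_all add: algebra_simps)
  from this[of ?A ?B ?C] cartan have k1: "?A * ?B * ((1 - ?B * ?C) * ?C) = 1 - ?B * ?C"
    and k2: "?A * ?B * (?A * ?C) = ?A" and k3: "1 - ?A + (1 - ?B * ?C) * ?A = 0"
    by simp_all
  have "comult Q (x * z - scal (?A * ?B) (z * x)) - tens (x * z - scal (?A * ?B) (z * x)) 1 - tens 1 (x * z - scal (?A * ?B) (z * x))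
     = (tens x z - scal (?A * ?B * (?A * ?C)) (tens x z)) + scal ((1 - ?B * ?C) * ?A) (tens x (x * y))
        - scal (?A * ?B * (1 - ?B * ?C)) (tens x (y * x))
        + (scal (1 - ?B * ?C) (tens (x * x) y) - scal (?A * ?B * ((1 - ?B * ?C) * ?C)) (tens (x * x) y))"
    by (simp add: comult_diff comult_scal xz zx tens_diff_left tens_diff_right tens_scal_left tens_scal_right scal_add scal_scal)
  also have "\<dots> = (tens x z - scal ?A (tens x z)) + scal ((1 - ?B * ?C) * ?A) (tens x z)"
    unfolding k1 k2 by (simp add: z_def tens_diff_right tens_scal_right scal_diff scal_scal mult_ac)
  also have "\<dots> = scal (1 - ?A + (1 - ?B * ?C) * ?A) (tens x z)"
    by (simp add: scal_add pm.scale_left_diff_distrib)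
  also note k3
  finally show ?thesis by (simp add: primitive_def algebra_simps)
qed

lemma prim_112: "primitive (xw Q [1, 1, 2])"
  using serre_primitive[OF primitive_wd homogeneous_wd primitive_wd homogeneous_wd, of 1 2] Q12 q1
  by (simp add: x112_eq bichar_unitv xb_eq Q11)

lemma prim_332: "primitive (xw Q [3, 3, 2])"
  using serre_primitive[OF primitive_wd homogeneous_wd primitive_wd homogeneous_wd, of 3 2] Q23 r1
  by (simp add: x332_eq bichar_unitv x32_eq Q33 mult.commute)

lemma I_eq: "I = Idl\<^bsub>TV\<^esub> {xe ^ 2, xw Q [1, 3], xw Q [1, 1, 2], xw Q [3, 3, 2]}"
  by (simp add: D21_ideal_def xw.simps(2))

lemma wd1_TV_comp: "wd [i] \<in> TV_comp 1"
  using bs_TV_comp[of "Word [i]"] by (simp add: wd_eq)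

lemma bracket_TV_comp:
  fixes x y :: "(3, 'k) tens_alg"
  shows "x \<in> TV_comp m \<Longrightarrow> y \<in> TV_comp n \<Longrightarrow> x * y - scal t (y * x) \<in> TV_comp (m + n)"
  using TV_comp_mult[of x m y n] TV_comp_mult[of y n x m]
  by (simp add: pm.subspace_diff[OF TV_comp_subspace] pm.subspace_scale[OF TV_comp_subspace] add.commute)

lemma comp_gens: "xe ^ 2 \<in> TV_comp 2" "xw Q [1, 3] \<in> TV_comp 2" "xw Q [1, 1, 2] \<in> TV_comp 3" "xw Q [3, 3, 2] \<in> TV_comp 3"
proof -
  have 2: "xb \<in> TV_comp 2" "xw Q [3, 2] \<in> TV_comp 2" "xw Q [1, 3] \<in> TV_comp 2"
    unfolding xb_eq x32_eq x13_eq using bracket_TV_comp[OF wd1_TV_comp wd1_TV_comp] by (simp_all add: numeral_2_eq_2)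
  show "xw Q [1, 3] \<in> TV_comp 2" by (rule 2)
  show "xe ^ 2 \<in> TV_comp 2" using TV_comp_mult[OF wd1_TV_comp wd1_TV_comp, of 2 2] by (simp add: power2_eq_square numeral_2_eq_2)
  show "xw Q [1, 1, 2] \<in> TV_comp 3" "xw Q [3, 3, 2] \<in> TV_comp 3"
    unfolding x112_eq x332_eq using bracket_TV_comp[OF wd1_TV_comp 2(1)] bracket_TV_comp[OF wd1_TV_comp 2(2)] by (simp_all add: numeral_3_eq_3)
qed

lemma hom_22: "homogeneous (\<alpha>2 + \<alpha>2) (xe ^ 2)"
  using homogeneous_mult[OF hom_gens(2,2)] by (simp add: power2_eq_square)

lemma hom_gens_I: "y \<in> {xe ^ 2, xw Q [1, 3], xw Q [1, 1, 2], xw Q [3, 3, 2]} \<Longrightarrow> \<exists>\<beta>. homogeneous \<beta> y"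
  using hom_22 hom_13 hom_112 hom_332 by blast

lemma tideal_I: "tideal I" unfolding I_eq by (rule tideal_Idl)

lemma I_gens: "xe ^ 2 \<in> I" "xw Q [1, 3] \<in> I" "xw Q [1, 1, 2] \<in> I" "xw Q [3, 3, 2] \<in> I"
  unfolding I_eq by (intro Idl_TV_base; simp)+

text \<open>All four relations are primitive in T(V) itself, so the smaller ideal required by
  \<open>pre_nichols_Idl\<close> can be zero.\<close>

lemma pre_nichols_I: "pre_nichols_ideal Q I"
  unfolding I_eq
proof (rule pre_nichols_Idl[of _ "{0}"])
  show "{xe ^ 2, xw Q [1, 3], xw Q [1, 1, 2], xw Q [3, 3, 2]} \<subseteq> (\<Union>n\<in>{2..}. TV_comp n)"
    using comp_gens by force
  fix y assume y: "y \<in> {xe ^ 2, xw Q [1, 3], xw Q [1, 1, 2], xw Q [3, 3, 2]}"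
  then show "\<exists>\<beta>. homogeneous \<beta> y" by (rule hom_gens_I)
  have "primitive y" using y prim_22 prim_13 prim_112 prim_332 by blast
  then show "comult Q y - tens y 1 - tens 1 y \<in> tens_ker Q {0} {0}"
    by (simp add: primitive_def pm.subspace_0[OF tens_ker_subspace])
qed (auto simp: tideal_zero[OF tideal_Idl], simp add: tideal_def)

lemma qnum_nonroot:
  assumes "\<And>m. m > 0 \<Longrightarrow> z ^ m \<noteq> (1::'k)" "1 \<le> n"
  shows "qnum z n \<noteq> 0"
proof -
  have "(z - 1) * qnum z n = z ^ n - 1"
    by (induction n) (auto simp: qnum_Suc algebra_simps)
  then show ?thesis using assms(1)[of n] assms(2) by auto
qed

lemma q_pow_ne: "0 < m \<Longrightarrow> q ^ n * q ^ m \<noteq> 1" and r_pow_ne: "0 < m \<Longrightarrow> r ^ n * r ^ m \<noteq> 1"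
  using qn[of "n + m"] rn[of "n + m"] by (simp_all add: power_add)

text \<open>Each relation forms a nondegenerate pair with some x_i. When x_1 acts, x_13 and x_112
  give the values q^(n+2) and q^(n+3); when x_3 acts, x_332 gives r^(n+3). None of these is ever
  1.\<close>

lemma I_least:
  assumes J: "pre_nichols_ideal Q J" and fin: "GKdim (pquot J) < \<infinity>"
  shows "I \<subseteq> J"
proof -
  have inf: "w \<in> J" if "primitive w" "w \<in> TV_comp m" "m \<ge> 2" "homogeneous \<gamma> w"
    "\<And>n. 1 \<le> n \<Longrightarrow> qnum (Q i i) n \<noteq> 0"
    "(\<forall>n. Q i i ^ n * (bichar Q (unitv i) \<gamma> * bichar Q \<gamma> (unitv i)) \<noteq> 1) \<or>
      (\<forall>n\<ge>1. qnum (bichar Q \<gamma> \<gamma>) n \<noteq> 0) \<and> (\<forall>n. bichar Q \<gamma> \<gamma> ^ n * (bichar Q \<gamma> (unitv i) * bichar Q (unitv i) \<gamma>) \<noteq> 1)"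
    for w m \<gamma> i
    using GKdim_infinite_primitive[OF J that(1-3) _ that(4-6)] fin by auto
  have qq: "qnum (Q 1 1) n \<noteq> 0" "qnum (Q 3 3) n \<noteq> 0" if "1 \<le> n" for n
    using qnum_nonroot[OF qn that] qnum_nonroot[OF rn that] by (auto simp: Q11 Q33)
  have 22: "xe ^ 2 \<in> J"
  proof (rule inf[OF prim_22 comp_gens(1) _ hom_22 qq(1)])
    \<comment> \<open>x_1 cannot act on x_2^2, since q^n q^-2 equals 1 at n = 2; the second
      alternative is the one that holds.\<close>
    have c1: "bichar Q (\<alpha>2 + \<alpha>2) (\<alpha>2 + \<alpha>2) = 1" unfolding bc by (simp add: Q22)
    have "bichar Q (\<alpha>2 + \<alpha>2) \<alpha>1 * bichar Q \<alpha>1 (\<alpha>2 + \<alpha>2) = (Q 1 2 * Q 2 1) * (Q 1 2 * Q 2 1)"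
      unfolding bc by (simp add: mult_ac)
    also have "\<dots> = inverse (q ^ 2)" by (simp add: Q12 power2_eq_square)
    also have "\<dots> \<noteq> 1" using qn[of 2] by simp
    finally show "(\<forall>n. Q 1 1 ^ n * (bichar Q \<alpha>1 (\<alpha>2 + \<alpha>2) * bichar Q (\<alpha>2 + \<alpha>2) \<alpha>1) \<noteq> 1) \<or>
      (\<forall>n\<ge>1. qnum (bichar Q (\<alpha>2 + \<alpha>2) (\<alpha>2 + \<alpha>2)) n \<noteq> 0) \<and> (\<forall>n. bichar Q (\<alpha>2 + \<alpha>2) (\<alpha>2 + \<alpha>2) ^ n * (bichar Q (\<alpha>2 + \<alpha>2) \<alpha>1 * bichar Q \<alpha>1 (\<alpha>2 + \<alpha>2)) \<noteq> 1)"
      unfolding c1 by (simp add: qnum_def)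
  qed simp_all
  have "Q 1 1 ^ n * (bichar Q \<alpha>1 (\<alpha>1 + \<alpha>3) * bichar Q (\<alpha>1 + \<alpha>3) \<alpha>1) \<noteq> 1" for n
  proof -
    have "bichar Q \<alpha>1 (\<alpha>1 + \<alpha>3) * bichar Q (\<alpha>1 + \<alpha>3) \<alpha>1 = q ^ 2 * (Q 1 3 * Q 3 1)"
      unfolding bc by (simp add: Q11 power2_eq_square mult_ac)
    then show ?thesis using q_pow_ne[of 2 n] by (simp add: Q13 Q11)
  qed
  then have 13: "xw Q [1, 3] \<in> J"
    by (intro inf[OF prim_13 comp_gens(2) _ hom_13 qq(1)]) simp_all
  have "Q 1 1 ^ n * (bichar Q \<alpha>1 (\<alpha>1 + \<alpha>1 + \<alpha>2) * bichar Q (\<alpha>1 + \<alpha>1 + \<alpha>2) \<alpha>1) \<noteq> 1" for n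
  proof -
    have "bichar Q \<alpha>1 (\<alpha>1 + \<alpha>1 + \<alpha>2) * bichar Q (\<alpha>1 + \<alpha>1 + \<alpha>2) \<alpha>1 = q ^ 4 * (Q 1 2 * Q 2 1)"
      unfolding bc by (simp add: Q11 power4_eq_xxxx mult_ac)
    also have "\<dots> = q ^ 3" using q1 by (simp add: Q12 power4_eq_xxxx power3_eq_cube)
    finally show ?thesis using q_pow_ne[of 3 n] by (simp add: Q11)
  qed
  then have 112: "xw Q [1, 1, 2] \<in> J"
    by (intro inf[OF prim_112 comp_gens(3) _ hom_112 qq(1)]) simp_all
  have "Q 3 3 ^ n * (bichar Q \<alpha>3 (\<alpha>3 + \<alpha>3 + \<alpha>2) * bichar Q (\<alpha>3 + \<alpha>3 + \<alpha>2) \<alpha>3) \<noteq> 1" for n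
  proof -
    have "bichar Q \<alpha>3 (\<alpha>3 + \<alpha>3 + \<alpha>2) * bichar Q (\<alpha>3 + \<alpha>3 + \<alpha>2) \<alpha>3 = r ^ 4 * (Q 2 3 * Q 3 2)"
      unfolding bc by (simp add: Q33 power4_eq_xxxx mult_ac)
    also have "\<dots> = r ^ 3" using r1 by (simp add: Q23 power4_eq_xxxx power3_eq_cube)
    finally show ?thesis using r_pow_ne[of 3 n] by (simp add: Q33)
  qed
  then have 332: "xw Q [3, 3, 2] \<in> J"
    by (intro inf[OF prim_332 comp_gens(4) _ hom_332 qq(2)]) simp_all
  show ?thesis
    unfolding I_eq using 22 13 112 332 pre_nicholsD(2)[OF J] by (intro Idl_TV_least) auto
qed

abbreviation \<pi> where "\<pi> \<equiv> qpi I"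

lemma q_plus_1: "1 + q \<noteq> 0" and r_plus_1: "1 + r \<noteq> 0"
proof -
  show "1 + q \<noteq> 0"
  proof
    assume "1 + q = 0"
    then have "q = -1" by (simp add: eq_neg_iff_add_eq_0 add.commute)
    then show False using qn[of 2] by simp
  qed
  show "1 + r \<noteq> 0"
  proof
    assume "1 + r = 0"
    then have "r = -1" by (simp add: eq_neg_iff_add_eq_0 add.commute)
    then show False using rn[of 2] by simp
  qed
qed

lemma pi_zero: "x \<in> I \<Longrightarrow> \<pi> x = 0"
  using qpi_eq_iff[OF tideal_I, of x 0] by (simp add: qpi_zero)

sublocale A: D21_algebra scuq "\<pi> xa" "\<pi> xe" "\<pi> xg" "\<pi> xb" "\<pi> xf" "\<pi> xc" "\<pi> xd" q r "Q 1 2" "Q 1 3" "Q 2 3" "Q 1 2 * Q 3 2"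
proof
  show "r * Q 2 3 * (Q 1 2 * Q 3 2) = Q 1 2"
    using Q23 r1 by (simp add: field_simps)
  show "\<pi> xe * \<pi> xe = 0"
    using pi_zero[OF I_gens(1)] by (simp add: power2_eq_square qpi_mult)
  show "\<pi> xa * \<pi> xg = scuq (Q 1 3) (\<pi> xg * \<pi> xa)"
    using pi_zero[OF I_gens(2)] by (simp add: x13_eq qpi_diff qpi_mult qpi_scal)
  have "\<pi> xa * \<pi> xb - scuq (q * Q 1 2) (\<pi> xb * \<pi> xa) = 0"
    using pi_zero[OF I_gens(3)] by (simp add: x112_eq qpi_diff qpi_mult qpi_scal)
  then show "\<pi> xa * (\<pi> xa * \<pi> xe) = scuq (Q 1 2 * (1 + q)) (\<pi> xa * (\<pi> xe * \<pi> xa)) - scuq (q * Q 1 2 * Q 1 2) (\<pi> xe * (\<pi> xa * \<pi> xa))"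
    by (simp add: xb_eq qpi_diff qpi_mult qpi_scal uq.sc_simps mult.assoc)
      (simp add: algebra_simps uq.sc_left_add)
  have k: "Q 3 2 * (r * Q 2 3) = 1" using Q23 r1 by (simp add: field_simps)
  have "\<pi> xg * \<pi> (xw Q [3, 2]) - scuq (r * Q 3 2) (\<pi> (xw Q [3, 2]) * \<pi> xg) = 0"
    using pi_zero[OF I_gens(4)] by (simp add: x332_eq qpi_diff qpi_mult qpi_scal)
  then have "\<pi> xg * (\<pi> xg * \<pi> xe) - scuq (Q 3 2 * (1 + r)) (\<pi> xg * (\<pi> xe * \<pi> xg)) + scuq (r * Q 3 2 * Q 3 2) (\<pi> xe * (\<pi> xg * \<pi> xg)) = 0"
    by (simp add: x32_eq qpi_diff qpi_mult qpi_scal uq.sc_simps mult.assoc)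
      (simp add: algebra_simps uq.sc_left_add)
  \<comment> \<open>The coefficient of x_2 x_3^2 is r q_32^2, and r q_23^2 is its inverse because r
    q_23 q_32 = 1.\<close>
  then have "scuq (r * Q 2 3 * Q 2 3) (\<pi> xg * (\<pi> xg * \<pi> xe) - scuq (Q 3 2 * (1 + r)) (\<pi> xg * (\<pi> xe * \<pi> xg)) + scuq (r * Q 3 2 * Q 3 2) (\<pi> xe * (\<pi> xg * \<pi> xg))) = 0"
    by simp
  moreover have "r * Q 2 3 * Q 2 3 * (Q 3 2 * (1 + r)) = Q 2 3 * (1 + r)" "r * Q 2 3 * Q 2 3 * (r * Q 3 2 * Q 3 2) = 1"
  proof -
    have id: "r * x * x * (y * (1 + r)) = (y * (r * x)) * (x * (1 + r))" "r * x * x * (r * y * y) = (y * (r * x)) * (y * (r * x))"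
      for x y :: 'k by (simp_all add: algebra_simps)
    then show "r * Q 2 3 * Q 2 3 * (Q 3 2 * (1 + r)) = Q 2 3 * (1 + r)" "r * Q 2 3 * Q 2 3 * (r * Q 3 2 * Q 3 2) = 1"
      by (simp_all only: id k mult_1_left)
  qed
  ultimately show "\<pi> xe * (\<pi> xg * \<pi> xg) = scuq (Q 2 3 * (1 + r)) (\<pi> xg * (\<pi> xe * \<pi> xg)) - scuq (r * Q 2 3 * Q 2 3) (\<pi> xg * (\<pi> xg * \<pi> xe))"
    by (simp only: uq.sc_add uq.sc_diff uq.sc_sc uq.sc_one) (simp add: algebra_simps)
qed (use q1 r1 q_nz q_plus_1 r_plus_1 in \<open>auto simp: xb_eq xf_eq xc_eq xd_eq qpi_diff qpi_add qpi_mult qpi_scal\<close>)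

end

section \<open>Leading coefficients along an operator\<close>

text \<open>Polynomials in t with coefficients from K on the left and exponents in D. An element may
  have several such expansions; uniqueness modulo I is what \<open>lowering\<close> provides
  later.\<close>

definition lay :: "('i, 'k::field) tens_alg set \<Rightarrow> ('i, 'k) tens_alg \<Rightarrow> nat set \<Rightarrow> ('i, 'k) tens_alg set" where
  "lay K t D = pm.span {x * t ^ n | x n. x \<in> K \<and> n \<in> D}"

lemma lay_expand:
  assumes K: "pm.subspace K" and z: "z \<in> lay K t D"
  obtains N X where "\<And>n. X n \<in> K" "\<And>n. n \<notin> D \<Longrightarrow> X n = 0" "z = (\<Sum>n\<le>N. X n * t ^ n)"
proof -
  have "\<exists>N X. (\<forall>n. X n \<in> K) \<and> (\<forall>n. n \<notin> D \<or> n > N \<longrightarrow> X n = 0) \<and> z = (\<Sum>n\<le>N. X n * t ^ n)"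
    using z unfolding lay_def
  proof (induction rule: pm.span_induct_alt)
    case base
    show ?case by (rule exI[of _ 0], rule exI[of _ "\<lambda>_. 0"]) (simp add: pm.subspace_0[OF K])
  next
    case (step u z' z)
    then obtain x m where x: "z' = x * t ^ m" "x \<in> K" "m \<in> D" by blast
    from step obtain N X where X: "\<And>n. X n \<in> K" "\<And>n. n \<notin> D \<or> n > N \<Longrightarrow> X n = 0" "z = (\<Sum>n\<le>N. X n * t ^ n)" by blast
    let ?Y = "\<lambda>n. X n + (if n = m then scal u x else 0)"
    have "z = (\<Sum>n\<le>max N m. X n * t ^ n)"
      unfolding X(3) by (rule sum.mono_neutral_left) (auto simp: X(2))
    moreover have "(\<Sum>n\<le>max N m. (if n = m then scal u x else 0) * t ^ n) = (\<Sum>n\<le>max N m. if n = m then scal u x * t ^ n else 0)"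
      by (rule sum.cong) auto
    ultimately have "scal u z' + z = (\<Sum>n\<le>max N m. ?Y n * t ^ n)"
      by (simp add: distrib_right sum.distrib x(1) add.commute)
    moreover have "?Y n \<in> K" for n using X(1) x(2) pm.subspace_add[OF K] pm.subspace_scale[OF K] by auto
    ultimately show ?case using X(2) x(3) by (intro exI[of _ "max N m"] exI[of _ ?Y]) auto
  qed
  then show ?thesis using that by blast
qed

lemma lay_subspace: "pm.subspace (lay K t D)"
  by (simp add: lay_def)

lemma lay_base: "x \<in> K \<Longrightarrow> n \<in> D \<Longrightarrow> x * t ^ n \<in> lay K t D"
  unfolding lay_def by (rule pm.span_base) blast

lemma lay_sum: "(\<And>n. n \<le> N \<Longrightarrow> X n \<in> K) \<Longrightarrow> {..N} \<subseteq> D \<Longrightarrow> (\<Sum>n\<le>N. X n * t ^ n) \<in> lay K t D"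
  by (rule pm.subspace_sum[OF lay_subspace]) (auto intro: lay_base)

text \<open>
  \<open>E\<close> lowers the exponent of \<open>t\<close> modulo \<open>I\<close>, so a subspace \<open>P \<supseteq> I\<close> that is stable under \<open>E\<close> and under
  right multiplication contains the coefficients of its elements.
\<close>

lemma lowering:
  fixes X :: "nat \<Rightarrow> ('i, 'k::field) tens_alg"
  assumes E: "plin E" "\<And>x. x \<in> P \<Longrightarrow> E x \<in> P" and P: "pm.subspace P" "I \<subseteq> P" "\<And>x. x \<in> P \<Longrightarrow> x * t \<in> P"
    and K: "pm.subspace K"
    and low: "\<And>x n. x \<in> K \<Longrightarrow> n \<le> N \<Longrightarrow> E (x * t ^ n) - scal (lam n) (x * t ^ (n - 1)) \<in> I"
    and lam: "lam 0 = 0" "\<And>n. 1 \<le> n \<Longrightarrow> n \<le> N \<Longrightarrow> lam n \<noteq> 0"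
    and X: "\<And>n. X n \<in> K"
  shows "E (\<Sum>n\<le>N. X n * t ^ n) \<in> P \<Longrightarrow> 1 \<le> n \<Longrightarrow> n \<le> N \<Longrightarrow> X n \<in> P"
    "(\<Sum>n\<le>N. X n * t ^ n) \<in> P \<Longrightarrow> n \<le> N \<Longrightarrow> X n \<in> P"
proof -
  have Pt: "x * t ^ n \<in> P" if "x \<in> P" for x n
    using that by (induction n) (auto simp: P(3) power_Suc2 simp del: power_Suc simp flip: mult.assoc)
  \<comment> \<open>E acts as a shift: modulo P, the coefficient at t^n becomes
    \<open>lam (Suc n)\<close> times \<open>X (Suc n)\<close>.\<close>
  have shift: "E (\<Sum>n\<le>Suc N. X n * t ^ n) - (\<Sum>n\<le>N. scal (lam (Suc n)) (X (Suc n)) * t ^ n) \<in> P"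
    if X: "\<And>n. X n \<in> K" and low: "\<And>x n. x \<in> K \<Longrightarrow> n \<le> Suc N \<Longrightarrow> E (x * t ^ n) - scal (lam n) (x * t ^ (n - 1)) \<in> I" for X N
  proof -
    have "E (\<Sum>n\<le>Suc N. X n * t ^ n) - (\<Sum>n\<le>Suc N. scal (lam n) (X n * t ^ (n - 1))) \<in> P"
      unfolding plin_sum[OF E(1)] sum_subtractf[symmetric]
      using low X P(2) by (intro pm.subspace_sum[OF P(1)]) auto
    also have "(\<Sum>n\<le>Suc N. scal (lam n) (X n * t ^ (n - 1))) = (\<Sum>n\<le>N. scal (lam (Suc n)) (X (Suc n)) * t ^ n)"
      by (subst sum.atMost_Suc_shift) (simp add: lam)
    finally show ?thesis .
  qed
  \<comment> \<open>Induction on N: the shifted sum is shorter and puts the coefficients of positive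
    index into P; the one of index 0 is then what remains.\<close>
  have main: "(\<And>n. X n \<in> K) \<Longrightarrow> (\<And>x n. x \<in> K \<Longrightarrow> n \<le> N \<Longrightarrow> E (x * t ^ n) - scal (lam n) (x * t ^ (n - 1)) \<in> I) \<Longrightarrow>
      (\<And>n. 1 \<le> n \<Longrightarrow> n \<le> N \<Longrightarrow> lam n \<noteq> 0) \<Longrightarrow> (\<Sum>n\<le>N. X n * t ^ n) \<in> P \<Longrightarrow> \<forall>n\<le>N. X n \<in> P" for X N
  proof (induction N arbitrary: X)
    case (Suc N)
    have "E (\<Sum>n\<le>Suc N. X n * t ^ n) \<in> P" using Suc.prems E(2) by blast
    from pm.subspace_diff[OF P(1) this shift[of X N]] Suc.prems
    have "(\<Sum>n\<le>N. scal (lam (Suc n)) (X (Suc n)) * t ^ n) \<in> P" by simp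
    then have "\<forall>n\<le>N. scal (lam (Suc n)) (X (Suc n)) \<in> P"
      by (intro Suc.IH) (use Suc.prems pm.subspace_scale[OF K] in auto)
    then have XS: "X (Suc n) \<in> P" if "n \<le> N" for n
      using subspace_scal_cancel[OF P(1), of "lam (Suc n)" "X (Suc n)"] Suc.prems(3)[of "Suc n"] that by auto
    have "(\<Sum>n\<le>Suc N. X n * t ^ n) = X 0 + (\<Sum>n\<le>N. X (Suc n) * t ^ Suc n)"
      by (subst sum.atMost_Suc_shift) simp
    moreover have "(\<Sum>n\<le>N. X (Suc n) * t ^ Suc n) \<in> P"
      using XS Pt by (intro pm.subspace_sum[OF P(1)]) blast
    ultimately have "X 0 \<in> P" using pm.subspace_diff[OF P(1) Suc.prems(4)] by force
    show ?case
    proof (intro allI impI)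
      fix n assume "n \<le> Suc N"
      then show "X n \<in> P" using \<open>X 0 \<in> P\<close> XS by (cases n) auto
    qed
  qed simp
  show "(\<Sum>n\<le>N. X n * t ^ n) \<in> P \<Longrightarrow> n \<le> N \<Longrightarrow> X n \<in> P"
    using main[of X N, OF X low lam(2)] by blast
  show "E (\<Sum>n\<le>N. X n * t ^ n) \<in> P \<Longrightarrow> 1 \<le> n \<Longrightarrow> n \<le> N \<Longrightarrow> X n \<in> P"
  proof (cases N)
    case (Suc M)
    assume "E (\<Sum>n\<le>N. X n * t ^ n) \<in> P" and n: "1 \<le> n" "n \<le> N"
    from pm.subspace_diff[OF P(1) this(1) shift[of X M, OF X, folded Suc, OF low]]
    have "(\<Sum>n\<le>M. scal (lam (Suc n)) (X (Suc n)) * t ^ n) \<in> P" by simp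
    then have "\<forall>n\<le>M. scal (lam (Suc n)) (X (Suc n)) \<in> P"
      by (intro main) (use low X lam(2) pm.subspace_scale[OF K] Suc in auto)
    then show "X n \<in> P"
      using subspace_scal_cancel[OF P(1), of "lam n" "X n"] lam(2)[OF n] n Suc by (cases n) auto
  qed simp
qed

context D21
begin

section \<open>Spanning by the PBW monomials\<close>

definition mm :: "nat \<times> nat \<times> nat \<times> nat \<times> nat \<times> nat \<times> nat \<Rightarrow> (3, 'k) tens_alg" where
  "mm = (\<lambda>(n1, n2, n3, n4, n5, n6, n7).
     xg ^ n1 * xf ^ n2 * xe ^ n3 * xd ^ n4 * xc ^ n5 * xb ^ n6 * xa ^ n7)"

lemma D21_monomial_mm: "D21_monomial Q e = cos I (mm e)"
  by (simp add: D21_monomial_def mm_def pcls_eq split_beta xw.simps(2))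

lemma pi_eq: "\<pi> x = \<pi> y \<longleftrightarrow> x - y \<in> I"
  by (rule qpi_eq_iff[OF tideal_I])

lemma pi_one_mult [simp]: "\<pi> 1 * \<pi> x = \<pi> x" "\<pi> x * \<pi> 1 = \<pi> x" "\<pi> 1 * (\<pi> x * z) = \<pi> x * z"
proof -
  show 1: "\<pi> 1 * \<pi> x = \<pi> x" "\<pi> x * \<pi> 1 = \<pi> x" by (simp_all flip: qpi_mult)
  show "\<pi> 1 * (\<pi> x * z) = \<pi> x * z" by (simp add: 1 flip: mult.assoc)
qed

lemma pi_power: "\<pi> x * \<pi> (x ^ n) = \<pi> (x ^ Suc n)" "\<pi> x * (\<pi> (x ^ n) * z) = \<pi> (x ^ Suc n) * z"
proof -
  show 1: "\<pi> x * \<pi> (x ^ n) = \<pi> (x ^ Suc n)" by (simp flip: qpi_mult)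
  show "\<pi> x * (\<pi> (x ^ n) * z) = \<pi> (x ^ Suc n) * z" unfolding 1[symmetric] by (simp add: mult.assoc)
qed

lemma pi_comm_pow:
  assumes "\<pi> x * \<pi> y = scuq t (\<pi> y * \<pi> x)"
  shows "\<pi> x * \<pi> (y ^ n) = scuq (t ^ n) (\<pi> (y ^ n) * \<pi> x)"
proof (induction n)
  case (Suc n)
  have "\<pi> x * \<pi> (y ^ Suc n) = (\<pi> x * \<pi> y) * \<pi> (y ^ n)"
    by (simp add: qpi_mult mult.assoc)
  also have "\<dots> = scuq t (\<pi> y * (\<pi> x * \<pi> (y ^ n)))"
    unfolding assms by (simp add: uq.sc_mult_left mult.assoc)
  also have "\<dots> = scuq (t ^ Suc n) (\<pi> (y ^ Suc n) * \<pi> x)"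
    unfolding Suc by (simp add: uq.sc_mult_right uq.sc_sc qpi_mult mult.assoc)
  finally show ?case .
qed (simp add: uq.sc_one)

lemma scuq_minus_eq: "- scuq t x = scuq (- t) x"
  by (simp add: uq.sc_minus)

lemmas comm_rules = A.ag A.ab A.ac A.cd A.bd A.bc[unfolded scuq_minus_eq] A.ef[unfolded scuq_minus_eq] A.fg

lemmas comm_pow_rules = comm_rules[THEN pi_comm_pow]

text \<open>Only the shape of the result matters for spanning, so the scalars stay anonymous. At n =
  0 the truncated exponent n - 1 is harmless, as the second scalar is then chosen to be 0.\<close>

lemma pi_eg_pow: "\<exists>t u. \<pi> xe * \<pi> (xg ^ n) = scuq t (\<pi> (xg ^ n) * \<pi> xe) + scuq u (\<pi> (xg ^ (n - 1)) * \<pi> xf)"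
proof (induction n)
  case 0
  have "\<pi> xe * \<pi> (xg ^ 0) = scuq 1 (\<pi> (xg ^ 0) * \<pi> xe) + scuq 0 (\<pi> (xg ^ (0 - 1)) * \<pi> xf)"
    by (simp add: uq.sc_one)
  then show ?case by blast
next
  case (Suc n)
  then obtain t u where tu: "\<pi> xe * \<pi> (xg ^ n) = scuq t (\<pi> (xg ^ n) * \<pi> xe) + scuq u (\<pi> (xg ^ (n - 1)) * \<pi> xf)" by blast
  have g1: "\<pi> xg * \<pi> (xg ^ (n - 1)) = \<pi> (xg ^ n)" if "n > 0" using that by (cases n) (auto simp: pi_power)
  show ?case
  proof (cases n)
    case 0
    have "\<pi> xe * \<pi> (xg ^ Suc n) = scuq (Q 2 3) (\<pi> (xg ^ Suc n) * \<pi> xe) + scuq 1 (\<pi> (xg ^ (Suc n - 1)) * \<pi> xf)"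
      using 0 by (simp add: A.eg uq.sc_one add.commute)
    then show ?thesis by blast
  next
    case (Suc m)
    then have n0: "n > 0" by simp
    note g1' = uq.ext_rule[OF g1[OF n0]] Suc_diff_1[OF n0]
    have "\<pi> xe * \<pi> (xg ^ Suc n) = (\<pi> xe * \<pi> xg) * \<pi> (xg ^ n)"
      by (simp add: qpi_mult mult.assoc)
    also have "\<dots> = \<pi> xf * \<pi> (xg ^ n) + scuq (Q 2 3) (\<pi> xg * (\<pi> xe * \<pi> (xg ^ n)))"
      by (simp add: A.eg uq.sc_simps mult.assoc)
    also have "\<pi> xf * \<pi> (xg ^ n) = scuq ((r * Q 2 3) ^ n) (\<pi> (xg ^ n) * \<pi> xf)"
      by (rule pi_comm_pow[OF A.fg])
    also have "\<pi> xg * (\<pi> xe * \<pi> (xg ^ n)) = scuq t (\<pi> (xg ^ Suc n) * \<pi> xe) + scuq u (\<pi> (xg ^ n) * \<pi> xf)"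
      unfolding tu by (simp only: uq.sc_mult_right distrib_left pi_power(2) g1')
    finally have "\<pi> xe * \<pi> (xg ^ Suc n) = scuq (Q 2 3 * t) (\<pi> (xg ^ Suc n) * \<pi> xe) +
        scuq ((r * Q 2 3) ^ n + Q 2 3 * u) (\<pi> (xg ^ (Suc n - 1)) * \<pi> xf)"
      by (simp add: uq.sc_add uq.sc_left_add uq.sc_sc algebra_simps)
    then show ?thesis by blast
  qed
qed

text \<open>The correction c b from \<open>A.ad\<close> crosses the remaining powers of d at the
  cost of scalars, so a single correction term of the same shape serves all n.\<close>

lemma pi_ad_pow: "\<exists>t u. \<pi> xa * \<pi> (xd ^ n) = scuq t (\<pi> (xd ^ n) * \<pi> xa) + scuq u (\<pi> (xd ^ (n - 1)) * (\<pi> xc * \<pi> xb))"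
proof (induction n)
  case 0
  have "\<pi> xa * \<pi> (xd ^ 0) = scuq 1 (\<pi> (xd ^ 0) * \<pi> xa) + scuq 0 (\<pi> (xd ^ (0 - 1)) * (\<pi> xc * \<pi> xb))"
    by (simp add: uq.sc_one)
  then show ?case by blast
next
  case (Suc n)
  then obtain t u where tu: "\<pi> xa * \<pi> (xd ^ n) = scuq t (\<pi> (xd ^ n) * \<pi> xa) + scuq u (\<pi> (xd ^ (n - 1)) * (\<pi> xc * \<pi> xb))" by blast
  obtain v w where ad: "\<pi> xa * \<pi> xd = scuq v (\<pi> xd * \<pi> xa) + scuq w (\<pi> xc * \<pi> xb)"
    using A.ad by blast
  show ?case
  proof (cases n)
    case 0
    have "\<pi> xa * \<pi> (xd ^ Suc n) = scuq v (\<pi> (xd ^ Suc n) * \<pi> xa) + scuq w (\<pi> (xd ^ (Suc n - 1)) * (\<pi> xc * \<pi> xb))"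
      using 0 by (simp add: ad)
    then show ?thesis by blast
  next
    case (Suc m)
    then have n0: "n > 0" by simp
    have cb: "\<pi> xc * (\<pi> xb * \<pi> (xd ^ n)) = scuq ((Q 1 2 * Q 1 3 * Q 2 3) ^ n * (Q 1 2 * Q 3 2) ^ n) (\<pi> (xd ^ n) * (\<pi> xc * \<pi> xb))"
      by (simp add: comm_pow_rules uq.sc_mult_right uq.sc_mult_left uq.ext_rule[OF pi_comm_pow[OF A.cd]] uq.sc_sc mult.assoc)
    have "\<pi> xa * \<pi> (xd ^ Suc n) = (\<pi> xa * \<pi> xd) * \<pi> (xd ^ n)"
      by (simp add: qpi_mult mult.assoc)
    also have "\<dots> = scuq v (\<pi> xd * (\<pi> xa * \<pi> (xd ^ n))) + scuq w (\<pi> xc * (\<pi> xb * \<pi> (xd ^ n)))"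
      by (simp add: ad uq.sc_simps mult.assoc)
    also have "\<pi> xd * (\<pi> xa * \<pi> (xd ^ n)) = scuq t (\<pi> (xd ^ Suc n) * \<pi> xa) + scuq u (\<pi> (xd ^ n) * (\<pi> xc * \<pi> xb))"
      unfolding tu by (simp only: uq.sc_mult_right distrib_left pi_power(2) Suc_diff_1[OF n0])
    finally have "\<pi> xa * \<pi> (xd ^ Suc n) = scuq (v * t) (\<pi> (xd ^ Suc n) * \<pi> xa) +
        scuq (v * u + w * ((Q 1 2 * Q 1 3 * Q 2 3) ^ n * (Q 1 2 * Q 3 2) ^ n)) (\<pi> (xd ^ (Suc n - 1)) * (\<pi> xc * \<pi> xb))"
      unfolding cb by (simp add: uq.sc_add uq.sc_left_add uq.sc_sc algebra_simps)
    then show ?thesis by blast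
  qed
qed

section \<open>Stability of the span of monomials under left multiplication\<close>

definition W :: "(3, 'k) tens_alg set" where
  "W = {x. \<exists>y\<in>pm.span (mm ` D21_exponents). x - y \<in> I}"

lemma W_subspace: "pm.subspace W"
proof -
  have W: "W = {x + y | x y. x \<in> I \<and> y \<in> pm.span (mm ` D21_exponents)}"
    unfolding W_def by (auto, metis diff_add_cancel, force)
  show ?thesis unfolding W by (rule pm.subspace_sums[OF tideal_subspace[OF tideal_I] pm.subspace_span])
qed

lemma W_pi: "x \<in> W \<Longrightarrow> \<pi> x = \<pi> y \<Longrightarrow> y \<in> W"
proof -
  assume "x \<in> W" "\<pi> x = \<pi> y"
  then obtain z where z: "z \<in> pm.span (mm ` D21_exponents)" "x - z \<in> I" by (auto simp: W_def)
  then have "\<pi> y = \<pi> z" using \<open>\<pi> x = \<pi> y\<close> pi_eq[of x z] by simp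
  then show ?thesis using z(1) pi_eq[of y z] by (auto simp: W_def)
qed

lemma W_I: "x \<in> I \<Longrightarrow> x \<in> W"
  unfolding W_def using pm.span_zero by force

lemma square_zero_power:
  assumes "\<pi> x * \<pi> x = 0" "2 \<le> n"
  shows "x ^ n \<in> I"
proof -
  have "x * x - 0 \<in> I" using assms(1) unfolding pi_eq[symmetric] by (simp add: qpi_mult qpi_zero)
  moreover have "x ^ n = x * x * x ^ (n - 2)"
    using assms(2) by (metis le_add_diff_inverse power2_eq_square power_add)
  ultimately show ?thesis using tideal_right[OF tideal_I] by simp
qed

text \<open>A forbidden exponent produces the square of x_23, x_2, x_123 or x_12, and these squares
  are zero modulo I. Straightening therefore need not keep track of the bounds.\<close>

lemma mm_W: "mm e \<in> W"
proof -
  obtain n1 n2 n3 n4 n5 n6 n7 where e: "e = (n1, n2, n3, n4, n5, n6, n7)" by (cases e) auto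
  show ?thesis
  proof (cases "e \<in> D21_exponents")
    case True
    then show ?thesis unfolding W_def using pm.subspace_0[OF tideal_subspace[OF tideal_I]]
      by (auto intro!: bexI[of _ "mm e"] pm.span_base)
  next
    case False
    then have "2 \<le> n2 \<or> 2 \<le> n3 \<or> 2 \<le> n5 \<or> 2 \<le> n6" by (auto simp: e D21_exponents_def)
    then have "xf ^ n2 \<in> I \<or> xe ^ n3 \<in> I \<or> xc ^ n5 \<in> I \<or> xb ^ n6 \<in> I"
      using square_zero_power[OF A.ff] square_zero_power[OF A.ee] square_zero_power[OF A.cc] square_zero_power[OF A.bb] by blast
    then have "mm e \<in> I"
      unfolding e mm_def prod.case by (elim disjE) (simp_all add: tideal_left[OF tideal_I] tideal_right[OF tideal_I])
    then show ?thesis by (rule W_I)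
  qed
qed

lemma pi_mm: "\<pi> (mm (n1, n2, n3, n4, n5, n6, n7)) =
   \<pi> (xg ^ n1) * (\<pi> (xf ^ n2) * (\<pi> (xe ^ n3) * (\<pi> (xd ^ n4) * (\<pi> (xc ^ n5) * (\<pi> (xb ^ n6) * \<pi> (xa ^ n7))))))"
  by (simp add: mm_def qpi_mult mult.assoc)

lemma W_scuq:
  assumes "\<pi> x = scuq t (\<pi> y) + scuq u (\<pi> z)" "y \<in> W" "z \<in> W"
  shows "x \<in> W"
proof -
  have "scal t y + scal u z \<in> W"
    by (intro pm.subspace_add[OF W_subspace] pm.subspace_scale[OF W_subspace] assms)
  then show ?thesis by (rule W_pi) (simp add: assms(1) qpi_add qpi_scal)
qed

lemma left_e: "xe * mm e \<in> W"
proof -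
  obtain n1 n2 n3 n4 n5 n6 n7 where e: "e = (n1, n2, n3, n4, n5, n6, n7)" by (cases e) auto
  let ?R = "\<pi> (xe ^ n3) * (\<pi> (xd ^ n4) * (\<pi> (xc ^ n5) * (\<pi> (xb ^ n6) * \<pi> (xa ^ n7))))"
  obtain t u where tu: "\<pi> xe * \<pi> (xg ^ n1) = scuq t (\<pi> (xg ^ n1) * \<pi> xe) + scuq u (\<pi> (xg ^ (n1 - 1)) * \<pi> xf)"
    using pi_eg_pow by blast
  have "\<pi> (xe * mm e) = (\<pi> xe * \<pi> (xg ^ n1)) * (\<pi> (xf ^ n2) * ?R)"
    unfolding e qpi_mult pi_mm by (simp add: mult.assoc)
  also have "\<dots> = scuq t (\<pi> (xg ^ n1) * ((\<pi> xe * \<pi> (xf ^ n2)) * ?R)) + scuq u (\<pi> (xg ^ (n1 - 1)) * (\<pi> xf * (\<pi> (xf ^ n2) * ?R)))"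
    unfolding tu by (simp add: distrib_right uq.sc_mult_left mult.assoc)
  also have "\<pi> xe * \<pi> (xf ^ n2) = scuq ((- Q 2 3) ^ n2) (\<pi> (xf ^ n2) * \<pi> xe)"
    by (rule pi_comm_pow[OF A.ef[unfolded scuq_minus_eq]])
  finally have "\<pi> (xe * mm e) = scuq (t * (- Q 2 3) ^ n2) (\<pi> (mm (n1, n2, Suc n3, n4, n5, n6, n7))) +
      scuq u (\<pi> (mm (n1 - 1, Suc n2, n3, n4, n5, n6, n7)))"
    by (simp only: uq.sc_mult_left uq.sc_mult_right uq.sc_sc mult.assoc pi_power pi_mm)
  then show ?thesis by (rule W_scuq[OF _ mm_W mm_W])
qed

lemma left_g: "xg * mm e \<in> W"
proof -
  obtain n1 n2 n3 n4 n5 n6 n7 where e: "e = (n1, n2, n3, n4, n5, n6, n7)" by (cases e) auto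
  have "xg * mm e = mm (Suc n1, n2, n3, n4, n5, n6, n7)" by (simp add: e mm_def mult.assoc)
  then show ?thesis using mm_W by metis
qed

abbreviation tl4 where "tl4 n4 n5 n6 n7 \<equiv> \<pi> (xd ^ n4) * (\<pi> (xc ^ n5) * (\<pi> (xb ^ n6) * \<pi> (xa ^ n7)))"

text \<open>W seen inside the ring type, where a sum of straightened terms can be recognised summand
  by summand.\<close>

definition Wq where "Wq = \<pi> ` W"

lemma Wq: "x \<in> W \<longleftrightarrow> \<pi> x \<in> Wq"
proof
  assume "\<pi> x \<in> Wq"
  then obtain z where "z \<in> W" "\<pi> z = \<pi> x" by (auto simp: Wq_def)
  then show "x \<in> W" by (rule W_pi)
qed (simp add: Wq_def)

lemma Wq_add: "X \<in> Wq \<Longrightarrow> Y \<in> Wq \<Longrightarrow> X + Y \<in> Wq"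
proof -
  assume "X \<in> Wq" "Y \<in> Wq"
  then obtain x y where "X = \<pi> x" "Y = \<pi> y" "x \<in> W" "y \<in> W" by (auto simp: Wq_def)
  then show ?thesis using Wq[of "x + y"] pm.subspace_add[OF W_subspace] by (simp add: qpi_add)
qed

lemma Wq_sc: "X \<in> Wq \<Longrightarrow> scuq t X \<in> Wq"
proof -
  assume "X \<in> Wq"
  then obtain x where "X = \<pi> x" "x \<in> W" by (auto simp: Wq_def)
  then show ?thesis using Wq[of "scal t x"] pm.subspace_scale[OF W_subspace] by (simp add: qpi_scal)
qed

lemma Wq_diff: "X \<in> Wq \<Longrightarrow> Y \<in> Wq \<Longrightarrow> X - Y \<in> Wq"
  using Wq_add[of X "scuq (-1) Y"] Wq_sc[of Y "-1"] by (simp add: uq.sc_minus uq.sc_one)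

lemma Wq_mm: "\<pi> (xg ^ n1) * (\<pi> (xf ^ n2) * (\<pi> (xe ^ n3) * tl4 n4 n5 n6 n7)) \<in> Wq"
  using mm_W[of "(n1, n2, n3, n4, n5, n6, n7)"] unfolding Wq pi_mm .

lemma Wq_mm': "\<pi> (xg ^ n1) * (\<pi> (xf ^ n2) * (tl4 n4 n5 n6 n7)) \<in> Wq" "\<pi> (xg ^ n1) * (\<pi> (xe ^ n3) * tl4 n4 n5 n6 n7) \<in> Wq"
  "\<pi> (xg ^ n1) * tl4 n4 n5 n6 n7 \<in> Wq"
  using Wq_mm[of n1 n2 0 n4 n5 n6 n7] Wq_mm[of n1 0 n3 n4 n5 n6 n7] Wq_mm[of n1 0 0 n4 n5 n6 n7] by simp_all

lemma a_tl: "\<exists>t u. \<pi> xa * tl4 n4 n5 n6 n7 = scuq t (tl4 n4 n5 n6 (Suc n7)) + scuq u (tl4 (n4 - 1) (Suc n5) (Suc n6) n7)"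
  and b_tl: "\<exists>t. \<pi> xb * tl4 n4 n5 n6 n7 = scuq t (tl4 n4 n5 (Suc n6) n7)"
  and c_tl: "\<exists>t. \<pi> xc * tl4 n4 n5 n6 n7 = scuq t (tl4 n4 (Suc n5) n6 n7)"
proof -
  note pows = comm_pow_rules comm_pow_rules[THEN uq.ext_rule] pi_power uq.sc_mult_left uq.sc_mult_right uq.sc_sc mult.assoc
  show "\<exists>t. \<pi> xc * tl4 n4 n5 n6 n7 = scuq t (tl4 n4 (Suc n5) n6 n7)"
    by (simp only: pows) blast
  show b: "\<exists>t. \<pi> xb * tl4 n4 n5 n6 n7 = scuq t (tl4 n4 n5 (Suc n6) n7)"
    by (simp only: pows) blast
  obtain t u where tu: "\<pi> xa * \<pi> (xd ^ n4) = scuq t (\<pi> (xd ^ n4) * \<pi> xa) + scuq u (\<pi> (xd ^ (n4 - 1)) * (\<pi> xc * \<pi> xb))"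
    using pi_ad_pow by blast
  show "\<exists>t u. \<pi> xa * tl4 n4 n5 n6 n7 = scuq t (tl4 n4 n5 n6 (Suc n7)) + scuq u (tl4 (n4 - 1) (Suc n5) (Suc n6) n7)"
    by (simp only: uq.ext_rule[OF tu] distrib_right distrib_left pows) blast
qed

lemma left_a: "xa * mm e \<in> W"
proof -
  obtain n1 n2 n3 n4 n5 n6 n7 where e: "e = (n1, n2, n3, n4, n5, n6, n7)" by (cases e) auto
  have "\<pi> xa * \<pi> (xg ^ n1) = scuq (Q 1 3 ^ n1) (\<pi> (xg ^ n1) * \<pi> xa)"
    by (rule pi_comm_pow[OF A.ag])
  note ag = uq.ext_rule[OF this]
  obtain t u where tu: "\<pi> xa * tl4 n4 n5 n6 n7 = scuq t (tl4 n4 n5 n6 (Suc n7)) + scuq u (tl4 (n4 - 1) (Suc n5) (Suc n6) n7)"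
    using a_tl by blast
  obtain v where v: "\<pi> xb * tl4 n4 n5 n6 n7 = scuq v (tl4 n4 n5 (Suc n6) n7)"
    using b_tl by blast
  obtain w where w: "\<pi> xc * tl4 n4 n5 n6 n7 = scuq w (tl4 n4 (Suc n5) n6 n7)"
    using c_tl by blast
  note ext = uq.ext_rule[OF A.ae] uq.ext_rule[OF A.af] uq.ext_rule[OF A.ce]
  \<comment> \<open>x_1 creates x_123 and x_12 when it passes x_23 and x_2. With these two exponents
    restricted to 0 and 1 only four cases are left, and rewriting settles each.\<close>
  consider "mm e \<in> I" | "n2 \<in> {0, 1}" "n3 \<in> {0, 1}"
  proof (cases "2 \<le> n2 \<or> 2 \<le> n3")
    case True
    then have "xf ^ n2 \<in> I \<or> xe ^ n3 \<in> I"
      using square_zero_power[OF A.ff] square_zero_power[OF A.ee] by blast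
    then have "mm e \<in> I"
      unfolding e mm_def prod.case by (elim disjE) (simp_all add: tideal_left[OF tideal_I] tideal_right[OF tideal_I])
    then show ?thesis using that by blast
  qed (use that in force)
  then show ?thesis
  proof cases
    case 1
    then show ?thesis using W_I tideal_left[OF tideal_I] by blast
  next
    case 2
    then have "\<pi> xa * \<pi> (mm e) \<in> Wq"
      unfolding e pi_mm
      by (auto simp: ag ext tu v w uq.sc_simps pi_power mult.assoc
        simp del: power_Suc intro!: Wq_add Wq_diff Wq_sc Wq_mm' Wq_mm[of _ 1 1, simplified] Wq_mm'(1)[of _ 1, simplified] Wq_mm'(2)[of _ 1, simplified])
    then show ?thesis unfolding Wq qpi_mult .
  qed
qed

text \<open>W contains 1 and is stable under left multiplication by each letter, hence contains
  every word.\<close>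

lemma W_UNIV: "x \<in> W"
proof -
  have one: "1 \<in> W" using mm_W[of "(0,0,0,0,0,0,0)"] by (simp add: mm_def)
  have step: "wd [i] * z \<in> W" if "z \<in> W" for i z
  proof -
    from that obtain z' where z': "z' \<in> pm.span (mm ` D21_exponents)" "\<pi> z = \<pi> z'" by (auto simp: W_def pi_eq)
    have "wd [i] * z' \<in> W"
    proof (rule plin_span_into[OF plin_mult_left W_subspace _ z'(1)])
      show "wd [i] * z \<in> W" if "z \<in> mm ` D21_exponents" for z
        using that three_cases[of i] left_a left_e left_g by blast
    qed
    then show ?thesis by (rule W_pi) (simp add: qpi_mult z'(2))
  qed
  show ?thesis
  proof (induction x rule: pm_induct)
    case (bs w)
    show ?case
    proof (induction w rule: word_induct)
      case (Cons i w)
      then show ?case using step[OF Cons, of i] by (simp add: wd_eq bs_mult)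
    qed (use one in simp)
  qed (auto intro: pm.subspace_0[OF W_subspace] pm.subspace_add[OF W_subspace] pm.subspace_scale[OF W_subspace])
qed

end

context D21
begin

section \<open>Skew derivations of the PBW generators\<close>

lemma three_neq [simp]: "(1::3) \<noteq> 2" "(2::3) \<noteq> 1" "(1::3) \<noteq> 3" "(3::3) \<noteq> 1" "(2::3) \<noteq> 3" "(3::3) \<noteq> 2"
  by simp_all

lemma gl_wd: "gl Q (unitv i) (wd [j]) = scal (Q i j) (wd [j])"
  by (simp add: gl_homogeneous[OF homogeneous_wd] bichar_unitv)

lemma gl_f: "gl Q (unitv i) xf = scal (Q i 2 * Q i 3) xf"
  and gl_c: "gl Q (unitv i) xc = scal (Q i 1 * Q i 2 * Q i 3) xc"
  by (simp_all add: gl_homogeneous[OF hom_f] gl_homogeneous[OF hom_c] bc)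

lemma s_eq: "s = inverse q * inverse r"
  using qrs q1 r1 by (simp add: field_simps)

lemma pd_b: "pd 1 xb = 0" "pd 2 xb = scal (1 - inverse q) xa" "pd 3 xb = 0"
  using Q12 by (simp_all add: xb_eq pd_diff pd_scal pd_wd_mult pd_wd gl_wd scal_scal pm.scale_left_diff_distrib)

lemma pd_f: "pd 1 xf = 0" "pd 2 xf = 0" "pd 3 xf = scal (1 - inverse r) xe"
  using Q23 by (simp_all add: xf_eq pd_diff pd_scal pd_wd_mult pd_wd gl_wd scal_scal pm.scale_left_diff_distrib)

lemma pd_c: "pd 1 xc = 0" "pd 2 xc = 0" "pd 3 xc = scal (1 - inverse r) xb"
proof -
  show "pd 1 xc = 0" "pd 2 xc = 0"
    by (simp_all add: xc_eq pd_diff pd_scal pd_wd_mult pd_mult pd_wd pd_f gl_f gl_wd scal_scal)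
  have "pd 3 xc = scal (1 - inverse r) (xa * xe) - scal (Q 1 2 * (Q 1 3 * Q 3 1) * (1 - inverse r)) (xe * xa)"
    by (simp add: xc_eq pd_diff pd_scal pd_wd_mult pd_mult pd_wd pd_f gl_f gl_wd scal_scal mult_ac)
  then show "pd 3 xc = scal (1 - inverse r) xb"
    by (simp only: Q13 xb_eq scal_diff scal_scal mult_1_right mult_1_left mult.commute)
qed

lemma pd_d: "pd 1 xd = 0" "pd 2 xd = scal (1 - s) xc" "pd 3 xd \<in> I"
proof -
  show "pd 1 xd = 0"
    by (simp add: xd_eq pd_add pd_scal pd_wd_mult pd_mult pd_wd pd_c)
  \<comment> \<open>The product of -1, q_12 q_21 = q^-1 and q_23 q_32 = r^-1; this is where s
    enters.\<close>
  have "Q 1 2 * Q 3 2 * (Q 2 1 * - 1 * Q 2 3) = - s"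
    using arg_cong2[OF Q12 Q23, of "(*)"] by (simp add: s_eq mult_ac)
  then have "xc + scal (Q 1 2 * Q 3 2) (scal (Q 2 1 * - 1 * Q 2 3) xc) = scal (1 - s) xc"
    by (simp only: scal_scal) (simp add: scal_minus pm.scale_left_diff_distrib)
  then show "pd 2 xd = scal (1 - s) xc"
    by (simp add: xd_eq pd_add pd_scal pd_wd_mult pd_mult pd_wd pd_c gl_c Q22)
  \<comment> \<open>A multiple of x_12 x_2 + q_12 x_2 x_12, which vanishes only modulo I.\<close>
  have "pd 3 xd = scal (1 - inverse r) (scal (Q 3 2) (xb * xe) + scal (Q 1 2 * Q 3 2) (xe * xb))"
    by (simp add: xd_eq pd_add pd_scal pd_wd_mult pd_mult pd_wd pd_c gl_wd scal_add scal_scal mult_ac)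
  moreover have "scal (Q 3 2) (xb * xe) + scal (Q 1 2 * Q 3 2) (xe * xb) - 0 \<in> I"
    unfolding pi_eq[symmetric] qpi_add qpi_scal qpi_mult qpi_zero A.be by (simp add: uq.sc_simps mult.commute)
  ultimately show "pd 3 xd \<in> I" using tideal_scal[OF tideal_I] by simp
qed

lemma pd_I: "x \<in> I \<Longrightarrow> pd i x \<in> I"
  by (rule pre_nicholsD(6)[OF pre_nichols_I])

lemma hspan_I: "hspan I"
  unfolding I_eq by (rule hspan_Idl[OF hom_gens_I])

lemma I_subspace: "pm.subspace I"
  by (rule tideal_subspace[OF tideal_I])

lemma gl_I: "x \<in> I \<Longrightarrow> gl Q \<beta> x \<in> I"
  by (rule plin_hspan_into[OF hspan_I plin_gl I_subspace]) (auto simp: gl_homogeneous tideal_scal[OF tideal_I])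

text \<open>\<open>pd i\<close> lowers the degree by that of x_i, which accounts for the
  scalar.\<close>

lemma pd_gl: "pd i (gl Q \<beta> x) = scal (bichar Q \<beta> (unitv i)) (gl Q \<beta> (pd i x))"
proof (induction x rule: T_induct)
  case (wd j w)
  have g: "gl Q \<beta> (wd [j]) = scal (bichar Q \<beta> (unitv j)) (wd [j])" by (rule gl_homogeneous[OF homogeneous_wd])
  have c: "gl Q \<beta> (gl Q \<gamma> x) = gl Q \<gamma> (gl Q \<beta> x)" for \<gamma> x by (simp add: gl_gl add.commute)
  show ?case
    by (auto simp: gl_mult g pd_scal pd_wd_mult wd gl_add scal_add scal_scal c mult.commute)
qed (auto simp: gl_add gl_scal pd_add pd_scal scal_add scal_scal mult.commute)

section \<open>Subalgebras on which the lowering operators vanish\<close>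

definition subalg :: "(3, 'k) tens_alg set \<Rightarrow> bool" where
  "subalg Z \<longleftrightarrow> pm.subspace Z \<and> I \<subseteq> Z \<and> 1 \<in> Z \<and> (\<forall>x\<in>Z. \<forall>y\<in>Z. x * y \<in> Z) \<and> (\<forall>x\<in>Z. \<forall>\<beta>. gl Q \<beta> x \<in> Z)"

lemma subalg_UNIV: "subalg UNIV"
  by (simp add: subalg_def pm.subspace_UNIV)

text \<open>By the skew Leibniz rule the condition on \<open>pd i\<close> is stable under products
  as soon as U is a bimodule over Z and stable under the twists.\<close>

lemma subalg_pd:
  assumes Z: "subalg Z" and U: "pm.subspace U" "I \<subseteq> U" "\<And>u \<beta>. u \<in> U \<Longrightarrow> gl Q \<beta> u \<in> U"
    "\<And>u z. u \<in> U \<Longrightarrow> z \<in> Z \<Longrightarrow> u * z \<in> U \<and> z * u \<in> U"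
  shows "subalg {x \<in> Z. pd i x \<in> U}"
  unfolding subalg_def
proof (intro conjI ballI allI)
  show "pm.subspace {x \<in> Z. pd i x \<in> U}"
    using Z U(1) by (auto simp: subalg_def pm.subspace_def pd_add pd_scal)
  show "I \<subseteq> {x \<in> Z. pd i x \<in> U}" using Z U(2) pd_I by (auto simp: subalg_def)
  show "1 \<in> {x \<in> Z. pd i x \<in> U}" using Z pm.subspace_0[OF U(1)] by (auto simp: subalg_def)
  fix x assume x: "x \<in> {x \<in> Z. pd i x \<in> U}"
  show "gl Q \<beta> x \<in> {x \<in> Z. pd i x \<in> U}" for \<beta>
    using Z x U(3) pm.subspace_scale[OF U(1)] by (auto simp: subalg_def pd_gl)
  show "x * y \<in> {x \<in> Z. pd i x \<in> U}" if y: "y \<in> {x \<in> Z. pd i x \<in> U}" for y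
    using Z x y U(4) pm.subspace_add[OF U(1)] by (auto simp: subalg_def pd_mult)
qed

lemma subalg_ker: "subalg {x. pd i x \<in> I}"
  using subalg_pd[OF subalg_UNIV I_subspace _ gl_I, of i] tideal_left[OF tideal_I] tideal_right[OF tideal_I] by simp

lemma subalg_pd_self: "subalg Z \<Longrightarrow> subalg {x \<in> Z. pd i x \<in> Z}"
  by (rule subalg_pd) (auto simp: subalg_def)

text \<open>Each condition asks that a derivative land in an earlier subalgebra. So
  \<partial>1\<partial>2 vanishes modulo I on Z2, \<partial>1\<partial>2\<partial>3 on Z3,
  \<partial>1\<partial>2\<partial>3\<partial>2 on Z4 and \<partial>2\<partial>3 on Z6: elements of
  these subalgebras are constants for the respective lowering operators.\<close>

definition "Z1 = {x. pd 1 x \<in> I}"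
definition "Z2 = {x \<in> Z1. pd 2 x \<in> Z1}"
definition "Z3 = {x \<in> Z2. pd 3 x \<in> Z2}"
definition "Z4 = {x \<in> Z3. pd 2 x \<in> Z3}"
definition "Z5 = {x. pd 2 x \<in> I}"
definition "Z6 = {x \<in> Z5. pd 3 x \<in> Z5}"
definition "Z7 = {x. pd 3 x \<in> I}"

lemma subalg_Z: "subalg Z1" "subalg Z2" "subalg Z3" "subalg Z4" "subalg Z5" "subalg Z6" "subalg Z7"
  unfolding Z1_def Z2_def Z3_def Z4_def Z5_def Z6_def Z7_def
  by (intro subalg_ker subalg_pd_self)+

lemma subalg_mult: "subalg Z \<Longrightarrow> x \<in> Z \<Longrightarrow> y \<in> Z \<Longrightarrow> x * y \<in> Z"
  and subalg_scal: "subalg Z \<Longrightarrow> x \<in> Z \<Longrightarrow> scal t x \<in> Z"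
  and subalg_one: "subalg Z \<Longrightarrow> 1 \<in> Z"
  and subalg_zero: "subalg Z \<Longrightarrow> 0 \<in> Z"
  and subalg_I: "subalg Z \<Longrightarrow> x \<in> I \<Longrightarrow> x \<in> Z"
  and subalg_gl: "subalg Z \<Longrightarrow> x \<in> Z \<Longrightarrow> gl Q \<beta> x \<in> Z"
  by (auto simp: subalg_def pm.subspace_def)

lemma subalg_power: "subalg Z \<Longrightarrow> x \<in> Z \<Longrightarrow> x ^ n \<in> Z"
  by (induction n) (auto intro: subalg_one subalg_mult)

lemmas subalg_simps = subalg_Z[THEN subalg_one] subalg_Z[THEN subalg_zero] subalg_Z[THEN subalg_scal] subalg_Z[THEN subalg_I]

lemma Z1_mem: "xg \<in> Z1" "xf \<in> Z1" "xe \<in> Z1" "xd \<in> Z1" "xc \<in> Z1" "xb \<in> Z1"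
  by (simp_all add: Z1_def pd_wd pd_b pd_c pd_d pd_f tideal_zero[OF tideal_I])

lemma Z2_mem: "xg \<in> Z2" "xf \<in> Z2" "xe \<in> Z2" "xd \<in> Z2" "xc \<in> Z2"
  by (simp_all add: Z2_def pd_wd pd_b pd_c pd_d pd_f subalg_simps Z1_mem)

lemma Z3_mem: "xg \<in> Z3" "xf \<in> Z3" "xe \<in> Z3" "xd \<in> Z3"
  by (simp_all add: Z3_def pd_wd pd_b pd_c pd_d pd_f subalg_simps Z2_mem)

definition y where "y = xd ^ L"

lemma qnum_s: "(s - 1) * qnum s n = s ^ n - 1"
  by (induction n) (auto simp: qnum_Suc algebra_simps)

lemma qnum_s_nz: "1 \<le> n \<Longrightarrow> n < L \<Longrightarrow> qnum s n \<noteq> 0"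
  using qnum_s[of n] L(3)[of n] by auto

lemma qnum_s_L: "qnum s L = 0"
  using qnum_s[of L] L(2) s1 by simp

text \<open>Crossing one more x_1223 costs chi(\<alpha>2,\<delta>) q_12 q_32 = s, whence the
  s-number of n. It vanishes at n = L, which puts y into the common kernel.\<close>

lemma pd2_d_pow: "pd 2 (xd ^ n) - scal ((1 - s) * qnum s n) (xd ^ (n - 1) * xc) \<in> I"
proof (induction n)
  case 0
  show ?case by (simp add: tideal_zero[OF tideal_I])
next
  case (Suc n)
  have ss: "bichar Q \<alpha>2 \<delta> * (Q 1 2 * Q 3 2) = s"
  proof -
    have "bichar Q \<alpha>2 \<delta> * (Q 1 2 * Q 3 2) = (Q 1 2 * Q 2 1) * (Q 2 3 * Q 3 2)"
      unfolding \<delta>_def bc by (simp add: Q22 mult_ac)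
    then show ?thesis by (simp add: Q12 Q23 s_eq)
  qed
  have p1: "\<pi> xd * \<pi> (xd ^ (n - 1) * xc) = \<pi> (xd ^ n * xc)" if "n \<noteq> 0"
    using that by (cases n) (simp_all add: mult.assoc flip: qpi_mult)
  have eq: "\<pi> (pd 2 (xd ^ n)) = scuq ((1 - s) * qnum s n) (\<pi> (xd ^ (n - 1) * xc))"
    using Suc unfolding pi_eq[symmetric] qpi_scal .
  have "gl Q \<alpha>2 (xd ^ n) = scal (bichar Q \<alpha>2 \<delta> ^ n) (xd ^ n)"
    by (simp add: gl_homogeneous[OF homogeneous_power[OF hom_d]] bichar_mult_right)
  then have "pd 2 (xd ^ Suc n) = xd * pd 2 (xd ^ n) + scal ((1 - s) * bichar Q \<alpha>2 \<delta> ^ n) (xc * xd ^ n)"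
    by (simp add: pd_mult pd_d scal_scal mult.commute)
  then have "\<pi> (pd 2 (xd ^ Suc n)) = \<pi> xd * \<pi> (pd 2 (xd ^ n)) + scuq ((1 - s) * bichar Q \<alpha>2 \<delta> ^ n) (\<pi> xc * \<pi> (xd ^ n))"
    by (simp add: qpi_add qpi_mult qpi_scal)
  also have "\<pi> xc * \<pi> (xd ^ n) = scuq ((Q 1 2 * Q 3 2) ^ n) (\<pi> (xd ^ n * xc))"
    by (simp add: pi_comm_pow[OF A.cd] qpi_mult)
  also have "\<pi> xd * \<pi> (pd 2 (xd ^ n)) = scuq ((1 - s) * qnum s n) (\<pi> (xd ^ n * xc))"
    unfolding eq using p1 by (cases "n = 0") (simp_all add: uq.sc_mult_right)
  also have "scuq ((1 - s) * bichar Q \<alpha>2 \<delta> ^ n) (scuq ((Q 1 2 * Q 3 2) ^ n) (\<pi> (xd ^ n * xc))) = scuq ((1 - s) * s ^ n) (\<pi> (xd ^ n * xc))"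
    unfolding uq.sc_sc by (simp only: mult.assoc power_mult_distrib[symmetric] ss)
  finally have "\<pi> (pd 2 (xd ^ Suc n)) = \<pi> (scal ((1 - s) * qnum s (Suc n)) (xd ^ n * xc))"
    by (simp add: qpi_scal uq.sc_left_add qnum_Suc distrib_left)
  then show ?case by (simp add: pi_eq)
qed

lemma pd_y: "pd i y \<in> I"
proof -
  have "pd 1 (xd ^ n) = 0" for n by (induction n) (simp_all add: pd_mult pd_d)
  moreover have "pd 3 (xd ^ n) \<in> I" for n
  proof (induction n)
    case (Suc n)
    then show ?case by (simp add: pd_mult tideal_add[OF tideal_I] tideal_left[OF tideal_I] tideal_right[OF tideal_I] pd_d)
  qed (simp add: tideal_zero[OF tideal_I])
  moreover have "pd 2 (xd ^ L) \<in> I" using pd2_d_pow[of L] by (simp add: qnum_s_L)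
  ultimately show ?thesis
    using three_cases[of i] by (auto simp: y_def tideal_zero[OF tideal_I])
qed

lemma y_Z: "y \<in> Z1" "y \<in> Z2" "y \<in> Z3" "y \<in> Z4" "y \<in> Z5" "y \<in> Z6" "y \<in> Z7"
proof -
  show 1: "y \<in> Z1" "y \<in> Z5" "y \<in> Z7" by (simp_all add: Z1_def Z5_def Z7_def pd_y)
  show 2: "y \<in> Z2" "y \<in> Z6" by (simp_all add: Z2_def Z6_def 1 subalg_simps pd_y)
  show 3: "y \<in> Z3" by (simp add: Z3_def 2 subalg_simps pd_y)
  show "y \<in> Z4" by (simp add: Z4_def 3 subalg_simps pd_y)
qed

lemma Z4_mem: "xg \<in> Z4" "xf \<in> Z4" "xe \<in> Z4"
  by (simp_all add: Z4_def pd_wd pd_f subalg_simps Z3_mem)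

lemma Z567_mem: "xg \<in> Z5" "xf \<in> Z5" "xg \<in> Z6"
  by (simp_all add: Z5_def Z6_def pd_wd pd_f tideal_zero[OF tideal_I])

text \<open>K8 consists of the polynomials in y. Each further layer adjoins one PBW generator on the
  right, in the order of \<open>mm\<close>, with the exponents of the basis except that
  \<open>xd\<close> occurs only with exponents below L. Each layer lies in the subalgebra of
  constants for the operator that lowers the next generator.\<close>

definition "K8 = pm.span (range (\<lambda>k. y ^ k))"
definition "K7 = lay K8 xg UNIV"
definition "K6 = lay K7 xf {..1}"
definition "K5 = lay K6 xe {..1}"
definition "K4 = lay K5 xd {..L - 1}"
definition "K3 = lay K4 xc {..1}"
definition "K2 = lay K3 xb {..1}"
definition "K1 = lay K2 xa UNIV"

lemma K_subspace: "pm.subspace K8" "pm.subspace K7" "pm.subspace K6" "pm.subspace K5" "pm.subspace K4"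
  "pm.subspace K3" "pm.subspace K2" "pm.subspace K1"
  by (simp_all add: K8_def K7_def K6_def K5_def K4_def K3_def K2_def K1_def lay_subspace)

lemma subalg_subspace: "subalg Z \<Longrightarrow> pm.subspace Z"
  by (simp add: subalg_def)

lemma lay_subalg: "subalg Z \<Longrightarrow> K \<subseteq> Z \<Longrightarrow> t \<in> Z \<Longrightarrow> lay K t D \<subseteq> Z"
  unfolding lay_def by (rule pm.span_minimal[OF _ subalg_subspace]) (auto intro: subalg_mult subalg_power)

lemma K8_subalg: "subalg Z \<Longrightarrow> y \<in> Z \<Longrightarrow> K8 \<subseteq> Z"
  unfolding K8_def by (rule pm.span_minimal[OF _ subalg_subspace]) (auto intro: subalg_power)

lemma K_Z: "K8 \<subseteq> Z7" "K7 \<subseteq> Z6" "K6 \<subseteq> Z5" "K5 \<subseteq> Z4" "K4 \<subseteq> Z3" "K3 \<subseteq> Z2" "K2 \<subseteq> Z1"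
proof -
  show "K8 \<subseteq> Z7" by (intro K8_subalg subalg_Z y_Z)
  show "K7 \<subseteq> Z6" unfolding K7_def by (intro lay_subalg K8_subalg subalg_Z y_Z Z567_mem)
  show "K6 \<subseteq> Z5" unfolding K6_def K7_def by (intro lay_subalg K8_subalg subalg_Z y_Z Z567_mem)
  show "K5 \<subseteq> Z4" unfolding K5_def K6_def K7_def by (intro lay_subalg K8_subalg subalg_Z y_Z Z4_mem)
  show "K4 \<subseteq> Z3" unfolding K4_def K5_def K6_def K7_def by (intro lay_subalg K8_subalg subalg_Z y_Z Z3_mem)
  show "K3 \<subseteq> Z2" unfolding K3_def K4_def K5_def K6_def K7_def by (intro lay_subalg K8_subalg subalg_Z y_Z Z2_mem)
  show "K2 \<subseteq> Z1" unfolding K2_def K3_def K4_def K5_def K6_def K7_def by (intro lay_subalg K8_subalg subalg_Z y_Z Z1_mem)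
qed

section \<open>Action of the lowering operators on the layers\<close>

lemma I_diff: "x - z \<in> I \<longleftrightarrow> \<pi> x = \<pi> z"
  by (simp add: pi_eq)

lemma pi_pd: "\<pi> x = \<pi> z \<Longrightarrow> \<pi> (pd i x) = \<pi> (pd i z)"
  using pd_I[of "x - z" i] by (simp add: pi_eq pd_diff)

lemma pi_I0: "x \<in> I \<longleftrightarrow> \<pi> x = 0"
  using pi_eq[of x 0] by (simp add: qpi_zero)

abbreviation "rq \<equiv> 1 - inverse r"
abbreviation "qq \<equiv> 1 - inverse q"

lemma low1: "x \<in> Z1 \<Longrightarrow> \<pi> (pd 1 (x * xa ^ n)) = \<pi> (scal (qnum q n) (x * xa ^ (n - 1)))"
  by (simp add: pd_mult qpi_add qpi_mult qpi_scal Z1_def pi_I0 pd_power Q11 uq.sc_mult_right)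

text \<open>\<partial>2 hits either x_12, leaving a multiple of x times x_1 that \<partial>1 lowers,
  or x, leaving an element of Z1 that \<partial>1 kills.\<close>

lemma low2: "x \<in> Z2 \<Longrightarrow> \<pi> (pd 1 (pd 2 (x * xb))) = \<pi> (scal qq x)"
proof -
  assume x: "x \<in> Z2"
  have "pd 2 x * gl Q \<alpha>2 xb \<in> Z1" using x by (auto simp: Z2_def intro!: subalg_mult subalg_gl subalg_Z Z1_mem)
  then have "\<pi> (pd 1 (pd 2 x * gl Q \<alpha>2 xb)) = 0" by (simp add: Z1_def pi_I0)
  moreover have "\<pi> (pd 1 x) = 0" using x by (simp add: Z2_def Z1_def pi_I0)
  ultimately show ?thesis
    by (simp add: pd_mult[of 2] pd_b pd_add pd_scal pd_mult[of 1 x] pd_wd qpi_add qpi_scal qpi_mult)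
qed

lemma E2_Z2: "x \<in> Z2 \<Longrightarrow> \<pi> (pd 1 (pd 2 x)) = 0"
  by (simp add: Z2_def Z1_def pi_I0)

text \<open>\<partial>3 turns x_123 into x_12 up to a scalar, and \<open>low2\<close> finishes; the
  term where \<partial>3 hits x stays in Z2, on which \<partial>1\<partial>2 vanishes.\<close>

lemma low3: "x \<in> Z3 \<Longrightarrow> \<pi> (pd 1 (pd 2 (pd 3 (x * xc)))) = \<pi> (scal (rq * qq) x)"
proof -
  assume x: "x \<in> Z3"
  have "pd 3 x * gl Q \<alpha>3 xc \<in> Z2" using x by (auto simp: Z3_def intro!: subalg_mult subalg_gl subalg_Z Z2_mem)
  then have "\<pi> (pd 1 (pd 2 (pd 3 x * gl Q \<alpha>3 xc))) = 0" by (rule E2_Z2)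
  moreover have "x \<in> Z2" using x by (simp add: Z3_def)
  ultimately show ?thesis
    using low2[of x] by (simp add: pd_mult[of 3] pd_c pd_add pd_scal qpi_add qpi_scal uq.sc_sc)
qed

lemma E3_Z3: "x \<in> Z3 \<Longrightarrow> \<pi> (pd 1 (pd 2 (pd 3 x))) = 0"
  by (rule E2_Z2) (simp add: Z3_def)

text \<open>\<partial>2 turns \<open>xd ^ n\<close> into \<open>xd ^ (n - 1) * xc\<close> with the
  factor (1 - s)[n]_s, and \<open>low3\<close> removes the last factor.\<close>

lemma low4: "x \<in> Z4 \<Longrightarrow> \<pi> (pd 1 (pd 2 (pd 3 (pd 2 (x * xd ^ n))))) = \<pi> (scal ((1 - s) * qnum s n * (rq * qq)) (x * xd ^ (n - 1)))"
proof -
  assume x: "x \<in> Z4"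
  then have x3: "x \<in> Z3" by (simp add: Z4_def)
  have "pd 2 x * gl Q \<alpha>2 (xd ^ n) \<in> Z3"
    using x by (auto simp: Z4_def intro!: subalg_mult subalg_gl subalg_power subalg_Z Z3_mem)
  then have "\<pi> (pd 1 (pd 2 (pd 3 (pd 2 x * gl Q \<alpha>2 (xd ^ n))))) = 0" by (rule E3_Z3)
  moreover have "\<pi> (x * pd 2 (xd ^ n)) = \<pi> (scal ((1 - s) * qnum s n) (x * xd ^ (n - 1) * xc))"
    using pd2_d_pow[of n] unfolding I_diff by (simp add: qpi_mult qpi_scal uq.sc_mult_right mult.assoc)
  from pi_pd[OF pi_pd[OF pi_pd[OF this, of 3], of 2], of 1]
  have "\<pi> (pd 1 (pd 2 (pd 3 (x * pd 2 (xd ^ n))))) = scuq ((1 - s) * qnum s n) (\<pi> (pd 1 (pd 2 (pd 3 (x * xd ^ (n - 1) * xc)))))"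
    by (simp only: pd_scal qpi_scal)
  moreover have "x * xd ^ (n - 1) \<in> Z3" by (intro subalg_mult subalg_power subalg_Z x3 Z3_mem)
  note low3[OF this]
  ultimately show ?thesis
    by (simp add: pd_mult[of 2 x] pd_add qpi_add qpi_scal uq.sc_sc mult.assoc)
qed

lemma low5: "x \<in> Z5 \<Longrightarrow> \<pi> (pd 2 (x * xe)) = \<pi> x"
  by (simp add: pd_mult pd_wd Z5_def pi_I0 qpi_add qpi_mult)

lemma low6: "x \<in> Z6 \<Longrightarrow> \<pi> (pd 2 (pd 3 (x * xf))) = \<pi> (scal rq x)"
proof -
  assume x: "x \<in> Z6"
  have "pd 3 x * gl Q \<alpha>3 xf \<in> Z5" using x by (auto simp: Z6_def intro!: subalg_mult subalg_gl subalg_Z Z567_mem)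
  then have "\<pi> (pd 2 (pd 3 x * gl Q \<alpha>3 xf)) = 0" by (simp add: Z5_def pi_I0)
  moreover have "x \<in> Z5" using x by (simp add: Z6_def)
  ultimately show ?thesis
    using low5[of x] by (simp add: pd_mult[of 3] pd_f pd_add pd_scal qpi_add qpi_scal)
qed

lemma low7: "x \<in> Z7 \<Longrightarrow> \<pi> (pd 3 (x * xg ^ n)) = \<pi> (scal (qnum r n) (x * xg ^ (n - 1)))"
  by (simp add: pd_mult qpi_add qpi_mult qpi_scal Z7_def pi_I0 pd_power Q33 uq.sc_mult_right)

lemma rq_nz: "rq \<noteq> 0" and qq_nz: "qq \<noteq> 0"
  using q1 r1 by auto

lemma qnum_q_nz: "1 \<le> n \<Longrightarrow> qnum q n \<noteq> 0" and qnum_r_nz: "1 \<le> n \<Longrightarrow> qnum r n \<noteq> 0"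
  using qnum_nonroot qn rn by blast+

text \<open>Applied to I and to the sum of two pre-Nichols ideals. Closure under right
  multiplication is what peeling off generators on the right calls for.\<close>

definition pdclosed :: "(3, 'k) tens_alg set \<Rightarrow> bool" where
  "pdclosed P \<longleftrightarrow> pm.subspace P \<and> I \<subseteq> P \<and> (\<forall>x\<in>P. \<forall>z. x * z \<in> P) \<and> (\<forall>x\<in>P. \<forall>i. pd i x \<in> P)"

lemma pdclosed_I: "pdclosed I"
  by (simp add: pdclosed_def I_subspace pd_I tideal_right[OF tideal_I])

text \<open>Modulo \<open>I\<close>, the operator \<open>E\<close> acts on \<open>\<Sum> K t\<^sup>n\<close> (sum over \<open>n \<in> D\<close>) like a weighted derivative in \<open>t\<close>.\<close>

definition lowers :: "((3, 'k) tens_alg \<Rightarrow> (3, 'k) tens_alg) \<Rightarrow> (3, 'k) tens_alg set \<Rightarrow> (3, 'k) tens_alg \<Rightarrow> nat set \<Rightarrow> bool" where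
  "lowers E K t D \<longleftrightarrow> pm.subspace K \<and> plin E \<and> (\<forall>P. pdclosed P \<longrightarrow> (\<forall>x\<in>P. E x \<in> P)) \<and>
    (D = UNIV \<or> (\<exists>m. D = {..m})) \<and>
    (\<exists>l. l 0 = 0 \<and> (\<forall>n\<in>D. 1 \<le> n \<longrightarrow> l n \<noteq> 0) \<and> (\<forall>x\<in>K. \<forall>n\<in>D. E (x * t ^ n) - scal (l n) (x * t ^ (n - 1)) \<in> I))"

lemma bounded_expand:
  assumes "pm.subspace K" "D = UNIV \<or> (\<exists>m. D = {..m})" "z \<in> lay K t D"
  obtains N X where "\<And>n. X n \<in> K" "{..N} \<subseteq> D" "z = (\<Sum>n\<le>N. X n * t ^ n)"
proof -
  obtain N X where X: "\<And>n. X n \<in> K" "\<And>n. n \<notin> D \<Longrightarrow> X n = 0" "z = (\<Sum>n\<le>N. X n * t ^ n)"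
    by (rule lay_expand[OF assms(1,3)]) blast
  from assms(2) show ?thesis
  proof
    assume "D = UNIV"
    then show ?thesis using that[OF X(1) _ X(3)] by simp
  next
    assume "\<exists>m. D = {..m}"
    then obtain m where m: "D = {..m}" by blast
    have "(\<Sum>n\<le>N. X n * t ^ n) = (\<Sum>n\<le>max N m. if n \<le> N then X n * t ^ n else 0)"
      by (rule sum.mono_neutral_cong_left) auto
    also have "\<dots> = (\<Sum>n\<le>m. if n \<le> N then X n * t ^ n else 0)"
      by (rule sum.mono_neutral_right) (auto simp: X(2) m)
    also have "\<dots> = (\<Sum>n\<le>m. (if n \<le> N then X n else 0) * t ^ n)" by (rule sum.cong) auto
    finally show ?thesis
      using that[of "\<lambda>n. if n \<le> N then X n else 0" m] X(1,3) m pm.subspace_0[OF assms(1)] by auto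
  qed
qed

lemma lowers_coeff:
  assumes low: "lowers E K t D" and P: "pdclosed P" and X: "\<And>n. X n \<in> K" and N: "{..N} \<subseteq> D"
  shows "(\<Sum>n\<le>N. X n * t ^ n) \<in> P \<Longrightarrow> n \<le> N \<Longrightarrow> X n \<in> P"
    "E (\<Sum>n\<le>N. X n * t ^ n) \<in> P \<Longrightarrow> 1 \<le> n \<Longrightarrow> n \<le> N \<Longrightarrow> X n \<in> P"
proof -
  obtain l where l: "l 0 = 0" "\<And>n. n \<in> D \<Longrightarrow> 1 \<le> n \<Longrightarrow> l n \<noteq> 0"
    "\<And>x n. x \<in> K \<Longrightarrow> n \<in> D \<Longrightarrow> E (x * t ^ n) - scal (l n) (x * t ^ (n - 1)) \<in> I"
    using low unfolding lowers_def by blast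
  have E: "plin E" "\<And>x. x \<in> P \<Longrightarrow> E x \<in> P" and K: "pm.subspace K" using low P by (auto simp: lowers_def)
  have P': "pm.subspace P" "I \<subseteq> P" "\<And>x. x \<in> P \<Longrightarrow> x * t \<in> P" using P by (auto simp: pdclosed_def)
  note lw = lowering[OF E P' K, of N l X]
  show "(\<Sum>n\<le>N. X n * t ^ n) \<in> P \<Longrightarrow> n \<le> N \<Longrightarrow> X n \<in> P"
    by (rule lw(2)) (use l X N in auto)
  show "E (\<Sum>n\<le>N. X n * t ^ n) \<in> P \<Longrightarrow> 1 \<le> n \<Longrightarrow> n \<le> N \<Longrightarrow> X n \<in> P"
    by (rule lw(1)) (use l X N in auto)
qed

text \<open>An element of P in the layer has its coefficients in P, hence in U, and powers of t on
  the right do not lead out of U.\<close>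

lemma lowers_peel:
  assumes low: "lowers E K t D" and P: "pdclosed P"
    and N: "pm.subspace U" "\<And>x z. x \<in> U \<Longrightarrow> x * z \<in> U" and sub: "P \<inter> K \<subseteq> U"
  shows "P \<inter> lay K t D \<subseteq> U"
proof
  fix z assume z: "z \<in> P \<inter> lay K t D"
  have "pm.subspace K" "D = UNIV \<or> (\<exists>m. D = {..m})" using low by (auto simp: lowers_def)
  then obtain M X where X: "\<And>n. X n \<in> K" "{..M} \<subseteq> D" "z = (\<Sum>n\<le>M. X n * t ^ n)"
    by (rule bounded_expand) (use z in auto)
  have "X n \<in> U" if "n \<le> M" for n
    using lowers_coeff(1)[OF low P, of X M n, OF X(1,2)] z X(1,3) that sub by blast
  then show "z \<in> U" unfolding X(3) by (intro pm.subspace_sum[OF N(1)] N(2)) auto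
qed

text \<open>If E z lies in I, so do the coefficients of positive exponent, and the constant term is
  what remains.\<close>

lemma lowers_kernel:
  assumes low: "lowers E K t D" and z: "z \<in> lay K t D" "E z \<in> I"
  shows "\<exists>x\<in>K. z - x \<in> I"
proof -
  have "pm.subspace K" "D = UNIV \<or> (\<exists>m. D = {..m})" using low by (auto simp: lowers_def)
  then obtain M X where X: "\<And>n. X n \<in> K" "{..M} \<subseteq> D" "z = (\<Sum>n\<le>M. X n * t ^ n)"
    by (rule bounded_expand) (use z in auto)
  have "z = X 0 + (\<Sum>n\<in>{1..M}. X n * t ^ n)"
  proof -
    have "{..M} = insert 0 {1..M}" by auto
    then show ?thesis unfolding X(3) by simp
  qed
  moreover have "(\<Sum>n\<in>{1..M}. X n * t ^ n) \<in> I"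
    using lowers_coeff(2)[OF low pdclosed_I, of X M, OF X(1,2)] z(2) X(3)
    by (intro pm.subspace_sum[OF I_subspace] tideal_right[OF tideal_I]) auto
  ultimately show ?thesis using X(1)[of 0] by (intro bexI[of _ "X 0"]) auto
qed

lemma lowersI:
  assumes "pm.subspace K" "D = UNIV \<or> (\<exists>m. D = {..m})" "plin E" "\<And>P x. pdclosed P \<Longrightarrow> x \<in> P \<Longrightarrow> E x \<in> P"
    "l 0 = 0" "\<And>n. n \<in> D \<Longrightarrow> 1 \<le> n \<Longrightarrow> l n \<noteq> 0"
    "\<And>x n. x \<in> K \<Longrightarrow> n \<in> D \<Longrightarrow> \<pi> (E (x * t ^ n)) = \<pi> (scal (l n) (x * t ^ (n - 1)))"
  shows "lowers E K t D"
  unfolding lowers_def I_diff using assms by blast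

lemma lowersI2:
  assumes "pm.subspace K" "plin E" "\<And>P x. pdclosed P \<Longrightarrow> x \<in> P \<Longrightarrow> E x \<in> P"
    "\<And>x. x \<in> K \<Longrightarrow> \<pi> (E x) = 0" "l \<noteq> 0" "\<And>x. x \<in> K \<Longrightarrow> \<pi> (E (x * t)) = \<pi> (scal l x)"
  shows "lowers E K t {..1}"
proof (rule lowersI[OF assms(1) _ assms(2,3), of _ "\<lambda>n. if n = 0 then 0 else l"])
  fix x and n :: nat assume x: "x \<in> K" and "n \<in> {..1}"
  then have "n = 0 \<or> n = 1" by auto
  then show "\<pi> (E (x * t ^ n)) = \<pi> (scal (if n = 0 then 0 else l) (x * t ^ (n - 1)))"
    using assms(4,6)[OF x] by (auto simp: qpi_zero)
qed (use assms(5) in auto)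

lemma pdclosed_pd: "pdclosed P \<Longrightarrow> x \<in> P \<Longrightarrow> pd i x \<in> P"
  by (simp add: pdclosed_def)

lemma lowers1: "lowers (pd 1) K2 xa UNIV"
  by (rule lowersI[of _ _ _ "qnum q"]) (use K_subspace K_Z low1 qnum_q_nz plin_pd pdclosed_pd in auto)

lemma lowers2: "lowers (\<lambda>x. pd 1 (pd 2 x)) K3 xb {..1}"
  by (rule lowersI2[of _ _ qq]) (use K_subspace K_Z low2 qq_nz E2_Z2 in \<open>auto intro!: plin_comp[OF plin_pd] plin_pd pdclosed_pd\<close>)

lemma lowers3: "lowers (\<lambda>x. pd 1 (pd 2 (pd 3 x))) K4 xc {..1}"
  by (rule lowersI2[of _ _ "rq * qq"]) (use K_subspace K_Z low3 qq_nz rq_nz E3_Z3 in \<open>auto intro!: plin_comp[OF plin_pd] plin_pd pdclosed_pd\<close>)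

lemma lowers4: "lowers (\<lambda>x. pd 1 (pd 2 (pd 3 (pd 2 x)))) K5 xd {..L - 1}"
proof (rule lowersI[of _ _ _ "\<lambda>n. (1 - s) * qnum s n * (rq * qq)"])
  fix n assume "n \<in> {..L - 1}" "1 \<le> n"
  \<comment> \<open>The bound L - 1, with L positive, keeps n below the order of s, where the
    s-number is nonzero.\<close>
  then have "n < L" using L(1) by auto
  then show "(1 - s) * qnum s n * (rq * qq) \<noteq> 0"
    using qnum_s_nz[OF \<open>1 \<le> n\<close>] rq_nz qq_nz s1(2) by auto
qed (use K_subspace K_Z low4 in \<open>auto intro!: plin_comp[OF plin_pd] plin_pd pdclosed_pd\<close>)

lemma lowers5: "lowers (pd 2) K6 xe {..1}"
  by (rule lowersI2[of _ _ 1]) (use K_subspace K_Z low5 in \<open>auto intro!: plin_pd pdclosed_pd simp: Z5_def pi_I0\<close>)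

lemma lowers6: "lowers (\<lambda>x. pd 2 (pd 3 x)) K7 xf {..1}"
  by (rule lowersI2[of _ _ rq]) (use K_subspace K_Z low6 rq_nz in \<open>auto intro!: plin_comp[OF plin_pd] plin_pd pdclosed_pd simp: Z6_def Z5_def pi_I0\<close>)

lemma lowers7: "lowers (pd 3) K8 xg UNIV"
  by (rule lowersI[of _ _ _ "qnum r"]) (use K_subspace K_Z low7 qnum_r_nz plin_pd pdclosed_pd in auto)

lemma peel_all:
  assumes P: "pdclosed P" and U: "pm.subspace U" "\<And>x z. x \<in> U \<Longrightarrow> x * z \<in> U" and sub: "P \<inter> K8 \<subseteq> U"
  shows "P \<inter> K1 \<subseteq> U"
proof -
  note p7 = lowers_peel[OF lowers7 P U(1) U(2) sub, folded K7_def]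
  note p6 = lowers_peel[OF lowers6 P U(1) U(2) p7, folded K6_def]
  note p5 = lowers_peel[OF lowers5 P U(1) U(2) p6, folded K5_def]
  note p4 = lowers_peel[OF lowers4 P U(1) U(2) p5, folded K4_def]
  note p3 = lowers_peel[OF lowers3 P U(1) U(2) p4, folded K3_def]
  note p2 = lowers_peel[OF lowers2 P U(1) U(2) p3, folded K2_def]
  show ?thesis by (rule lowers_peel[OF lowers1 P U(1) U(2) p2, folded K1_def])
qed

section \<open>Coordinates with \<open>y\<close> in front\<close>

lemma qcomm_power:
  assumes "\<pi> xd * \<pi> z = scuq t (\<pi> z * \<pi> xd)" "t \<noteq> 0"
  shows "\<exists>t. t \<noteq> 0 \<and> \<pi> (z ^ n) * \<pi> (xd ^ m) = scuq t (\<pi> (xd ^ m) * \<pi> (z ^ n))"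
proof -
  have 1: "\<pi> z * \<pi> xd = scuq (inverse t) (\<pi> xd * \<pi> z)"
    using assms by (simp add: uq.sc_sc uq.sc_one)
  have 2: "\<pi> z * \<pi> (xd ^ m) = scuq (inverse t ^ m) (\<pi> (xd ^ m) * \<pi> z)"
    by (rule pi_comm_pow[OF 1])
  have 3: "\<pi> (xd ^ m) * \<pi> z = scuq (t ^ m) (\<pi> z * \<pi> (xd ^ m))"
    unfolding 2 using assms(2) by (simp add: uq.sc_sc uq.sc_one power_inverse)
  have "\<pi> (xd ^ m) * \<pi> (z ^ n) = scuq ((t ^ m) ^ n) (\<pi> (z ^ n) * \<pi> (xd ^ m))"
    by (rule pi_comm_pow[OF 3])
  then have "\<pi> (z ^ n) * \<pi> (xd ^ m) = scuq (inverse ((t ^ m) ^ n)) (\<pi> (xd ^ m) * \<pi> (z ^ n))"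
    using assms(2) by (simp add: uq.sc_sc uq.sc_one)
  then show ?thesis using assms(2) by (intro exI[of _ "inverse ((t ^ m) ^ n)"]) simp
qed

definition mm' :: "nat \<times> nat \<times> nat \<times> nat \<times> nat \<times> nat \<times> nat \<Rightarrow> (3, 'k) tens_alg" where
  "mm' = (\<lambda>(n1, n2, n3, n4, n5, n6, n7).
     y ^ (n4 div L) * xg ^ n1 * xf ^ n2 * xe ^ n3 * xd ^ (n4 mod L) * xc ^ n5 * xb ^ n6 * xa ^ n7)"

text \<open>Only x_3, x_23 and x_2 stand to the left of x_1223, and it commutes with all three up to
  nonzero scalars. The block with exponent L(n4 div L) thus moves to the front, and the nonzero
  scalar preserves both spanning and independence.\<close>

lemma mm_mm': "\<exists>t. t \<noteq> 0 \<and> \<pi> (mm e) = scuq t (\<pi> (mm' e))"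
proof -
  obtain n1 n2 n3 n4 n5 n6 n7 where e: "e = (n1, n2, n3, n4, n5, n6, n7)" by (cases e) auto
  let ?m = "n4 div L * L" and ?R = "\<pi> (xd ^ (n4 mod L)) * (\<pi> (xc ^ n5) * (\<pi> (xb ^ n6) * \<pi> (xa ^ n7)))"
  have k_nz: "Q 1 2 * Q 3 2 \<noteq> 0" "Q 1 2 * Q 1 3 * Q 2 3 \<noteq> 0" "Q 1 3 * Q 2 3 * (Q 2 3 * r) \<noteq> 0"
    using q_nz r1 by auto
  obtain t1 where t1: "t1 \<noteq> 0" "\<pi> (xe ^ n3) * \<pi> (xd ^ ?m) = scuq t1 (\<pi> (xd ^ ?m) * \<pi> (xe ^ n3))"
    using qcomm_power[OF A.de k_nz(1)] by blast
  obtain t2 where t2: "t2 \<noteq> 0" "\<pi> (xf ^ n2) * \<pi> (xd ^ ?m) = scuq t2 (\<pi> (xd ^ ?m) * \<pi> (xf ^ n2))"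
    using qcomm_power[OF A.df k_nz(2)] by blast
  obtain t3 where t3: "t3 \<noteq> 0" "\<pi> (xg ^ n1) * \<pi> (xd ^ ?m) = scuq t3 (\<pi> (xd ^ ?m) * \<pi> (xg ^ n1))"
    using qcomm_power[OF A.dg k_nz(3)] by blast
  have yk: "y ^ (n4 div L) = xd ^ ?m" by (simp add: y_def power_mult[symmetric] mult.commute)
  have "\<pi> (xd ^ n4) = \<pi> (xd ^ ?m) * \<pi> (xd ^ (n4 mod L))"
    by (simp flip: qpi_mult power_add)
  then have "\<pi> (mm e) = \<pi> (xg ^ n1) * (\<pi> (xf ^ n2) * (\<pi> (xe ^ n3) * (\<pi> (xd ^ ?m) * ?R)))"
    unfolding e pi_mm by (simp add: mult.assoc)
  also have "\<dots> = scuq (t1 * t2 * t3) (\<pi> (xd ^ ?m) * (\<pi> (xg ^ n1) * (\<pi> (xf ^ n2) * (\<pi> (xe ^ n3) * ?R))))"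
    by (simp only: uq.ext_rule[OF t1(2)] uq.ext_rule[OF t2(2)] uq.ext_rule[OF t3(2)] uq.sc_mult_left uq.sc_mult_right
      uq.sc_sc mult.assoc)
  also have "\<pi> (xd ^ ?m) * (\<pi> (xg ^ n1) * (\<pi> (xf ^ n2) * (\<pi> (xe ^ n3) * ?R))) = \<pi> (mm' e)"
    unfolding e mm'_def by (simp add: qpi_mult mult.assoc yk)
  finally show ?thesis using t1 t2 t3 by (intro exI[of _ "t1 * t2 * t3"]) auto
qed

lemma mm'_K1: "e \<in> D21_exponents \<Longrightarrow> mm' e \<in> K1"
proof -
  assume e: "e \<in> D21_exponents"
  obtain n1 n2 n3 n4 n5 n6 n7 where e': "e = (n1, n2, n3, n4, n5, n6, n7)" by (cases e) auto
  have b: "n2 \<in> {..1}" "n3 \<in> {..1}" "n5 \<in> {..1}" "n6 \<in> {..1}"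
    using e by (auto simp: e' D21_exponents_def)
  have b4: "n4 mod L \<in> {..L - 1}"
    using mod_less_divisor[of L n4] L(1) unfolding atMost_iff by linarith
  have "y ^ (n4 div L) \<in> K8" unfolding K8_def by (intro pm.span_base) simp
  then show ?thesis
    unfolding e' mm'_def prod.case K1_def K2_def K3_def K4_def K5_def K6_def K7_def
    by (intro lay_base b b4 UNIV_I)
qed

lemma K1_spans: "\<exists>x\<in>K1. z - x \<in> I"
proof -
  let ?U = "{x + z | x z. x \<in> I \<and> z \<in> K1}"
  have U: "pm.subspace ?U" by (rule pm.subspace_sums[OF I_subspace K_subspace(8)])
  obtain w where w: "w \<in> pm.span (mm ` D21_exponents)" "z - w \<in> I"
    using W_UNIV[of z] by (auto simp: W_def)
  have "w \<in> ?U"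
  proof (rule plin_span_into[OF plin_id U _ w(1)])
    fix m assume "m \<in> mm ` D21_exponents"
    then obtain e where e: "m = mm e" "e \<in> D21_exponents" by blast
    obtain t where "\<pi> (mm e) = scuq t (\<pi> (mm' e))" using mm_mm' by blast
    then have "mm e - scal t (mm' e) \<in> I" by (simp add: I_diff qpi_scal)
    moreover have "scal t (mm' e) \<in> K1" using mm'_K1[OF e(2)] pm.subspace_scale[OF K_subspace(8)] by blast
    moreover have "m = (mm e - scal t (mm' e)) + scal t (mm' e)" by (simp add: e(1))
    ultimately show "m \<in> ?U" by blast
  qed
  then obtain x k where xk: "w = x + k" "x \<in> I" "k \<in> K1" by blast
  then have "z - k = (z - w) + x" by simp
  then have "z - k \<in> I" using w(2) xk(2) tideal_add[OF tideal_I] by metis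
  then show ?thesis using xk(3) by blast
qed

text \<open>Each lowering operator begins by applying some \<partial>j, so it sends z into I.
  Starting from K1, \<open>lowers_kernel\<close> therefore drops one layer at a time until only
  polynomials in y are left.\<close>

lemma common_kernel:
  assumes "\<And>i. pd i z \<in> I"
  shows "\<exists>x\<in>K8. z - x \<in> I"
proof -
  have sub: "pd i x \<in> I" if "z - x \<in> I" for i x
    using pd_I[OF that, of i] assms[of i] tideal_diff[OF tideal_I, of "pd i z" "pd i (z - x)"] by (simp add: pd_diff)
  have step: "\<exists>x\<in>K. z - x \<in> I" if "lowers (\<lambda>x. E' (pd j x)) K t D" "\<And>x. x \<in> I \<Longrightarrow> E' x \<in> I" "\<exists>x\<in>lay K t D. z - x \<in> I" for E' j K t D
  proof -
    from that(3) obtain x where x: "x \<in> lay K t D" "z - x \<in> I" by blast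
    from lowers_kernel[OF that(1) x(1) that(2)[OF sub[OF x(2)]]] obtain w where w: "w \<in> K" "x - w \<in> I" by blast
    then have "z - w \<in> I" using tideal_minus_cancel[OF tideal_I x(2)] by blast
    then show ?thesis using w by blast
  qed
  have 1: "\<exists>x\<in>K2. z - x \<in> I" by (rule step[of "\<lambda>x. x" 1, OF lowers1 _ K1_spans[of z, unfolded K1_def]])
  have 2: "\<exists>x\<in>K3. z - x \<in> I" by (rule step[OF lowers2 pd_I 1[unfolded K2_def]])
  have 3: "\<exists>x\<in>K4. z - x \<in> I" by (rule step[of "\<lambda>x. pd 1 (pd 2 x)", OF lowers3 pd_I[OF pd_I] 2[unfolded K3_def]])
  have 4: "\<exists>x\<in>K5. z - x \<in> I" by (rule step[of "\<lambda>x. pd 1 (pd 2 (pd 3 x))", OF lowers4 pd_I[OF pd_I[OF pd_I]] 3[unfolded K4_def]])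
  have 5: "\<exists>x\<in>K6. z - x \<in> I" by (rule step[of "\<lambda>x. x" 2, OF lowers5 _ 4[unfolded K5_def]])
  have 6: "\<exists>x\<in>K7. z - x \<in> I" by (rule step[OF lowers6 pd_I 5[unfolded K6_def]])
  show ?thesis by (rule step[of "\<lambda>x. x" 3, OF lowers7 _ 6[unfolded K7_def]])
qed

section \<open>Independence of the powers of \<open>y\<close> and of the PBW monomials\<close>

text \<open>The words occurring in the relations are not factors of the periodic word \<open>(1232)\<^sup>m\<close>.\<close>

definition pw :: "nat \<Rightarrow> 3 list" where
  "pw m = concat (replicate m [1, 2, 3, 2])"

lemma length_pw: "length (pw m) = 4 * m"
  by (induction m) (auto simp: pw_def)

lemma pw_nth: "j < 4 * m \<Longrightarrow> pw m ! j = [1, 2, 3, 2] ! (j mod 4)"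
proof (induction m arbitrary: j)
  case (Suc m)
  have "pw (Suc m) = [1, 2, 3, 2] @ pw m" by (simp add: pw_def)
  moreover have "length [1, 2, 3, 2 :: 3] = 4" by simp
  ultimately have nth: "pw (Suc m) ! j = (if j < 4 then [1, 2, 3, 2] ! j else pw m ! (j - 4))"
    by (simp only: nth_append)
  show ?case
  proof (cases "j < 4")
    case False
    then have "j - 4 < 4 * m" using Suc.prems by arith
    then have "pw m ! (j - 4) = [1, 2, 3, 2] ! ((j - 4) mod 4)" by (rule Suc.IH)
    moreover have "(j - 4) mod 4 = j mod 4" using False by (simp only: le_mod_geq not_less)
    ultimately show ?thesis unfolding nth using False by (simp only: if_False)
  next
    case True
    then have "j mod 4 = j" by (rule mod_less)
    then show ?thesis unfolding nth using True by (simp only: if_True)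
  qed
qed simp

text \<open>The letters are read off from the position modulo 4.\<close>

lemma pw_factor2: "pw m = u @ [i, j] @ v \<Longrightarrow> (i, j) \<in> {(1, 2), (2, 3), (3, 2), (2, 1)}"
proof -
  assume eq: "pw m = u @ [i, j] @ v"
  let ?p = "length u"
  have "?p + 1 < 4 * m" using arg_cong[OF eq, of length] by (simp add: length_pw)
  then have "i = [1, 2, 3, 2] ! (?p mod 4)" "j = [1, 2, 3, 2] ! (Suc ?p mod 4)"
    using pw_nth[of ?p m] pw_nth[of "Suc ?p" m] arg_cong[OF eq, of "\<lambda>l. l ! ?p"] arg_cong[OF eq, of "\<lambda>l. l ! Suc ?p"]
    by (simp_all add: nth_append)
  moreover have "?p mod 4 = 0 \<or> ?p mod 4 = 1 \<or> ?p mod 4 = 2 \<or> ?p mod 4 = 3" by linarith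
  ultimately show ?thesis by (auto simp: mod_Suc)
qed

lemma pw_factor3: "pw m = u @ [i, j, k] @ v \<Longrightarrow> (i, j, k) \<in> {(1, 2, 3), (2, 3, 2), (3, 2, 1), (2, 1, 2)}"
proof -
  assume eq: "pw m = u @ [i, j, k] @ v"
  let ?p = "length u"
  have "?p + 2 < 4 * m" using arg_cong[OF eq, of length] by (simp add: length_pw)
  then have "i = [1, 2, 3, 2] ! (?p mod 4)" "j = [1, 2, 3, 2] ! (Suc ?p mod 4)" "k = [1, 2, 3, 2] ! (Suc (Suc ?p) mod 4)"
    using pw_nth[of ?p m] pw_nth[of "Suc ?p" m] pw_nth[of "Suc (Suc ?p)" m] arg_cong[OF eq, of "\<lambda>l. l ! ?p"]
      arg_cong[OF eq, of "\<lambda>l. l ! Suc ?p"] arg_cong[OF eq, of "\<lambda>l. l ! Suc (Suc ?p)"]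
    by (simp_all add: nth_append)
  moreover have "?p mod 4 = 0 \<or> ?p mod 4 = 1 \<or> ?p mod 4 = 2 \<or> ?p mod 4 = 3" by linarith
  ultimately show ?thesis by (auto simp: mod_Suc)
qed

lemma lookup_pw2: "(i, j) \<notin> {(1, 2), (2, 3), (3, 2), (2, 1)} \<Longrightarrow> Poly_Mapping.lookup (bs u * wd [i, j] * bs v) (Word (pw m)) = (0 :: 'k)"
  using pw_factor2[of m "letters u" i j "letters v"]
  by (auto simp: wd_eq bs_mult lookup_single when_def plus_word_def)

lemma lookup_pw3: "(i, j, k) \<notin> {(1, 2, 3), (2, 3, 2), (3, 2, 1), (2, 1, 2)} \<Longrightarrow> Poly_Mapping.lookup (bs u * wd [i, j, k] * bs v) (Word (pw m)) = (0 :: 'k)"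
  using pw_factor3[of m "letters u" i j k "letters v"]
  by (auto simp: wd_eq bs_mult lookup_single when_def plus_word_def)

lemma lookup_pw_I:
  assumes "x \<in> I" shows "Poly_Mapping.lookup x (Word (pw m)) = 0"
proof -
  let ?S = "{x. Poly_Mapping.lookup x (Word (pw m)) = (0 :: 'k)}"
  have sub: "pm.subspace ?S" by (simp add: pm.subspace_def lookup_add)
  have "{bs u * g * bs v | u g v. g \<in> {xe ^ 2, xw Q [1, 3], xw Q [1, 1, 2], xw Q [3, 3, 2]}} \<subseteq> ?S"
  proof safe
    fix u v
    show "Poly_Mapping.lookup (bs u * xe ^ 2 * bs v) (Word (pw m)) = (0 :: 'k)"
      by (simp add: power2_eq_square wd_mult lookup_pw2)
    show "Poly_Mapping.lookup (bs u * xw Q [1, 3] * bs v) (Word (pw m)) = 0"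
      by (simp add: x13_eq wd_mult left_diff_distrib right_diff_distrib lookup_minus lookup_pw2)
    show "Poly_Mapping.lookup (bs u * xw Q [1, 1, 2] * bs v) (Word (pw m)) = 0"
      by (simp add: x112_eq xb_eq wd_mult left_diff_distrib right_diff_distrib lookup_minus lookup_pw3 scal_diff)
    show "Poly_Mapping.lookup (bs u * xw Q [3, 3, 2] * bs v) (Word (pw m)) = 0"
      by (simp add: x332_eq x32_eq wd_mult left_diff_distrib right_diff_distrib lookup_minus lookup_pw3 scal_diff)
  qed
  then have "pm.span {bs u * g * bs v | u g v. g \<in> {xe ^ 2, xw Q [1, 3], xw Q [1, 1, 2], xw Q [3, 3, 2]}} \<subseteq> ?S"
    by (rule pm.span_minimal[OF _ sub])
  then show ?thesis using assms unfolding I_eq Idl_TV by blast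
qed

lemma comp_bfc: "xb \<in> TV_comp 2" "xf \<in> TV_comp 2" "xc \<in> TV_comp 3" "xd \<in> TV_comp 4"
proof -
  show 2: "xb \<in> TV_comp 2" "xf \<in> TV_comp 2"
    unfolding xb_eq xf_eq using bracket_TV_comp[OF wd1_TV_comp wd1_TV_comp] by (simp_all add: numeral_2_eq_2)
  show 3: "xc \<in> TV_comp 3"
    unfolding xc_eq using bracket_TV_comp[OF wd1_TV_comp 2(2)] by (simp add: numeral_3_eq_3)
  have "xc * xe - scal (- (Q 1 2 * Q 3 2)) (xe * xc) \<in> TV_comp (3 + 1)"
    by (rule bracket_TV_comp[OF 3 wd1_TV_comp])
  then show "xd \<in> TV_comp 4" by (simp add: xd_eq scal_minus)
qed

text \<open>When the left factor is homogeneous in length, a word can be cut in only one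
  place.\<close>

lemma lookup_mult_split:
  fixes x z :: "(3, 'k) tens_alg"
  assumes "x \<in> TV_comp n" "length u = n"
  shows "Poly_Mapping.lookup (x * z) (Word (u @ v)) = Poly_Mapping.lookup x (Word u) * Poly_Mapping.lookup z (Word v)"
proof -
  have "Poly_Mapping.lookup ((\<Sum>w\<in>A. Poly_Mapping.single w (Poly_Mapping.lookup x w)) * z) (Word (u @ v)) =
      Poly_Mapping.lookup (\<Sum>w\<in>A. Poly_Mapping.single w (Poly_Mapping.lookup x w)) (Word u) * Poly_Mapping.lookup z (Word v)"
    if "A \<subseteq> Poly_Mapping.keys x" for A
    using that
  proof (induction A rule: infinite_finite_induct)
    case (insert w A)
    have "length (letters w) = n" using insert assms(1) by (auto simp: TV_comp_def)
    have "Poly_Mapping.lookup (Poly_Mapping.single w c * z) (Word (u @ v)) = (if w = Word u then c * Poly_Mapping.lookup z (Word v) else 0)" for c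
    proof (induction z rule: pm_induct_single)
      case (single w' d)
      have "w + w' = Word (u @ v) \<longleftrightarrow> w = Word u \<and> w' = Word v"
        using \<open>length (letters w) = n\<close> assms(2) by (cases w; cases w') (auto simp: plus_word_def)
      then show ?case by (auto simp: mult_single lookup_single when_def)
    qed (auto simp: distrib_left lookup_add algebra_simps)
    then show ?case using insert by (auto simp: distrib_right lookup_add lookup_single when_def)
  qed auto
  from this[of "Poly_Mapping.keys x"] show ?thesis by (simp flip: expand_single)
qed

text \<open>The word 1232 has coefficient 1 in x_1223, and homogeneity in length makes coefficients
  of concatenated words multiplicative.\<close>

lemma lookup_d_pow: "Poly_Mapping.lookup (xd ^ n) (Word (pw n)) = 1"
proof (induction n)
  case 0
  show ?case by (simp add: pw_def lookup_one zero_word_def)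
next
  case (Suc n)
  have "Poly_Mapping.lookup xd (Word [1, 2, 3, 2]) = 1"
    by (simp add: xd_eq xc_eq xf_eq wd_mult left_diff_distrib right_diff_distrib scal_diff lookup_add lookup_minus wd_eq lookup_single when_def bs_mult plus_word_def)
  then have "Poly_Mapping.lookup (xd * xd ^ n) (Word ([1, 2, 3, 2] @ pw n)) = 1"
    by (subst lookup_mult_split[OF comp_bfc(4)]) (simp_all add: Suc)
  then show ?case by (simp add: pw_def)
qed

lemma pow_TV_comp: "(x :: (3, 'k) tens_alg) \<in> TV_comp m \<Longrightarrow> x ^ n \<in> TV_comp (n * m)"
proof (induction n)
  case 0
  then show ?case using bs_TV_comp[of "0 :: 3 word", where 'b='k] by (simp add: zero_word_def flip: bs_zero)
next
  case (Suc n)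
  then show ?case using TV_comp_mult[of x m "x ^ n" "n * m"] by simp
qed

lemma y_TV_comp: "y ^ k \<in> TV_comp (4 * L * k)"
  using pow_TV_comp[OF comp_bfc(4), of "L * k"] by (simp add: y_def power_mult[symmetric] mult_ac)

lemma lookup_y_pow: "Poly_Mapping.lookup (y ^ k) (Word (pw (L * j))) = (if j = k then 1 else 0)"
proof (cases "j = k")
  case True
  then show ?thesis using lookup_d_pow[of "L * k"] by (simp add: y_def power_mult)
next
  case False
  then have "length (pw (L * j)) \<noteq> 4 * L * k" using L(1) by (simp add: length_pw)
  then have "Word (pw (L * j)) \<notin> Poly_Mapping.keys (y ^ k)" using y_TV_comp[of k] by (auto simp: TV_comp_def)
  then show ?thesis using False by (simp add: in_keys_iff)
qed

text \<open>The coefficient of (1232)^(Lj) is 1 on y^j, 0 on the other powers by degree, and 0 on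
  I.\<close>

lemma y_indep:
  assumes "(\<Sum>k\<le>N. scal (c k) (y ^ k)) \<in> I" "j \<le> N"
  shows "c j = 0"
proof -
  have "(\<Sum>k\<le>N. c k * (if j = k then 1 else 0)) = 0"
    using lookup_pw_I[OF assms(1), of "L * j"] by (simp add: lookup_sum lookup_y_pow)
  moreover have "(\<Sum>k\<le>N. c k * (if j = k then 1 else 0)) = (\<Sum>k\<le>N. if j = k then c k else 0)"
    by (rule sum.cong) auto
  ultimately show ?thesis using assms(2) by simp
qed

end

text \<open>R carries the conditions on the remaining exponents, so the same rule applies again in
  the next layer.\<close>

lemma sum_collapse:
  fixes t X :: "('i, 'k::field) tens_alg"
  assumes "e \<le> N"
  shows "(\<Sum>n\<le>N. (if n = e \<and> R then X else 0) * t ^ n) = (if R then X * t ^ e else 0)"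
proof -
  have "(\<Sum>n\<le>N. (if n = e \<and> R then X else 0) * t ^ n) = (\<Sum>n\<le>N. if e = n then (if R then X * t ^ e else 0) else 0)"
    by (rule sum.cong) auto
  then show ?thesis using assms by simp
qed

context D21
begin

section \<open>The PBW basis\<close>

type_synonym exps8 = "nat \<times> nat \<times> nat \<times> nat \<times> nat \<times> nat \<times> nat \<times> nat"

text \<open>A linear combination of monomials with y in front, in nested form with one sum per
  layer, so that \<open>lowers_coeff\<close> can extract coefficients layer by layer. C takes eight
  exponents, that of y first.\<close>

definition "f8 N (C :: exps8 \<Rightarrow> 'k) n1 n2 n3 m n5 n6 n7 = (\<Sum>k\<le>N. scal (C (k, n1, n2, n3, m, n5, n6, n7)) (y ^ k))"
definition "f7 N C n2 n3 m n5 n6 n7 = (\<Sum>n1\<le>N. f8 N C n1 n2 n3 m n5 n6 n7 * xg ^ n1)"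
definition "f6 N C n3 m n5 n6 n7 = (\<Sum>n2\<le>1. f7 N C n2 n3 m n5 n6 n7 * xf ^ n2)"
definition "f5 N C m n5 n6 n7 = (\<Sum>n3\<le>1. f6 N C n3 m n5 n6 n7 * xe ^ n3)"
definition "f4 N C n5 n6 n7 = (\<Sum>m\<le>L - 1. f5 N C m n5 n6 n7 * xd ^ m)"
definition "f3 N C n6 n7 = (\<Sum>n5\<le>1. f4 N C n5 n6 n7 * xc ^ n5)"
definition "f2 N C n7 = (\<Sum>n6\<le>1. f3 N C n6 n7 * xb ^ n6)"
definition "f1 N C = (\<Sum>n7\<le>N. f2 N C n7 * xa ^ n7)"

lemmas f_defs = f8_def f7_def f6_def f5_def f4_def f3_def f2_def f1_def

lemma f_add: "f1 N (\<lambda>x. C x + C' x) = f1 N C + f1 N C'"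
  by (simp only: f_defs scal_add sum.distrib distrib_right)

lemma f_zero: "f1 N (\<lambda>x. 0) = 0"
  by (simp add: f_defs)

lemma f_mem: "f8 N C n1 n2 n3 m n5 n6 n7 \<in> K8" "f7 N C n2 n3 m n5 n6 n7 \<in> K7" "f6 N C n3 m n5 n6 n7 \<in> K6"
  "f5 N C m n5 n6 n7 \<in> K5" "f4 N C n5 n6 n7 \<in> K4" "f3 N C n6 n7 \<in> K3" "f2 N C n7 \<in> K2"
proof -
  show 8: "f8 N C n1 n2 n3 m n5 n6 n7 \<in> K8" for n1 n2 n3 m n5 n6 n7
    unfolding f8_def K8_def by (intro pm.span_sum pm.span_scale pm.span_base) simp
  show 7: "f7 N C n2 n3 m n5 n6 n7 \<in> K7" for n2 n3 m n5 n6 n7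
    unfolding f7_def K7_def by (intro lay_sum 8 subset_UNIV)
  show 6: "f6 N C n3 m n5 n6 n7 \<in> K6" for n3 m n5 n6 n7
    unfolding f6_def K6_def by (intro lay_sum 7 subset_refl)
  show 5: "f5 N C m n5 n6 n7 \<in> K5" for m n5 n6 n7
    unfolding f5_def K5_def by (intro lay_sum 6 subset_refl)
  show 4: "f4 N C n5 n6 n7 \<in> K4" for n5 n6 n7
    unfolding f4_def K4_def by (intro lay_sum 5 subset_refl)
  show 3: "f3 N C n6 n7 \<in> K3" for n6 n7
    unfolding f3_def K3_def by (intro lay_sum 4 subset_refl)
  show "f2 N C n7 \<in> K2"
    unfolding f2_def K2_def by (intro lay_sum 3 subset_refl)
qed

lemma f_indep:
  assumes f: "f1 N C \<in> I" and b: "k \<le> N" "n1 \<le> N" "n2 \<le> 1" "n3 \<le> 1" "m \<le> L - 1" "n5 \<le> 1" "n6 \<le> 1" "n7 \<le> N"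
  shows "C (k, n1, n2, n3, m, n5, n6, n7) = 0"
proof -
  note coeff = lowers_coeff(1)[OF _ pdclosed_I]
  have "f2 N C n7 \<in> I" by (rule coeff[OF lowers1 f_mem(7) subset_UNIV f[unfolded f1_def] b(8)])
  then have "f3 N C n6 n7 \<in> I" unfolding f2_def by (rule coeff[OF lowers2 f_mem(6) subset_refl _ b(7)])
  then have "f4 N C n5 n6 n7 \<in> I" unfolding f3_def by (rule coeff[OF lowers3 f_mem(5) subset_refl _ b(6)])
  then have "f5 N C m n5 n6 n7 \<in> I" unfolding f4_def by (rule coeff[OF lowers4 f_mem(4) subset_refl _ b(5)])
  then have "f6 N C n3 m n5 n6 n7 \<in> I" unfolding f5_def by (rule coeff[OF lowers5 f_mem(3) subset_refl _ b(4)])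
  then have "f7 N C n2 n3 m n5 n6 n7 \<in> I" unfolding f6_def by (rule coeff[OF lowers6 f_mem(2) subset_refl _ b(3)])
  then have "f8 N C n1 n2 n3 m n5 n6 n7 \<in> I" unfolding f7_def by (rule coeff[OF lowers7 f_mem(1) subset_UNIV _ b(2)])
  then show ?thesis unfolding f8_def by (rule y_indep[OF _ b(1)])
qed

definition spl :: "nat \<times> nat \<times> nat \<times> nat \<times> nat \<times> nat \<times> nat \<Rightarrow> exps8" where
  "spl = (\<lambda>(n1, n2, n3, n4, n5, n6, n7). (n4 div L, n1, n2, n3, n4 mod L, n5, n6, n7))"

lemma inj_spl: "spl e = spl e' \<longleftrightarrow> e = e'"
proof
  assume "spl e = spl e'"
  then show "e = e'" unfolding spl_def by (auto split: prod.splits) (metis div_mult_mod_eq)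
qed simp

lemma f_single:
  assumes e: "e = (n1, n2, n3, n4, n5, n6, n7)" "e \<in> D21_exponents" and N: "n4 div L \<le> N" "n1 \<le> N" "n7 \<le> N"
  shows "f1 N (\<lambda>x. if x = spl e then v else 0) = scal v (mm' e)"
proof -
  have b: "n2 \<le> 1" "n3 \<le> 1" "n5 \<le> 1" "n6 \<le> 1"
    using e(2) by (auto simp: e(1) D21_exponents_def)
  have b4: "n4 mod L \<le> L - 1"
    using mod_less_divisor[of L n4] L(1) by linarith
  let ?C = "\<lambda>x. if x = spl e then v else 0"
  \<comment> \<open>The conjunction is nested to the right and ends in \<open>True\<close>, so that
    each use of \<open>sum_collapse\<close>, down to the last, finds a condition of the required
    form.\<close>
  have 8: "f8 N ?C k1 k2 k3 m k5 k6 k7 = (if k1 = n1 \<and> (k2 = n2 \<and> (k3 = n3 \<and> (m = n4 mod L \<and> (k5 = n5 \<and> (k6 = n6 \<and> (k7 = n7 \<and> True)))))) then scal v (y ^ (n4 div L)) else 0)"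
    for k1 k2 k3 m k5 k6 k7
  proof -
    have "f8 N ?C k1 k2 k3 m k5 k6 k7 = (\<Sum>k\<le>N. if n4 div L = k then (if k1 = n1 \<and> (k2 = n2 \<and> (k3 = n3 \<and> (m = n4 mod L \<and> (k5 = n5 \<and> (k6 = n6 \<and> (k7 = n7 \<and> True)))))) then scal v (y ^ (n4 div L)) else 0) else 0)"
      unfolding f8_def e(1) spl_def by (rule sum.cong) auto
    then show ?thesis using N(1) by simp
  qed
  show ?thesis
    unfolding f1_def f2_def f3_def f4_def f5_def f6_def f7_def 8 sum_collapse[OF N(2)] sum_collapse[OF b(1)]
      sum_collapse[OF b(2)] sum_collapse[OF b4] sum_collapse[OF b(3)] sum_collapse[OF b(4)] sum_collapse[OF N(3)]
    by (simp add: e(1) mm'_def)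
qed

lemma mm_indep: "indep_mod I D21_exponents mm"
  unfolding indep_mod_def
proof (intro allI impI ballI)
  fix F c e assume F: "finite F \<and> F \<subseteq> D21_exponents \<and> (\<Sum>e\<in>F. scal (c e) (mm e)) \<in> I" and e: "e \<in> F"
  have "\<forall>e. \<exists>t. t \<noteq> 0 \<and> \<pi> (mm e) = scuq t (\<pi> (mm' e))" using mm_mm' by blast
  then obtain T where T: "\<And>e. T e \<noteq> 0" "\<And>e. \<pi> (mm e) = scuq (T e) (\<pi> (mm' e))" by metis
  \<comment> \<open>The sum of the three unbounded exponents; its maximum over F bounds each of
    them.\<close>
  define B where "B = (\<lambda>(n1 :: nat, n2 :: nat, n3 :: nat, n4 :: nat, n5 :: nat, n6 :: nat, n7 :: nat). n1 + n4 div L + n7)"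
  define N where "N = Max (B ` F)"
  have BN: "B e \<le> N" if "e \<in> F" for e unfolding N_def using F that by (intro Max_ge) auto
  have "(\<Sum>e\<in>F. scal (c e * T e) (mm' e)) \<in> I"
  proof -
    have "(\<Sum>e\<in>F. scal (c e) (mm e - scal (T e) (mm' e))) \<in> I"
      using T(2) by (intro pm.subspace_sum[OF I_subspace] pm.subspace_scale[OF I_subspace]) (simp add: I_diff qpi_scal)
    then have "(\<Sum>e\<in>F. scal (c e) (mm e)) - (\<Sum>e\<in>F. scal (c e * T e) (mm' e)) \<in> I"
      by (simp add: scal_diff scal_scal sum_subtractf)
    then show ?thesis using F tideal_diff[OF tideal_I, of "\<Sum>e\<in>F. scal (c e) (mm e)"] by fastforce
  qed
  moreover have "(\<Sum>e\<in>F'. scal (c e * T e) (mm' e)) = f1 N (\<lambda>x. \<Sum>e\<in>F'. if x = spl e then c e * T e else 0)" if "finite F'" "F' \<subseteq> F" for F'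
    using that
  proof (induction F' rule: finite_induct)
    case (insert a F')
    obtain n1 n2 n3 n4 n5 n6 n7 where a: "a = (n1, n2, n3, n4, n5, n6, n7)" by (cases a) auto
    have "B a \<le> N" using BN insert by auto
    then have "f1 N (\<lambda>x. if x = spl a then c a * T a else 0) = scal (c a * T a) (mm' a)"
      using F insert.prems by (intro f_single[OF a]) (auto simp: a B_def)
    then show ?case using insert by (simp add: f_add)
  qed (simp add: f_zero)
  ultimately have f: "f1 N (\<lambda>x. \<Sum>e\<in>F. if x = spl e then c e * T e else 0) \<in> I" using F by simp
  obtain n1 n2 n3 n4 n5 n6 n7 where e': "e = (n1, n2, n3, n4, n5, n6, n7)" by (cases e) auto
  have "e \<in> D21_exponents" "B e \<le> N" using F e BN by auto
  moreover have "n4 mod L \<le> L - 1" using mod_less_divisor[of L n4] L(1) by linarith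
  ultimately have "(\<lambda>x. \<Sum>e\<in>F. if x = spl e then c e * T e else 0) (n4 div L, n1, n2, n3, n4 mod L, n5, n6, n7) = 0"
    by (intro f_indep[OF f]) (auto simp: e' D21_exponents_def B_def)
  then have "(\<Sum>e'\<in>F. if spl e = spl e' then c e' * T e' else 0) = 0"
    by (simp add: spl_def e')
  then have "(\<Sum>e'\<in>F. if e = e' then c e' * T e' else 0) = 0" by (simp only: inj_spl)
  then show "c e = 0" using F e T(1)[of e] by simp
qed

lemma mm_span: "\<exists>w\<in>pm.span (mm ` D21_exponents). x - w \<in> I"
  using W_UNIV[of x] by (simp add: W_def)

theorem PBW_basis:
  "inj_on (D21_monomial Q) D21_exponents"
  "is_basis_of (pquot I) (carrier (pquot I)) (D21_monomial Q ` D21_exponents)"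
proof -
  have eq: "D21_monomial Q = (\<lambda>e. cos I (mm e))" by (rule ext) (rule D21_monomial_mm)
  show "inj_on (D21_monomial Q) D21_exponents"
    unfolding eq by (rule indep_mod_inj[OF mm_indep I_subspace])
  let ?E = "(\<lambda>e. cos I (mm e)) ` D21_exponents"
  have "lspan (pquot I) (cos I ` (mm ` D21_exponents)) = carrier (pquot I)"
    unfolding carrier_pquot
  proof (rule trans[OF TV.quot_lspan[OF I_subspace, folded pquot_def]], rule subset_antisym)
    show "range (cos I) \<subseteq> cos I ` pm.span (mm ` D21_exponents)"
    proof (rule image_subsetI)
      fix x :: "(3, 'k) tens_alg"
      obtain w where w: "w \<in> pm.span (mm ` D21_exponents)" "x - w \<in> I" using mm_span by blast
      show "cos I x \<in> cos I ` pm.span (mm ` D21_exponents)"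
        by (rule image_eqI[OF _ w(1)]) (simp only: cos_eq_iff[OF I_subspace] w(2))
    qed
  qed (rule image_mono[OF subset_UNIV])
  then have "lspan (pquot I) ?E = carrier (pquot I)" by (simp only: image_image)
  moreover have "?E \<subseteq> carrier (pquot I)" unfolding carrier_pquot by (rule image_subsetI) (rule rangeI)
  moreover have "lin_indep (pquot I) ?E"
    unfolding pquot_def by (rule TV.lin_indep_quot[OF I_subspace mm_indep])
  ultimately show "is_basis_of (pquot I) (carrier (pquot I)) (D21_monomial Q ` D21_exponents)"
    unfolding is_basis_of_def eq by (intro conjI)
qed

section \<open>The element \<open>y\<close> is primitive and normal modulo \<open>I\<close>\<close>

text \<open>Terms are grouped by the word in the first slot, so that a property of all slices
  becomes a statement about the tensor.\<close>

lemma slice_expand: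
  fixes t :: "(3, 'k) tens_sq"
  shows "t = (\<Sum>w\<in>fst ` Poly_Mapping.keys t. tens (bs w) (lsl (\<lambda>x. Poly_Mapping.lookup x w) t))"
proof (rule poly_mapping_eqI)
  fix p :: "3 word \<times> 3 word"
  obtain u v where p: "p = (u, v)" by (cases p)
  have t: "Poly_Mapping.lookup (tens (bs w) z) (u, v) = (if w = u then Poly_Mapping.lookup z v else 0)" for w and z :: "(3, 'k) tens_alg"
    by (induction z rule: pm_induct) (auto simp: tens_add_right tens_scal_right lookup_add tens_bs lookup_single when_def)
  have l: "Poly_Mapping.lookup (lsl (\<lambda>x. Poly_Mapping.lookup x w) t) v = Poly_Mapping.lookup t (w, v)" for w and t :: "(3, 'k) tens_sq"
  proof (induction t rule: tens_sq_induct)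
    case (tens a b)
    show ?case unfolding lsl_bs by (simp add: tens_bs lookup_single when_def)
  qed (auto simp: lsl_add lsl_scal lookup_add plin_zero[OF plin_lsl])
  have "Poly_Mapping.lookup t (u, v) = 0" if "u \<notin> fst ` Poly_Mapping.keys t"
    using that by (force simp: in_keys_iff)
  then show "Poly_Mapping.lookup t p = Poly_Mapping.lookup (\<Sum>w\<in>fst ` Poly_Mapping.keys t. tens (bs w) (lsl (\<lambda>x. Poly_Mapping.lookup x w) t)) p"
    by (simp add: p lookup_sum t l)
qed

lemma lsl_ker:
  assumes f: "pfun f" "\<And>x. x \<in> I \<Longrightarrow> f x = 0" and t: "t \<in> tens_ker Q I I"
  shows "lsl f t \<in> I"
  by (rule tens_ker_into[OF plin_lsl I_subspace _ _ t])
    (auto simp: lsl_tens[OF f(1)] f(2) tideal_zero[OF tideal_I] tideal_scal[OF tideal_I])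

lemma comult_total:
  assumes "x \<in> TV_comp n"
  shows "comult Q x \<in> pm.span {tens (bs u) (bs v) | u v. length (letters u) + length (letters v) = n}" (is "_ \<in> ?S n")
proof -
  have w: "comult Q (bs w) \<in> ?S (length (letters w))" for w
  proof (induction w rule: word_induct)
    case Nil
    have "tens (bs 0) (bs 0) \<in> {tens (bs u) (bs v) | u v :: 3 word. length (letters u) + length (letters v) = length (letters (0 :: 3 word))}"
      by (intro CollectI exI[of _ 0]) (simp add: zero_word_def)
    from pm.span_base[OF this] show ?case by simp
  next
    case (Cons i w)
    have "tmult Q (comult Q (wd [i])) (comult Q (bs w)) \<in> ?S (Suc (length (letters w)))"
    proof (rule plin_span_into[OF plin_tmult_right pm.subspace_span _ Cons], clarify)
      fix u v :: "3 word" assume uv: "length (letters u) + length (letters v) = length (letters w)"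
      have "tens (bs (Word [i] + u)) (bs v) \<in> {tens (bs u) (bs v) | u v :: 3 word. length (letters u) + length (letters v) = Suc (length (letters w))}"
        using uv by (intro CollectI exI[of _ "Word [i] + u"] exI[of _ v]) (simp add: plus_word_def)
      moreover have "tens (bs u) (bs (Word [i] + v)) \<in> {tens (bs u) (bs v) | u v :: 3 word. length (letters u) + length (letters v) = Suc (length (letters w))}"
        using uv by (intro CollectI exI[of _ u] exI[of _ "Word [i] + v"]) (simp add: plus_word_def)
      moreover have "tmult Q (comult Q (wd [i])) (tens (bs u) (bs v)) = tens (bs (Word [i] + u)) (bs v) + scal (bichar Q (unitv i) (wdeg u)) (tens (bs u) (bs (Word [i] + v)))"
        by (simp add: comult_wd tmult_add_left tmult_tens_1 tmult_tens[OF homogeneous_wd homogeneous_single]) (simp add: wd_eq bs_mult)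
      ultimately show "tmult Q (comult Q (wd [i])) (tens (bs u) (bs v)) \<in> ?S (Suc (length (letters w)))"
        by (simp only:) (intro pm.span_add pm.span_scale pm.span_base)
    qed
    moreover have "comult Q (bs (Word [i] + w)) = tmult Q (comult Q (wd [i])) (comult Q (bs w))"
      by (simp add: wd_eq bs_mult flip: comult_mult)
    ultimately show ?case by (simp add: length_plus_word)
  qed
  have "comult Q (prj n x) \<in> ?S n" for x
  proof (induction x rule: pm_induct)
    case (bs u)
    show ?case using w[of u] by (auto simp: prj_bs pm.span_zero)
  qed (auto simp: plin_zero[OF plin_prj] plin_add[OF plin_prj] plin_scal[OF plin_prj] comult_add comult_scal
      pm.span_zero pm.span_add pm.span_scale)
  from this[of x] show ?thesis using prj_TV_comp[OF assms, of n] by simp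
qed

lemma prj0: "prj 0 x = scal (counit x) (1 :: (3, 'k) tens_alg)"
proof (induction x rule: pm_induct)
  case (bs u)
  show ?case by (cases u) (auto simp: prj_bs counit_bs zero_word_def bs_zero[unfolded zero_word_def])
qed (simp_all add: plin_zero[OF plin_prj] plin_add[OF plin_prj] plin_scal[OF plin_prj]
    pfun_add[OF pfun_counit] pfun_scal[OF pfun_counit] pfun_zero[OF pfun_counit] scal_add scal_scal)

text \<open>The total length determines the length in one slot from that in the other; hence for the
  two extreme parts a single projection is enough.\<close>

lemma bidegree_expand:
  fixes t :: "(3, 'k) tens_sq"
  assumes t: "t \<in> pm.span {tens (bs u) (bs v) | u v. length (letters u) + length (letters v) = n}"
  shows "t = (\<Sum>l\<le>n. tid (prj (n - l)) (idt (prj l) t))" "tid (prj 0) (idt (prj n) t) = tid (prj 0) t"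
    "tid (prj n) (idt (prj 0) t) = idt (prj 0) t"
proof -
  have z: "plin (\<lambda>t. t - (\<Sum>l\<le>n. tid (prj (n - l)) (idt (prj l) t)))"
    by (auto simp: plin_def idt_add idt_scal plin_add[OF plin_tid] plin_scal[OF plin_tid] sum.distrib scal_sum scal_diff)
  have "t - (\<Sum>l\<le>n. tid (prj (n - l)) (idt (prj l) t)) \<in> {0}"
  proof (rule plin_span_into[OF z pm.subspace_single_0 _ t], clarify)
    fix u v :: "3 word" assume uv: "n = length (letters u) + length (letters v)"
    have "(\<Sum>l\<le>n. tid (prj (n - l)) (idt (prj l) (tens (bs u) (bs v) :: (3, 'k) tens_sq))) = (\<Sum>l\<le>n. if length (letters v) = l then tens (bs u) (bs v) else 0)"
      using uv by (intro sum.cong) (auto simp: idt_bs prj_bs tid_bs plin_zero[OF plin_tid])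
    also have "\<dots> = tens (bs u) (bs v)" using uv by simp
    finally have eq: "(\<Sum>l\<le>n. tid (prj (n - l)) (idt (prj l) (tens (bs u) (bs v) :: (3, 'k) tens_sq))) = tens (bs u) (bs v)" .
    show "(tens (bs u) (bs v) :: (3, 'k) tens_sq) - (\<Sum>l\<le>length (letters u) + length (letters v). tid (prj (length (letters u) + length (letters v) - l)) (idt (prj l) (tens (bs u) (bs v)))) = 0"
      by (subst eq[unfolded uv]) simp
  qed
  then show "t = (\<Sum>l\<le>n. tid (prj (n - l)) (idt (prj l) t))" by simp
  have "tid (prj 0) (idt (prj n) t) - tid (prj 0) t \<in> {0}"
    by (rule plin_span_into[OF plin_minus_fun[OF plin_comp[OF plin_tid plin_idt] plin_tid] pm.subspace_single_0 _ t])
      (auto simp: idt_bs prj_bs tid_bs plin_zero[OF plin_tid])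
  then show "tid (prj 0) (idt (prj n) t) = tid (prj 0) t" by simp
  have "tid (prj n) (idt (prj 0) t) - idt (prj 0) t \<in> {0}"
    by (rule plin_span_into[OF plin_minus_fun[OF plin_comp[OF plin_tid plin_idt] plin_idt] pm.subspace_single_0 _ t])
      (auto simp: idt_bs prj_bs tid_bs plin_zero[OF plin_tid])
  then show "tid (prj n) (idt (prj 0) t) = idt (prj 0) t" by simp
qed

lemma prj_I: "x \<in> I \<Longrightarrow> prj n x \<in> I"
  by (rule pre_nicholsD(3)[OF pre_nichols_I])

lemma y_comp: "y \<in> TV_comp (4 * L)"
  using y_TV_comp[of 1] by simp

text \<open>
  Since \<open>(id \<otimes> \<partial>\<^sub>i) \<Delta>(y) = \<Delta>(\<partial>\<^sub>i y)\<close> vanishes modulo \<open>I\<close>, the right tensor factors of \<open>\<Delta>(y)\<close> lie in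
  the common kernel, the span of the powers of \<open>y\<close>; by degree only \<open>1\<close> and \<open>y\<close> occur.
\<close>

lemma comult_y: "comult Q y - tens y 1 - tens 1 y \<in> tens_ker Q I I"
proof -
  let ?K = "tens_ker Q I I" and ?t = "comult Q y" and ?n = "4 * L"
  obtain P where P: "plin P" "\<And>x. P x = 0 \<longleftrightarrow> x \<in> I" "\<And>x. P x - x \<in> I"
    by (rule ex_projection[OF I_subspace]) blast
  have comI: "comult Q x \<in> ?K" if "x \<in> I" for x
    using braided_hopf_idealD(3)[OF pre_nicholsD(1)[OF pre_nichols_I]] that by blast
  \<comment> \<open>Coordinates are taken after the projection P: these functionals vanish on I, so
    slicing with them is compatible with reduction modulo I.\<close>
  let ?f = "\<lambda>w x. Poly_Mapping.lookup (P x) w"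
  have f: "pfun (?f w)" "\<And>x. x \<in> I \<Longrightarrow> ?f w x = 0" for w
  proof -
    show "pfun (?f w)" by (rule pfun_comp[OF pfun_lookup P(1)])
    show "?f w x = 0" if "x \<in> I" for x using P(2)[of x] that by simp
  qed
  have slice: "\<exists>z\<in>K8. lsl (?f w) ?t - z \<in> I" for w
  proof (rule common_kernel)
    fix i
    have "pd i (lsl (?f w) ?t) = lsl (?f w) (comult Q (pd i y))"
      by (simp add: comult_pd lsl_idt[OF f(1) plin_pd])
    then show "pd i (lsl (?f w) ?t) \<in> I"
      using lsl_ker[OF f comI[OF pd_y]] by simp
  qed
  have lP: "lsl (\<lambda>x. Poly_Mapping.lookup x w) (tid P t) = lsl (?f w) t" for w t
    by (rule plin_eqI_tens[of "\<lambda>t. lsl (\<lambda>x. Poly_Mapping.lookup x w) (tid P t)" "lsl (?f w)"])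
      (auto intro!: plin_comp[OF plin_lsl plin_tid] plin_lsl simp: tid_bs lsl_tens[OF pfun_lookup] lsl_bs)
  have tidK: "tid P t - t \<in> ?K" for t
  proof (induction t rule: tens_sq_induct)
    case zero
    then show ?case by (simp add: plin_zero[OF plin_tid] pm.subspace_0[OF tens_ker_subspace])
  next
    case (add s t)
    then show ?case using pm.subspace_add[OF tens_ker_subspace] by (fastforce simp: plin_add[OF plin_tid] algebra_simps)
  next
    case (scal c t)
    then show ?case using pm.subspace_scale[OF tens_ker_subspace] by (fastforce simp: plin_scal[OF plin_tid] simp flip: scal_diff)
  next
    case (tens u v)
    show ?case using tens_ker_left[OF P(3)] by (simp add: tid_bs flip: tens_diff_left)
  qed
  \<comment> \<open>Every slice is replaced by a congruent polynomial in y; t0 agrees with Delta(y)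
    modulo the kernel.\<close>
  define t0 where "t0 = (\<Sum>w\<in>fst ` Poly_Mapping.keys (tid P ?t). tens (bs w) (SOME z. z \<in> K8 \<and> lsl (?f w) ?t - z \<in> I))"
  have some: "(SOME z. z \<in> K8 \<and> lsl (?f w) ?t - z \<in> I) \<in> K8 \<and> lsl (?f w) ?t - (SOME z. z \<in> K8 \<and> lsl (?f w) ?t - z \<in> I) \<in> I" for w
    using someI_ex[of "\<lambda>z. z \<in> K8 \<and> lsl (?f w) ?t - z \<in> I"] slice[of w] by blast
  have "tid P ?t - t0 \<in> ?K"
  proof -
    have "tid P ?t - t0 = (\<Sum>w\<in>fst ` Poly_Mapping.keys (tid P ?t). tens (bs w) (lsl (?f w) ?t - (SOME z. z \<in> K8 \<and> lsl (?f w) ?t - z \<in> I)))"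
      unfolding t0_def by (subst (1) slice_expand) (simp add: lP tens_diff_right sum_subtractf)
    then show ?thesis using some by (auto intro!: pm.subspace_sum[OF tens_ker_subspace] tens_ker_right)
  qed
  from pm.subspace_diff[OF tens_ker_subspace this tidK[of ?t]] have t_t0: "?t - t0 \<in> ?K" by simp
  have prK: "tid (prj i) (idt (prj j) t) \<in> ?K" if "t \<in> ?K" for i j t
    by (rule tens_ker_into[OF plin_comp[OF plin_tid plin_idt] tens_ker_subspace _ _ that])
      (auto simp: idt_tens[OF plin_prj] tid_tens[OF plin_prj] intro: tens_ker_left tens_ker_right prj_I)
  \<comment> \<open>The powers of y have lengths divisible by 4L, so the second slots of t0 have no
    component of length strictly between 0 and 4L.\<close>
  have mid: "tid (prj (?n - l)) (idt (prj l) ?t) \<in> ?K" if l: "0 < l" "l < ?n" for l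
  proof -
    have "prj l z \<in> {0}" if z: "z \<in> K8" for z
    proof (rule plin_span_into[OF plin_prj pm.subspace_single_0 _ z[unfolded K8_def]], clarify)
      fix k
      have "l \<noteq> 4 * L * k"
      proof
        assume k: "l = 4 * L * k"
        then have "k \<noteq> 0" using l by (intro notI) simp
        then have "4 * L * 1 \<le> 4 * L * k" by (intro mult_left_mono) auto
        then show False using l k by simp
      qed
      then show "prj l (y ^ k) = 0" by (simp add: prj_TV_comp[OF y_TV_comp])
    qed
    then have "tid (prj (?n - l)) (idt (prj l) t0) = 0"
      unfolding t0_def using some by (simp add: plin_sum[OF plin_idt] plin_sum[OF plin_tid] idt_tens[OF plin_prj] plin_zero[OF plin_tid])
    then have "tid (prj (?n - l)) (idt (prj l) ?t) = tid (prj (?n - l)) (idt (prj l) (?t - t0))"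
      by (simp add: plin_diff[OF plin_idt] plin_diff[OF plin_tid])
    then show ?thesis using prK[OF t_t0] by simp
  qed
  note tot = bidegree_expand[OF comult_total[OF y_comp]]
  have n0: "0 < ?n" using L(1) by simp
  have c0: "idt (prj 0) t = tens (rsl counit t) 1" "tid (prj 0) t = tens 1 (lsl counit t)" for t :: "(3, 'k) tens_sq"
    by (induction t rule: tens_sq_induct; simp add: idt_add idt_scal rsl_add rsl_scal tens_add_left tens_scal_left idt_bs rsl_bs
      plin_add[OF plin_tid] plin_scal[OF plin_tid] plin_zero[OF plin_tid] lsl_add lsl_scal tens_add_right tens_scal_right tid_bs lsl_bs prj0)+
  \<comment> \<open>The two extreme parts are fixed by the counit axioms.\<close>
  have ends: "tid (prj (?n - 0)) (idt (prj 0) ?t) = tens y 1" "tid (prj (?n - ?n)) (idt (prj ?n) ?t) = tens 1 y"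
    using tot(2,3) by (simp_all add: c0 rsl_counit_comult lsl_counit_comult)
  have "{..?n} = insert 0 (insert ?n {0<..<?n})" using n0 by auto
  then have "?t = tens y 1 + (tens 1 y + (\<Sum>l\<in>{0<..<?n}. tid (prj (?n - l)) (idt (prj l) ?t)))"
    by (subst tot(1)) (use n0 ends in simp)
  then have "?t - tens y 1 - tens 1 y = (\<Sum>l\<in>{0<..<?n}. tid (prj (?n - l)) (idt (prj l) ?t))" by (simp add: algebra_simps)
  also have "\<dots> \<in> ?K" using mid by (intro pm.subspace_sum[OF tens_ker_subspace]) auto
  finally show ?thesis .
qed

lemma hom_y: "homogeneous (dmul L \<delta>) y"
  unfolding y_def by (rule homogeneous_power[OF hom_d])

text \<open>All \<partial>j send the braided commutator of x_i and y into I; for j = i the remaining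
  terms cancel by the choice of the scalar. So it is a polynomial in y modulo I, and it vanishes
  there because its degree 1 + 4L is not divisible by 4.\<close>

lemma y_normal: "\<exists>t. \<pi> y * \<pi> (wd [i]) = scuq t (\<pi> (wd [i]) * \<pi> y)"
proof -
  let ?\<chi> = "bichar Q (unitv i) (dmul L \<delta>)"
  let ?z = "wd [i] * y - scal ?\<chi> (y * wd [i])"
  have "pd j ?z \<in> I" for j
  proof -
    have "pd j ?z = (wd [i] * pd j y - scal ?\<chi> (pd j y * gl Q (unitv j) (wd [i])))"
      by (cases "i = j") (auto simp: pd_diff pd_scal pd_wd_mult pd_mult pd_wd gl_homogeneous[OF hom_y] scal_add algebra_simps)
    moreover have "wd [i] * pd j y - scal ?\<chi> (pd j y * gl Q (unitv j) (wd [i])) \<in> I"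
      by (rule tideal_diff[OF tideal_I tideal_left[OF tideal_I pd_y] tideal_scal[OF tideal_I tideal_right[OF tideal_I pd_y]]])
    ultimately show ?thesis by simp
  qed
  from common_kernel[OF this] obtain x where x: "x \<in> K8" "?z - x \<in> I" by blast
  have z: "?z \<in> TV_comp (1 + 4 * L)" by (rule bracket_TV_comp[OF wd1_TV_comp y_comp])
  have "prj (1 + 4 * L) x \<in> {0}"
  proof (rule plin_span_into[OF plin_prj pm.subspace_single_0 _ x(1)[unfolded K8_def]], clarify)
    fix k
    have "(1 + 4 * L) mod 4 \<noteq> (4 * L * k) mod 4" by (simp add: mult.assoc)
    then have "1 + 4 * L \<noteq> 4 * L * k" by metis
    then show "prj (1 + 4 * L) (y ^ k) = 0" using prj_TV_comp[OF y_TV_comp[of k], of "1 + 4 * L"] by simp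
  qed
  then have "?z \<in> I" using prj_I[OF x(2), of "1 + 4 * L"] prj_TV_comp[OF z, of "1 + 4 * L"] by (simp add: plin_diff[OF plin_prj])
  then have "\<pi> (wd [i]) * \<pi> y = scuq ?\<chi> (\<pi> y * \<pi> (wd [i]))"
    unfolding I_diff by (simp add: qpi_mult qpi_scal)
  then have "\<pi> y * \<pi> (wd [i]) = scuq (inverse ?\<chi>) (\<pi> (wd [i]) * \<pi> y)"
    by (simp add: uq.sc_sc uq.sc_one)
  then show ?thesis by blast
qed

lemma y_word: "\<exists>t. \<pi> y * \<pi> (bs w) = scuq t (\<pi> (bs w) * \<pi> y)"
proof (induction w rule: word_induct)
  case Nil
  have "\<pi> y * \<pi> 1 = scuq 1 (\<pi> 1 * \<pi> y)" by (simp add: uq.sc_one)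
  then show ?case by auto
next
  case (Cons i w)
  then obtain t where t: "\<pi> y * \<pi> (bs w) = scuq t (\<pi> (bs w) * \<pi> y)" by blast
  obtain u where u: "\<pi> y * \<pi> (wd [i]) = scuq u (\<pi> (wd [i]) * \<pi> y)" using y_normal by blast
  have "\<pi> y * (\<pi> (wd [i]) * \<pi> (bs w)) = scuq (u * t) (\<pi> (wd [i]) * \<pi> (bs w) * \<pi> y)"
    by (simp add: uq.ext_rule[OF u] uq.sc_mult_left uq.sc_mult_right t uq.sc_sc mult.assoc)
  then have "\<pi> y * \<pi> (bs (Word [i] + w)) = scuq (u * t) (\<pi> (bs (Word [i] + w)) * \<pi> y)"
    by (simp add: wd_eq bs_mult flip: qpi_mult)
  then show ?case by blast
qed

section \<open>The Nichols algebra\<close>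

definition "N = Idl\<^bsub>TV\<^esub> ({xe ^ 2, xw Q [1, 3], xw Q [1, 1, 2], xw Q [3, 3, 2]} \<union> {y})"

lemma I_N: "I \<subseteq> N"
  unfolding I_eq N_def by (rule Idl_TV_least[OF tideal_Idl]) (auto intro: Idl_TV_base)

lemma y_N: "y \<in> N"
  unfolding N_def by (rule Idl_TV_base) simp

lemma tideal_N: "tideal N"
  unfolding N_def by (rule tideal_Idl)

text \<open>\<open>comult_y\<close> gives primitivity of y modulo I, so I is the smaller ideal in
  \<open>pre_nichols_Idl\<close>.\<close>

lemma pre_nichols_N: "pre_nichols_ideal Q N"
  unfolding N_def
proof (rule pre_nichols_Idl[of _ I])
  fix z assume z: "z \<in> {xe ^ 2, xw Q [1, 3], xw Q [1, 1, 2], xw Q [3, 3, 2]} \<union> {y}"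
  then show "\<exists>\<beta>. homogeneous \<beta> z" using hom_gens_I hom_y by blast
  have "comult Q z - tens z 1 - tens 1 z = 0" if "primitive z" using that by (simp add: primitive_def)
  then show "comult Q z - tens z 1 - tens 1 z \<in> tens_ker Q I I"
    using z prim_22 prim_13 prim_112 prim_332 comult_y pm.subspace_0[OF tens_ker_subspace, of Q I I] by auto
next
  have "2 \<le> 4 * L" using L(1) by linarith
  then show "{xe ^ 2, xw Q [1, 3], xw Q [1, 1, 2], xw Q [3, 3, 2]} \<union> {y} \<subseteq> (\<Union>n\<in>{2..}. TV_comp n)"
    using comp_gens y_comp by force
  show "I \<subseteq> Idl\<^bsub>TV\<^esub> ({xe ^ 2, xw Q [1, 3], xw Q [1, 1, 2], xw Q [3, 3, 2]} \<union> {y})"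
    using I_N by (simp only: N_def)
qed (use tideal_I braided_hopf_idealD(5)[OF pre_nicholsD(1)[OF pre_nichols_I]] in auto)

lemma counit_y_pow: "counit (y ^ k) = (if k = 0 then 1 else 0)"
proof (cases "k = 0")
  case False
  then have "4 * L * k \<noteq> 0" using L(1) by simp
  then have "0 \<notin> Poly_Mapping.keys (y ^ k)" using y_TV_comp[of k] by (force simp: TV_comp_def zero_word_def)
  then show ?thesis using False by (simp add: counit_def in_keys_iff)
qed (simp add: counit_def lookup_one)

lemma K8_counit: "x \<in> K8 \<Longrightarrow> \<exists>z. x = scal (counit x) 1 + z * y \<and> z \<in> K8"
  unfolding K8_def
proof (induction rule: pm.span_induct_alt)
  case base
  show ?case by (rule exI[of _ 0]) (simp add: pfun_zero[OF pfun_counit] pm.span_zero)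
next
  case (step c x w)
  then obtain k z where k: "x = y ^ k" and z: "w = scal (counit w) 1 + z * y" "z \<in> pm.span (range ((^) y))" by blast
  show ?case
  proof (cases k)
    case 0
    have "scal c x + w = scal (c + counit w) 1 + z * y" using z(1) 0 k by (simp add: scal_add add.assoc)
    moreover have "counit (scal c x + w) = c + counit w"
      using counit_y_pow[of 0] by (simp add: k 0 pfun_add[OF pfun_counit] pfun_scal[OF pfun_counit])
    ultimately show ?thesis using z(2) by auto
  next
    case (Suc j)
    have "scal c x + w = scal (counit w) 1 + (scal c (y ^ j) + z) * y"
      using z(1) by (simp add: k Suc distrib_right add_ac power_commutes)
    moreover have "counit (scal c x + w) = counit w"
      using counit_y_pow[of k] Suc by (simp add: k pfun_add[OF pfun_counit] pfun_scal[OF pfun_counit])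
    moreover have "scal c (y ^ j) + z \<in> pm.span (range ((^) y))"
      by (rule pm.span_add[OF pm.span_scale[OF pm.span_base] z(2)]) simp
    ultimately show ?thesis by auto
  qed
qed

lemma N_greatest:
  assumes J: "pre_nichols_ideal Q J" shows "J \<subseteq> N"
proof
  \<comment> \<open>J need not contain I, as \<open>pdclosed\<close> demands; adding N repairs this
    without weakening the conclusion.\<close>
  let ?P = "{j + n | j n. j \<in> J \<and> n \<in> N}"
  note J' = pre_nicholsD[OF J] and N' = pre_nicholsD[OF pre_nichols_N]
  have P: "pdclosed ?P"
    unfolding pdclosed_def
  proof (intro conjI ballI allI)
    show "pm.subspace ?P" by (rule pm.subspace_sums[OF tideal_subspace[OF J'(2)] tideal_subspace[OF tideal_N]])
    show "I \<subseteq> ?P" using I_N tideal_zero[OF J'(2)] by force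
    fix x assume "x \<in> ?P"
    then obtain j n where x: "x = j + n" "j \<in> J" "n \<in> N" by blast
    show "x * z \<in> ?P" for z
      unfolding x(1) distrib_right using tideal_right[OF J'(2) x(2)] tideal_right[OF tideal_N x(3)] by blast
    show "pd i x \<in> ?P" for i
      unfolding x(1) pd_add using J'(6)[OF x(2)] N'(6)[OF x(3)] by blast
  qed
  have "?P \<inter> K8 \<subseteq> N"
  proof
    fix x assume x: "x \<in> ?P \<inter> K8"
    then obtain j n where jn: "x = j + n" "j \<in> J" "n \<in> N" by blast
    have "counit j = 0" "counit n = 0"
      using braided_hopf_idealD(4)[OF J'(1)] braided_hopf_idealD(4)[OF N'(1)] jn by blast+
    then have "counit x = 0" by (simp add: jn pfun_add[OF pfun_counit])
    then obtain z where "x = z * y" using K8_counit[of x] x by auto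
    then show "x \<in> N" using tideal_left[OF tideal_N y_N] by simp
  qed
  from peel_all[OF P tideal_subspace[OF tideal_N] tideal_right[OF tideal_N] this]
  have PK: "?P \<inter> K1 \<subseteq> N" by blast
  fix j assume j: "j \<in> J"
  obtain x where x: "x \<in> K1" "j - x \<in> I" using K1_spans by blast
  have jx: "j - x \<in> N" "x - j \<in> N" using x(2) I_N tideal_minus_sym[OF tideal_I] by auto
  have "x = j + (x - j)" by simp
  then have "x \<in> N" using PK x(1) j jx(2) by blast
  then have "(j - x) + x \<in> N" by (rule tideal_add[OF tideal_N jx(1)])
  then show "j \<in> N" by simp
qed

lemma nichols_N: "nichols_ideal Q = N"
  unfolding nichols_ideal_def by (rule Greatest_equality[of "pre_nichols_ideal Q"]) (use pre_nichols_N N_greatest in auto)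

text \<open>Modulo I, y commutes with words up to scalars, so the two-sided ideal generated by y is
  already the left ideal.\<close>

lemma N_decomp:
  assumes "x \<in> N" shows "\<exists>z. x - z * y \<in> I"
proof -
  let ?U = "{x. \<exists>z. x - z * y \<in> I}"
  have U: "pm.subspace ?U"
    unfolding pm.subspace_def
  proof (intro conjI ballI allI)
    show "0 \<in> ?U" by (auto intro!: exI[of _ 0] simp: tideal_zero[OF tideal_I])
    fix x x' assume "x \<in> ?U" "x' \<in> ?U"
    then obtain z z' where "x - z * y \<in> I" "x' - z' * y \<in> I" by blast
    from tideal_add[OF tideal_I this] have "x + x' - (z + z') * y \<in> I" by (simp add: algebra_simps)
    then show "x + x' \<in> ?U" by blast
  next
    fix c x assume "x \<in> ?U"
    then obtain z where "x - z * y \<in> I" by blast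
    from tideal_scal[OF tideal_I this, of c] have "scal c x - scal c z * y \<in> I" by (simp add: scal_diff)
    then show "scal c x \<in> ?U" by blast
  qed
  show ?thesis
  proof -
    have "x \<in> ?U"
    proof (rule plin_span_into[OF plin_id U _ assms[unfolded N_def Idl_TV]])
      fix a assume "a \<in> {bs u * g * bs v | u g v. g \<in> {xe ^ 2, xw Q [1, 3], xw Q [1, 1, 2], xw Q [3, 3, 2]} \<union> {y}}"
      then obtain u g v where a: "a = bs u * g * bs v" and g: "g \<in> {xe ^ 2, xw Q [1, 3], xw Q [1, 1, 2], xw Q [3, 3, 2]} \<union> {y}" by blast
      show "a \<in> ?U"
      proof (cases "g = y")
        case True
        obtain t where t: "\<pi> y * \<pi> (bs v) = scuq t (\<pi> (bs v) * \<pi> y)" using y_word by blast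
        have "a - scal t (bs u * bs v) * y \<in> I"
          unfolding I_diff a True by (simp add: qpi_mult qpi_scal mult.assoc t uq.sc_mult_right)
        then show ?thesis by blast
      next
        case False
        then have "g \<in> I" using g I_gens by blast
        then have "a - 0 * y \<in> I" unfolding a by (simp add: tideal_left[OF tideal_I] tideal_right[OF tideal_I])
        then show ?thesis by blast
      qed
    qed
    then show ?thesis by blast
  qed
qed

end

section \<open>Word lengths in products and graded components\<close>

lemma lookup_prj: "Poly_Mapping.lookup (prj n x) w = (if length (letters w) = n then Poly_Mapping.lookup x w else 0)"
  by (induction x rule: pm_induct) (auto simp: prj_bs plin_add[OF plin_prj] plin_scal[OF plin_prj] plin_zero[OF plin_prj]
    lookup_add lookup_single when_def)

lemma sum_prj_bounded:
  assumes "\<And>w. w \<in> Poly_Mapping.keys x \<Longrightarrow> length (letters w) \<le> D"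
  shows "(\<Sum>n\<le>D. prj n x) = x"
proof (rule poly_mapping_eqI)
  fix w
  show "Poly_Mapping.lookup (\<Sum>n\<le>D. prj n x) w = Poly_Mapping.lookup x w"
    using assms[of w] by (auto simp: lookup_sum lookup_prj in_keys_iff)
qed

lemma bs_prod_list: "(bs u :: ('i, 'k::field) tens_alg) = prod_list (map (\<lambda>i. wd [i]) (letters u))"
proof (induction u rule: word_induct)
  case Nil
  show ?case by (simp add: bs_zero) (simp add: zero_word_def)
next
  case (Cons i w)
  have "bs (Word [i] + w) = (wd [i] * bs w :: ('i, 'k) tens_alg)" by (simp add: wd_eq bs_mult)
  then show ?case by (simp add: Cons plus_word_def)
qed

lemma TV_comp_wprods:
  fixes x :: "('i, 'k::field) tens_alg"
  assumes "x \<in> TV_comp n"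
  shows "x \<in> pm.span (wprods (range (\<lambda>i. wd [i])) n)"
proof -
  have "bs u \<in> wprods (range (\<lambda>i. wd [i])) n" if "u \<in> Poly_Mapping.keys x" for u
    using assms that unfolding wprods_def bs_prod_list
    by (intro CollectI exI[of _ "map (\<lambda>i. wd [i]) (letters u)"]) (auto simp: TV_comp_def)
  then have "(\<Sum>u\<in>Poly_Mapping.keys x. scal (Poly_Mapping.lookup x u) (bs u)) \<in> pm.span (wprods (range (\<lambda>i. wd [i])) n)"
    by (intro pm.span_sum pm.span_scale pm.span_base)
  then show ?thesis
    using expand_single[of x] by (simp add: scal_single)
qed

lemma wprods_bounded:
  fixes S :: "('i, 'k::field) tens_alg set"
  assumes S: "\<And>x w. x \<in> S \<Longrightarrow> w \<in> Poly_Mapping.keys x \<Longrightarrow> length (letters w) \<le> m"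
    and x: "x \<in> wprods S n" and w: "w \<in> Poly_Mapping.keys x"
  shows "length (letters w) \<le> m * n"
proof -
  have *: "length (letters w) \<le> m * length xs" if "set xs \<subseteq> S" "w \<in> Poly_Mapping.keys (prod_list xs)" for xs :: "('i, 'k) tens_alg list" and w
    using that
  proof (induction xs arbitrary: w)
    case Nil
    then have "w = 0" by (auto simp: in_keys_iff lookup_one when_def split: if_splits)
    then show ?case by (simp add: zero_word_def)
  next
    case (Cons a xs)
    then obtain u v where uv: "w = u + v" "u \<in> Poly_Mapping.keys a" "v \<in> Poly_Mapping.keys (prod_list xs)"
      using keys_mult[of a "prod_list xs"] by auto
    have "length (letters v) \<le> m * length xs" using Cons uv by auto
    moreover have "length (letters u) \<le> m" using S[of a u] Cons.prems uv by auto
    ultimately show ?case by (simp add: uv(1) plus_word_def)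
  qed
  obtain xs where xs: "x = prod_list xs" "set xs \<subseteq> S" "length xs \<le> n" using x by (auto simp: wprods_def)
  have "length (letters w) \<le> m * length xs" using *[OF xs(2)] w xs(1) by simp
  also have "\<dots> \<le> m * n" using xs(3) by simp
  finally show ?thesis .
qed

context D21
begin

section \<open>Gelfand-Kirillov dimension\<close>

text \<open>The weights are the lengths of the generators x_3, x_23, x_2, x_1223, x_123, x_12,
  x_1.\<close>

definition "edeg = (\<lambda>(n1 :: nat, n2 :: nat, n3 :: nat, n4 :: nat, n5 :: nat, n6 :: nat, n7 :: nat). n1 + n2 * 2 + n3 + n4 * 4 + n5 * 3 + n6 * 2 + n7)"

lemma mm_TV_comp: "mm e \<in> TV_comp (edeg e)"
proof -
  obtain n1 n2 n3 n4 n5 n6 n7 where e: "e = (n1, n2, n3, n4, n5, n6, n7)" by (cases e) auto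
  have "(wd [i] :: (3, 'k) tens_alg) ^ n \<in> TV_comp n" for i n using pow_TV_comp[OF wd1_TV_comp, of i n] by simp
  then show ?thesis
    unfolding e mm_def edeg_def prod.case by (intro TV_comp_mult pow_TV_comp comp_bfc)
qed

definition "exps_le D = {e \<in> D21_exponents. edeg e \<le> D}"

text \<open>Three exponents range up to D and four over 0 and 1, whence the cube and 16 =
  2^4.\<close>

lemma exps_le: "finite (exps_le D)" "card (exps_le D) \<le> 16 * (D + 1) ^ 3"
proof -
  let ?P = "{..D} \<times> {..1 :: nat} \<times> {..1 :: nat} \<times> {..D} \<times> {..1 :: nat} \<times> {..1 :: nat} \<times> {..D}"
  have sub: "exps_le D \<subseteq> ?P" by (auto simp: exps_le_def D21_exponents_def edeg_def)
  show "finite (exps_le D)" by (rule finite_subset[OF sub]) simp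
  have "card (exps_le D) \<le> card ?P" by (rule card_mono[OF _ sub]) simp
  also have "\<dots> = 16 * (D + 1) ^ 3" by (simp add: power3_eq_cube algebra_simps)
  finally show "card (exps_le D) \<le> 16 * (D + 1) ^ 3" .
qed

lemma span_exps_le:
  assumes "\<And>w. w \<in> Poly_Mapping.keys x \<Longrightarrow> length (letters w) \<le> D"
  shows "\<exists>z\<in>pm.span (mm ` exps_le D). x - z \<in> I"
proof -
  obtain z where z: "z \<in> pm.span (mm ` D21_exponents)" "x - z \<in> I" using mm_span by blast
  have "prj n z \<in> pm.span (mm ` exps_le D)" if n: "n \<le> D" for n
  proof (rule plin_span_into[OF plin_prj pm.subspace_span _ z(1)], clarify)
    fix e assume "e \<in> D21_exponents"
    then show "prj n (mm e) \<in> pm.span (mm ` exps_le D)"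
      using n by (auto simp: prj_TV_comp[OF mm_TV_comp] pm.span_zero exps_le_def intro: pm.span_base)
  qed
  then have "(\<Sum>n\<le>D. prj n z) \<in> pm.span (mm ` exps_le D)" by (intro pm.span_sum) simp
  moreover have "x - (\<Sum>n\<le>D. prj n z) = (\<Sum>n\<le>D. prj n (x - z))"
    by (simp add: plin_diff[OF plin_prj] sum_subtractf sum_prj_bounded[OF assms])
  moreover have "(\<Sum>n\<le>D. prj n (x - z)) \<in> I" by (intro pm.subspace_sum[OF I_subspace] prj_I z(2))
  ultimately show ?thesis by (intro bexI[of _ "\<Sum>n\<le>D. prj n z"]) simp_all
qed

lemma fdim_upper:
  assumes S: "finite S" "\<And>x w. x \<in> S \<Longrightarrow> w \<in> Poly_Mapping.keys x \<Longrightarrow> length (letters w) \<le> m"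
  shows "fdim (pquot I) (word_filtration (pquot I) (cos I ` S) n) \<le> 16 * (m * n + 1) ^ 3"
proof -
  have "fdim (pquot I) (word_filtration (pquot I) (cos I ` S) n) \<le> card (mm ` exps_le (m * n))"
    unfolding word_filtration_cos[OF tideal_I] unfolding pquot_def
    by (rule TV.fdim_le[OF I_subspace finite_wprods[OF S(1)] finite_imageI[OF exps_le(1)] span_exps_le])
      (rule wprods_bounded[OF S(2)])
  also have "\<dots> \<le> card (exps_le (m * n))" by (rule card_image_le[OF exps_le(1)])
  also have "\<dots> \<le> 16 * (m * n + 1) ^ 3" by (rule exps_le(2))
  finally show ?thesis .
qed

text \<open>The monomials in x_3, x_1223 and x_1 with exponents at most M have length at most M + 4M
  + M.\<close>

lemma fdim_lower:
  assumes M: "6 * M \<le> n"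
  shows "(M + 1) ^ 3 \<le> fdim (pquot I) (word_filtration (pquot I) (cos I ` range (\<lambda>i. wd [i])) n)"
proof -
  let ?j = "\<lambda>(n1 :: nat, n4 :: nat, n7 :: nat). (n1, 0 :: nat, 0 :: nat, n4, 0 :: nat, 0 :: nat, n7)"
  let ?E = "?j ` ({..M} \<times> {..M} \<times> {..M})"
  have "card ?E \<le> fdim (pquot I) (word_filtration (pquot I) (cos I ` range (\<lambda>i. wd [i])) n)"
  proof (rule fdim_wprods_ge[OF tideal_I])
    show "indep_mod I ?E mm"
      by (rule indep_mod_subset[OF mm_indep]) (auto simp: D21_exponents_def)
    fix e assume e: "e \<in> ?E"
    have "mm e \<in> pm.span (wprods (range (\<lambda>i. wd [i])) (edeg e))" by (rule TV_comp_wprods[OF mm_TV_comp])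
    moreover have "edeg e \<le> n" using e M by (auto simp: edeg_def)
    ultimately show "mm e \<in> pm.span (wprods (range (\<lambda>i. wd [i])) n)"
      using pm.span_mono[OF wprods_mono] by blast
  qed auto
  moreover have "card ?E = (M + 1) ^ 3"
    by (subst card_image) (auto simp: inj_on_def power3_eq_cube algebra_simps)
  ultimately show ?thesis by simp
qed

lemma GKdim_3: "GKdim (pquot I) = 3"
proof (rule antisym)
  show "GKdim (pquot I) \<le> 3"
    unfolding GKdim_def
  proof (rule SUP_least)
    fix S' assume "S' \<in> {S. finite S \<and> S \<subseteq> carrier (pquot I)}"
    then have "finite S'" "S' \<subseteq> cos I ` UNIV" by (simp_all add: carrier_pquot)
    then obtain S where S: "finite S" "S' = cos I ` S" by (meson finite_subset_image)
    \<comment> \<open>A common length bound for representatives of S'; \<open>Suc\<close> keeps it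
      positive for the asymptotics.\<close>
    define m where "m = Suc (Max (insert 0 (\<Union>x\<in>S. (\<lambda>w. length (letters w)) ` Poly_Mapping.keys x)))"
    have m: "length (letters w) \<le> m" if "x \<in> S" "w \<in> Poly_Mapping.keys x" for x w
      unfolding m_def by (rule le_SucI, rule Max_ge) (use S(1) that in auto)
    have m0: "real m > 0" by (simp add: m_def)
    let ?d = "\<lambda>n. fdim (pquot I) (word_filtration (pquot I) S' n)"
    have "log (real n) (real (?d n)) \<le> log (real n) (16 * (real m * real n + 1) ^ 3)" if "n \<ge> 2" for n
    proof -
      have "?d n \<le> 16 * (m * n + 1) ^ 3" unfolding S(2) by (rule fdim_upper[OF S(1) m])
      then have "real (?d n) \<le> real (16 * (m * n + 1) ^ 3)" by (rule of_nat_mono)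
      then have u: "real (?d n) \<le> 16 * (real m * real n + 1) ^ 3" by (simp add: add.commute)
      have one: "1 \<le> 16 * (real m * real n + 1) ^ 3"
      proof -
        have "1 \<le> (real m * real n + 1) ^ 3" by (rule one_le_power) simp
        then show ?thesis by linarith
      qed
      show ?thesis
      proof (cases "?d n = 0")
        \<comment> \<open>By the convention \<open>ln 0 = 0\<close> the left side is 0, so it is
          enough that the bound is nonnegative.\<close>
        case True
        have "0 \<le> ln (16 * (real m * real n + 1) ^ 3)" by (rule ln_ge_zero[OF one])
        then show ?thesis using that by (simp add: True log_def divide_nonneg_pos)
      next
        case False
        then show ?thesis using u that by (intro log_mono) auto
      qed
    qed
    then have "limsup (\<lambda>n. ereal (log (real n) (real (?d n)))) \<le> limsup (\<lambda>n. ereal (log (real n) (16 * (real m * real n + 1) ^ 3)))"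
      by (intro Limsup_mono) (auto simp: eventually_sequentially)
    also have "\<dots> = 3"
    proof (rule lim_imp_Limsup)
      have "(\<lambda>n. log (real n) (16 * (real m * real n + 1) ^ 3)) \<longlonglongrightarrow> 3" using m0 by real_asymp
      then show "(\<lambda>n. ereal (log (real n) (16 * (real m * real n + 1) ^ 3))) \<longlonglongrightarrow> 3"
        using tendsto_ereal[of _ 3] by simp
    qed simp
    finally show "limsup (\<lambda>n. ereal (log (real n) (real (?d n)))) \<le> 3" .
  qed
next
  let ?S = "range (\<lambda>i :: 3. wd [i] :: (3, 'k) tens_alg)"
  let ?d = "\<lambda>n. fdim (pquot I) (word_filtration (pquot I) (cos I ` ?S) n)"
  have "log (real n) ((real n / 6) ^ 3) \<le> log (real n) (real (?d n))" if n: "n \<ge> 6" for n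
  proof -
    have "(n div 6 + 1) ^ 3 \<le> ?d n" by (rule fdim_lower) simp
    then have "real ((n div 6 + 1) ^ 3) \<le> real (?d n)" by (rule of_nat_mono)
    then have "real (n div 6 + 1) ^ 3 \<le> real (?d n)" by (simp only: of_nat_power)
    moreover have "(real n / 6) ^ 3 \<le> real (n div 6 + 1) ^ 3"
    proof (rule power_mono)
      have "n \<le> 6 * (n div 6 + 1)" using dividend_less_times_div[of 6 n] by simp
      then have "real n \<le> real (6 * (n div 6 + 1))" by (rule of_nat_mono)
      then show "real n / 6 \<le> real (n div 6 + 1)" by simp
    qed simp
    ultimately have "(real n / 6) ^ 3 \<le> real (?d n)" by (rule order_trans[rotated])
    then show ?thesis using n by (intro log_mono) auto
  qed
  then have "limsup (\<lambda>n. ereal (log (real n) ((real n / 6) ^ 3))) \<le> limsup (\<lambda>n. ereal (log (real n) (real (?d n))))"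
    by (intro Limsup_mono) (auto simp: eventually_sequentially)
  also have "\<dots> \<le> GKdim (pquot I)" by (rule GKdim_ge_limsup) simp
  also have "limsup (\<lambda>n. ereal (log (real n) ((real n / 6) ^ 3))) = 3"
  proof (rule lim_imp_Limsup)
    have "(\<lambda>n. log (real n) ((real n / 6) ^ 3)) \<longlonglongrightarrow> 3" by real_asymp
    then show "(\<lambda>n. ereal (log (real n) ((real n / 6) ^ 3))) \<longlonglongrightarrow> 3"
      using tendsto_ereal[of _ 3] by simp
  qed simp
  finally show "3 \<le> GKdim (pquot I)" .
qed

lemma eminent_I: "eminent Q I"
  unfolding eminent_def
proof (intro conjI allI impI)
  fix J assume J: "pre_nichols_ideal Q J \<and> GKdim (pquot J) < \<infinity>"
  then have IJ: "I \<subseteq> J" by (intro I_least) auto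
  note can = can_proj_hopf_hom[OF pre_nicholsD(1)[OF pre_nichols_I] pre_nicholsD(1)[OF conjunct1[OF J]] IJ]
  show "\<exists>\<phi>\<in>hopf_hom Q I J. \<phi> ` carrier (pquot I) = carrier (pquot J) \<and> (\<forall>i. \<phi> (pcls I (wd [i])) = pcls J (wd [i]))"
    using can by blast
qed (simp_all add: pre_nichols_I GKdim_3)

section \<open>The extension\<close>

lemma y_K8: "y ^ k \<in> K8" "y \<in> K8" "1 \<in> K8"
proof -
  show *: "y ^ k \<in> K8" for k unfolding K8_def by (rule pm.span_base) simp
  show "y \<in> K8" "1 \<in> K8" using *[of 1] *[of 0] by simp_all
qed

lemma K8_into: "plin f \<Longrightarrow> pm.subspace U \<Longrightarrow> (\<And>k. f (y ^ k) \<in> U) \<Longrightarrow> x \<in> K8 \<Longrightarrow> f x \<in> U"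
  unfolding K8_def by (rule plin_span_into[of f U "range (\<lambda>k. y ^ k)"]) auto

lemma K8_mult: "x \<in> K8 \<Longrightarrow> z \<in> K8 \<Longrightarrow> x * z \<in> K8"
  by (rule K8_into[OF plin_mult_right K_subspace(1)], rule K8_into[OF plin_mult_left K_subspace(1)])
    (auto simp: y_K8 simp flip: power_add)

lemma subalgebra_K8: "subalgebra (pquot I) (cos I ` K8)"
  unfolding subalgebra_def
proof (intro conjI ballI allI)
  show "cos I ` K8 \<subseteq> carrier (pquot I)" unfolding carrier_pquot by blast
  show "\<zero>\<^bsub>pquot I\<^esub> \<in> cos I ` K8"
    unfolding zero_pquot by (rule image_eqI[of _ _ 0]) (simp_all add: cos_zero pm.subspace_0[OF K_subspace(1)])
  show "\<one>\<^bsub>pquot I\<^esub> \<in> cos I ` K8" unfolding one_pquot by (rule imageI[OF y_K8(3)])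
  fix X assume "X \<in> cos I ` K8"
  then obtain x where x: "X = cos I x" "x \<in> K8" by blast
  show "c \<odot>\<^bsub>pquot I\<^esub> X \<in> cos I ` K8" for c
    unfolding x(1) smult_pquot[OF tideal_I] by (rule imageI[OF pm.subspace_scale[OF K_subspace(1) x(2)]])
  fix Z assume "Z \<in> cos I ` K8"
  then obtain z where z: "Z = cos I z" "z \<in> K8" by blast
  show "X \<oplus>\<^bsub>pquot I\<^esub> Z \<in> cos I ` K8"
    unfolding x(1) z(1) add_pquot[OF tideal_I] by (rule imageI[OF pm.subspace_add[OF K_subspace(1) x(2) z(2)]])
  show "X \<otimes>\<^bsub>pquot I\<^esub> Z \<in> cos I ` K8"
    unfolding x(1) z(1) mult_pquot[OF tideal_I] by (rule imageI[OF K8_mult[OF x(2) z(2)]])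
qed

lemma hull_y: "subalgebra (pquot I) hull {pcls I xd [^]\<^bsub>pquot I\<^esub> L} = cos I ` K8"
proof (rule hull_unique)
  show "subalgebra (pquot I) (cos I ` K8)" by (rule subalgebra_K8)
  have X: "pcls I xd [^]\<^bsub>pquot I\<^esub> L = cos I y" by (simp add: pcls_eq pow_pquot[OF tideal_I] y_def)
  show "{pcls I xd [^]\<^bsub>pquot I\<^esub> L} \<subseteq> cos I ` K8" unfolding X using y_K8(2) by blast
  fix C assume "{pcls I xd [^]\<^bsub>pquot I\<^esub> L} \<subseteq> C" and C: "subalgebra (pquot I) C"
  then have yC: "cos I y \<in> C" by (simp add: X)
  have pC: "cos I (y ^ k) \<in> C" for k
  proof (induction k)
    case 0
    then show ?case using C by (simp add: subalgebra_def one_pquot)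
  next
    case (Suc k)
    then have "cos I y \<otimes>\<^bsub>pquot I\<^esub> cos I (y ^ k) \<in> C" using C yC by (simp add: subalgebra_def)
    then show ?case by (simp add: mult_pquot[OF tideal_I])
  qed
  show "cos I ` K8 \<subseteq> C"
  proof (rule image_subsetI)
    fix x assume "x \<in> K8"
    then show "cos I x \<in> C"
      unfolding K8_def
    proof (induction rule: pm.span_induct_alt)
      case base
      then show ?case using C by (simp add: subalgebra_def zero_pquot cos_zero)
    next
      case (step c x z)
      then obtain k where "x = y ^ k" by blast
      then have "c \<odot>\<^bsub>pquot I\<^esub> cos I x \<oplus>\<^bsub>pquot I\<^esub> cos I z \<in> C"
        using C pC step by (simp add: subalgebra_def)
      then show ?case by (simp add: smult_pquot[OF tideal_I] add_pquot[OF tideal_I])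
    qed
  qed
qed

section \<open>Hopf structure on the polynomials in y\<close>

definition "T2 = pm.span {tens (y ^ i) (y ^ j) | i j. True}"

lemma tens_T2: "x \<in> K8 \<Longrightarrow> z \<in> K8 \<Longrightarrow> tens x z \<in> T2"
  by (rule K8_into[OF plin_tens_left], simp add: T2_def, rule K8_into[OF plin_tens_right])
    (auto simp: T2_def intro: pm.span_base)

lemma T2_into: "plin f \<Longrightarrow> pm.subspace U \<Longrightarrow> (\<And>i j. f (tens (y ^ i) (y ^ j)) \<in> U) \<Longrightarrow> t \<in> T2 \<Longrightarrow> f t \<in> U"
  unfolding T2_def by (rule plin_span_into[of f U "{tens (y ^ i) (y ^ j) | i j. True}"]) auto

lemma ptens_sub_K8: "ptens_sub Q I (cos I ` K8) (cos I ` K8) = cos (tens_ker Q I I) ` T2"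
proof -
  have "{ptens Q I I X Y | X Y. X \<in> cos I ` K8 \<and> Y \<in> cos I ` K8} = cos (tens_ker Q I I) ` {tens x z | x z. x \<in> K8 \<and> z \<in> K8}"
    (is "?A = ?B")
  proof
    show "?A \<subseteq> ?B"
    proof
      fix A assume "A \<in> ?A"
      then obtain x z where "A = ptens Q I I (cos I x) (cos I z)" "x \<in> K8" "z \<in> K8" by blast
      then show "A \<in> ?B" unfolding ptens_cos[OF I_subspace I_subspace] by blast
    qed
    show "?B \<subseteq> ?A"
    proof
      fix B assume "B \<in> ?B"
      then obtain x z where "B = ptens Q I I (cos I x) (cos I z)" "x \<in> K8" "z \<in> K8"
        unfolding ptens_cos[OF I_subspace I_subspace] by blast
      then show "B \<in> ?A" by blast
    qed
  qed
  moreover have "pm.span {tens x z | x z. x \<in> K8 \<and> z \<in> K8} = T2"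
  proof
    show "pm.span {tens x z | x z. x \<in> K8 \<and> z \<in> K8} \<subseteq> T2"
      by (rule pm.span_minimal) (use tens_T2 in \<open>auto simp: T2_def\<close>)
    show "T2 \<subseteq> pm.span {tens x z | x z. x \<in> K8 \<and> z \<in> K8}"
      unfolding T2_def by (rule pm.span_mono) (use y_K8 in auto)
  qed
  ultimately show ?thesis
    unfolding ptens_sub_def ptens_sp_def by (simp only: TT.quot_lspan[OF tens_ker_subspace])
qed

lemma braid_T2: "braid Q ` T2 = T2"
proof
  have b: "braid Q (tens (y ^ i) (y ^ j)) = scal (bichar Q (dmul i (dmul L \<delta>)) (dmul j (dmul L \<delta>))) (tens (y ^ j) (y ^ i))" for i j
    by (rule braid_tens[OF homogeneous_power[OF hom_y] homogeneous_power[OF hom_y]])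
  show "braid Q ` T2 \<subseteq> T2"
  proof (rule image_subsetI)
    fix t assume t: "t \<in> T2"
    show "braid Q t \<in> T2"
      by (rule T2_into[OF plin_braid _ _ t]) (auto simp: b T2_def intro!: pm.span_scale intro: pm.span_base)
  qed
  have sub: "pm.subspace (braid Q ` T2)"
    unfolding T2_def plin_image_span[OF plin_braid] by simp
  show "T2 \<subseteq> braid Q ` T2"
  proof
    fix t assume t: "t \<in> T2"
    show "t \<in> braid Q ` T2"
    proof (rule T2_into[OF plin_id sub _ t])
      fix i j
      let ?c = "bichar Q (dmul j (dmul L \<delta>)) (dmul i (dmul L \<delta>))"
      have "braid Q (tens (y ^ j) (y ^ i)) \<in> braid Q ` T2" by (intro imageI tens_T2 y_K8)
      then have "scal (inverse ?c) (braid Q (tens (y ^ j) (y ^ i))) \<in> braid Q ` T2" by (rule pm.subspace_scale[OF sub])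
      then show "tens (y ^ i) (y ^ j) \<in> braid Q ` T2" by (simp add: b scal_scal)
    qed
  qed
qed

lemma tmult_ker_cong:
  assumes "tideal J" "hspan J" "tideal J'" "hspan J'" "t - t' \<in> tens_ker Q J J'" "u - u' \<in> tens_ker Q J J'"
  shows "tmult Q t u - tmult Q t' u' \<in> tens_ker Q J J'"
proof -
  have "tmult Q (t - t') u + tmult Q t' (u - u') \<in> tens_ker Q J J'"
    by (intro pm.subspace_add[OF tens_ker_subspace] tens_ker_ideal[OF assms(1-4)] assms(5,6))
  then show ?thesis by (simp add: tmult_diff_left tmult_diff_right)
qed

lemma gl_K8: "x \<in> K8 \<Longrightarrow> gl Q \<beta> x \<in> K8"
  by (rule K8_into[OF plin_gl K_subspace(1)])
    (auto simp: gl_homogeneous[OF homogeneous_power[OF hom_y]] y_K8 intro: pm.subspace_scale[OF K_subspace(1)])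

text \<open>Delta(y) may be replaced by y (x) 1 + 1 (x) y, and multiplication by this preserves
  \<open>T2\<close>, as the twist is a scalar on each power of y.\<close>

lemma comult_y_pow: "\<exists>u\<in>T2. comult Q (y ^ k) - u \<in> tens_ker Q I I"
proof (induction k)
  case 0
  have "tens 1 1 \<in> T2" by (intro tens_T2 y_K8)
  then show ?case by (intro bexI[of _ "tens 1 1"]) (simp_all add: pm.subspace_0[OF tens_ker_subspace])
next
  case (Suc k)
  then obtain u where u: "u \<in> T2" "comult Q (y ^ k) - u \<in> tens_ker Q I I" by blast
  have sub: "pm.subspace T2" by (simp add: T2_def)
  have "tmult Q (tens y 1 + tens 1 y) u \<in> T2"
  proof (rule T2_into[OF plin_tmult_right sub _ u(1)])
    fix i j
    show "tmult Q (tens y 1 + tens 1 y) (tens (y ^ i) (y ^ j)) \<in> T2"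
      unfolding tmult_add_left tmult_tens_1 tmult_tens_gl[OF hom_y]
      by (intro pm.subspace_add[OF sub] tens_T2 K8_mult gl_K8 y_K8)
  qed
  moreover have "comult Q (y ^ Suc k) - tmult Q (tens y 1 + tens 1 y) u \<in> tens_ker Q I I"
    unfolding power_Suc comult_mult
    by (rule tmult_ker_cong[OF tideal_I hspan_I tideal_I hspan_I _ u(2)]) (use comult_y in \<open>simp add: diff_diff_eq\<close>)
  ultimately show ?case by blast
qed

text \<open>The preimage in T(V) of the subalgebra generated by y, that is, K8 + I.\<close>

definition "K8I = {x. \<exists>z\<in>K8. x - z \<in> I}"

lemma K8I_subspace: "pm.subspace K8I"
  unfolding pm.subspace_def
proof (intro conjI ballI allI)
  show "0 \<in> K8I" using pm.subspace_0[OF K_subspace(1)] tideal_zero[OF tideal_I] by (force simp: K8I_def)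
next
  fix x x' assume "x \<in> K8I" "x' \<in> K8I"
  then obtain z z' where z: "z \<in> K8" "x - z \<in> I" "z' \<in> K8" "x' - z' \<in> I" by (auto simp: K8I_def)
  have "(x + x') - (z + z') \<in> I" using tideal_add[OF tideal_I z(2,4)] by (simp add: algebra_simps)
  then show "x + x' \<in> K8I" using pm.subspace_add[OF K_subspace(1) z(1,3)] by (auto simp: K8I_def)
next
  fix c x assume "x \<in> K8I"
  then obtain z where z: "z \<in> K8" "x - z \<in> I" by (auto simp: K8I_def)
  have "scal c x - scal c z \<in> I" using tideal_scal[OF tideal_I z(2)] by (simp add: scal_diff)
  then show "scal c x \<in> K8I" using pm.subspace_scale[OF K_subspace(1) z(1)] by (auto simp: K8I_def)
qed

lemma cos_K8I: "cos I x \<in> cos I ` K8 \<longleftrightarrow> x \<in> K8I"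
  unfolding image_iff cos_eq_iff[OF I_subspace] K8I_def by simp

text \<open>The antipode axiom is applied to Delta(y) - y (x) 1 - 1 (x) y, which lies in the kernel
  of the reduction modulo I.\<close>

lemma antip_y: "antip Q y + y \<in> I"
proof -
  have "mul_antip (comult Q y - tens y 1 - tens 1 y) \<in> I"
  proof (rule tens_ker_into[OF plin_mul_antip I_subspace _ _ comult_y])
    show "mul_antip (tens a b) \<in> I" if "a \<in> I" for a b
      using braided_hopf_idealD(5)[OF pre_nicholsD(1)[OF pre_nichols_I]] that
      by (auto simp: mul_antip_tens intro!: tideal_right[OF tideal_I])
    show "mul_antip (tens a b) \<in> I" if "b \<in> I" for a b
      using that by (simp add: mul_antip_tens tideal_left[OF tideal_I])
  qed
  moreover have "mul_antip (comult Q y - tens y 1 - tens 1 y) = - (antip Q y + y)"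
    using counit_y_pow[of 1] by (simp add: plin_diff[OF plin_mul_antip] mul_antip_comult mul_antip_tens)
  ultimately have "- (antip Q y + y) \<in> I" by simp
  from pm.subspace_neg[OF I_subspace this] show ?thesis by (simp add: add.commute)
qed

lemma antip_K8: "x \<in> K8 \<Longrightarrow> antip Q x \<in> K8I"
proof (rule K8_into[OF plin_antip K8I_subspace])
  fix k
  show "antip Q (y ^ k) \<in> K8I"
  proof (induction k)
    case 0
    show ?case
      unfolding K8I_def by (intro CollectI bexI[of _ 1]) (simp_all add: tideal_zero[OF tideal_I] y_K8(3))
  next
    case (Suc k)
    then obtain z where z: "z \<in> K8" "antip Q (y ^ k) - z \<in> I" by (auto simp: K8I_def)
    have "(antip Q (y ^ k) - z) * antip Q y + z * (antip Q y + y) \<in> I"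
      by (intro tideal_add[OF tideal_I] tideal_right[OF tideal_I z(2)] tideal_left[OF tideal_I antip_y])
    then have "antip Q (y ^ k) * antip Q y - (- (z * y)) \<in> I" by (simp add: algebra_simps)
    moreover have "- (z * y) \<in> K8" by (intro pm.subspace_neg[OF K_subspace(1)] K8_mult z(1) y_K8)
    ultimately have "antip Q (y ^ k) * antip Q y \<in> K8I" unfolding K8I_def by blast
    then show ?case
      unfolding power_Suc antip_mult[OF hom_y homogeneous_power[OF hom_y]] by (rule pm.subspace_scale[OF K8I_subspace])
  qed
qed

lemma graded_hopf_subalgebra_K8: "graded_hopf_subalgebra Q I (cos I ` K8)"
  unfolding graded_hopf_subalgebra_def
proof (intro conjI)
  let ?K = "tens_ker Q I I"
  note bh = pre_nicholsD(1)[OF pre_nichols_I]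
  show "subalgebra (pquot I) (cos I ` K8)" by (rule subalgebra_K8)
  let ?U = "\<Union>n. cos I ` K8 \<inter> pcomp I n"
  \<comment> \<open>Representatives in K8 of homogeneous classes; the powers of y are among them and
    already span K8.\<close>
  define R where "R = {x \<in> K8. cos I x \<in> ?U}"
  have U: "?U = cos I ` R" unfolding R_def by blast
  have "pm.span R = K8"
  proof
    show "pm.span R \<subseteq> K8" by (rule pm.span_minimal[OF _ K_subspace(1)]) (auto simp: R_def)
    have "y ^ k \<in> R" for k
      unfolding R_def pcomp_def pcls_eq using y_K8(1)[of k] y_TV_comp[of k] by blast
    then show "K8 \<subseteq> pm.span R" unfolding K8_def by (intro pm.span_mono) blast
  qed
  then show "cos I ` K8 = lspan (pquot I) ?U"
    unfolding U pquot_def TV.quot_lspan[OF I_subspace] by simp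
  have "pbraid Q I ` cos ?K ` T2 = cos ?K ` braid Q ` T2"
    by (simp only: image_image pbraid_cos[OF bh])
  then show "pbraid Q I ` ptens_sub Q I (cos I ` K8) (cos I ` K8) = ptens_sub Q I (cos I ` K8) (cos I ` K8)"
    unfolding ptens_sub_K8 braid_T2 .
  show "pcomult Q I ` cos I ` K8 \<subseteq> ptens_sub Q I (cos I ` K8) (cos I ` K8)"
    unfolding ptens_sub_K8 image_image
  proof (rule image_subsetI)
    fix x assume x: "x \<in> K8"
    have "\<exists>u\<in>T2. comult Q x - u \<in> ?K"
    proof -
      have "comult Q x \<in> {a + b | a b. a \<in> T2 \<and> b \<in> ?K}"
      proof (rule K8_into[OF plin_comult pm.subspace_sums[OF _ tens_ker_subspace] _ x])
        show "pm.subspace T2" by (simp add: T2_def)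
        fix k
        obtain u where "u \<in> T2" "comult Q (y ^ k) - u \<in> ?K" using comult_y_pow by blast
        moreover have "comult Q (y ^ k) = u + (comult Q (y ^ k) - u)" by simp
        ultimately show "comult Q (y ^ k) \<in> {a + b | a b. a \<in> T2 \<and> b \<in> ?K}" by blast
      qed
      then obtain a b where "comult Q x = a + b" "a \<in> T2" "b \<in> ?K" by blast
      then show ?thesis by (intro bexI[of _ a]) simp_all
    qed
    then obtain u where "u \<in> T2" "cos ?K (comult Q x) = cos ?K u" using cos_eq_iff[OF tens_ker_subspace] by blast
    then show "pcomult Q I (cos I x) \<in> cos ?K ` T2"
      unfolding pcomult_cos[OF I_subspace braided_hopf_idealD(3)[OF bh] plin_comult] by simp
  qed
  show "pantip Q I ` cos I ` K8 \<subseteq> cos I ` K8"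
    unfolding image_image by (rule image_subsetI) (simp only: pantip_cos[OF bh] cos_K8I antip_K8)
qed

text \<open>N has no part of degree one, so slicing the second slot at x_i kills T(V) (x) N, and a
  coinvariant lies in the common kernel modulo I. Conversely y is coinvariant because 1 (x) y lies
  in T(V) (x) N, and coinvariance passes to powers because the kernel is an ideal of the braided
  square.\<close>

lemma coinvariants:
  "comult Q x - tens x 1 \<in> tens_ker Q I N \<longleftrightarrow> x \<in> K8I"
proof
  assume x: "comult Q x - tens x 1 \<in> tens_ker Q I N"
  have "pd i x \<in> I" for i
  proof -
    have "rsl (coeff1 i) (comult Q x - tens x 1) \<in> I"
    proof (rule tens_ker_into[OF plin_rsl I_subspace _ _ x])
      show "rsl (coeff1 i) (tens a b) \<in> I" if "a \<in> I" for a b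
        using that by (simp add: rsl_tens[OF pfun_coeff1] tideal_scal[OF tideal_I])
      show "rsl (coeff1 i) (tens a b) \<in> I" if "b \<in> N" for a b
      proof -
        have "coeff1 i b = 0"
          using pre_nicholsD(4)[OF pre_nichols_N that, of 1] by (subst coeff1_prj) (simp add: pfun_zero[OF pfun_coeff1])
        then show ?thesis by (simp add: rsl_tens[OF pfun_coeff1] tideal_zero[OF tideal_I])
      qed
    qed
    moreover have "coeff1 i (1 :: (3, 'k) tens_alg) = 0" by (simp add: coeff1_def lookup_one zero_word_def when_def)
    ultimately show ?thesis by (simp add: plin_diff[OF plin_rsl] rsl_tens[OF pfun_coeff1] pd_def)
  qed
  then show "x \<in> K8I" unfolding K8I_def using common_kernel by blast
next
  let ?K = "tens_ker Q I N" and ?f = "\<lambda>x. comult Q x - tens x 1"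
  have f: "plin ?f" by (rule plin_minus_fun[OF plin_comult plin_tens_left])
  have KK: "tens_ker Q I I \<subseteq> ?K" by (rule tens_ker_mono[OF subset_refl I_N])
  have hN: "hspan N"
    unfolding N_def by (rule hspan_Idl) (use hom_gens_I hom_y in blast)
  have y: "comult Q y - tens y 1 \<in> ?K"
  proof -
    have "(comult Q y - tens y 1 - tens 1 y) + tens 1 y \<in> ?K"
      by (intro pm.subspace_add[OF tens_ker_subspace] tens_ker_right[OF y_N] subsetD[OF KK comult_y])
    then show ?thesis by simp
  qed
  have pow: "?f (y ^ k) \<in> ?K" for k
  proof (induction k)
    case (Suc k)
    have "tmult Q (comult Q y) (comult Q (y ^ k)) - tmult Q (tens y 1) (tens (y ^ k) 1) \<in> ?K"
      by (rule tmult_ker_cong[OF tideal_I hspan_I tideal_N hN y Suc])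
    then show ?case by (simp add: comult_mult tmult_tens_1)
  qed (simp add: pm.subspace_0[OF tens_ker_subspace])
  assume "x \<in> K8I"
  then obtain z where z: "z \<in> K8" "x - z \<in> I" by (auto simp: K8I_def)
  have "?f z \<in> ?K" by (rule K8_into[OF f tens_ker_subspace pow z(1)])
  moreover have "?f (x - z) \<in> ?K"
    using braided_hopf_idealD(3)[OF pre_nicholsD(1)[OF pre_nichols_I]] z(2) KK
    by (intro pm.subspace_diff[OF tens_ker_subspace] tens_ker_left[OF z(2)]) blast
  ultimately have "?f (x - z) + ?f z \<in> ?K" by (intro pm.subspace_add[OF tens_ker_subspace])
  then show "?f x \<in> ?K" by (simp add: plin_diff[OF f])
qed

text \<open>The kernel of the projection consists of the classes of N, and N is T(V) y modulo I.
  Polynomials in y with zero counit are multiples of y, which identifies this kernel with the left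
  ideal generated by the augmentation ideal of Z.\<close>

lemma hopf_extension_N: "hopf_extension Q (cos I ` K8) I N (can_proj N)"
  unfolding hopf_extension_def
proof (intro conjI)
  note bhI = pre_nicholsD(1)[OF pre_nichols_I] and bhN = pre_nicholsD(1)[OF pre_nichols_N]
  note subN = tideal_subspace[OF tideal_N]
  have can: "can_proj N (cos I x) = cos N x" for x by (rule can_proj_cos[OF I_N I_subspace subN])
  show "graded_hopf_subalgebra Q I (cos I ` K8)" by (rule graded_hopf_subalgebra_K8)
  show "can_proj N \<in> hopf_hom Q I N" "can_proj N ` carrier (pquot I) = carrier (pquot N)"
    by (rule can_proj_hopf_hom[OF bhI bhN I_N])+
  let ?R = "{x * z | x z. z \<in> K8 \<and> counit z = 0}"
  have ker: "{X \<in> carrier (pquot I). can_proj N X = \<zero>\<^bsub>pquot N\<^esub>} = cos I ` N"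
  proof -
    have "can_proj N (cos I x) = \<zero>\<^bsub>pquot N\<^esub> \<longleftrightarrow> x \<in> N" for x
      unfolding can zero_pquot using cos_eq_iff[OF subN, of x 0] by (simp add: cos_zero)
    then show ?thesis unfolding carrier_pquot by blast
  qed
  have cu: "pcounit (cos I x) = counit x" for x by (rule pcounit_cos[OF I_subspace braided_hopf_idealD(4)[OF bhI]])
  have "{X \<otimes>\<^bsub>pquot I\<^esub> Y | X Y. X \<in> carrier (pquot I) \<and> Y \<in> cos I ` K8 \<and> pcounit Y = 0} = cos I ` ?R" (is "?A = ?B")
  proof
    show "?A \<subseteq> ?B"
    proof
      fix A assume "A \<in> ?A"
      then obtain x z where "A = cos I x \<otimes>\<^bsub>pquot I\<^esub> cos I z" "z \<in> K8" "pcounit (cos I z) = 0"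
        unfolding carrier_pquot by blast
      then show "A \<in> ?B" unfolding mult_pquot[OF tideal_I] cu by blast
    qed
    show "?B \<subseteq> ?A"
    proof
      fix B assume "B \<in> ?B"
      then obtain x z where "B = cos I x \<otimes>\<^bsub>pquot I\<^esub> cos I z" "z \<in> K8" "pcounit (cos I z) = 0"
        unfolding mult_pquot[OF tideal_I] cu by blast
      then show "B \<in> ?A" unfolding carrier_pquot by blast
    qed
  qed
  moreover have "cos I ` N = cos I ` pm.span ?R"
  proof
    show "cos I ` N \<subseteq> cos I ` pm.span ?R"
    proof (rule image_subsetI)
      fix x assume "x \<in> N"
      then obtain z where "x - z * y \<in> I" using N_decomp by blast
      then have eq: "cos I x = cos I (z * y)" by (simp only: cos_eq_iff[OF I_subspace])
      have "z * y \<in> ?R" using y_K8(2) counit_y_pow[of 1] by auto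
      then show "cos I x \<in> cos I ` pm.span ?R" unfolding eq by (intro imageI pm.span_base)
    qed
    have "?R \<subseteq> N"
    proof clarify
      fix x z assume z: "z \<in> K8" "counit z = 0"
      then obtain w where "z = w * y" using K8_counit[of z] by auto
      then have "x * z = (x * w) * y" by (simp add: mult.assoc)
      then show "x * z \<in> N" by (simp add: tideal_left[OF tideal_N y_N])
    qed
    then show "cos I ` pm.span ?R \<subseteq> cos I ` N" by (intro image_mono pm.span_minimal subN)
  qed
  ultimately show "{X \<in> carrier (pquot I). can_proj N X = \<zero>\<^bsub>pquot N\<^esub>} =
      lspan (pquot I) {X \<otimes>\<^bsub>pquot I\<^esub> Y | X Y. X \<in> carrier (pquot I) \<and> Y \<in> cos I ` K8 \<and> pcounit Y = 0}"
    unfolding ker by (simp only: TV.quot_lspan[OF I_subspace, folded pquot_def])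
  have "ptens_map Q I I I N (\<lambda>Y. Y) (can_proj N) (pcomult Q I (cos I x)) = ptens Q I N (cos I x) \<one>\<^bsub>pquot N\<^esub> \<longleftrightarrow> cos I x \<in> cos I ` K8" for x
    unfolding pcomult_cos[OF I_subspace braided_hopf_idealD(3)[OF bhI] plin_comult] one_pquot
      ptens_map_cos[OF I_subspace I_subspace I_subspace subN subset_refl I_N refl can]
      ptens_cos[OF I_subspace subN] cos_eq_iff[OF tens_ker_subspace] coinvariants cos_K8I ..
  then show "cos I ` K8 = {X \<in> carrier (pquot I). ptens_map Q I I I N (\<lambda>Y. Y) (can_proj N) (pcomult Q I X) = ptens Q I N X \<one>\<^bsub>pquot N\<^esub>}"
    unfolding carrier_pquot by blast
qed

end

theorem proposition4p8:
  fixes q r s :: "'k::{alg_closed_field, field_char_0}"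
    and Q :: "3 \<Rightarrow> 3 \<Rightarrow> 'k"
    and L :: nat
  assumes "q \<noteq> 0" "q \<noteq> 1" "r \<noteq> 0" "r \<noteq> 1" "s \<noteq> 0" "s \<noteq> 1"
    and "q * r * s = 1"
    and "L > 0" "s ^ L = 1" "\<forall>m. 0 < m \<and> m < L \<longrightarrow> s ^ m \<noteq> 1"
    and "\<forall>m>0. q ^ m \<noteq> 1" "\<forall>m>0. r ^ m \<noteq> 1"
    and "\<forall>i j. Q i j \<noteq> 0"
    and "Q 1 1 = q" "Q 1 2 * Q 2 1 = inverse q"
    and "Q 2 2 = -1" "Q 2 3 * Q 3 2 = inverse r"
    and "Q 3 3 = r" "Q 1 3 * Q 3 1 = 1"
  defines "I \<equiv> D21_ideal Q"
  defines "Z \<equiv> subalgebra (pquot I) hull {pcls I (x1223 Q) [^]\<^bsub>pquot I\<^esub> L}"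
  shows "eminent Q I \<and>
    inj_on (D21_monomial Q) D21_exponents \<and>
    is_basis_of (pquot I) (carrier (pquot I)) (D21_monomial Q ` D21_exponents) \<and>
    GKdim (pquot I) = 3 \<and>
    hopf_extension Q Z I (nichols_ideal Q) (can_proj (nichols_ideal Q))"
proof -
  interpret D21 Q q r s L
    by unfold_locales (use assms in auto)
  show ?thesis
    unfolding Z_def I_def hull_y nichols_N
    by (intro conjI eminent_I PBW_basis GKdim_3 hopf_extension_N)
qed

end
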